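(* Let $n\ge2$, $1<p<\infty$, $F$ as in the context, let $\Omega\subset\mathbb R^n$ be a bounded convex open set with $C^{1,\alpha}$ boundary ($\alpha\in\,]0,1[$), let $\mathcal W_R$ be a Wulff shape of radius $R$ with $\mathcal W_R\subset\Omega$, and let $\bar\beta$ be a positive constant. Then $\ell_1(\bar\beta,\Omega)\le\ell_1(\bar\beta,\mathcal W_R)$.
   Context: $F:\mathbb R^n\to[0,\infty)$ is convex, even, $F(t\xi)=|t|F(\xi)$, $a|\xi|\le F(\xi)\le b|\xi|$ ($0<a\le b$), $F\in C^2(\mathbb R^n\setminus\{0\})$, Hessian of $F^p$ positive definite off the origin. $F^o(v)=\sup_{\xi\ne0}\langle\xi,v\rangle/F(\xi)$; a Wulff shape of radius $R$ is a set $x_0+\{x:F^o(x)<R\}$. For a bounded open set $D$ with Lipschitz boundary and Euclidean outer normal $\nu$, $\ell_1(\bar\beta,D)=\inf_{v\in W^{1,p}(D),v\not\equiv0}\frac{\int_DF^p(\nabla v)dx+\bar\beta\int_{\partial D}|v|^pF(\nu)d\mathcal H^{n-1}}{\int_D|v|^pdx}$ (first Robin eigenvalue of $\mathcal Q_pu=\operatorname{div}(F^{p-1}(\nabla u)F_\xi(\nabla u))$). *)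

theory Defs
  imports "HOL-Analysis.Analysis"
begin

section \<open>Hausdorff measure (normalised so that H^n = Lebesgue measure)\<close>

definition hausdorff_content :: "real \<Rightarrow> real \<Rightarrow> (real^'n) set \<Rightarrow> ennreal" where
  "hausdorff_content s \<delta> A =
     (INF C \<in> {C :: nat \<Rightarrow> (real^'n) set. A \<subseteq> (\<Union>k. C k) \<and>
                 (\<forall>k. bounded (C k) \<and> diameter (C k) \<le> \<delta>)}.
        (\<Sum>k. ennreal (unit_ball_vol s * (diameter (C k) / 2) powr s)))"

definition hausdorff_outer :: "real \<Rightarrow> (real^'n) set \<Rightarrow> ennreal" where
  "hausdorff_outer s A = (SUP \<delta> \<in> {0<..}. hausdorff_content s \<delta> A)"

definition hausdorff_measure :: "real \<Rightarrow> (real^'n) measure" where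
  "hausdorff_measure s = measure_of UNIV (sets borel) (hausdorff_outer s)"

definition surface_measure :: "(real^'n) set \<Rightarrow> (real^'n) measure" where
  "surface_measure D = restrict_space (hausdorff_measure (real CARD('n) - 1)) (frontier D)"

definition is_outer_normal :: "(real^'n) set \<Rightarrow> real^'n \<Rightarrow> real^'n \<Rightarrow> bool" where
  "is_outer_normal D x \<nu> \<longleftrightarrow> norm \<nu> = 1 \<and>
     (\<forall>\<epsilon>>0. \<exists>r>0. \<forall>y\<in>ball x r.
        ((y - x) \<bullet> \<nu> < - \<epsilon> * norm (y - x) \<longrightarrow> y \<in> D) \<and>
        ((y - x) \<bullet> \<nu> > \<epsilon> * norm (y - x) \<longrightarrow> y \<notin> D))"

definition outer_normal :: "(real^'n) set \<Rightarrow> real^'n \<Rightarrow> real^'n" where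
  "outer_normal D x = (if \<exists>\<nu>. is_outer_normal D x \<nu> then (SOME \<nu>. is_outer_normal D x \<nu>) else 0)"

definition Lp_fun :: "(real^'n) set \<Rightarrow> real \<Rightarrow> (real^'n \<Rightarrow> real) \<Rightarrow> bool" where
  "Lp_fun D p v \<longleftrightarrow> v \<in> borel_measurable (lebesgue_on D) \<and>
     integrable (lebesgue_on D) (\<lambda>x. \<bar>v x\<bar> powr p)"

definition test_fun :: "(real^'n) set \<Rightarrow> (real^'n \<Rightarrow> real) \<Rightarrow> (real^'n \<Rightarrow> real^'n) \<Rightarrow> bool" where
  "test_fun D \<phi> d\<phi> \<longleftrightarrow> (\<forall>x. (\<phi> has_derivative (\<lambda>h. d\<phi> x \<bullet> h)) (at x)) \<and>
     continuous_on UNIV d\<phi> \<and> compact (closure {x. \<phi> x \<noteq> 0}) \<and> closure {x. \<phi> x \<noteq> 0} \<subseteq> D"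

definition weak_gradient :: "(real^'n) set \<Rightarrow> real \<Rightarrow> (real^'n \<Rightarrow> real) \<Rightarrow> (real^'n \<Rightarrow> real^'n) \<Rightarrow> bool" where
  "weak_gradient D p v g \<longleftrightarrow> Lp_fun D p v \<and> (\<forall>i. Lp_fun D p (\<lambda>x. g x $ i)) \<and>
     (\<forall>\<phi> d\<phi>. test_fun D \<phi> d\<phi> \<longrightarrow>
        (\<forall>i. integral\<^sup>L (lebesgue_on D) (\<lambda>x. v x * d\<phi> x $ i) =
             - integral\<^sup>L (lebesgue_on D) (\<lambda>x. g x $ i * \<phi> x)))"

definition boundary_trace :: "(real^'n) set \<Rightarrow> real \<Rightarrow> (real^'n \<Rightarrow> real) \<Rightarrow> (real^'n \<Rightarrow> real^'n)
    \<Rightarrow> (real^'n \<Rightarrow> real) \<Rightarrow> bool" where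
  "boundary_trace D p v g t \<longleftrightarrow>
     t \<in> borel_measurable (surface_measure D) \<and>
     integrable (surface_measure D) (\<lambda>x. \<bar>t x\<bar> powr p) \<and>
     (\<exists>u gu. (\<forall>k. continuous_on (closure D) (u k) \<and> weak_gradient D p (u k) (gu k)) \<and>
        (\<lambda>k. integral\<^sup>L (lebesgue_on D) (\<lambda>x. \<bar>u k x - v x\<bar> powr p)) \<longlonglongrightarrow> 0 \<and>
        (\<lambda>k. integral\<^sup>L (lebesgue_on D) (\<lambda>x. norm (gu k x - g x) powr p)) \<longlonglongrightarrow> 0 \<and>
        (\<lambda>k. integral\<^sup>L (surface_measure D) (\<lambda>x. \<bar>u k x - t x\<bar> powr p)) \<longlonglongrightarrow> 0)"

definition robin_eig1 :: "(real^'n \<Rightarrow> real) \<Rightarrow> real \<Rightarrow> real \<Rightarrow> (real^'n) set \<Rightarrow> real" where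
  "robin_eig1 F p \<beta> D = Inf
     {(integral\<^sup>L (lebesgue_on D) (\<lambda>x. F (g x) powr p)
        + \<beta> * integral\<^sup>L (surface_measure D) (\<lambda>x. \<bar>t x\<bar> powr p * F (outer_normal D x)))
       / integral\<^sup>L (lebesgue_on D) (\<lambda>x. \<bar>v x\<bar> powr p)
      | v g t. weak_gradient D p v g \<and> boundary_trace D p v g t \<and>
               \<not> (AE x in lebesgue_on D. v x = 0)}"

definition polar :: "(real^'n \<Rightarrow> real) \<Rightarrow> real^'n \<Rightarrow> real" where
  "polar F v = Sup ((\<lambda>\<xi>. (\<xi> \<bullet> v) / F \<xi>) ` (UNIV - {0}))"

definition wulff_shape :: "(real^'n \<Rightarrow> real) \<Rightarrow> real^'n \<Rightarrow> real \<Rightarrow> (real^'n) set" where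
  "wulff_shape F x0 R = {x. polar F (x - x0) < R}"

definition C2_on :: "(real^'n) set \<Rightarrow> (real^'n \<Rightarrow> real) \<Rightarrow> bool" where
  "C2_on S f \<longleftrightarrow> (\<exists>Df H. (\<forall>x\<in>S. (f has_derivative (\<lambda>w. Df x \<bullet> w)) (at x)) \<and>
      (\<forall>x\<in>S. (Df has_derivative (\<lambda>w. H x *v w)) (at x)) \<and> continuous_on S H)"

definition hessian_posdef_on :: "(real^'n) set \<Rightarrow> (real^'n \<Rightarrow> real) \<Rightarrow> bool" where
  "hessian_posdef_on S f \<longleftrightarrow> (\<exists>Df H. (\<forall>x\<in>S. (f has_derivative (\<lambda>w. Df x \<bullet> w)) (at x)) \<and>
      (\<forall>x\<in>S. (Df has_derivative (\<lambda>w. H x *v w)) (at x)) \<and>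
      (\<forall>x\<in>S. \<forall>w. w \<noteq> 0 \<longrightarrow> w \<bullet> (H x *v w) > 0))"

definition C1_alpha_boundary :: "real \<Rightarrow> (real^'n) set \<Rightarrow> bool" where
  "C1_alpha_boundary \<alpha> D \<longleftrightarrow> (\<forall>x\<in>frontier D. \<exists>r>0. \<exists>e h dh L. norm e = 1 \<and>
      (\<forall>y. (h has_derivative (\<lambda>w. dh y \<bullet> w)) (at y)) \<and>
      (\<forall>y z. norm (dh y - dh z) \<le> L * norm (y - z) powr \<alpha>) \<and>
      D \<inter> ball x r = {y \<in> ball x r. y \<bullet> e < h (y - (y \<bullet> e) *\<^sub>R e)})"

end

theory Submission
  imports Defs
begin

text \<open>Both domains are balls \<open>{x. G (x - x0) < 1}\<close> of differentiable gauges: the Minkowski gauge of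
  \<open>\<Omega>\<close>, and \<open>polar F / R\<close> for the Wulff shape.  In polar coordinates of \<open>G\<close>, volume is
  \<open>n s\<^sup>n\<^sup>-\<^sup>1 ds\<close> times cone measure and surface measure is \<open>c |dG|\<close> times cone measure, with the same \<open>c\<close>
  for all gauges.  Since \<open>F (dG) \<le> 1 / R\<close> whenever the ball contains the Wulff shape, testing with
  functions \<open>W (G (x - x0))\<close> bounds the eigenvalue of \<open>\<Omega>\<close> by a one-dimensional quotient \<open>Q W\<close>
  that depends on \<open>n, p, \<beta>, R, c\<close> only.  On the Wulff shape itself \<open>F (dG) = 1 / R\<close> and
  \<open>|\<xi> \<bullet> x| \<le> R F \<xi> G x\<close>, so the Rayleigh quotient of any competitor is at least an average of the
  quotients \<open>Q\<close> of its restrictions to rays from the centre.  Hence some ray supplies a profile that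
  is at least as good, and this profile is transplanted to \<open>\<Omega>\<close>; no eigenfunction is needed.\<close>

section \<open>Hausdorff measure under Lipschitz maps\<close>

text \<open>Strictness is what lets the approximations through. A competitor on the Wulff shape with
  quotient strictly below \<open>robin_eig1 F p \<beta> \<Omega>\<close> leaves room for two losses:
  a trace is only a limit of continuous functions, and the restriction to a ray must be smoothed. A
  gauge is not differentiable at its centre, so profiles are made constant near 0. The main obstacle
  is the boundary term, where Hausdorff measure is integrated over two different surfaces. On a
  hyperplane, Hausdorff measure and the volume of the cone over a set are both translation
  invariant, hence proportional; a gauge sphere is then compared locally with its tangent planes.
  The factor depends on the dimension only, so it can stay an unspecified \<open>c\<close> in
  \<open>Q\<close>. Averages over directions are written as integrals over the solid ball of
  functions that are constant along rays. The two gauge inequalities are dual: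
  \<open>F (dG x) \<le> 1 / R\<close> says that no supporting hyperplane of the larger domain cuts
  the Wulff shape, and the bound on the inner product is the polar inequality.\<close>

lemma hausdorff_content_lipschitz:
  fixes f :: "real^'n \<Rightarrow> real^'n"
  assumes L: "0 < L" and s: "0 \<le> s"
    and f: "\<And>x y. x \<in> A \<Longrightarrow> y \<in> A \<Longrightarrow> norm (f x - f y) \<le> L * norm (x - y)"
  shows "hausdorff_content s (L * \<delta>) (f ` A) \<le> ennreal (L powr s) * hausdorff_content s \<delta> A"
proof -
  have *: "hausdorff_content s (L * \<delta>) (f ` A)
      \<le> ennreal (L powr s) * (\<Sum>k. ennreal (unit_ball_vol s * (diameter (C k) / 2) powr s))"
    if C: "A \<subseteq> (\<Union>k. C k)" "\<And>k. bounded (C k)" "\<And>k. diameter (C k) \<le> \<delta>" for C :: "nat \<Rightarrow> (real^'n) set"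
  proof -
    \<comment> \<open>The Lipschitz bound is available on \<open>A\<close> only, so the covering
      sets are intersected with \<open>A\<close> before they are mapped.\<close>
    define D where "D k = f ` (C k \<inter> A)" for k
    have diam_D: "\<forall>x\<in>D k. \<forall>y\<in>D k. norm (x - y) \<le> L * diameter (C k)" for k
    proof (intro ballI)
      fix u v assume "u \<in> D k" "v \<in> D k"
      then obtain x y where xy: "u = f x" "v = f y" "x \<in> C k" "x \<in> A" "y \<in> C k" "y \<in> A"
        by (auto simp: D_def)
      have "norm (x - y) \<le> diameter (C k)"
        using diameter_bounded_bound[OF C(2) xy(3) xy(5)] by (simp add: dist_norm)
      then show "norm (u - v) \<le> L * diameter (C k)"
        using f[OF xy(4) xy(6)] L xy(1,2) by (meson mult_left_mono order.trans less_imp_le)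
    qed
    have diam_nonneg: "0 \<le> diameter (C k)" for k
      by (simp add: C(2) diameter_ge_0)
    have dD: "diameter (D k) \<le> L * diameter (C k)" for k
      by (rule diameter_le) (use diam_D diam_nonneg L in auto)
    have bD: "bounded (D k)" for k
    proof (cases "D k = {}")
      case False
      then obtain a where "a \<in> D k" by auto
      then have "D k \<subseteq> cball a (L * diameter (C k))"
        using diam_D by (auto simp: dist_norm)
      then show ?thesis by (rule bounded_subset[OF bounded_cball])
    qed simp
    have "hausdorff_content s (L * \<delta>) (f ` A) \<le> (\<Sum>k. ennreal (unit_ball_vol s * (diameter (D k) / 2) powr s))"
      unfolding hausdorff_content_def
    proof (rule INF_lower, safe)
      fix x assume "x \<in> A"
      with C(1) obtain k where "x \<in> C k" by auto
      with \<open>x \<in> A\<close> show "f x \<in> (\<Union>k. D k)" by (auto simp: D_def)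
    next
      fix k show "diameter (D k) \<le> L * \<delta>"
        using dD[of k] C(3)[of k] L by (meson mult_left_mono order.trans less_imp_le)
    qed (rule bD)
    also have "\<dots> \<le> (\<Sum>k. ennreal (L powr s) * ennreal (unit_ball_vol s * (diameter (C k) / 2) powr s))"
    proof (rule suminf_le)
      fix k
      have "(diameter (D k) / 2) powr s \<le> (L * (diameter (C k) / 2)) powr s"
        using dD[of k] s bD by (intro powr_mono2) (auto simp: diameter_ge_0)
      also have "\<dots> = L powr s * (diameter (C k) / 2) powr s"
        by (rule powr_mult)
      finally have "unit_ball_vol s * (diameter (D k) / 2) powr s
          \<le> L powr s * (unit_ball_vol s * (diameter (C k) / 2) powr s)"
        using s by (metis mult.left_commute mult_left_mono unit_ball_vol_nonneg)
      then show "ennreal (unit_ball_vol s * (diameter (D k) / 2) powr s)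
          \<le> ennreal (L powr s) * ennreal (unit_ball_vol s * (diameter (C k) / 2) powr s)"
        by (simp add: ennreal_mult''[symmetric] ennreal_leI s)
    qed auto
    also have "\<dots> = ennreal (L powr s) * (\<Sum>k. ennreal (unit_ball_vol s * (diameter (C k) / 2) powr s))"
      by simp
    finally show ?thesis .
  qed
  \<comment> \<open>The factor is moved to the left so that the estimate for a single cover passes
    to the infimum.\<close>
  have "ennreal (1 / L powr s) * hausdorff_content s (L * \<delta>) (f ` A) \<le> hausdorff_content s \<delta> A"
    unfolding hausdorff_content_def[of s \<delta> A]
  proof (intro INF_greatest, safe)
    fix C :: "nat \<Rightarrow> (real^'n) set"
    assume "A \<subseteq> (\<Union>k. C k)" "\<forall>k. bounded (C k) \<and> diameter (C k) \<le> \<delta>"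
    then have "hausdorff_content s (L * \<delta>) (f ` A)
      \<le> ennreal (L powr s) * (\<Sum>k. ennreal (unit_ball_vol s * (diameter (C k) / 2) powr s))"
      using * by blast
    then have "ennreal (1 / L powr s) * hausdorff_content s (L * \<delta>) (f ` A)
      \<le> ennreal (1 / L powr s) * (ennreal (L powr s) * (\<Sum>k. ennreal (unit_ball_vol s * (diameter (C k) / 2) powr s)))"
      by (intro mult_left_mono) auto
    then show "ennreal (1 / L powr s) * hausdorff_content s (L * \<delta>) (f ` A)
      \<le> (\<Sum>k. ennreal (unit_ball_vol s * (diameter (C k) / 2) powr s))"
      using L by (simp add: mult.assoc[symmetric] ennreal_mult''[symmetric])
  qed
  then have "ennreal (L powr s) * (ennreal (1 / L powr s) * hausdorff_content s (L * \<delta>) (f ` A))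
      \<le> ennreal (L powr s) * hausdorff_content s \<delta> A"
    by (intro mult_left_mono) auto
  then show ?thesis
    using L by (simp add: mult.assoc[symmetric] ennreal_mult''[symmetric])
qed

lemma hausdorff_outer_lipschitz:
  fixes f :: "real^'n \<Rightarrow> real^'n"
  assumes L: "0 < L" and s: "0 \<le> s"
    and f: "\<And>x y. x \<in> A \<Longrightarrow> y \<in> A \<Longrightarrow> norm (f x - f y) \<le> L * norm (x - y)"
  shows "hausdorff_outer s (f ` A) \<le> ennreal (L powr s) * hausdorff_outer s A"
  unfolding hausdorff_outer_def[of s "f ` A"]
proof (rule SUP_least)
  fix \<delta> :: real assume "\<delta> \<in> {0<..}"
  then have "hausdorff_content s (\<delta> / L) A \<le> hausdorff_outer s A"
    unfolding hausdorff_outer_def using L by (intro SUP_upper) auto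
  moreover have "hausdorff_content s \<delta> (f ` A) \<le> ennreal (L powr s) * hausdorff_content s (\<delta> / L) A"
    using hausdorff_content_lipschitz[OF L s f, where \<delta> = "\<delta> / L"] L by simp
  ultimately show "hausdorff_content s \<delta> (f ` A) \<le> ennreal (L powr s) * hausdorff_outer s A"
    by (meson mult_left_mono order.trans zero_le)
qed

lemma hausdorff_content_finite_cover:
  fixes C :: "'i \<Rightarrow> (real^'n) set"
  assumes I: "finite I" and A: "A \<subseteq> (\<Union>i\<in>I. C i)" and s: "0 < s" and d: "0 \<le> d" "d \<le> \<delta>"
    and C: "\<And>i. i \<in> I \<Longrightarrow> bounded (C i)" "\<And>i. i \<in> I \<Longrightarrow> diameter (C i) \<le> d"
  shows "hausdorff_content s \<delta> A \<le> ennreal (real (card I) * (unit_ball_vol s * (d / 2) powr s))"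
proof -
  obtain h where h: "bij_betw h {0..<card I} I"
    using ex_bij_betw_nat_finite[OF I] by auto
  \<comment> \<open>Empty sets extend the finite cover to a sequence and contribute 0.\<close>
  define D where "D k = (if k < card I then C (h k) else {})" for k
  have hI: "h k \<in> I" if "k < card I" for k
    using h that by (auto simp: bij_betw_def)
  have "hausdorff_content s \<delta> A \<le> (\<Sum>k. ennreal (unit_ball_vol s * (diameter (D k) / 2) powr s))"
    unfolding hausdorff_content_def
  proof (rule INF_lower, safe)
    fix x assume "x \<in> A"
    then obtain i where i: "i \<in> I" "x \<in> C i" using A by auto
    then have "i \<in> h ` {0..<card I}" using bij_betw_imp_surj_on[OF h] by simp
    then obtain k where "k < card I" "h k = i" by auto
    with i show "x \<in> (\<Union>k. D k)"
      by (auto simp: D_def intro!: exI[of _ k])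
  next
    fix k show "diameter (D k) \<le> \<delta>" "bounded (D k)"
      using C[OF hI, of k] d by (auto simp: D_def)
  qed
  also have "\<dots> = (\<Sum>k<card I. ennreal (unit_ball_vol s * (diameter (D k) / 2) powr s))"
    by (rule suminf_finite) (auto simp: D_def)
  also have "\<dots> \<le> (\<Sum>k<card I. ennreal (unit_ball_vol s * (d / 2) powr s))"
  proof (intro sum_mono ennreal_leI mult_left_mono powr_mono2)
    fix k assume k: "k \<in> {..<card I}"
    show "0 \<le> diameter (D k) / 2" "diameter (D k) / 2 \<le> d / 2"
      using C[OF hI] k by (auto simp: D_def diameter_ge_0)
  qed (use s in auto)
  also have "\<dots> = ennreal (real (card I) * (unit_ball_vol s * (d / 2) powr s))"
    using s by (simp add: ennreal_mult' ennreal_of_nat_eq_real_of_nat)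
  finally show ?thesis .
qed

text \<open>A grid of mesh 1/m needs about m^(n-1) cells, because one coordinate is fixed, and each
  cell has diameter at most n/m. In the product of the number of cells with the (n-1)-th power of
  the diameter the mesh cancels, so the content is bounded uniformly in the scale.\<close>

lemma hausdorff_outer_coordinate_cube_finite:
  fixes k :: "'n::finite" and N :: nat
  assumes n: "2 \<le> CARD('n)"
  shows "hausdorff_outer (real CARD('n) - 1) {x :: real^'n. x $ k = 0 \<and> (\<forall>i. \<bar>x $ i\<bar> \<le> N)} < \<infinity>"
proof -
  define s where "s = real CARD('n) - 1"
  have s0: "s > 0" and s_eq: "s = real (CARD('n) - 1)"
    using n by (auto simp: s_def of_nat_diff)
  let ?K = "{x :: real^'n. x $ k = 0 \<and> (\<forall>i. \<bar>x $ i\<bar> \<le> N)}"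
  \<comment> \<open>Comes from 2 m N + 1 <= m (2 N + 1) for the cells per free coordinate,
    multiplied by half the diameter bound n/m.\<close>
  define M where "M = unit_ball_vol s * ((2 * real N + 1) * real CARD('n) / 2) powr s"
  have "hausdorff_content s \<delta> ?K \<le> ennreal M" if \<delta>: "\<delta> > 0" for \<delta>
  proof -
    obtain m :: nat where m: "m > 0" "real CARD('n) / real m \<le> \<delta>"
    proof -
      obtain m :: nat where "real m > real CARD('n) / \<delta>" using reals_Archimedean2 by blast
      moreover have "0 < real CARD('n) / \<delta>" using \<delta> n by simp
      ultimately have "real m > 0" by linarith
      with \<open>real m > real CARD('n) / \<delta>\<close> \<delta> show ?thesis by (intro that[of m]) (auto simp: field_simps)
    qed
    \<comment> \<open>The floor of m times a coordinate may equal m N at the right end, which gives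
      2 m N + 1 values for each free index.\<close>
    define Q where "Q = (\<Pi>\<^sub>E i\<in>(UNIV::'n set). if i = k then {0::int} else {- int (m * N)..int (m * N)})"
    define C where "C q = {x :: real^'n. \<forall>i. of_int (q i) \<le> real m * x $ i \<and> real m * x $ i \<le> of_int (q i) + 1}" for q
    have cQ: "card Q = (2 * m * N + 1) ^ (CARD('n) - 1)"
    proof -
      have "card Q = (\<Prod>i\<in>(UNIV::'n set). if i = k then 1 else 2 * m * N + 1)"
        unfolding Q_def by (subst card_PiE) (auto intro!: prod.cong simp: nat_add_distrib nat_mult_distrib)
      also have "\<dots> = (\<Prod>i\<in>UNIV - {k}. 2 * m * N + 1)"
        by (subst prod.remove[of _ k]) auto
      finally show ?thesis by (simp add: card_Diff_singleton)
    qed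
    have finQ: "finite Q" unfolding Q_def by (intro finite_PiE) auto
    have dist_C: "norm (x - y) \<le> real CARD('n) / m" if "x \<in> C q" "y \<in> C q" for x y q
    proof -
      have "norm (x - y) \<le> (\<Sum>i\<in>UNIV. \<bar>(x - y) $ i\<bar>)" by (rule norm_le_l1_cart)
      also have "\<dots> \<le> (\<Sum>i\<in>(UNIV::'n set). 1 / m)"
      proof (rule sum_mono)
        fix i
        have "\<bar>real m * x $ i - real m * y $ i\<bar> \<le> 1"
          using that[unfolded C_def] by (auto simp: abs_le_iff dest!: spec[of _ i])
        then have "real m * \<bar>x $ i - y $ i\<bar> \<le> 1"
          using m by (simp add: abs_mult right_diff_distrib[symmetric] del: right_diff_distrib)
        then show "\<bar>(x - y) $ i\<bar> \<le> 1 / m" using m by (simp add: field_simps)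
      qed
      finally show ?thesis by simp
    qed
    have "hausdorff_content s \<delta> ?K \<le> ennreal (real (card Q) * (unit_ball_vol s * ((real CARD('n) / m) / 2) powr s))"
    proof (rule hausdorff_content_finite_cover[OF finQ, where C=C])
      show "?K \<subseteq> (\<Union>q\<in>Q. C q)"
      proof
        fix x assume x: "x \<in> ?K"
        have "(\<lambda>i. \<lfloor>real m * x $ i\<rfloor>) \<in> Q"
        proof -
          have "\<bar>real m * x $ i\<bar> \<le> m * N" for i
            using x by (simp add: abs_mult mult_left_mono)
          then have *: "- real_of_int (int (m * N)) \<le> real m * x $ i \<and> real m * x $ i \<le> real_of_int (int (m * N))" for i
            by (simp add: abs_le_iff minus_le_iff)
          have "- int (m * N) \<le> \<lfloor>real m * x $ i\<rfloor> \<and> \<lfloor>real m * x $ i\<rfloor> \<le> int (m * N)" for i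
            using *[of i] unfolding le_floor_iff floor_le_iff by (simp del: of_nat_mult)
          then show ?thesis using x by (auto simp: Q_def)
        qed
        moreover have "x \<in> C (\<lambda>i. \<lfloor>real m * x $ i\<rfloor>)"
          by (simp add: C_def)
        ultimately show "x \<in> (\<Union>q\<in>Q. C q)" by blast
      qed
      show "bounded (C q)" for q
      proof (cases "C q = {}")
        case False
        then obtain a where "a \<in> C q" by auto
        then have "C q \<subseteq> cball a (real CARD('n) / m)"
          using dist_C by (auto simp: dist_norm)
        then show ?thesis by (rule bounded_subset[OF bounded_cball])
      qed simp
      show "diameter (C q) \<le> real CARD('n) / real m" for q
        by (rule diameter_le) (use dist_C in auto)
    qed (use s0 m in auto)
    also have "real (card Q) * (unit_ball_vol s * ((real CARD('n) / m) / 2) powr s) \<le> M"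
    proof -
      have "real (card Q) = (real (2 * m * N + 1)) powr s"
        unfolding cQ s_eq of_nat_power by (rule powr_realpow[symmetric]) linarith
      also have "\<dots> \<le> (real m * (2 * real N + 1)) powr s"
        using m s0 by (intro powr_mono2) (auto simp: algebra_simps)
      finally have "real (card Q) * ((real CARD('n) / m) / 2) powr s
         \<le> (real m * (2 * real N + 1)) powr s * ((real CARD('n) / m) / 2) powr s"
        by (intro mult_right_mono) auto
      also have "\<dots> = ((real m * (2 * real N + 1)) * ((real CARD('n) / m) / 2)) powr s"
        by (subst powr_mult) auto
      also have "(real m * (2 * real N + 1)) * ((real CARD('n) / m) / 2) = (2 * real N + 1) * real CARD('n) / 2"
        using m by (simp add: field_simps)
      finally have "unit_ball_vol s * (real (card Q) * ((real CARD('n) / m) / 2) powr s) \<le> M"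
        unfolding M_def using s0 by (intro mult_left_mono) auto
      then show ?thesis by (simp add: mult.left_commute)
    qed
    finally show ?thesis by (simp add: ennreal_leI)
  qed
  then have "hausdorff_outer s ?K \<le> ennreal M"
    unfolding hausdorff_outer_def by (intro SUP_least) auto
  then show ?thesis
    unfolding s_def[symmetric] using ennreal_less_top[of M] by (simp add: le_less_trans)
qed

section \<open>Hausdorff measure on hyperplanes\<close>

text \<open>The uniqueness argument for Haar measure: the double integral of 1_A(x) 1_B(y - x) is
  evaluated with the invariance of \<open>N\<close> in one order, and in the other after the
  substitution of y + x for x under \<open>M\<close>. In the application \<open>P\<close> is a
  hyperplane that carries both measures; only shifts by elements of \<open>P\<close> are available,
  and the complement of \<open>P\<close> is skipped as a null set.\<close>

lemma translation_invariant_measures_proportional: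
  fixes M N :: "'a::euclidean_space measure"
  assumes sets [simp, measurable_cong]: "sets M = sets borel" "sets N = sets borel"
    and sf: "sigma_finite_measure M" "sigma_finite_measure N"
    and P: "AE x in M. x \<in> P" "AE x in N. x \<in> P" "\<And>x. x \<in> P \<Longrightarrow> - x \<in> P"
    and M: "\<And>z A. z \<in> P \<Longrightarrow> A \<in> sets borel \<Longrightarrow> emeasure M ((+) z -` A) = emeasure M A"
    and N: "\<And>z A. z \<in> P \<Longrightarrow> A \<in> sets borel \<Longrightarrow> emeasure N ((+) z -` A) = emeasure N A"
    and A [measurable]: "A \<in> sets borel" and B [measurable]: "B \<in> sets borel"
  shows "emeasure M A * emeasure N B = emeasure N A * emeasure M (uminus -` B)"
proof -
  interpret M: sigma_finite_measure M by (rule sf)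
  interpret N: sigma_finite_measure N by (rule sf)
  interpret MN: pair_sigma_finite M N ..
  have sp [simp]: "space M = UNIV" "space N = UNIV"
    using sets_eq_imp_space_eq[OF sets(1)] sets_eq_imp_space_eq[OF sets(2)] by auto
  have mA [measurable]: "uminus -` B \<in> sets borel"
    using measurable_sets[of uminus borel borel B] by simp
  have nnM: "(\<integral>\<^sup>+x. f x \<partial>M) = (\<integral>\<^sup>+x. f (y + x) \<partial>M)" if "y \<in> P" and f: "f \<in> borel_measurable borel" for f y
  proof -
    have "M = distr M borel ((+) y)"
    proof (rule measure_eqI)
      fix A assume "A \<in> sets M"
      moreover have "(+) y \<in> M \<rightarrow>\<^sub>M borel" by measurable
      ultimately show "emeasure M A = emeasure (distr M borel ((+) y)) A"
        by (simp add: emeasure_distr M[OF that(1)])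
    qed simp
    then have "(\<integral>\<^sup>+x. f x \<partial>M) = (\<integral>\<^sup>+x. f x \<partial>distr M borel ((+) y))" by simp
    also have "\<dots> = (\<integral>\<^sup>+x. f (y + x) \<partial>M)"
      by (rule nn_integral_distr) (use f in auto)
    finally show ?thesis .
  qed
  have tN: "(\<integral>\<^sup>+y. indicator C (y + x) \<partial>N) = emeasure N C" if "x \<in> P" and C[measurable]: "C \<in> sets borel" for C x
  proof -
    have [measurable]: "(+) x -` C \<in> sets borel"
      using measurable_sets[of "(+) x" borel borel C] by simp
    have "(\<integral>\<^sup>+y. indicator C (y + x) \<partial>N) = (\<integral>\<^sup>+y. indicator ((+) x -` C) y \<partial>N)"
      by (intro nn_integral_cong) (auto simp: indicator_def add.commute)
    also have "\<dots> = emeasure N C"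
      by (simp add: N[OF that(1)])
    finally show ?thesis .
  qed
  have "emeasure M A * emeasure N B = (\<integral>\<^sup>+x. indicator A x * emeasure N B \<partial>M)"
    by (simp add: nn_integral_multc)
  also have "\<dots> = (\<integral>\<^sup>+x. indicator A x * (\<integral>\<^sup>+y. indicator B (y + - x) \<partial>N) \<partial>M)"
    by (rule nn_integral_cong_AE) (use P(1) in \<open>eventually_elim, simp only: tN[OF P(3) B]\<close>)
  also have "\<dots> = (\<integral>\<^sup>+x. (\<integral>\<^sup>+y. indicator A x * indicator B (y + - x) \<partial>N) \<partial>M)"
    by (intro nn_integral_cong, subst nn_integral_cmult) auto
  also have "\<dots> = (\<integral>\<^sup>+y. (\<integral>\<^sup>+x. indicator A x * indicator B (y + - x) \<partial>M) \<partial>N)"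
    by (rule MN.Fubini'[symmetric]) measurable
  also have "\<dots> = (\<integral>\<^sup>+y. (\<integral>\<^sup>+x. indicator A (y + x) * indicator B (- x) \<partial>M) \<partial>N)"
  proof (rule nn_integral_cong_AE, use P(2) in eventually_elim)
    fix y assume y: "y \<in> P"
    show "(\<integral>\<^sup>+x. indicator A x * indicator B (y + - x) \<partial>M) = (\<integral>\<^sup>+x. indicator A (y + x) * indicator B (- x) \<partial>M)"
      by (subst nnM[OF y]) auto
  qed
  also have "\<dots> = (\<integral>\<^sup>+x. (\<integral>\<^sup>+y. indicator A (y + x) * indicator B (- x) \<partial>N) \<partial>M)"
    by (rule MN.Fubini') measurable
  also have "\<dots> = (\<integral>\<^sup>+x. emeasure N A * indicator (uminus -` B) x \<partial>M)"
  proof (rule nn_integral_cong_AE, use P(1) in eventually_elim)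
    fix x assume x: "x \<in> P"
    have "(\<integral>\<^sup>+y. indicator A (y + x) * indicator B (- x) \<partial>N) = (\<integral>\<^sup>+y. indicator A (y + x) \<partial>N) * indicator B (- x)"
      by (rule nn_integral_multc) measurable
    also have "\<dots> = emeasure N A * indicator (uminus -` B) x"
      unfolding tN[OF x A] by (simp add: indicator_def)
    finally show "(\<integral>\<^sup>+y. indicator A (y + x) * indicator B (- x) \<partial>N) = emeasure N A * indicator (uminus -` B) x" .
  qed
  also have "\<dots> = emeasure N A * emeasure M (uminus -` B)"
    by (simp add: nn_integral_cmult)
  finally show ?thesis .
qed

lemma sigma_finite_if_balls_finite:
  fixes M :: "'a::euclidean_space measure"
  assumes sets: "sets M = sets borel" and fin: "\<And>r. emeasure M (ball 0 r) < \<infinity>"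
  shows "sigma_finite_measure M"
proof
  have "space M = UNIV" using sets_eq_imp_space_eq[OF sets] by simp
  moreover have "\<exists>n::nat. norm x < real n" for x :: 'a by (rule reals_Archimedean2)
  ultimately show "\<exists>A. countable A \<and> A \<subseteq> sets M \<and> \<Union> A = space M \<and> (\<forall>a\<in>A. emeasure M a \<noteq> \<infinity>)"
    using fin by (intro exI[of _ "range (\<lambda>n::nat. ball 0 (real n))"]) (auto simp: sets less_top[symmetric])
qed

lemma ennreal_mult_eq_self_imp_1:
  assumes "ennreal k * U = U" "U \<noteq> 0" "U \<noteq> \<infinity>" "0 \<le> k"
  shows "k = 1"
proof -
  obtain u where u: "U = ennreal u" "0 \<le> u"
    using assms(3) by (cases U) auto
  then have "u > 0" using assms(2) by (cases "u = 0") auto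
  moreover have "k * u = u"
    using assms(1,4) u by (simp flip: ennreal_mult)
  ultimately show ?thesis by simp
qed

section \<open>Lebesgue measure under linear maps\<close>

lemma emeasure_lborel_unit_ball:
  "emeasure lborel (ball 0 1 :: 'a::euclidean_space set) \<noteq> 0"
  "emeasure lborel (ball 0 1 :: 'a::euclidean_space set) \<noteq> \<infinity>"
  using open_not_negligible[of "ball 0 1 :: 'a set"] emeasure_lborel_ball_finite[of "0::'a" 1]
  by (auto simp: negligible_iff_null_sets null_sets_def)

text \<open>The image of Lebesgue measure under an invertible linear map is again translation
  invariant, hence a multiple of Lebesgue measure. The factor is not computed as a determinant; for
  the maps of interest it is found later from a symmetry.\<close>

lemma emeasure_lborel_linear_vimage:
  fixes f g :: "'a::euclidean_space \<Rightarrow> 'a"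
  assumes f: "linear f" and g: "linear g" and fg: "\<And>x. f (g x) = x"
  shows "\<exists>k\<ge>0. \<forall>A\<in>sets borel. emeasure lborel (f -` A) = ennreal k * emeasure lborel A"
proof -
  have inj: "g (f x) = x" for x
  proof -
    have "surj f" using fg by (rule surjI)
    then have "inj f" by (rule linear_surjective_imp_injective[OF f]) simp
    then show ?thesis using fg by (auto dest: injD)
  qed
  interpret f: linear f by (rule f)
  interpret g: linear g by (rule g)
  have [measurable]: "f \<in> borel_measurable borel"
    by (intro borel_measurable_continuous_onI linear_continuous_on) (use f in \<open>simp add: linear_linear\<close>)
  define M where "M = distr lborel borel f"
  have eM: "emeasure M A = emeasure lborel (f -` A)" if "A \<in> sets borel" for A
    unfolding M_def using that by (subst emeasure_distr) auto
  have fin: "emeasure M (ball 0 r) < \<infinity>" for r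
  proof -
    have "f -` ball 0 r = g ` ball 0 r"
    proof (intro equalityI subsetI)
      fix x assume "x \<in> f -` ball 0 r"
      then have "g (f x) \<in> g ` ball 0 r" by (intro imageI) auto
      then show "x \<in> g ` ball 0 r" by (simp add: inj)
    qed (auto simp: fg)
    moreover have "bounded (g ` ball 0 r)"
      by (rule bounded_linear_image) (use g in \<open>auto simp: linear_linear\<close>)
    ultimately obtain b where "f -` ball 0 r \<subseteq> ball 0 b"
      using bounded_subset_ballD[of "g ` ball 0 r" 0] by auto
    then have "emeasure lborel (f -` ball 0 r) \<le> emeasure lborel (ball 0 b :: 'a set)"
      by (intro emeasure_mono) auto
    then show ?thesis using emeasure_lborel_ball_finite[of "0::'a" b] by (auto simp: eM intro: le_less_trans)
  qed
  have inv: "emeasure M ((+) z -` A) = emeasure M A" if A: "A \<in> sets borel" for z A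
  proof -
    have 1: "(+) z -` A \<in> sets borel" using measurable_sets[of "(+) z" borel borel A] A by simp
    have 2: "f -` A \<in> sets borel" using measurable_sets[of f borel borel A] A by simp
    have "emeasure M ((+) z -` A) = emeasure lborel ((+) (g z) -` (f -` A))"
      using eM[OF 1] by (simp add: vimage_def f.add fg)
    also have "\<dots> = emeasure (distr lborel borel ((+) (g z))) (f -` A)"
      using 2 by (subst emeasure_distr) auto
    also have "\<dots> = emeasure M A" by (simp add: lborel_distr_plus eM A)
    finally show ?thesis .
  qed
  have inv': "emeasure lborel ((+) z -` A) = emeasure lborel A" if A: "A \<in> sets borel" for z and A :: "'a set"
    using emeasure_distr[of "(+) z" lborel borel A] A by (simp add: lborel_distr_plus)
  let ?U = "ball 0 1 :: 'a set"
  have U: "uminus -` ?U = ?U" by auto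
  have "emeasure M A * emeasure lborel ?U = emeasure lborel A * emeasure M ?U" if A: "A \<in> sets borel" for A
    using translation_invariant_measures_proportional[of M lborel UNIV A ?U]
      sigma_finite_if_balls_finite[OF _ fin] A inv inv'
    by (simp add: U M_def lborel.sigma_finite_measure_axioms)
  moreover define u where "u = measure lborel ?U"
  moreover have "emeasure lborel ?U = ennreal u" "u > 0"
  proof -
    show u: "emeasure lborel ?U = ennreal u"
      unfolding u_def using emeasure_lborel_ball_finite[of "0::'a" 1]
      by (intro emeasure_eq_ennreal_measure) auto
    show "u > 0"
      using emeasure_lborel_unit_ball(1)[where 'a='a] u by (cases "u > 0") (auto simp: ennreal_neg)
  qed
  moreover define m where "m = measure M ?U"
  moreover have "emeasure M ?U = ennreal m"
    unfolding m_def using fin[of 1] by (intro emeasure_eq_ennreal_measure) auto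
  ultimately have *: "emeasure M A * ennreal u = emeasure lborel A * ennreal m" if "A \<in> sets borel" for A
    using that by simp
  have m0: "m \<ge> 0" by (simp add: m_def)
  have **: "emeasure lborel (f -` A) = ennreal (m / u) * emeasure lborel A" if "A \<in> sets borel" for A
  proof -
    have "emeasure M A = emeasure M A * ennreal u * ennreal (1 / u)"
      using \<open>u > 0\<close> by (simp add: mult.assoc flip: ennreal_mult)
    also have "\<dots> = emeasure lborel A * (ennreal m * ennreal (1 / u))"
      using *[OF that] by (simp add: mult.assoc)
    also have "ennreal m * ennreal (1 / u) = ennreal (m / u)"
      using \<open>u > 0\<close> m0 by (simp flip: ennreal_mult)
    finally show ?thesis using that by (simp add: eM mult.commute)
  qed
  show ?thesis
    by (rule exI[of _ "m / u"]) (use ** m0 \<open>u > 0\<close> in auto)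
qed

text \<open>The unit ball is its own preimage, which forces the factor to be 1.\<close>

lemma emeasure_lborel_orthogonal_vimage:
  fixes f :: "'a::euclidean_space \<Rightarrow> 'a"
  assumes f: "orthogonal_transformation f" and A: "A \<in> sets borel"
  shows "emeasure lborel (f -` A) = emeasure lborel A"
proof -
  have lf: "linear f" using f by (simp add: orthogonal_transformation_linear)
  have "orthogonal_transformation (inv f)" using f by (rule orthogonal_transformation_inv)
  then have li: "linear (inv f)" by (simp add: orthogonal_transformation_linear)
  have fi: "f (inv f x) = x" for x
    using f by (simp add: orthogonal_transformation_surj surj_f_inv_f)
  obtain k where k: "0 \<le> k" "\<And>A. A \<in> sets borel \<Longrightarrow> emeasure lborel (f -` A) = ennreal k * emeasure lborel A"
    using emeasure_lborel_linear_vimage[OF lf li fi] by auto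
  have "f -` ball 0 1 = ball 0 1"
    using f by (auto simp: orthogonal_transformation_norm)
  then have "emeasure lborel (ball 0 1 :: 'a set) = ennreal k * emeasure lborel (ball 0 1 :: 'a set)"
    using k(2)[of "ball 0 1"] by simp
  then have "k = 1"
    by (rule ennreal_mult_eq_self_imp_1[OF sym]) (use emeasure_lborel_unit_ball k(1) in auto)
  then show ?thesis using k(2)[OF A] by simp
qed

text \<open>The reflection fixing the line through \<open>e\<close> conjugates a shear to its inverse,
  so the two scale volumes by the same factor.\<close>

lemma emeasure_lborel_shear_vimage:
  fixes e z :: "'a::euclidean_space"
  assumes e: "norm e = 1" and z: "z \<bullet> e = 0" and A: "A \<in> sets borel"
  shows "emeasure lborel ((\<lambda>x. x + (x \<bullet> e) *\<^sub>R z) -` A) = emeasure lborel A"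
proof -
  define f where "f w x = x + (x \<bullet> e) *\<^sub>R w" for w x :: 'a
  have ee: "e \<bullet> e = 1" using e by (simp add: norm_eq_1)
  have lin: "linear (f w)" for w
    unfolding f_def by (intro linearI) (auto simp: inner_add_left scaleR_add_left scaleR_add_right)
  have ff: "f w (f (- w) x) = x" if "w \<bullet> e = 0" for w x
    using that by (simp add: f_def inner_diff_left)
  obtain k where k: "0 \<le> k" "\<And>A. A \<in> sets borel \<Longrightarrow> emeasure lborel (f z -` A) = ennreal k * emeasure lborel A"
    using emeasure_lborel_linear_vimage[OF lin[of z] lin[of "- z"] ff[OF z]] by auto
  define \<rho> where "\<rho> x = (2 * (x \<bullet> e)) *\<^sub>R e - x" for x :: 'a
  have orth: "orthogonal_transformation \<rho>"
    unfolding orthogonal_transformation_def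
  proof (intro conjI allI)
    show "linear \<rho>"
      by (intro linearI) (auto simp: \<rho>_def inner_add_left scaleR_add_left scaleR_diff_right distrib_left)
    show "\<rho> v \<bullet> \<rho> w = v \<bullet> w" for v w
      unfolding \<rho>_def inner_diff_left inner_diff_right inner_scaleR_left inner_scaleR_right ee inner_commute[of e w]
      by simp
  qed
  have conj: "f (- z) -` B = \<rho> -` (f z -` (\<rho> -` B))" for B
  proof -
    have "f (- z) x = \<rho> (f z (\<rho> x))" for x
    proof -
      have 1: "\<rho> x \<bullet> e = x \<bullet> e" by (simp add: \<rho>_def inner_diff_left ee)
      have 2: "(\<rho> x + (x \<bullet> e) *\<^sub>R z) \<bullet> e = x \<bullet> e" by (simp add: inner_add_left 1 z)
      show ?thesis unfolding f_def 1 unfolding \<rho>_def[of "\<rho> x + (x \<bullet> e) *\<^sub>R z"] 2 unfolding \<rho>_def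
        by simp
    qed
    then show ?thesis by (auto simp: vimage_def)
  qed
  have mf: "f z -` B \<in> sets borel" "\<rho> -` B \<in> sets borel" "f (- z) -` B \<in> sets borel" if "B \<in> sets borel" for B
  proof -
    have "f w \<in> borel_measurable borel" "\<rho> \<in> borel_measurable borel" for w
      unfolding f_def \<rho>_def by measurable
    then show "f z -` B \<in> sets borel" "\<rho> -` B \<in> sets borel" "f (- z) -` B \<in> sets borel"
      using that measurable_sets[of _ borel borel B] by (metis inf_top.right_neutral space_borel)+
  qed
  let ?U = "ball 0 1 :: 'a set"
  have k': "emeasure lborel (f (- z) -` B) = ennreal k * emeasure lborel B" if "B \<in> sets borel" for B
    using that by (simp add: conj emeasure_lborel_orthogonal_vimage[OF orth] mf k(2))
  have "?U = f (- z) -` (f z -` ?U)"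
    using z by (auto simp: f_def inner_diff_left inner_add_left)
  then have "emeasure lborel ?U = ennreal k * (ennreal k * emeasure lborel ?U)"
    using k'[OF mf(1)[of ?U]] k(2)[of ?U] by simp
  also have "\<dots> = ennreal (k * k) * emeasure lborel ?U"
    using k(1) by (simp add: ennreal_mult mult.assoc)
  finally have "k * k = 1"
    by (rule ennreal_mult_eq_self_imp_1[OF sym emeasure_lborel_unit_ball]) (use k(1) in auto)
  then have "k = 1"
    using k(1) by (simp add: square_eq_1_iff)
  moreover have "f z = (\<lambda>x. x + (x \<bullet> e) *\<^sub>R z)" by (simp add: f_def fun_eq_iff)
  ultimately show ?thesis using k(2)[OF A] by simp
qed

text \<open>For a unit vector \<open>e\<close> and \<open>A\<close> in the hyperplane orthogonal to
  \<open>e\<close>, this is the cone with apex 0, the apex removed, over the base \<open>A\<close>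
  shifted to height \<open>h\<close>. A point is tested by projecting it centrally to height
  \<open>h\<close> and shifting the result back.\<close>

definition flat_cone :: "'a::euclidean_space \<Rightarrow> real \<Rightarrow> 'a set \<Rightarrow> 'a set" where
  "flat_cone e h A = {x. 0 < x \<bullet> e \<and> x \<bullet> e \<le> h \<and> (h / (x \<bullet> e)) *\<^sub>R x - h *\<^sub>R e \<in> A}"

text \<open>Cone volume as a Borel measure in the base. For a unit vector \<open>e\<close> it lives
  on the hyperplane orthogonal to \<open>e\<close>, which is the form in which it can be compared
  with Hausdorff measure.\<close>

definition flat_cone_measure :: "'a::euclidean_space \<Rightarrow> real \<Rightarrow> 'a measure" where
  "flat_cone_measure e h = distr (restrict_space lborel {x. 0 < x \<bullet> e \<and> x \<bullet> e \<le> h}) borel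
     (\<lambda>x. (h / (x \<bullet> e)) *\<^sub>R x - h *\<^sub>R e)"

lemma sets_flat_cone_measure [simp, measurable_cong]: "sets (flat_cone_measure e h) = sets borel"
  by (simp add: flat_cone_measure_def)

lemma flat_cone_borel [measurable]: "A \<in> sets borel \<Longrightarrow> flat_cone e h A \<in> sets borel"
proof -
  assume [measurable]: "A \<in> sets borel"
  have "(\<lambda>x. (h / (x \<bullet> e)) *\<^sub>R x - h *\<^sub>R e) \<in> borel_measurable borel" by measurable
  from measurable_sets[OF this, of A]
  have [measurable]: "{x. (h / (x \<bullet> e)) *\<^sub>R x - h *\<^sub>R e \<in> A} \<in> sets borel" by (simp add: vimage_def)
  have "flat_cone e h A = {x. 0 < x \<bullet> e \<and> x \<bullet> e \<le> h} \<inter> {x. (h / (x \<bullet> e)) *\<^sub>R x - h *\<^sub>R e \<in> A}"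
    by (auto simp: flat_cone_def)
  also have "\<dots> \<in> sets borel" by measurable
  finally show ?thesis .
qed

lemma emeasure_flat_cone_measure:
  assumes A: "A \<in> sets borel"
  shows "emeasure (flat_cone_measure e h) A = emeasure lborel (flat_cone e h A)"
proof -
  have m: "(\<lambda>x. (h / (x \<bullet> e)) *\<^sub>R x - h *\<^sub>R e) \<in> borel_measurable (restrict_space lborel {x. 0 < x \<bullet> e \<and> x \<bullet> e \<le> h})"
    by (intro measurable_restrict_space1) measurable
  have S: "{x. 0 < x \<bullet> e \<and> x \<bullet> e \<le> h} \<in> sets lborel" by measurable
  have "emeasure (flat_cone_measure e h) A = emeasure (restrict_space lborel {x. 0 < x \<bullet> e \<and> x \<bullet> e \<le> h})
    ((\<lambda>x. (h / (x \<bullet> e)) *\<^sub>R x - h *\<^sub>R e) -` A \<inter> {x. 0 < x \<bullet> e \<and> x \<bullet> e \<le> h})"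
    unfolding flat_cone_measure_def using emeasure_distr[OF m A] by (simp add: space_restrict_space)
  also have "\<dots> = emeasure lborel ((\<lambda>x. (h / (x \<bullet> e)) *\<^sub>R x - h *\<^sub>R e) -` A \<inter> {x. 0 < x \<bullet> e \<and> x \<bullet> e \<le> h})"
    by (rule emeasure_restrict_space) (use S in auto)
  also have "(\<lambda>x. (h / (x \<bullet> e)) *\<^sub>R x - h *\<^sub>R e) -` A \<inter> {x. 0 < x \<bullet> e \<and> x \<bullet> e \<le> h} = flat_cone e h A"
    by (auto simp: flat_cone_def)
  finally show ?thesis .
qed

text \<open>Moving the base inside its plane shears the cone, and a shear preserves volume.\<close>

lemma emeasure_flat_cone_translate:
  assumes e: "norm e = 1" and h: "h > 0" and z: "z \<bullet> e = 0" and A: "A \<in> sets borel"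
  shows "emeasure lborel (flat_cone e h ((+) z -` A)) = emeasure lborel (flat_cone e h A)"
proof -
  \<comment> \<open>The shear has to move points at height \<open>h\<close> by \<open>z\<close>, so
    its slope is \<open>z\<close> divided by \<open>h\<close>.\<close>
  define w where "w = (1 / h) *\<^sub>R z"
  have w: "w \<bullet> e = 0" using z by (simp add: w_def)
  have "flat_cone e h ((+) z -` A) = (\<lambda>x. x + (x \<bullet> e) *\<^sub>R w) -` flat_cone e h A"
  proof -
    have 1: "(x + (x \<bullet> e) *\<^sub>R w) \<bullet> e = x \<bullet> e" for x using w by (simp add: inner_add_left)
    have "(h / (x \<bullet> e)) *\<^sub>R (x + (x \<bullet> e) *\<^sub>R w) - h *\<^sub>R e = z + ((h / (x \<bullet> e)) *\<^sub>R x - h *\<^sub>R e)" if "0 < x \<bullet> e" for x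
      using that h by (simp add: w_def scaleR_add_right)
    note * = this
    show ?thesis unfolding flat_cone_def vimage_def mem_Collect_eq 1
    proof (intro Collect_cong conj_cong refl)
      fix x assume "0 < x \<bullet> e"
      from *[OF this] show "(z + ((h / (x \<bullet> e)) *\<^sub>R x - h *\<^sub>R e) \<in> A)
          = ((h / (x \<bullet> e)) *\<^sub>R (x + (x \<bullet> e) *\<^sub>R w) - h *\<^sub>R e \<in> A)"
        by (simp only:)
    qed
  qed
  then show ?thesis
    using emeasure_lborel_shear_vimage[OF e w flat_cone_borel[OF A]] by simp
qed

lemma flat_cone_ball_subset:
  assumes e: "norm e = 1" and h: "h > 0"
  shows "flat_cone e h (ball 0 r) \<subseteq> ball 0 (r + h)"
proof
  fix x assume "x \<in> flat_cone e h (ball 0 r)"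
  then have x: "0 < x \<bullet> e" "x \<bullet> e \<le> h" "norm ((h / (x \<bullet> e)) *\<^sub>R x - h *\<^sub>R e) < r"
    by (auto simp: flat_cone_def)
  have "norm x \<le> (h / (x \<bullet> e)) * norm x"
    using x mult_right_mono[of 1 "h / (x \<bullet> e)" "norm x"] by simp
  also have "\<dots> = norm ((h / (x \<bullet> e)) *\<^sub>R x)" using x h by simp
  also have "\<dots> \<le> norm ((h / (x \<bullet> e)) *\<^sub>R x - h *\<^sub>R e) + norm (h *\<^sub>R e)"
    by (metis diff_add_cancel norm_triangle_ineq)
  also have "\<dots> < r + h" using x(3) e h by simp
  finally show "x \<in> ball 0 (r + h)" by simp
qed

lemma flat_cone_measure_props:
  fixes e :: "'a::euclidean_space"
  assumes e: "norm e = 1" and h: "h > 0"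
  shows "sigma_finite_measure (flat_cone_measure e h)"
    and "AE x in flat_cone_measure e h. x \<bullet> e = 0"
    and "\<And>z A. z \<bullet> e = 0 \<Longrightarrow> A \<in> sets borel \<Longrightarrow>
      emeasure (flat_cone_measure e h) ((+) z -` A) = emeasure (flat_cone_measure e h) A"
    and "emeasure lborel (flat_cone e h (ball 0 r)) < \<infinity>"
    and "emeasure lborel (flat_cone e h (ball 0 1)) \<noteq> 0"
proof -
  have ee: "e \<bullet> e = 1" using e by (simp add: norm_eq_1)
  show fin: "emeasure lborel (flat_cone e h (ball 0 r)) < \<infinity>" for r
    using emeasure_mono[OF flat_cone_ball_subset[OF e h, of r], of lborel] emeasure_lborel_ball_finite[of "0::'a" "r + h"]
    by (auto intro: le_less_trans)
  show "sigma_finite_measure (flat_cone_measure e h)"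
    by (rule sigma_finite_if_balls_finite) (use fin in \<open>auto simp: emeasure_flat_cone_measure\<close>)
  have "flat_cone e h {x. x \<bullet> e \<noteq> 0} = {}"
    by (auto simp: flat_cone_def inner_diff_left ee)
  then have "emeasure (flat_cone_measure e h) {x. x \<bullet> e \<noteq> 0} = 0"
    by (subst emeasure_flat_cone_measure) auto
  then show "AE x in flat_cone_measure e h. x \<bullet> e = 0"
    by (intro AE_I[where N = "{x. x \<bullet> e \<noteq> 0}"]) auto
  show "emeasure (flat_cone_measure e h) ((+) z -` A) = emeasure (flat_cone_measure e h) A"
    if "z \<bullet> e = 0" and A: "A \<in> sets borel" for z A
  proof -
    have "(+) z -` A \<in> sets borel" using measurable_sets[of "(+) z" borel borel A] A by simp
    then show ?thesis
      using emeasure_flat_cone_translate[OF e h that] A by (simp add: emeasure_flat_cone_measure)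
  qed
  \<comment> \<open>The open part of the cone over the unit disc, with denominators cleared so that
    openness is visible.\<close>
  define V where "V = {x. 0 < x \<bullet> e} \<inter> {x. x \<bullet> e < h} \<inter> {x. norm (h *\<^sub>R x - (h * (x \<bullet> e)) *\<^sub>R e) < x \<bullet> e}"
  have "open V" unfolding V_def
    by (intro open_Int open_Collect_less continuous_intros)
  moreover have "(h / 2) *\<^sub>R e \<in> V" using h by (simp add: V_def ee)
  ultimately have "emeasure lborel V \<noteq> 0"
    using open_not_negligible[of V] by (auto simp: negligible_iff_null_sets null_sets_def)
  moreover have "V \<subseteq> flat_cone e h (ball 0 1)"
  proof
    fix x assume x: "x \<in> V"
    have "(h / (x \<bullet> e)) *\<^sub>R x - h *\<^sub>R e = (1 / (x \<bullet> e)) *\<^sub>R (h *\<^sub>R x - (h * (x \<bullet> e)) *\<^sub>R e)"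
      using x by (simp add: V_def scaleR_diff_right)
    then have "norm ((h / (x \<bullet> e)) *\<^sub>R x - h *\<^sub>R e) < 1"
      using x by (simp add: V_def)
    then show "x \<in> flat_cone e h (ball 0 1)"
      using x by (simp add: flat_cone_def V_def)
  qed
  ultimately show "emeasure lborel (flat_cone e h (ball 0 1)) \<noteq> 0"
    using emeasure_mono[of V "flat_cone e h (ball 0 1)" lborel] by auto
qed

lemma emeasure_flat_cone_orthogonal:
  fixes f :: "'a::euclidean_space \<Rightarrow> 'a"
  assumes f: "orthogonal_transformation f" and A: "A \<in> sets borel"
  shows "emeasure lborel (flat_cone (f e) h A) = emeasure lborel (flat_cone e h (f -` A))"
proof -
  have lf: "linear f" using f by (simp add: orthogonal_transformation_linear)
  interpret linear f by (rule lf)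
  have 1: "f x \<bullet> f e = x \<bullet> e" for x
    using f by (simp add: orthogonal_transformation_def)
  have "f -` flat_cone (f e) h A = flat_cone e h (f -` A)"
    by (auto simp: flat_cone_def 1 diff scale)
  then show ?thesis
    using emeasure_lborel_orthogonal_vimage[OF f, of "flat_cone (f e) h A"] flat_cone_borel[OF A] by simp
qed

lemma emeasure_lborel_scaled_vimage:
  fixes S :: "'a::euclidean_space set"
  assumes "c > 0" and S: "S \<in> sets borel"
  shows "emeasure lborel ((\<lambda>x. (1 / c) *\<^sub>R x) -` S) = ennreal (c ^ DIM('a)) * emeasure lborel S"
proof -
  have [measurable]: "S \<in> sets borel" by fact
  have m: "(\<lambda>x. (1 / c) *\<^sub>R x) -` S \<in> sets borel"
    using measurable_sets[of "\<lambda>x::'a. (1 / c) *\<^sub>R x" borel borel S] by simp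
  have "emeasure lborel ((\<lambda>x. (1 / c) *\<^sub>R x) -` S) = emeasure (density (distr lborel borel (\<lambda>x::'a. 0 + c *\<^sub>R x)) (\<lambda>_. ennreal (\<bar>c\<bar> ^ DIM('a)))) ((\<lambda>x. (1 / c) *\<^sub>R x) -` S)"
    using lborel_affine[of c "0::'a"] assms by simp
  also have "\<dots> = ennreal (c ^ DIM('a)) * emeasure (distr lborel borel (\<lambda>x::'a. c *\<^sub>R x)) ((\<lambda>x. (1 / c) *\<^sub>R x) -` S)"
    using assms m by (simp add: emeasure_density nn_integral_cmult)
  also have "emeasure (distr lborel borel (\<lambda>x::'a. c *\<^sub>R x)) ((\<lambda>x. (1 / c) *\<^sub>R x) -` S) = emeasure lborel S"
    using assms m by (subst emeasure_distr) (auto simp: vimage_def)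
  finally show ?thesis .
qed

text \<open>A dilation by \<open>h\<close> turns the cone of height 1 over \<open>A\<close> into the
  cone of height \<open>h\<close> over the dilated base.\<close>

lemma emeasure_flat_cone_scale:
  fixes e :: "'a::euclidean_space"
  assumes h: "h > 0" and A: "A \<in> sets borel"
  shows "emeasure lborel (flat_cone e h ((\<lambda>x. (1 / h) *\<^sub>R x) -` A)) = ennreal (h ^ DIM('a)) * emeasure lborel (flat_cone e 1 A)"
proof -
  have "flat_cone e h ((\<lambda>x. (1 / h) *\<^sub>R x) -` A) = (\<lambda>x. (1 / h) *\<^sub>R x) -` flat_cone e 1 A"
    using h by (auto simp: flat_cone_def scaleR_diff_right field_simps)
  then show ?thesis using emeasure_lborel_scaled_vimage[OF h flat_cone_borel[OF A]] by simp
qed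

section \<open>Hausdorff measure under isometries and dilations, and on hyperplanes\<close>

lemma hausdorff_outer_isometry:
  fixes f :: "real^'n \<Rightarrow> real^'n"
  assumes f: "\<And>x y. norm (f x - f y) = norm (x - y)" and s: "0 \<le> s"
  shows "hausdorff_outer s (f ` A) = hausdorff_outer s A"
proof (rule antisym)
  show "hausdorff_outer s (f ` A) \<le> hausdorff_outer s A"
    using hausdorff_outer_lipschitz[of 1 s A f] s f by simp
  have "inj_on f A"
  proof (rule inj_onI)
    fix x y assume "f x = f y"
    then show "x = y" using f[of x y] by simp
  qed
  then have inj: "inv_into A f (f x) = x" if "x \<in> A" for x
    using that by simp
  have "inv_into A f ` f ` A = A" using inj by (auto simp: image_iff)
  moreover have "norm (inv_into A f x - inv_into A f y) \<le> 1 * norm (x - y)" if xy: "x \<in> f ` A" "y \<in> f ` A" for x y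
    using that inj f by auto
  ultimately show "hausdorff_outer s A \<le> hausdorff_outer s (f ` A)"
    using hausdorff_outer_lipschitz[of 1 s "f ` A" "inv_into A f"] s by simp
qed

text \<open>The two inequalities are the Lipschitz estimates for the dilation and for its
  inverse.\<close>

lemma hausdorff_outer_scaled_vimage:
  fixes A :: "(real^'n) set"
  assumes c: "c > 0" and s: "0 \<le> s"
  shows "hausdorff_outer s ((\<lambda>x. (1 / c) *\<^sub>R x) -` A) = ennreal (c powr s) * hausdorff_outer s A"
proof (rule antisym)
  have eq: "(\<lambda>x. (1 / c) *\<^sub>R x) -` A = (\<lambda>x. c *\<^sub>R x) ` A"
    using c by (auto simp: image_iff intro!: bexI[of _ "(1/c) *\<^sub>R _"])
  show "hausdorff_outer s ((\<lambda>x. (1 / c) *\<^sub>R x) -` A) \<le> ennreal (c powr s) * hausdorff_outer s A"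
    unfolding eq using c by (intro hausdorff_outer_lipschitz s) (auto simp flip: scaleR_diff_right)
  have "(\<lambda>x. (1/c) *\<^sub>R x) ` ((\<lambda>x. (1 / c) *\<^sub>R x) -` A) = A"
    unfolding eq using c by (auto simp: image_iff)
  then have "hausdorff_outer s A \<le> ennreal ((1/c) powr s) * hausdorff_outer s ((\<lambda>x. (1 / c) *\<^sub>R x) -` A)"
    using hausdorff_outer_lipschitz[of "1/c" s "(\<lambda>x. (1 / c) *\<^sub>R x) -` A" "\<lambda>x. (1/c) *\<^sub>R x"] c s
    by (simp add: right_diff_distrib flip: scaleR_diff_right)
  then have "ennreal (c powr s) * hausdorff_outer s A \<le> ennreal (c powr s) * (ennreal ((1/c) powr s) * hausdorff_outer s ((\<lambda>x. (1 / c) *\<^sub>R x) -` A))"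
    by (intro mult_left_mono) auto
  also have "\<dots> = hausdorff_outer s ((\<lambda>x. (1 / c) *\<^sub>R x) -` A)"
    using c by (simp add: mult.assoc[symmetric] ennreal_mult''[symmetric] powr_mult[symmetric])
  finally show "ennreal (c powr s) * hausdorff_outer s A \<le> hausdorff_outer s ((\<lambda>x. (1 / c) *\<^sub>R x) -` A)" .
qed

text \<open>\<open>measure_of\<close> yields the zero measure unless the given set function is a
  measure, so the identification is conditional. The condition is carried along until
  \<open>surface_measure_formula\<close> settles both cases.\<close>

lemma emeasure_hausdorff_measure:
  assumes "measure_space UNIV (sets borel) (hausdorff_outer s :: (real^'n) set \<Rightarrow> ennreal)" "A \<in> sets borel"
  shows "emeasure (hausdorff_measure s) A = hausdorff_outer s (A :: (real^'n) set)"
  unfolding hausdorff_measure_def using assms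
  by (subst emeasure_measure_of_conv) (auto simp: sets.sigma_sets_eq[of borel, simplified])

lemma sets_hausdorff_measure [simp, measurable_cong]: "sets (hausdorff_measure s) = sets borel"
  by (simp add: hausdorff_measure_def sets.sigma_sets_eq[of borel, simplified])

lemma hausdorff_hyperplane_ball_finite:
  fixes e :: "real^'n"
  assumes n: "2 \<le> CARD('n)" and e: "norm e = 1"
    and ms: "measure_space UNIV (sets borel) (hausdorff_outer (real CARD('n) - 1) :: (real^'n) set \<Rightarrow> ennreal)"
  shows "hausdorff_outer (real CARD('n) - 1) ({x. x \<bullet> e = 0} \<inter> ball 0 r) < \<infinity>"
proof -
  let ?H = "hausdorff_outer (real CARD('n) - 1) :: (real^'n) set \<Rightarrow> ennreal"
  let ?k = "undefined :: 'n"
  have s: "0 \<le> real CARD('n) - 1" using n by simp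
  obtain f :: "real^'n \<Rightarrow> real^'n" where f: "orthogonal_transformation f" "f (axis ?k 1) = e"
    by (rule orthogonal_transformation_exists_1[OF norm_axis_1[of ?k] e]) blast
  have lf: "linear f" using f by (simp add: orthogonal_transformation_linear)
  have fn: "norm (f x - f y) = norm (x - y)" for x y
    using orthogonal_transformation_norm[OF f(1), of "x - y"] by (simp add: linear_diff[OF lf])
  obtain N :: nat where N: "r \<le> real N" using real_arch_simple by blast
  let ?K = "{x :: real^'n. x $ ?k = 0 \<and> (\<forall>i. \<bar>x $ i\<bar> \<le> real N)}"
  have sub: "{x. x \<bullet> e = 0} \<inter> ball 0 r \<subseteq> f ` ?K"
  proof
    fix y assume y: "y \<in> {x. x \<bullet> e = 0} \<inter> ball 0 r"
    obtain x where x: "y = f x"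
      using orthogonal_transformation_surj[OF f(1)] by auto
    have "x \<bullet> axis ?k 1 = f x \<bullet> f (axis ?k 1)"
      using f(1) by (simp add: orthogonal_transformation_def)
    then have "x $ ?k = 0" using y x f(2) by (simp add: inner_axis)
    moreover have "\<bar>x $ i\<bar> \<le> real N" for i
    proof -
      have "norm x = norm y" using x f(1) by (simp add: orthogonal_transformation_norm)
      then show ?thesis using component_le_norm_cart[of x i] y N by auto
    qed
    ultimately show "y \<in> f ` ?K" using x by blast
  qed
  have Kb: "?K \<in> sets borel"
  proof -
    have "?K = {x. x $ ?k = 0} \<inter> (\<Inter>i. {x. \<bar>x $ i\<bar> \<le> real N})" by auto
    also have "closed \<dots>"
      by (intro closed_Int closed_INT ballI closed_Collect_eq closed_Collect_le continuous_intros)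
    finally show ?thesis by (rule borel_closed)
  qed
  \<comment> \<open>Monotonicity will be applied to the measure, so the rotated cube must be
    Borel.\<close>
  have fK: "f ` ?K \<in> sets borel"
  proof -
    have "compact ?K"
    proof -
      have "?K \<subseteq> cbox (- (\<chi> i. real N)) (\<chi> i. real N)" by (auto simp: mem_box_cart abs_le_iff minus_le_iff)
      then have "bounded ?K" by (rule bounded_subset[OF bounded_cbox])
      moreover have "closed ?K"
      proof -
        have "?K = {x. x $ ?k = 0} \<inter> (\<Inter>i. {x. \<bar>x $ i\<bar> \<le> real N})" by auto
        also have "closed \<dots>"
          by (intro closed_Int closed_INT ballI closed_Collect_eq closed_Collect_le continuous_intros)
        finally show ?thesis .
      qed
      ultimately show ?thesis by (simp add: compact_eq_bounded_closed)
    qed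
    then show ?thesis
      by (intro borel_compact compact_continuous_image linear_continuous_on) (use lf in \<open>simp_all add: linear_linear\<close>)
  qed
  have "?H ({x. x \<bullet> e = 0} \<inter> ball 0 r) = emeasure (hausdorff_measure (real CARD('n) - 1)) ({x. x \<bullet> e = 0} \<inter> ball 0 r)"
    by (subst emeasure_hausdorff_measure[OF ms]) auto
  also have "\<dots> \<le> emeasure (hausdorff_measure (real CARD('n) - 1)) (f ` ?K)"
    using sub fK by (intro emeasure_mono) auto
  also have "\<dots> = ?H (f ` ?K)" using emeasure_hausdorff_measure[OF ms fK] .
  also have "\<dots> = ?H ?K" by (rule hausdorff_outer_isometry[OF fn s])
  also have "\<dots> < \<infinity>" by (rule hausdorff_outer_coordinate_cube_finite[OF n])
  finally show ?thesis .
qed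

text \<open>The law "volume is base times height divided by n" with an unspecified constant in place
  of n. For fixed \<open>e\<close> and \<open>h\<close> both sides are translation-invariant
  measures on the same hyperplane, hence proportional. Rotations remove the dependence on
  \<open>e\<close>, and the homogeneities of degree n-1 and n under dilations produce the factor
  1/h.\<close>

lemma hausdorff_hyperplane_flat_cone:
  assumes n: "2 \<le> CARD('n::finite)"
    and ms: "measure_space UNIV (sets borel) (hausdorff_outer (real CARD('n) - 1) :: (real^'n) set \<Rightarrow> ennreal)"
  shows "\<exists>c\<ge>0. \<forall>e h. \<forall>A::(real^'n) set. norm e = 1 \<longrightarrow> h > 0 \<longrightarrow> A \<in> sets borel \<longrightarrow> A \<subseteq> {x. x \<bullet> e = 0} \<longrightarrow>
    hausdorff_outer (real CARD('n) - 1) A = ennreal (c / h) * emeasure lborel (flat_cone e h A)"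
proof -
  define s where "s = real CARD('n) - 1"
  let ?H = "hausdorff_outer s :: (real^'n) set \<Rightarrow> ennreal"
  have s: "0 \<le> s" using n by (simp add: s_def)
  have ms': "measure_space UNIV (sets borel) ?H" using ms by (simp add: s_def)
  \<comment> \<open>The unit disc of the hyperplane, used to normalise the proportionality.\<close>
  define B where "B e = {x::real^'n. x \<bullet> e = 0} \<inter> ball 0 1" for e
  have Bb [measurable]: "B e \<in> sets borel" for e
    unfolding B_def by (intro sets.Int borel_closed[OF closed_Collect_eq]) (auto intro!: continuous_intros)
  have HE: "emeasure (hausdorff_measure s) A = ?H A" if "A \<in> sets borel" for A :: "(real^'n) set"
    by (rule emeasure_hausdorff_measure[OF ms' that])
  have fe: "flat_cone e h (B e) = flat_cone e h (ball 0 1)" if "norm e = 1" for e h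
    using that by (auto simp: flat_cone_def B_def inner_diff_left norm_eq_1)
  have key: "?H A * emeasure lborel (flat_cone e h (B e)) = emeasure lborel (flat_cone e h A) * ?H (B e)"
    if e: "norm e = 1" and h: "h > 0" and A [measurable]: "A \<in> sets borel" and AP: "A \<subseteq> {x. x \<bullet> e = 0}" for e h and A :: "(real^'n) set"
  proof -
    let ?P = "{x::real^'n. x \<bullet> e = 0}"
    have P [measurable]: "?P \<in> sets borel" by (intro borel_closed closed_Collect_eq) (auto intro!: continuous_intros)
    \<comment> \<open>Restricting to the hyperplane gives finite mass to balls, which supplies
      sigma-finiteness for the uniqueness argument.\<close>
    define M where "M = density (hausdorff_measure s) (indicator ?P)"
    have eM: "emeasure M C = ?H (C \<inter> ?P)" if C: "C \<in> sets borel" for C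
    proof -
      have "emeasure M C = (\<integral>\<^sup>+x. indicator ?P x * indicator C x \<partial>hausdorff_measure s)"
        unfolding M_def using C P by (intro emeasure_density) auto
      also have "\<dots> = (\<integral>\<^sup>+x. indicator (C \<inter> ?P) x \<partial>hausdorff_measure s)"
        by (intro nn_integral_cong) (auto simp: indicator_def)
      also have "\<dots> = ?H (C \<inter> ?P)" using C P by (subst nn_integral_indicator) (auto simp: HE)
      finally show ?thesis .
    qed
    have sM: "sets M = sets borel" by (simp add: M_def)
    have 1: "sigma_finite_measure M"
      using hausdorff_hyperplane_ball_finite[OF n e ms]
      by (intro sigma_finite_if_balls_finite[OF sM]) (simp add: eM Int_commute s_def)
    have "emeasure M (- ?P) = 0"
    proof -
      have "emeasure M (- ?P) = ?H {}" by (subst eM) auto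
      also have "\<dots> = 0" using HE[of "{}"] by simp
      finally show ?thesis .
    qed
    then have 2: "AE x in M. x \<in> ?P"
      by (intro AE_I[where N = "- ?P"]) (auto simp: sM)
    have 3: "emeasure M ((+) z -` C) = emeasure M C" if z: "z \<in> ?P" and C: "C \<in> sets borel" for z C
    proof -
      have "(+) z -` C \<in> sets borel" using measurable_sets[of "(+) z" borel borel C] C by simp
      then have "emeasure M ((+) z -` C) = ?H ((+) z -` C \<inter> ?P)" by (rule eM)
      also have "\<dots> = ?H ((+) z ` ((+) z -` C \<inter> ?P))"
        by (rule hausdorff_outer_isometry[symmetric, OF _ s]) simp
      also have "(+) z ` ((+) z -` C \<inter> ?P) = C \<inter> ?P"
      proof (intro equalityI subsetI)
        fix x assume x: "x \<in> C \<inter> ?P"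
        then have "x - z \<in> (+) z -` C \<inter> ?P" using z by (auto simp: inner_diff_left)
        then have "z + (x - z) \<in> (+) z ` ((+) z -` C \<inter> ?P)" by (rule imageI)
        then show "x \<in> (+) z ` ((+) z -` C \<inter> ?P)" by simp
      qed (use z in \<open>auto simp: inner_add_left\<close>)
      finally show ?thesis using C by (simp add: eM)
    qed
    have um: "uminus -` B e = B e" by (auto simp: B_def)
    have "emeasure M A * emeasure (flat_cone_measure e h) (B e) = emeasure (flat_cone_measure e h) A * emeasure M (uminus -` B e)"
    proof (rule translation_invariant_measures_proportional[where P = ?P])
      show "emeasure (flat_cone_measure e h) ((+) z -` C) = emeasure (flat_cone_measure e h) C"
        if "z \<in> ?P" "C \<in> sets borel" for z C using flat_cone_measure_props(3)[OF e h, of z C] that by simp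
    qed (use sM 1 2 3 flat_cone_measure_props(1,2)[OF e h] in simp_all)
    moreover have "A \<inter> ?P = A" "B e \<inter> ?P = B e" using AP by (auto simp: B_def)
    ultimately show ?thesis by (simp add: emeasure_flat_cone_measure eM um)
  qed
  let ?e0 = "axis (undefined::'n) 1 :: real^'n"
  have e0: "norm ?e0 = 1" by simp
  define \<eta> where "\<eta> = enn2real (?H (B ?e0))"
  have \<eta>fin: "?H (B e) < \<infinity>" if "norm e = 1" for e
    using hausdorff_hyperplane_ball_finite[OF n that ms, of 1] by (simp add: B_def s_def)
  have rot: "?H (B e) = ennreal \<eta> \<and> emeasure lborel (flat_cone e h (B e)) = emeasure lborel (flat_cone ?e0 h (B ?e0))"
    if e: "norm e = 1" for e h
  proof -
    obtain f where f: "orthogonal_transformation f" "f ?e0 = e"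
      by (rule orthogonal_transformation_exists_1[OF e0 e]) blast
    have lf: "linear f" using f by (simp add: orthogonal_transformation_linear)
    have fn: "norm (f x - f y) = norm (x - y)" for x y
      using orthogonal_transformation_norm[OF f(1), of "x - y"] by (simp add: linear_diff[OF lf])
    have in_f: "f x \<bullet> e = x \<bullet> ?e0" for x
    proof -
      have "f x \<bullet> f ?e0 = x \<bullet> ?e0" using f(1) by (simp add: orthogonal_transformation_def)
      then show ?thesis unfolding f(2) .
    qed
    have nf: "norm (f x) = norm x" for x using f(1) by (simp add: orthogonal_transformation_norm)
    have v: "f -` B e = B ?e0"
      by (auto simp: B_def in_f nf)
    have "f ` B ?e0 = B e"
      using surj_image_vimage_eq[OF orthogonal_transformation_surj[OF f(1)], of "B e"] v by simp
    then have "?H (B e) = ?H (B ?e0)"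
      using hausdorff_outer_isometry[OF fn s, of "B ?e0"] by simp
    moreover have "?H (B ?e0) = ennreal \<eta>" using \<eta>fin[OF e0] by (simp add: \<eta>_def)
    moreover have "emeasure lborel (flat_cone e h (B e)) = emeasure lborel (flat_cone ?e0 h (B ?e0))"
      using emeasure_flat_cone_orthogonal[OF f(1) Bb, of ?e0 h e] by (simp add: f(2) v)
    ultimately show ?thesis by simp
  qed
  \<comment> \<open>The volume of the cone of height \<open>h\<close> over the unit disc, the same
    for all directions by rotation.\<close>
  define l where "l h = enn2real (emeasure lborel (flat_cone ?e0 h (B ?e0)))" for h
  have le: "emeasure lborel (flat_cone e h (B e)) = ennreal (l h)" and l0: "l h > 0" if "norm e = 1" "h > 0" for e h
  proof -
    have "emeasure lborel (flat_cone ?e0 h (B ?e0)) < \<infinity>" "emeasure lborel (flat_cone ?e0 h (B ?e0)) \<noteq> 0"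
      using flat_cone_measure_props(4,5)[OF e0 \<open>h > 0\<close>] by (simp_all add: fe)
    then show "l h > 0" "emeasure lborel (flat_cone e h (B e)) = ennreal (l h)"
      using rot[OF that(1), of h] by (auto simp: l_def enn2real_positive_iff zero_less_iff_neq_zero)
  qed
  have \<eta>0: "\<eta> \<ge> 0" by (simp add: \<eta>_def)
  have HA: "?H A = ennreal (\<eta> / l h) * emeasure lborel (flat_cone e h A)"
    if e: "norm e = 1" and h: "h > 0" and A: "A \<in> sets borel" and AP: "A \<subseteq> {x. x \<bullet> e = 0}" for e h and A :: "(real^'n) set"
  proof -
    have "?H A * ennreal (l h) = emeasure lborel (flat_cone e h A) * ennreal \<eta>"
      using key[OF that] le[OF e h] rot[OF e] by simp
    then have "?H A * (ennreal (l h) * ennreal (1 / l h)) = emeasure lborel (flat_cone e h A) * (ennreal \<eta> * ennreal (1 / l h))"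
      by (simp only: mult.assoc[symmetric])
    moreover have "ennreal (l h) * ennreal (1 / l h) = 1" "ennreal \<eta> * ennreal (1 / l h) = ennreal (\<eta> / l h)"
      using l0[OF e h] \<eta>0 by (simp_all flip: ennreal_mult)
    ultimately show ?thesis by (simp add: mult.commute)
  qed
  \<comment> \<open>The disc of radius \<open>h\<close> is measured in two ways: Hausdorff measure
    gains h^(n-1), cone volume at height \<open>h\<close> gains h^n. The comparison divides by
    \<open>\<eta>\<close>, so the case \<open>\<eta> = 0\<close>, where both sides vanish, is
    separate.\<close>
  have lh: "\<eta> / l h = \<eta> / l 1 / h" if h: "h > 0" for h
  proof (cases "\<eta> = 0")
    case False
    then have "\<eta> > 0" using \<eta>0 by simp
    let ?V = "(\<lambda>x. (1 / h) *\<^sub>R x) -` B ?e0"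
    have V: "?V \<in> sets borel" using measurable_sets[of "\<lambda>x::real^'n. (1 / h) *\<^sub>R x" borel borel "B ?e0"] by simp
    have "?V \<subseteq> {x. x \<bullet> ?e0 = 0}" using h by (auto simp: B_def)
    from HA[OF e0 h V this] have "?H ?V = ennreal (\<eta> / l h) * (ennreal (h ^ CARD('n)) * ennreal (l 1))"
      using emeasure_flat_cone_scale[OF h Bb, of ?e0 ?e0] le[OF e0, of 1] by simp
    moreover have "?H ?V = ennreal (h powr s) * ennreal \<eta>"
      using hausdorff_outer_scaled_vimage[OF h s, of "B ?e0"] rot[OF e0] by simp
    ultimately have "ennreal (h powr s * \<eta>) = ennreal (\<eta> / l h * (h ^ CARD('n) * l 1))"
      using \<eta>0 l0[OF e0 h] l0[OF e0, of 1] h by (simp flip: ennreal_mult)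
    then have 1: "h powr s * \<eta> = \<eta> / l h * (h ^ CARD('n) * l 1)"
      using \<eta>0 l0[OF e0 h] l0[OF e0, of 1] h by (subst (asm) ennreal_inj) auto
    have 2: "h ^ CARD('n) = h powr s * h"
      using powr_realpow[OF h, of "CARD('n)"] powr_add[of h s 1] h by (simp add: s_def)
    have "h powr s * \<eta> = \<eta> / l h * (h powr s * h * l 1)" by (rule 1[unfolded 2])
    also have "\<dots> = h powr s * (\<eta> / l h * (h * l 1))" by (simp only: mult_ac)
    finally have *: "h powr s * \<eta> = h powr s * (\<eta> / l h * (h * l 1))" .
    have "h powr s \<noteq> 0" using h by simp
    from mult_left_cancel[OF this, THEN iffD1, OF *] have 3: "\<eta> = (\<eta> * (h * l 1)) / l h"
      unfolding times_divide_eq_left .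
    have "l h \<noteq> 0" using l0[OF e0 h] by simp
    from nonzero_eq_divide_eq[OF this, THEN iffD1, OF 3] have "\<eta> * l h = \<eta> * (h * l 1)" .
    then have "l h = h * l 1" using \<open>\<eta> > 0\<close> by simp
    then show ?thesis by simp
  qed simp
  show ?thesis
    unfolding s_def[symmetric]
  proof (intro exI[of _ "\<eta> / l 1"] conjI allI impI)
    show "0 \<le> \<eta> / l 1" using \<eta>0 l0[OF e0, of 1] by simp
  next
    fix e :: "real^'n" and h :: real and A :: "(real^'n) set"
    assume *: "norm e = 1" "h > 0" "A \<in> sets borel" "A \<subseteq> {x. x \<bullet> e = 0}"
    show "?H A = ennreal (\<eta> / l 1 / h) * emeasure lborel (flat_cone e h A)"
      using HA[OF *] unfolding lh[OF *(2)] .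
  qed
qed

section \<open>Gauges and polar coordinates\<close>

text \<open>The conditions on \<open>dG\<close> say that the subdifferential of \<open>G\<close> at a point \<open>x \<noteq> 0\<close> is the
  singleton \<open>{dG x}\<close>; the value of \<open>dG\<close> at the origin is irrelevant.\<close>

locale smooth_gauge =
  fixes G :: "real^'n \<Rightarrow> real" and dG :: "real^'n \<Rightarrow> real^'n" and m M :: real
  assumes m_pos: "0 < m"
    and lower: "m * norm x \<le> G x"
    and upper: "G x \<le> M * norm x"
    and hom: "0 \<le> t \<Longrightarrow> G (t *\<^sub>R x) = t * G x"
    and dG_le: "x \<noteq> 0 \<Longrightarrow> dG x \<bullet> y \<le> G y"
    and dG_self: "x \<noteq> 0 \<Longrightarrow> dG x \<bullet> x = G x"
    and dG_unique: "x \<noteq> 0 \<Longrightarrow> (\<And>y. d \<bullet> y \<le> G y) \<Longrightarrow> d \<bullet> x = G x \<Longrightarrow> d = dG x"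
    and dG_zero: "dG 0 = 0"
begin

lemma G_zero [simp]: "G 0 = 0"
  using hom[of 0 0] by simp

lemma G_pos: "x \<noteq> 0 \<Longrightarrow> 0 < G x"
  using lower[of x] m_pos by (metis less_le_trans mult_pos_pos zero_less_norm_iff)

lemma G_nonneg: "0 \<le> G x"
  using G_pos[of x] by (cases "x = 0") auto

lemma M_pos: "0 < M"
proof -
  have "0 < G (axis undefined 1)" by (rule G_pos) (simp add: axis_eq_0_iff)
  also have "\<dots> \<le> M" using upper[of "axis undefined 1"] by simp
  finally show ?thesis .
qed

text \<open>The subgradient inequality is tested with the vector \<open>dG x\<close> itself.\<close>

lemma norm_dG_le: "norm (dG x) \<le> M"
proof (cases "dG x = 0")
  case True
  then show ?thesis using M_pos by simp
next
  case False
  then have "x \<noteq> 0" using dG_zero by auto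
  have "norm (dG x) * norm (dG x) = dG x \<bullet> dG x" by (simp add: dot_square_norm power2_eq_square)
  also have "\<dots> \<le> M * norm (dG x)" using dG_le[OF \<open>x \<noteq> 0\<close>, of "dG x"] upper[of "dG x"] by linarith
  finally show ?thesis using False by simp
qed

text \<open>By homogeneity a subgradient at \<open>t *\<^sub>R x\<close> is also a subgradient at
  \<open>x\<close>, and there is only one.\<close>

lemma dG_scale:
  assumes "0 < t" shows "dG (t *\<^sub>R x) = dG x"
proof (cases "x = 0")
  case False
  show ?thesis
  proof (rule dG_unique[OF False])
    show "dG (t *\<^sub>R x) \<bullet> y \<le> G y" for y using False assms by (intro dG_le) auto
    have "dG (t *\<^sub>R x) \<bullet> (t *\<^sub>R x) = t * G x"
      using False assms by (subst dG_self) (auto simp: hom)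
    then show "dG (t *\<^sub>R x) \<bullet> x = G x" using assms by simp
  qed
qed simp

lemma G_diff_le: "G x - G y \<le> M * norm (x - y)"
proof (cases "x = 0")
  case True
  have "0 \<le> M * norm (x - y)" using M_pos by simp
  then show ?thesis using G_nonneg[of y] True by simp
next
  case False
  have "G x - G y \<le> dG x \<bullet> (x - y)"
    using dG_self[OF False] dG_le[OF False, of y] by (simp add: inner_diff_right)
  also have "\<dots> \<le> norm (dG x) * norm (x - y)" by (rule norm_cauchy_schwarz)
  also have "\<dots> \<le> M * norm (x - y)" by (intro mult_right_mono norm_dG_le) simp
  finally show ?thesis .
qed

lemma continuous_on_G: "continuous_on S G"
proof -
  have "lipschitz_on M UNIV G"
  proof (rule lipschitz_onI)
    show "dist (G x) (G y) \<le> M * dist x y" for x y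
      using G_diff_le[of x y] G_diff_le[of y x] by (simp add: dist_norm norm_minus_commute)
  qed (use M_pos in simp)
  then have "continuous_on UNIV G" by (rule lipschitz_on_continuous_on)
  then show ?thesis by (rule continuous_on_subset) simp
qed

lemma borel_measurable_G [measurable]: "G \<in> borel_measurable borel"
  by (intro borel_measurable_continuous_onI continuous_on_G)

text \<open>The conditions that define a subgradient are closed in the pair of point and vector. By
  uniqueness the graph of \<open>dG\<close> is exactly this closed set, and a function with closed
  graph and values in a compact ball is continuous.\<close>

lemma continuous_on_dG: "continuous_on (- {0}) dG"
proof -
  have fim: "dG \<in> (- {0}) \<rightarrow> cball 0 M" using norm_dG_le by auto
  define C where "C = (\<Inter>y. {p :: (real^'n) \<times> (real^'n). snd p \<bullet> y \<le> G y}) \<inter> {p. snd p \<bullet> fst p = G (fst p)}"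
  have "continuous_on UNIV (\<lambda>p :: (real^'n) \<times> (real^'n). G (fst p))"
    by (rule continuous_on_compose2[OF continuous_on_G[of UNIV]]) (auto intro!: continuous_intros)
  then have "closed C" unfolding C_def
    by (intro closed_Int closed_INT ballI closed_Collect_le closed_Collect_eq continuous_intros)
  moreover have "(\<lambda>x. (x, dG x)) ` (- {0}) = (- {0}) \<times> cball 0 M \<inter> C"
  proof (intro equalityI subsetI)
    fix p assume "p \<in> (- {0}) \<times> cball 0 M \<inter> C"
    then have "fst p \<noteq> 0" "\<And>y. snd p \<bullet> y \<le> G y" "snd p \<bullet> fst p = G (fst p)"
      by (auto simp: C_def)
    then have "snd p = dG (fst p)" by (intro dG_unique) auto
    then show "p \<in> (\<lambda>x. (x, dG x)) ` (- {0})"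
      using \<open>fst p \<noteq> 0\<close> by (intro image_eqI[of _ _ "fst p"]) (auto simp: prod_eq_iff)
  qed (use norm_dG_le dG_le dG_self in \<open>auto simp: C_def\<close>)
  ultimately have "closedin (top_of_set ((- {0}) \<times> cball 0 M)) ((\<lambda>x. (x, dG x)) ` (- {0}))"
    using closedin_closed_Int[of C "(- {0}) \<times> cball 0 M"] by simp
  then show ?thesis
    using continuous_closed_graph_eq[OF compact_cball fim] by simp
qed

lemma borel_measurable_dG [measurable]: "dG \<in> borel_measurable borel"
proof -
  have "(\<lambda>x. indicator (- {0}) x *\<^sub>R dG x) \<in> borel_measurable borel"
    by (intro borel_measurable_continuous_on_indicator continuous_on_dG) auto
  moreover have "(\<lambda>x. indicator (- {0}) x *\<^sub>R dG x) = dG"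
    by (auto simp: fun_eq_iff indicator_def dG_zero)
  ultimately show ?thesis by simp
qed

lemma dG_diff_bounds:
  assumes "x \<noteq> 0" "y \<noteq> 0"
  shows "dG x \<bullet> (y - x) \<le> G y - G x" "G y - G x \<le> dG y \<bullet> (y - x)"
  using dG_le[OF assms(1), of y] dG_le[OF assms(2), of x] dG_self[OF assms(1)] dG_self[OF assms(2)]
  by (auto simp: inner_diff_right)

lemma dG_near:
  assumes "x \<noteq> 0" "0 < e"
  obtains d where "0 < d" "d \<le> 1" "\<And>y. norm (y - x) < d \<Longrightarrow> y \<noteq> 0 \<and> norm (dG y - dG x) \<le> e"
proof -
  have "isCont dG x"
    using continuous_on_dG assms(1) continuous_on_eq_continuous_at[of "- {0}" dG] by (simp add: open_Compl)
  then have "\<exists>d>0. \<forall>y. dist y x < d \<longrightarrow> dist (dG y) (dG x) < e"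
    using assms(2) unfolding continuous_at_eps_delta by simp
  then obtain d where d: "0 < d" "\<And>y. norm (y - x) < d \<Longrightarrow> norm (dG y - dG x) < e"
    unfolding dist_norm by auto
  show ?thesis
  proof (rule that[of "min 1 (min d (norm x))"])
    show "0 < min 1 (min d (norm x))" using d assms by simp
  next
    fix y assume y: "norm (y - x) < min 1 (min d (norm x))"
    then have "y \<noteq> 0" by auto
    with d(2)[of y] y show "y \<noteq> 0 \<and> norm (dG y - dG x) \<le> e" by simp
  qed simp
qed

text \<open>The increment of \<open>G\<close> lies between the linear maps given by the subgradients
  at the two ends, and these are close by continuity of \<open>dG\<close>.\<close>

lemma has_derivative_G:
  assumes x: "x \<noteq> 0"
  shows "(G has_derivative (\<lambda>h. dG x \<bullet> h)) (at x)"
  unfolding has_derivative_at_alt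
proof (intro conjI allI impI)
  show "bounded_linear (\<lambda>h. dG x \<bullet> h)" by (rule bounded_linear_inner_right)
  fix e :: real assume "0 < e"
  from dG_near[OF x this] obtain d where d: "0 < d" "\<And>y. norm (y - x) < d \<Longrightarrow> y \<noteq> 0 \<and> norm (dG y - dG x) \<le> e"
    by blast
  have "norm (G y - G x - dG x \<bullet> (y - x)) \<le> e * norm (y - x)" if y: "norm (y - x) < d" for y
  proof -
    have "(dG y - dG x) \<bullet> (y - x) \<le> norm (dG y - dG x) * norm (y - x)" by (rule norm_cauchy_schwarz)
    also have "\<dots> \<le> e * norm (y - x)" using d(2)[OF y] by (intro mult_right_mono) auto
    finally show ?thesis
      using dG_diff_bounds[OF x, of y] d(2)[OF y] by (simp add: inner_diff_left)
  qed
  with d(1) show "\<exists>d>0. \<forall>y. norm (y - x) < d \<longrightarrow> norm (G y - G x - dG x \<bullet> (y - x)) \<le> e * norm (y - x)"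
    by blast
qed

lemma G_ray: "x \<noteq> 0 \<Longrightarrow> 0 \<le> s \<Longrightarrow> G ((s / G x) *\<^sub>R x) = s"
  using G_pos[of x] by (simp add: hom)

text \<open>Polar coordinates with the solid ball as the space of directions: the inner integral
  depends only on the ray through \<open>x\<close>. Put s = \<sigma> G x inside, exchange the
  integrals, put z = \<sigma> x outside, exchange again, and integrate out \<sigma>.\<close>

lemma polar_formula:
  fixes f :: "real^'n \<Rightarrow> ennreal"
  assumes [measurable]: "f \<in> borel_measurable borel"
  shows "(\<integral>\<^sup>+x. f x * indicator {x. G x < 1} x \<partial>lborel) =
    (\<integral>\<^sup>+x. (\<integral>\<^sup>+s. ennreal (real CARD('n) * s ^ (CARD('n) - 1)) * f ((s / G x) *\<^sub>R x) * indicator {0<..<1} s \<partial>lborel)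
        * indicator {x. G x < 1} x \<partial>lborel)"
proof -
  let ?n = "CARD('n)"
  have n: "0 < ?n" by simp
  have ae0: "AE x in lborel. x \<noteq> (0::real^'n)"
    by (rule AE_lborel_singleton)
  \<comment> \<open>The integrand after z = \<sigma> x, with the Jacobian \<sigma>^(-n)
    included.\<close>
  define k where "k \<sigma> z = ennreal (real ?n * (G z / \<sigma>) ^ ?n / \<sigma>) * f z * indicator {z. G z < 1} z * indicator {z. G z < \<sigma>} z" for \<sigma> z
  have inner: "(\<integral>\<^sup>+s. ennreal (real ?n * s ^ (?n - 1)) * f ((s / G x) *\<^sub>R x) * indicator {0<..<1} s \<partial>lborel) * indicator {x. G x < 1} x
    = (\<integral>\<^sup>+\<sigma>. ennreal (real ?n * G x * (\<sigma> * G x) ^ (?n - 1)) * f (\<sigma> *\<^sub>R x) * indicator {x. G x < 1} x * indicator {0<..<1} (\<sigma> * G x) \<partial>lborel)"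
    if x: "x \<noteq> 0" for x
  proof -
    have g: "0 < G x" using G_pos[OF x] .
    have "(\<integral>\<^sup>+s. ennreal (real ?n * s ^ (?n - 1)) * f ((s / G x) *\<^sub>R x) * indicator {0<..<1} s \<partial>lborel)
       = ennreal \<bar>G x\<bar> * (\<integral>\<^sup>+\<sigma>. ennreal (real ?n * (0 + G x * \<sigma>) ^ (?n - 1)) * f (((0 + G x * \<sigma>) / G x) *\<^sub>R x) * indicator {0<..<1} (0 + G x * \<sigma>) \<partial>lborel)"
      using g by (intro nn_integral_real_affine) auto
    also have "\<dots> = (\<integral>\<^sup>+\<sigma>. ennreal (G x) * (ennreal (real ?n * (G x * \<sigma>) ^ (?n - 1)) * f (\<sigma> *\<^sub>R x) * indicator {0<..<1} (G x * \<sigma>)) \<partial>lborel)"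
      using g by (subst nn_integral_cmult[symmetric]) auto
    also have "\<dots> = (\<integral>\<^sup>+\<sigma>. ennreal (real ?n * G x * (\<sigma> * G x) ^ (?n - 1)) * f (\<sigma> *\<^sub>R x) * indicator {0<..<1} (\<sigma> * G x) \<partial>lborel)"
    proof (intro nn_integral_cong)
      fix \<sigma> :: real
      show "ennreal (G x) * (ennreal (real ?n * (G x * \<sigma>) ^ (?n - 1)) * f (\<sigma> *\<^sub>R x) * indicator {0<..<1} (G x * \<sigma>))
        = ennreal (real ?n * G x * (\<sigma> * G x) ^ (?n - 1)) * f (\<sigma> *\<^sub>R x) * indicator {0<..<1} (\<sigma> * G x)"
      proof (cases "G x * \<sigma> \<in> {0<..<1}")
        case True
        then have "ennreal (real ?n * G x * (\<sigma> * G x) ^ (?n - 1)) = ennreal (G x) * ennreal (real ?n * (G x * \<sigma>) ^ (?n - 1))"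
          using g by (subst ennreal_mult[symmetric]) (auto simp: mult_ac)
        then show ?thesis by (simp add: mult_ac)
      qed (simp add: mult.commute)
    qed
    finally have "(\<integral>\<^sup>+s. ennreal (real ?n * s ^ (?n - 1)) * f ((s / G x) *\<^sub>R x) * indicator {0<..<1} s \<partial>lborel) * indicator {x. G x < 1} x
      = (\<integral>\<^sup>+\<sigma>. ennreal (real ?n * G x * (\<sigma> * G x) ^ (?n - 1)) * f (\<sigma> *\<^sub>R x) * indicator {0<..<1} (\<sigma> * G x) \<partial>lborel) * indicator {x. G x < 1} x"
      by (simp only:)
    also have "\<dots> = (\<integral>\<^sup>+\<sigma>. ennreal (real ?n * G x * (\<sigma> * G x) ^ (?n - 1)) * f (\<sigma> *\<^sub>R x) * indicator {0<..<1} (\<sigma> * G x) * indicator {x. G x < 1} x \<partial>lborel)"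
      by (rule nn_integral_multc[symmetric]) measurable
    finally show ?thesis by (simp only: mult.assoc mult.commute[of "indicator {x. G x < 1} x"])
  qed
  have outer: "(\<integral>\<^sup>+x. ennreal (real ?n * G x * (\<sigma> * G x) ^ (?n - 1)) * f (\<sigma> *\<^sub>R x) * indicator {x. G x < 1} x * indicator {0<..<1} (\<sigma> * G x) \<partial>lborel)
    = (\<integral>\<^sup>+z. k \<sigma> z \<partial>lborel) * indicator {0<..} \<sigma>" for \<sigma>
  proof (cases "0 < \<sigma>")
    case True
    have [measurable]: "k \<sigma> \<in> borel_measurable borel" unfolding k_def by measurable
    have "(\<integral>\<^sup>+z. k \<sigma> z \<partial>lborel) = (\<integral>\<^sup>+z. k \<sigma> z \<partial>density (distr lborel borel (\<lambda>x::real^'n. 0 + \<sigma> *\<^sub>R x)) (\<lambda>_. \<bar>\<sigma>\<bar> ^ DIM(real^'n)))"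
      using lborel_affine[of \<sigma> "0 :: real^'n"] True by simp
    also have "\<dots> = (\<integral>\<^sup>+x. ennreal (\<sigma> ^ ?n) * k \<sigma> (\<sigma> *\<^sub>R x) \<partial>lborel)"
      using True by (simp add: nn_integral_density nn_integral_distr)
    also have "\<dots> = (\<integral>\<^sup>+x. ennreal (real ?n * G x * (\<sigma> * G x) ^ (?n - 1)) * f (\<sigma> *\<^sub>R x) * indicator {x. G x < 1} x * indicator {0<..<1} (\<sigma> * G x) \<partial>lborel)"
    proof (rule nn_integral_cong_AE, use ae0 in eventually_elim)
      fix x :: "real^'n" assume "x \<noteq> 0"
      then have g: "0 < G x" by (rule G_pos)
      have "\<sigma> ^ ?n * (real ?n * G x ^ ?n / \<sigma>) = real ?n * G x * (\<sigma> * G x) ^ (?n - 1)"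
        using True n by (cases ?n) (auto simp: field_simps power_mult_distrib)
      then have "ennreal (real ?n * G x * (\<sigma> * G x) ^ (?n - 1)) = ennreal (\<sigma> ^ ?n) * ennreal (real ?n * (G (\<sigma> *\<^sub>R x) / \<sigma>) ^ ?n / \<sigma>)"
        using True g by (subst ennreal_mult[symmetric]) (auto simp: hom)
      moreover have "indicator {z. G z < 1} (\<sigma> *\<^sub>R x) * indicator {z. G z < \<sigma>} (\<sigma> *\<^sub>R x)
          = (indicator {x. G x < 1} x * indicator {0<..<1} (\<sigma> * G x) :: ennreal)"
        using True g by (auto simp: indicator_def hom)
      ultimately show "ennreal (\<sigma> ^ ?n) * k \<sigma> (\<sigma> *\<^sub>R x)
        = ennreal (real ?n * G x * (\<sigma> * G x) ^ (?n - 1)) * f (\<sigma> *\<^sub>R x) * indicator {x. G x < 1} x * indicator {0<..<1} (\<sigma> * G x)"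
        by (simp add: k_def mult.assoc)
    qed
    finally show ?thesis using True by simp
  next
    case False
    then have "indicator {0<..<1} (\<sigma> * G x) = (0::ennreal)" for x
      using G_nonneg[of x] by (auto simp: indicator_def zero_less_mult_iff)
    then show ?thesis using False by simp
  qed
  have km [measurable]: "(\<lambda>(\<sigma>, z). k \<sigma> z) \<in> borel_measurable (borel \<Otimes>\<^sub>M borel)"
    unfolding k_def by measurable
  have last: "(\<integral>\<^sup>+\<sigma>. k \<sigma> z * indicator {0<..} \<sigma> \<partial>lborel) = f z * indicator {x. G x < 1} z" if z: "z \<noteq> 0" for z
  proof -
    have g: "0 < G z" using G_pos[OF z] .
    \<comment> \<open>For fixed z the parameter \<sigma> runs from \<open>G z\<close> to infinity,
      and \<open>q\<close> is a probability density on that half-line; this is where the factor n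
      s^(n-1) is normalised.\<close>
    define q where "q = (\<lambda>\<sigma>. real ?n * G z ^ ?n * inverse \<sigma> ^ (?n + 1))"
    have "(\<integral>\<^sup>+\<sigma>. ennreal (q \<sigma>) * indicator {G z ..} \<sigma> \<partial>lborel) = ennreal (0 - (- (G z ^ ?n * inverse (G z) ^ ?n)))"
    proof (rule nn_integral_FTC_atLeast[where F = "\<lambda>\<sigma>. - (G z ^ ?n * inverse \<sigma> ^ ?n)" and T = 0])
      show "q \<in> borel_measurable borel" unfolding q_def by measurable
      show "DERIV (\<lambda>\<sigma>. - (G z ^ ?n * inverse \<sigma> ^ ?n)) \<sigma> :> q \<sigma>" if "G z \<le> \<sigma>" for \<sigma>
      proof -
        have "\<sigma> \<noteq> 0" using that g by simp
        then show ?thesis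
          using n unfolding q_def
          by (cases ?n) (auto intro!: derivative_eq_intros simp: power_inverse field_simps power2_eq_square,
              subst (asm) power_Suc[symmetric], simp)
      qed
      show "0 \<le> q \<sigma>" if "G z \<le> \<sigma>" for \<sigma> using that g by (simp add: q_def)
      have "((\<lambda>\<sigma>. - (G z ^ ?n * inverse \<sigma> ^ ?n)) \<longlongrightarrow> - (G z ^ ?n * 0 ^ ?n)) at_top"
        by (intro tendsto_intros tendsto_inverse_0_at_top filterlim_ident)
      then show "((\<lambda>\<sigma>. - (G z ^ ?n * inverse \<sigma> ^ ?n)) \<longlongrightarrow> 0) at_top" using n by (simp add: zero_power)
    qed
    also have "\<dots> = 1" using g by (simp add: power_inverse)
    finally have q1: "(\<integral>\<^sup>+\<sigma>. ennreal (q \<sigma>) * indicator {G z ..} \<sigma> \<partial>lborel) = 1" .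
    have "(\<integral>\<^sup>+\<sigma>. k \<sigma> z * indicator {0<..} \<sigma> \<partial>lborel) = (\<integral>\<^sup>+\<sigma>. (ennreal (q \<sigma>) * indicator {G z ..} \<sigma>) * (f z * indicator {z. G z < 1} z) \<partial>lborel)"
    proof (rule nn_integral_cong_AE)
      have "AE \<sigma> in lborel. \<sigma> \<noteq> G z" by (rule AE_lborel_singleton)
      then show "AE \<sigma> in lborel. k \<sigma> z * indicator {0<..} \<sigma> = (ennreal (q \<sigma>) * indicator {G z ..} \<sigma>) * (f z * indicator {z. G z < 1} z)"
      proof eventually_elim
        fix \<sigma> assume "\<sigma> \<noteq> G z"
        moreover have "real ?n * (G z / \<sigma>) ^ ?n / \<sigma> = q \<sigma>"
          by (simp add: q_def field_simps power_inverse)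
        ultimately show "k \<sigma> z * indicator {0<..} \<sigma> = (ennreal (q \<sigma>) * indicator {G z ..} \<sigma>) * (f z * indicator {z. G z < 1} z)"
          using g by (auto simp: k_def indicator_def)
      qed
    qed
    also have "\<dots> = f z * indicator {z. G z < 1} z"
      using q1 by (subst nn_integral_multc) (auto simp: q_def)
    finally show ?thesis .
  qed
  have "(\<integral>\<^sup>+x. (\<integral>\<^sup>+s. ennreal (real ?n * s ^ (?n - 1)) * f ((s / G x) *\<^sub>R x) * indicator {0<..<1} s \<partial>lborel)
        * indicator {x. G x < 1} x \<partial>lborel)
    = (\<integral>\<^sup>+x. (\<integral>\<^sup>+\<sigma>. ennreal (real ?n * G x * (\<sigma> * G x) ^ (?n - 1)) * f (\<sigma> *\<^sub>R x) * indicator {x. G x < 1} x * indicator {0<..<1} (\<sigma> * G x) \<partial>lborel) \<partial>lborel)"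
    by (rule nn_integral_cong_AE, rule AE_mp[OF ae0], intro AE_I2 impI, rule inner)
  also have "\<dots> = (\<integral>\<^sup>+\<sigma>. (\<integral>\<^sup>+x. ennreal (real ?n * G x * (\<sigma> * G x) ^ (?n - 1)) * f (\<sigma> *\<^sub>R x) * indicator {x. G x < 1} x * indicator {0<..<1} (\<sigma> * G x) \<partial>lborel) \<partial>lborel)"
    by (rule lborel_pair.Fubini') measurable
  also have "\<dots> = (\<integral>\<^sup>+\<sigma>. (\<integral>\<^sup>+z. k \<sigma> z * indicator {0<..} \<sigma> \<partial>lborel) \<partial>lborel)"
  proof (rule nn_integral_cong)
    fix \<sigma> :: real
    have [measurable]: "k \<sigma> \<in> borel_measurable borel" unfolding k_def by measurable
    show "(\<integral>\<^sup>+x. ennreal (real ?n * G x * (\<sigma> * G x) ^ (?n - 1)) * f (\<sigma> *\<^sub>R x) * indicator {x. G x < 1} x * indicator {0<..<1} (\<sigma> * G x) \<partial>lborel)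
      = (\<integral>\<^sup>+z. k \<sigma> z * indicator {0<..} \<sigma> \<partial>lborel)"
      unfolding outer by (rule nn_integral_multc[symmetric]) simp
  qed
  also have "\<dots> = (\<integral>\<^sup>+z. (\<integral>\<^sup>+\<sigma>. k \<sigma> z * indicator {0<..} \<sigma> \<partial>lborel) \<partial>lborel)"
    by (rule lborel_pair.Fubini') measurable
  also have "\<dots> = (\<integral>\<^sup>+x. f x * indicator {x. G x < 1} x \<partial>lborel)"
    by (rule nn_integral_cong_AE, rule AE_mp[OF ae0], intro AE_I2 impI, rule last)
  finally show ?thesis by simp
qed

end

section \<open>Surface measure of gauge balls\<close>

text \<open>Compactness leaves finitely many neighbourhoods, and the set is cut into disjoint Borel
  pieces, each inside one of them. This is why the local estimate is required for all Borel subsets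
  of a neighbourhood.\<close>

lemma emeasure_le_of_local:
  fixes M N :: "'a::{second_countable_topology, t2_space} measure"
  assumes sets: "sets M = sets borel" "sets N = sets borel"
    and Z: "compact Z"
    and loc: "\<And>z. z \<in> Z \<Longrightarrow> \<exists>U. open U \<and> z \<in> U \<and>
      (\<forall>A\<in>sets borel. A \<subseteq> Z \<inter> U \<longrightarrow> emeasure M A \<le> K * emeasure N A)"
    and A: "A \<in> sets borel" "A \<subseteq> Z"
  shows "emeasure M A \<le> K * emeasure N A"
proof -
  have "\<forall>z\<in>Z. \<exists>U. open U \<and> z \<in> U \<and> (\<forall>A\<in>sets borel. A \<subseteq> Z \<inter> U \<longrightarrow> emeasure M A \<le> K * emeasure N A)"
    using loc by simp
  from bchoice[OF this] obtain U where "\<forall>z\<in>Z. open (U z) \<and> z \<in> U z \<and>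
      (\<forall>A\<in>sets borel. A \<subseteq> Z \<inter> U z \<longrightarrow> emeasure M A \<le> K * emeasure N A)" ..
  then have U: "open (U z)" "z \<in> U z" "A \<in> sets borel \<Longrightarrow> A \<subseteq> Z \<inter> U z \<Longrightarrow> emeasure M A \<le> K * emeasure N A"
    if "z \<in> Z" for z A using that by auto
  have "Z \<subseteq> (\<Union>z\<in>Z. U z)" using U(2) by blast
  then obtain C where C: "C \<subseteq> Z" "finite C" "Z \<subseteq> (\<Union>z\<in>C. U z)"
    using compactE_image[OF Z, of Z U] U(1) by metis
  have "emeasure M B \<le> K * emeasure N B"
    if "finite D" "D \<subseteq> Z" "B \<in> sets borel" "B \<subseteq> Z \<inter> (\<Union>z\<in>D. U z)" for D B
    using that
  proof (induction D arbitrary: B rule: finite_induct)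
    case (insert z D)
    have Uz: "U z \<in> sets borel" using U(1) insert.prems by auto
    have "emeasure M B = emeasure M (B \<inter> U z) + emeasure M (B - U z)"
      using insert.prems Uz sets by (subst plus_emeasure) (auto simp: Int_Diff_Un)
    also have "\<dots> \<le> K * emeasure N (B \<inter> U z) + K * emeasure N (B - U z)"
    proof (rule add_mono)
      show "emeasure M (B \<inter> U z) \<le> K * emeasure N (B \<inter> U z)"
        by (rule U(3)) (use insert.prems Uz in auto)
      show "emeasure M (B - U z) \<le> K * emeasure N (B - U z)"
        by (rule insert.IH) (use insert.prems Uz in auto)
    qed
    also have "\<dots> = K * emeasure N B"
      unfolding distrib_left[symmetric]
      using insert.prems Uz sets by (subst plus_emeasure) (auto simp: Int_Diff_Un)
    finally show ?case .
  qed simp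
  from this[OF C(2,1) A(1)] show ?thesis using C(3) A(2) by auto
qed

lemma ennreal_le_if_le_mult:
  fixes a b :: ennreal
  assumes "\<And>K::real. 1 < K \<Longrightarrow> a \<le> ennreal K * b"
  shows "a \<le> b"
proof (cases "b = \<infinity>")
  case False
  then obtain b' where b: "b = ennreal b'" "0 \<le> b'" by (cases b) auto
  have "a \<le> ennreal (2 * b')" using assms[of 2] b by (simp add: ennreal_mult')
  then have "a \<noteq> \<infinity>" by (auto simp: top_unique)
  then obtain a' where a: "a = ennreal a'" "0 \<le> a'" by (cases a) auto
  have "a' \<le> K * b'" if "1 < K" for K
    using assms[OF that] that a b by (simp add: ennreal_mult'[symmetric] ennreal_le_iff)
  note le = this
  have "((\<lambda>K. K * b' - a') \<longlongrightarrow> 1 * b' - a') (at_right (1::real))"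
    by (intro tendsto_intros)
  moreover have "eventually (\<lambda>K. 0 \<le> K * b' - a') (at_right (1::real))"
    using eventually_at_right_less[of "1::real"] by eventually_elim (use le in auto)
  ultimately have "0 \<le> 1 * b' - a'" by (intro tendsto_lowerbound) auto
  then show ?thesis using a b by (simp add: ennreal_leI)
qed simp

context smooth_gauge
begin

text \<open>The candidate for surface measure on the gauge sphere. A surface element dS at y spans a
  cone of volume (y \<bullet> \<nu>) dS / n, and y \<bullet> \<nu> = 1 / |dG y| since dG y \<bullet>
  y = 1. Hence dS is n |dG| times cone volume, and \<open>c\<close> stands in for n.\<close>

definition cone_surface :: "real \<Rightarrow> (real^'n) measure" where
  "cone_surface c = distr (density lborel (\<lambda>x. ennreal (c * norm (dG x)) * indicator {x. 0 < G x \<and> G x \<le> 1} x)) borel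
     (\<lambda>x. (1 / G x) *\<^sub>R x)"

lemma sets_cone_surface [simp, measurable_cong]: "sets (cone_surface c) = sets borel"
  by (simp add: cone_surface_def)

lemma nn_integral_cone_surface:
  assumes [measurable]: "f \<in> borel_measurable borel"
  shows "(\<integral>\<^sup>+x. f x \<partial>cone_surface c) =
    (\<integral>\<^sup>+x. f ((1 / G x) *\<^sub>R x) * ennreal (c * norm (dG x)) * indicator {x. 0 < G x \<and> G x \<le> 1} x \<partial>lborel)"
  unfolding cone_surface_def
  by (subst nn_integral_distr, simp, simp, subst nn_integral_density) (auto intro!: nn_integral_cong simp: mult_ac)

lemma emeasure_cone_surface:
  assumes A: "A \<in> sets borel"
  shows "emeasure (cone_surface c) A =
    (\<integral>\<^sup>+x. ennreal (c * norm (dG x)) * indicator {x. 0 < G x \<and> G x \<le> 1 \<and> (1 / G x) *\<^sub>R x \<in> A} x \<partial>lborel)"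
proof -
  have "emeasure (cone_surface c) A = (\<integral>\<^sup>+x. indicator A x \<partial>cone_surface c)"
    using A by simp
  also have "\<dots> = (\<integral>\<^sup>+x. indicator A ((1 / G x) *\<^sub>R x) * ennreal (c * norm (dG x)) * indicator {x. 0 < G x \<and> G x \<le> 1} x \<partial>lborel)"
    by (rule nn_integral_cone_surface) (use A in simp)
  also have "\<dots> = (\<integral>\<^sup>+x. ennreal (c * norm (dG x)) * indicator {x. 0 < G x \<and> G x \<le> 1 \<and> (1 / G x) *\<^sub>R x \<in> A} x \<partial>lborel)"
    by (intro nn_integral_cong) (auto simp: indicator_def)
  finally show ?thesis .
qed

text \<open>Every expression tends to 0 or to 1 as \<open>\<eta>\<close> decreases to 0. The two
  products bounded by \<open>K\<close> are the total distortions of the next comparison: a Lipschitz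
  constant of the projection or of its inverse to the power \<open>s\<close>, a radial dilation to
  the power \<open>n\<close>, and a ratio of gradient lengths.\<close>

lemma surface_comparison_parameter:
  fixes \<rho> \<delta> K s :: real and n :: nat
  assumes "0 < \<delta>" "1 < K"
  shows "\<exists>\<eta>>0. \<eta> < 1 \<and> \<eta> < \<delta> \<and> \<rho> * \<eta> / (1 - \<eta>)\<^sup>2 < 1 \<and>
    (1 / (1 - \<rho> * \<eta> / (1 - \<eta>)\<^sup>2)) powr s * (1 / (1 - \<eta>)) ^ n * (\<delta> / (\<delta> - \<eta>)) < K \<and>
    (1 / (1 - \<eta>) + \<rho> * \<eta> / (1 - \<eta>)\<^sup>2) powr s * ((\<delta> + \<eta>) / \<delta>) < K"
proof -
  have "((\<lambda>\<eta>. (1 / (1 - \<rho> * \<eta> / (1 - \<eta>)\<^sup>2)) powr s * (1 / (1 - \<eta>)) ^ n * (\<delta> / (\<delta> - \<eta>))) \<longlongrightarrow>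
     (1 / (1 - \<rho> * 0 / (1 - 0)\<^sup>2)) powr s * (1 / (1 - 0)) ^ n * (\<delta> / (\<delta> - 0))) (at_right (0::real))"
    by (intro tendsto_intros) (use assms in auto)
  then have 1: "\<forall>\<^sub>F \<eta> in at_right 0. (1 / (1 - \<rho> * \<eta> / (1 - \<eta>)\<^sup>2)) powr s * (1 / (1 - \<eta>)) ^ n * (\<delta> / (\<delta> - \<eta>)) < K"
    by (rule order_tendstoD) (use assms in auto)
  have "((\<lambda>\<eta>. (1 / (1 - \<eta>) + \<rho> * \<eta> / (1 - \<eta>)\<^sup>2) powr s * ((\<delta> + \<eta>) / \<delta>)) \<longlongrightarrow>
     (1 / (1 - 0) + \<rho> * 0 / (1 - 0)\<^sup>2) powr s * ((\<delta> + 0) / \<delta>)) (at_right (0::real))"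
    by (intro tendsto_intros) (use assms in auto)
  then have 2: "\<forall>\<^sub>F \<eta> in at_right 0. (1 / (1 - \<eta>) + \<rho> * \<eta> / (1 - \<eta>)\<^sup>2) powr s * ((\<delta> + \<eta>) / \<delta>) < K"
    by (rule order_tendstoD) (use assms in auto)
  have "((\<lambda>\<eta>. \<rho> * \<eta> / (1 - \<eta>)\<^sup>2) \<longlongrightarrow> \<rho> * 0 / (1 - 0)\<^sup>2) (at_right (0::real))"
    by (intro tendsto_intros) auto
  then have 3: "\<forall>\<^sub>F \<eta> in at_right 0. \<rho> * \<eta> / (1 - \<eta>)\<^sup>2 < 1"
    by (rule order_tendstoD) auto
  have 4: "\<forall>\<^sub>F \<eta> in at_right 0. \<eta> \<in> {0<..<min 1 \<delta>}"
    by (rule eventually_at_right_real) (use assms in auto)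
  have "\<forall>\<^sub>F \<eta> in at_right 0. \<eta> > 0 \<and> \<eta> < 1 \<and> \<eta> < \<delta> \<and> \<rho> * \<eta> / (1 - \<eta>)\<^sup>2 < 1 \<and>
    (1 / (1 - \<rho> * \<eta> / (1 - \<eta>)\<^sup>2)) powr s * (1 / (1 - \<eta>)) ^ n * (\<delta> / (\<delta> - \<eta>)) < K \<and>
    (1 / (1 - \<eta>) + \<rho> * \<eta> / (1 - \<eta>)\<^sup>2) powr s * ((\<delta> + \<eta>) / \<delta>) < K"
    using 1 2 3 4 by eventually_elim simp
  then show ?thesis
    using eventually_happens'[OF trivial_limit_at_right_real] by blast
qed

text \<open>Central projection onto the tangent plane at \<open>y\<^sub>0\<close> is nearly an isometry near \<open>y\<^sub>0\<close> and
  maps the cone over a piece of the surface to a flat cone that differs from it only by a radial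
  factor close to one.\<close>

lemma surface_local_comparison:
  assumes n: "2 \<le> CARD('n)" and c: "0 \<le> c"
    and flat: "\<And>e h A. norm e = 1 \<Longrightarrow> h > 0 \<Longrightarrow> A \<in> sets borel \<Longrightarrow> A \<subseteq> {x::real^'n. x \<bullet> e = 0} \<Longrightarrow>
      hausdorff_outer (real CARD('n) - 1) A = ennreal (c / h) * emeasure lborel (flat_cone e h A)"
    and y0: "G y0 = 1" and K: "1 < K"
  shows "\<exists>U. open U \<and> y0 \<in> U \<and> (\<forall>A\<in>sets borel. A \<subseteq> {x. G x = 1} \<inter> U \<longrightarrow>
    hausdorff_outer (real CARD('n) - 1) A \<le> ennreal K * emeasure (cone_surface c) A \<and>
    emeasure (cone_surface c) A \<le> ennreal K * hausdorff_outer (real CARD('n) - 1) A)"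
proof -
  define s where "s = real CARD('n) - 1"
  have s: "0 \<le> s" using n by (simp add: s_def)
  let ?H = "hausdorff_outer s :: (real^'n) set \<Rightarrow> ennreal"
  have y0_ne: "y0 \<noteq> 0" using y0 by auto
  define d0 where "d0 = dG y0"
  define \<delta> where "\<delta> = norm d0"
  have d0y0: "d0 \<bullet> y0 = 1" using dG_self[OF y0_ne] y0 by (simp add: d0_def)
  then have \<delta>: "\<delta> > 0" by (auto simp: \<delta>_def)
  \<comment> \<open>The tangent plane at \<open>y0\<close> is d0 \<bullet> x = 1, the plane with
    unit normal \<open>e\<close> at height \<open>h\<close>.\<close>
  define e where "e = (1 / \<delta>) *\<^sub>R d0"
  define h where "h = 1 / \<delta>"
  have h: "h > 0" using \<delta> by (simp add: h_def)
  have e: "norm e = 1" using \<delta> by (simp add: e_def \<delta>_def)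
  have dd: "d0 \<bullet> d0 = \<delta> * \<delta>" by (simp add: \<delta>_def dot_square_norm power2_eq_square)
  have xe: "x \<bullet> e = (d0 \<bullet> x) / \<delta>" for x by (simp add: e_def inner_commute)
  have he: "d0 \<bullet> (h *\<^sub>R e) = 1" using \<delta> by (simp add: h_def e_def dd)
  define \<rho> where "\<rho> = norm y0 + 1"
  have \<rho>: "\<rho> > 0" by (simp add: \<rho>_def add_nonneg_pos)
  obtain \<eta> where \<eta>: "\<eta> > 0" "\<eta> < 1" "\<eta> < \<delta>" "\<rho> * \<eta> / (1 - \<eta>)\<^sup>2 < 1"
    "(1 / (1 - \<rho> * \<eta> / (1 - \<eta>)\<^sup>2)) powr s * (1 / (1 - \<eta>)) ^ CARD('n) * (\<delta> / (\<delta> - \<eta>)) < K"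
    "(1 / (1 - \<eta>) + \<rho> * \<eta> / (1 - \<eta>)\<^sup>2) powr s * ((\<delta> + \<eta>) / \<delta>) < K"
    using surface_comparison_parameter[OF \<delta> K, of \<rho> s "CARD('n)"] by blast
  define \<theta> where "\<theta> = \<rho> * \<eta> / (1 - \<eta>)\<^sup>2"
  define L1 where "L1 = 1 / (1 - \<eta>) + \<theta>"
  define L2 where "L2 = 1 / (1 - \<theta>)"
  have \<theta>: "0 \<le> \<theta>" "\<theta> < 1" using \<eta> \<rho> by (auto simp: \<theta>_def)
  have L1: "L1 > 0" using \<eta> \<theta> by (simp add: L1_def add_pos_nonneg)
  have L2: "L2 > 0" using \<theta> by (simp add: L2_def)
  obtain r where r: "0 < r" "r \<le> 1" "\<And>y. norm (y - y0) < r \<Longrightarrow> y \<noteq> 0 \<and> norm (dG y - d0) \<le> \<eta>"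
    using dG_near[OF y0_ne \<eta>(1)] unfolding d0_def by blast
  have main: "?H A \<le> ennreal K * emeasure (cone_surface c) A \<and> emeasure (cone_surface c) A \<le> ennreal K * ?H A"
    if A [measurable]: "A \<in> sets borel" and sub: "A \<subseteq> {x. G x = 1} \<inter> ball y0 r" for A
  proof -
    have near: "G y = 1" "y \<noteq> 0" "norm (y - y0) < r" "norm (dG y - d0) \<le> \<eta>" "norm y \<le> \<rho>" if "y \<in> A" for y
    proof -
      show 1: "G y = 1" "norm (y - y0) < r" using sub that by (auto simp: dist_norm norm_minus_commute)
      then show "y \<noteq> 0" "norm (dG y - d0) \<le> \<eta>" using r(3)[of y] by auto
      have "norm y \<le> norm y0 + norm (y - y0)" by (metis add.commute diff_add_cancel norm_triangle_ineq)
      then show "norm y \<le> \<rho>" using 1 r(2) by (simp add: \<rho>_def)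
    qed
    define a where "a y = d0 \<bullet> y" for y
    \<comment> \<open>Both points lie on the sphere, so dG v \<bullet> (u - v) is nonpositive by
      convexity; replacing \<open>dG v\<close> by \<open>d0\<close> costs at most
      \<open>\<eta>\<close> times the distance.\<close>
    have diff_le: "\<bar>a y - a y'\<bar> \<le> \<eta> * norm (y - y')" if "y \<in> A" "y' \<in> A" for y y'
    proof -
      have *: "d0 \<bullet> (u - v) \<le> \<eta> * norm (u - v)" if "u \<in> A" "v \<in> A" for u v
      proof -
        have "dG v \<bullet> (u - v) \<le> 0" using dG_diff_bounds(1)[of v u] near[OF that(1)] near[OF that(2)] by simp
        moreover have "(d0 - dG v) \<bullet> (u - v) \<le> norm (d0 - dG v) * norm (u - v)" by (rule norm_cauchy_schwarz)
        moreover have "\<dots> \<le> \<eta> * norm (u - v)"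
          using near(4)[OF that(2)] by (intro mult_right_mono) (auto simp: norm_minus_commute)
        ultimately show ?thesis by (simp add: inner_diff_left)
      qed
      have "a y - a y' = d0 \<bullet> (y - y')" "a y' - a y = d0 \<bullet> (y' - y)" by (simp_all add: a_def inner_diff_right)
      then show ?thesis using *[OF that] *[OF that(2,1)] by (simp add: norm_minus_commute abs_le_iff)
    qed
    have a_bounds: "1 - \<eta> \<le> a y" "a y \<le> 1" "0 < a y" if y: "y \<in> A" for y
    proof -
      show "a y \<le> 1" using dG_le[OF y0_ne, of y] near(1)[OF y] by (simp add: a_def d0_def)
      have "0 \<le> dG y \<bullet> (y - y0)" using dG_diff_bounds(2)[OF y0_ne near(2)[OF y]] near(1)[OF y] y0 by simp
      moreover have "(dG y - d0) \<bullet> (y - y0) \<le> norm (dG y - d0) * norm (y - y0)" by (rule norm_cauchy_schwarz)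
      moreover have "\<dots> \<le> \<eta> * 1"
        using near[OF y] r(2) \<eta>(1) by (intro mult_mono) auto
      ultimately show "1 - \<eta> \<le> a y" using d0y0 by (simp add: a_def inner_diff_left inner_diff_right)
      then show "0 < a y" using \<eta>(2) by simp
    qed
    \<comment> \<open>\<open>Q\<close> projects from the origin onto the tangent plane and shifts
      that plane to the origin; \<open>P\<close> is the inverse, radial projection back to the
      sphere.\<close>
    define Q where "Q y = (1 / a y) *\<^sub>R y - h *\<^sub>R e" for y
    define P where "P z = (1 / G (z + h *\<^sub>R e)) *\<^sub>R (z + h *\<^sub>R e)" for z
    define E where "E = {z. z \<bullet> e = 0 \<and> P z \<in> A}"
    have PQ: "P (Q y) = y" if y: "y \<in> A" for y
      using a_bounds[OF y] near[OF y] by (simp add: P_def Q_def hom)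
    have QE: "Q ` A = E"
    proof (intro equalityI subsetI)
      fix z assume "z \<in> Q ` A"
      then obtain y where y: "y \<in> A" "z = Q y" by auto
      have "Q y \<bullet> e = 0" using a_bounds[OF y(1)] e \<delta>
        by (simp add: Q_def inner_diff_left xe[of y] a_def[symmetric] norm_eq_1 h_def)
      then show "z \<in> E" using y PQ by (simp add: E_def)
    next
      fix z assume z: "z \<in> E"
      then have "P z \<in> A" "z \<bullet> e = 0" by (auto simp: E_def)
      then have gz: "G (z + h *\<^sub>R e) \<noteq> 0" using near(1)[of "P z"] by (auto simp: P_def)
      have "d0 \<bullet> z = 0" using \<open>z \<bullet> e = 0\<close> \<delta> by (simp add: xe)
      then have "d0 \<bullet> (z + h *\<^sub>R e) = 1" unfolding inner_add_right he by simp
      then have "a (P z) = 1 / G (z + h *\<^sub>R e)" unfolding a_def P_def inner_scaleR_right[of d0 "1 / G (z + h *\<^sub>R e)"] by simp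
      then have "Q (P z) = z" using gz by (simp add: Q_def P_def)
      then show "z \<in> Q ` A" using \<open>P z \<in> A\<close> by (metis imageI)
    qed
    have PE: "P ` E = A" using QE PQ by (auto simp: image_iff)
    have Eb: "E \<in> sets borel"
    proof -
      have "P \<in> borel_measurable borel" unfolding P_def by measurable
      from measurable_sets[OF this A] have "P -` A \<in> sets borel" by simp
      moreover have "closed {z. z \<bullet> e = 0}" by (intro closed_Collect_eq continuous_intros)
      moreover have "E = {z. z \<bullet> e = 0} \<inter> P -` A" by (auto simp: E_def)
      ultimately show ?thesis by auto
    qed
    \<comment> \<open>Up to the relative error \<open>\<theta>\<close>, \<open>Q\<close> acts on
      differences as multiplication by the scalar 1 / a y, which lies between 1 and 1 / (1 -
      \<eta>). Both Lipschitz constants follow.\<close>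
    have close: "norm ((Q y - Q y') - (1 / a y) *\<^sub>R (y - y')) \<le> \<theta> * norm (y - y')" if y: "y \<in> A" "y' \<in> A" for y y'
    proof -
      have "(Q y - Q y') - (1 / a y) *\<^sub>R (y - y') = ((a y' - a y) / (a y * a y')) *\<^sub>R y'"
        using a_bounds[OF y(1)] a_bounds[OF y(2)]
        by (simp add: Q_def scaleR_diff_right diff_divide_distrib scaleR_diff_left)
      then have "norm ((Q y - Q y') - (1 / a y) *\<^sub>R (y - y')) = \<bar>a y' - a y\<bar> / (a y * a y') * norm y'"
        using a_bounds[OF y(1)] a_bounds[OF y(2)] by (simp add: abs_mult)
      also have "\<dots> \<le> (\<eta> * norm (y - y')) / ((1 - \<eta>) * (1 - \<eta>)) * \<rho>"
      proof (intro mult_mono frac_le)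
        show "\<bar>a y' - a y\<bar> \<le> \<eta> * norm (y - y')" using diff_le[OF y] by (simp add: abs_minus_commute)
      qed (use \<eta> \<rho> a_bounds[OF y(1)] a_bounds[OF y(2)] near(5)[OF y(2)] in auto)
      also have "\<dots> = \<theta> * norm (y - y')" by (simp add: \<theta>_def power2_eq_square)
      finally show ?thesis .
    qed
    have lip1: "norm (Q y - Q y') \<le> L1 * norm (y - y')" if y: "y \<in> A" "y' \<in> A" for y y'
    proof -
      have "norm (Q y - Q y') \<le> norm ((1 / a y) *\<^sub>R (y - y')) + norm ((Q y - Q y') - (1 / a y) *\<^sub>R (y - y'))"
        by (metis add.commute diff_add_cancel norm_triangle_ineq)
      moreover have "norm ((1 / a y) *\<^sub>R (y - y')) \<le> (1 / (1 - \<eta>)) * norm (y - y')"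
        using a_bounds[OF y(1)] \<eta>(2) by (simp add: divide_left_mono mult_right_mono frac_le)
      ultimately show ?thesis using close[OF y] by (simp add: L1_def distrib_right)
    qed
    have lip2: "norm (P z - P z') \<le> L2 * norm (z - z')" if z: "z \<in> E" "z' \<in> E" for z z'
    proof -
      obtain y y' where y: "y \<in> A" "y' \<in> A" "z = Q y" "z' = Q y'" using z QE by blast
      have "norm (y - y') \<le> norm ((1 / a y) *\<^sub>R (y - y'))"
        using a_bounds[OF y(1)] mult_right_mono[of 1 "1 / a y" "norm (y - y')"] by simp
      also have "\<dots> \<le> norm (Q y - Q y') + norm ((Q y - Q y') - (1 / a y) *\<^sub>R (y - y'))"
        by (metis norm_minus_commute norm_triangle_sub)
      finally have "norm (y - y') * (1 - \<theta>) \<le> norm (Q y - Q y')"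
        using close[OF y(1,2)] by (simp add: algebra_simps)
      then have "norm (y - y') \<le> L2 * norm (Q y - Q y')"
        using \<theta>(2) by (simp add: L2_def pos_le_divide_eq)
      then show ?thesis using y PQ by simp
    qed
    have H1: "?H E \<le> ennreal (L1 powr s) * ?H A"
      unfolding QE[symmetric] by (rule hausdorff_outer_lipschitz[OF L1 s]) (rule lip1)
    have H2: "?H A \<le> ennreal (L2 powr s) * ?H E"
      unfolding PE[symmetric] by (rule hausdorff_outer_lipschitz[OF L2 s]) (rule lip2)
    \<comment> \<open>\<open>S\<close> is the cone over \<open>A\<close> closed off by the sphere,
      and \<open>F\<close> is the same cone closed off by the tangent plane.\<close>
    define S where "S = {x. 0 < G x \<and> G x \<le> 1 \<and> (1 / G x) *\<^sub>R x \<in> A}"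
    define F where "F = {x. 0 < d0 \<bullet> x \<and> d0 \<bullet> x \<le> 1 \<and> (1 / G x) *\<^sub>R x \<in> A}"
    have rb: "{x. (1 / G x) *\<^sub>R x \<in> A} \<in> sets borel"
    proof -
      have "(\<lambda>x. (1 / G x) *\<^sub>R x) \<in> borel_measurable borel" by measurable
      from measurable_sets[OF this A] show ?thesis by (simp add: vimage_def)
    qed
    have Sb [measurable]: "S \<in> sets borel"
    proof -
      have "S = {x. 0 < G x \<and> G x \<le> 1} \<inter> {x. (1 / G x) *\<^sub>R x \<in> A}" by (auto simp: S_def)
      also have "\<dots> \<in> sets borel" by (intro sets.Int rb) measurable
      finally show ?thesis .
    qed
    have Fb [measurable]: "F \<in> sets borel"
    proof -
      have "F = {x. 0 < d0 \<bullet> x \<and> d0 \<bullet> x \<le> 1} \<inter> {x. (1 / G x) *\<^sub>R x \<in> A}" by (auto simp: F_def)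
      also have "\<dots> \<in> sets borel" by (intro sets.Int rb) measurable
      finally show ?thesis .
    qed
    have ray: "x = G x *\<^sub>R ((1 / G x) *\<^sub>R x)" "d0 \<bullet> x = G x * a ((1 / G x) *\<^sub>R x)" "0 < G x" if "(1 / G x) *\<^sub>R x \<in> A" for x
    proof -
      have "x \<noteq> 0" using near(2)[OF that] by auto
      then show 1: "0 < G x" by (rule G_pos)
      then show "x = G x *\<^sub>R ((1 / G x) *\<^sub>R x)" "d0 \<bullet> x = G x * a ((1 / G x) *\<^sub>R x)" by (simp_all add: a_def)
    qed
    have fc: "flat_cone e h E = F"
    proof -
      have "flat_cone e h E = {x. 0 < d0 \<bullet> x \<and> d0 \<bullet> x \<le> 1 \<and> (1 / (d0 \<bullet> x)) *\<^sub>R x - h *\<^sub>R e \<in> E}"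
        using \<delta> by (auto simp: flat_cone_def xe h_def field_simps)
      also have "\<dots> = F" unfolding F_def
      proof (intro Collect_cong conj_cong refl)
        fix x assume x: "0 < d0 \<bullet> x"
        have 0: "((1 / (d0 \<bullet> x)) *\<^sub>R x - h *\<^sub>R e) \<bullet> e = 0"
          using x e \<delta> by (simp add: inner_diff_left xe[of x] norm_eq_1 h_def)
        have "P ((1 / (d0 \<bullet> x)) *\<^sub>R x - h *\<^sub>R e) = (1 / G x) *\<^sub>R x"
          using x by (simp add: P_def hom)
        with 0 show "((1 / (d0 \<bullet> x)) *\<^sub>R x - h *\<^sub>R e \<in> E) = ((1 / G x) *\<^sub>R x \<in> A)" by (simp add: E_def)
      qed
      finally show ?thesis .
    qed
    have SF: "S \<subseteq> F"
    proof
      fix x assume "x \<in> S"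
      then have x: "0 < G x" "G x \<le> 1" "(1 / G x) *\<^sub>R x \<in> A" by (auto simp: S_def)
      then show "x \<in> F" using ray[OF x(3)] a_bounds[OF x(3)]
        by (simp add: F_def mult_le_one)
    qed
    \<comment> \<open>On rays through \<open>A\<close> the functional \<open>d0\<close> is at least
      (1 - \<eta>) G, so \<open>F\<close> lies in the dilation of \<open>S\<close> by
      \<open>\<kappa>\<close>.\<close>
    define \<kappa> where "\<kappa> = 1 / (1 - \<eta>)"
    have \<kappa>: "\<kappa> > 0" using \<eta> by (simp add: \<kappa>_def)
    have FS: "F \<subseteq> (\<lambda>x. (1 / \<kappa>) *\<^sub>R x) -` S"
    proof
      fix x assume "x \<in> F"
      then have x: "d0 \<bullet> x \<le> 1" "(1 / G x) *\<^sub>R x \<in> A" by (auto simp: F_def)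
      have "G x * (1 - \<eta>) \<le> G x * a ((1 / G x) *\<^sub>R x)"
        using a_bounds[OF x(2)] ray(3)[OF x(2)] by (intro mult_left_mono) auto
      then have "G x * (1 - \<eta>) \<le> 1" using x(1) ray(2)[OF x(2)] by simp
      then have "G ((1 / \<kappa>) *\<^sub>R x) \<le> 1" using \<eta> by (simp add: hom \<kappa>_def mult.commute)
      then show "x \<in> (\<lambda>x. (1 / \<kappa>) *\<^sub>R x) -` S"
        using x ray(3)[OF x(2)] \<kappa> by (simp add: S_def hom)
    qed
    have F_le: "emeasure lborel F \<le> ennreal (\<kappa> ^ CARD('n)) * emeasure lborel S"
    proof -
      have "(\<lambda>x. (1 / \<kappa>) *\<^sub>R x) -` S \<in> sets borel"
        using measurable_sets[of "\<lambda>x::real^'n. (1 / \<kappa>) *\<^sub>R x" borel borel S] by simp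
      then have "emeasure lborel F \<le> emeasure lborel ((\<lambda>x. (1 / \<kappa>) *\<^sub>R x) -` S)"
        by (intro emeasure_mono FS) simp
      then show ?thesis using emeasure_lborel_scaled_vimage[OF \<kappa> Sb] by simp
    qed
    have S_le: "emeasure lborel S \<le> emeasure lborel F" by (intro emeasure_mono SF) simp
    have HE: "?H E = ennreal (c * \<delta>) * emeasure lborel F"
    proof -
      have "E \<subseteq> {x. x \<bullet> e = 0}" by (auto simp: E_def)
      from flat[OF e h Eb this] have "?H E = ennreal (c / h) * emeasure lborel F"
        unfolding fc s_def .
      then show ?thesis by (simp add: h_def)
    qed
    have dGS: "\<delta> - \<eta> \<le> norm (dG x)" "norm (dG x) \<le> \<delta> + \<eta>" if "x \<in> S" for x
    proof -
      have x: "(1 / G x) *\<^sub>R x \<in> A" "0 < G x" using that by (auto simp: S_def)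
      have "dG x = dG ((1 / G x) *\<^sub>R x)" using x by (simp add: dG_scale)
      then have "norm (dG x - d0) \<le> \<eta>" using near(4)[OF x(1)] by simp
      then show "\<delta> - \<eta> \<le> norm (dG x)" "norm (dG x) \<le> \<delta> + \<eta>"
        using norm_triangle_ineq2[of "dG x" d0] norm_triangle_ineq2[of d0 "dG x"]
        by (auto simp: \<delta>_def norm_minus_commute)
    qed
    have cs: "emeasure (cone_surface c) A = (\<integral>\<^sup>+x. ennreal (c * norm (dG x)) * indicator S x \<partial>lborel)"
      using emeasure_cone_surface[OF A] by (simp add: S_def)
    have lowcs: "ennreal (c * (\<delta> - \<eta>)) * emeasure lborel S \<le> emeasure (cone_surface c) A"
    proof -
      have "ennreal (c * (\<delta> - \<eta>)) * emeasure lborel S = (\<integral>\<^sup>+x. ennreal (c * (\<delta> - \<eta>)) * indicator S x \<partial>lborel)"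
        by (subst nn_integral_cmult_indicator) auto
      also have "\<dots> \<le> emeasure (cone_surface c) A"
        unfolding cs using dGS(1) c
        by (intro nn_integral_mono) (auto simp: indicator_def intro!: ennreal_leI mult_left_mono)
      finally show ?thesis .
    qed
    have upcs: "emeasure (cone_surface c) A \<le> ennreal (c * (\<delta> + \<eta>)) * emeasure lborel S"
    proof -
      have "emeasure (cone_surface c) A \<le> (\<integral>\<^sup>+x. ennreal (c * (\<delta> + \<eta>)) * indicator S x \<partial>lborel)"
        unfolding cs using dGS(2) c
        by (intro nn_integral_mono) (auto simp: indicator_def intro!: ennreal_leI mult_left_mono)
      also have "\<dots> = ennreal (c * (\<delta> + \<eta>)) * emeasure lborel S"
        by (subst nn_integral_cmult_indicator) auto
      finally show ?thesis .
    qed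
    show ?thesis
    proof
      have "?H A \<le> ennreal (L2 powr s) * (ennreal (c * \<delta>) * (ennreal (\<kappa> ^ CARD('n)) * emeasure lborel S))"
        using H2 F_le unfolding HE by (meson mult_left_mono order_trans zero_le)
      also have "\<dots> = ennreal (L2 powr s * (c * \<delta>) * \<kappa> ^ CARD('n)) * emeasure lborel S"
        using c \<delta> \<kappa> by (simp add: ennreal_mult mult.assoc)
      also have "\<dots> \<le> ennreal (K * (c * (\<delta> - \<eta>))) * emeasure lborel S"
      proof (intro mult_right_mono ennreal_leI)
        have "L2 powr s * \<kappa> ^ CARD('n) * (\<delta> / (\<delta> - \<eta>)) < K"
          using \<eta>(5) by (simp add: L2_def \<theta>_def \<kappa>_def)
        then have "L2 powr s * \<kappa> ^ CARD('n) * \<delta> \<le> K * (\<delta> - \<eta>)"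
          using \<eta>(3) by (simp add: field_simps)
        then have "c * (L2 powr s * \<kappa> ^ CARD('n) * \<delta>) \<le> c * (K * (\<delta> - \<eta>))"
          using c by (rule mult_left_mono)
        then show "L2 powr s * (c * \<delta>) * \<kappa> ^ CARD('n) \<le> K * (c * (\<delta> - \<eta>))" by (simp only: mult_ac)
      qed simp
      also have "\<dots> = ennreal K * (ennreal (c * (\<delta> - \<eta>)) * emeasure lborel S)"
        using K c \<eta>(3) by (simp add: ennreal_mult mult.assoc)
      also have "\<dots> \<le> ennreal K * emeasure (cone_surface c) A"
        by (intro mult_left_mono lowcs) simp
      finally show "?H A \<le> ennreal K * emeasure (cone_surface c) A" .
    next
      have "emeasure (cone_surface c) A \<le> ennreal (c * (\<delta> + \<eta>)) * emeasure lborel F"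
        using upcs S_le by (meson mult_left_mono order_trans zero_le)
      also have "\<dots> = ennreal ((\<delta> + \<eta>) / \<delta>) * ?H E"
        using c \<delta> \<eta> unfolding HE by (simp add: mult.assoc[symmetric] ennreal_mult[symmetric] mult.commute[of c])
      also have "\<dots> \<le> ennreal ((\<delta> + \<eta>) / \<delta>) * (ennreal (L1 powr s) * ?H A)"
        by (intro mult_left_mono H1) simp
      also have "\<dots> = ennreal (L1 powr s * ((\<delta> + \<eta>) / \<delta>)) * ?H A"
        using \<delta> \<eta> by (subst ennreal_mult) (auto simp: mult_ac)
      also have "\<dots> \<le> ennreal K * ?H A"
        using \<eta>(6) by (intro mult_right_mono ennreal_leI) (auto simp: L1_def \<theta>_def)
      finally show "emeasure (cone_surface c) A \<le> ennreal K * ?H A" .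
    qed
  qed
  show ?thesis
    unfolding s_def[symmetric]
  proof (intro exI[of _ "ball y0 r"] conjI ballI impI)
    fix A assume "A \<in> sets borel" "A \<subseteq> {x. G x = 1} \<inter> ball y0 r"
    from main[OF this] show "?H A \<le> ennreal K * emeasure (cone_surface c) A"
      "emeasure (cone_surface c) A \<le> ennreal K * ?H A" by auto
  qed (use r in auto)
qed

text \<open>Near each point the two measures agree up to a factor \<open>K\<close> as close to 1 as
  desired. Compactness of the gauge sphere makes the estimate global, and then \<open>K\<close>
  tends to 1.\<close>

lemma emeasure_surface_eq_cone_surface:
  assumes n: "2 \<le> CARD('n)" and c: "0 \<le> c"
    and ms: "measure_space UNIV (sets borel) (hausdorff_outer (real CARD('n) - 1) :: (real^'n) set \<Rightarrow> ennreal)"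
    and flat: "\<And>e h A. norm e = 1 \<Longrightarrow> h > 0 \<Longrightarrow> A \<in> sets borel \<Longrightarrow> A \<subseteq> {x::real^'n. x \<bullet> e = 0} \<Longrightarrow>
      hausdorff_outer (real CARD('n) - 1) A = ennreal (c / h) * emeasure lborel (flat_cone e h A)"
    and A: "A \<in> sets borel" "A \<subseteq> {x. G x = 1}"
  shows "emeasure (hausdorff_measure (real CARD('n) - 1)) A = emeasure (cone_surface c) A"
proof -
  let ?M = "hausdorff_measure (real CARD('n) - 1) :: (real^'n) measure"
  have Z: "compact {x. G x = 1}"
    unfolding compact_eq_bounded_closed
  proof
    have "norm x \<le> 1 / m" if "G x = 1" for x
      using lower[of x] that m_pos by (simp add: field_simps)
    then show "bounded {x. G x = 1}" by (intro boundedI) auto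
    show "closed {x. G x = 1}" by (intro closed_Collect_eq continuous_on_G continuous_intros)
  qed
  have loc: "\<exists>U. open U \<and> z \<in> U \<and> (\<forall>A\<in>sets borel. A \<subseteq> {x. G x = 1} \<inter> U \<longrightarrow>
      emeasure ?M A \<le> ennreal K * emeasure (cone_surface c) A \<and>
      emeasure (cone_surface c) A \<le> ennreal K * emeasure ?M A)" if "1 < K" "z \<in> {x. G x = 1}" for K z
  proof -
    have "G z = 1" using that by simp
    from surface_local_comparison[OF n c flat this that(1)]
    obtain U where U: "open U \<and> z \<in> U \<and> (\<forall>A\<in>sets borel. A \<subseteq> {x. G x = 1} \<inter> U \<longrightarrow>
      hausdorff_outer (real CARD('n) - 1) A \<le> ennreal K * emeasure (cone_surface c) A \<and>
      emeasure (cone_surface c) A \<le> ennreal K * hausdorff_outer (real CARD('n) - 1) A)" ..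
    show ?thesis
    proof (intro exI[of _ U] conjI[OF _ conjI] ballI impI)
      fix A :: "(real^'n) set" assume "A \<in> sets borel" "A \<subseteq> {x. G x = 1} \<inter> U"
      then show "emeasure ?M A \<le> ennreal K * emeasure (cone_surface c) A \<and>
        emeasure (cone_surface c) A \<le> ennreal K * emeasure ?M A"
        using U unfolding emeasure_hausdorff_measure[OF ms \<open>A \<in> sets borel\<close>] by blast
    qed (use U in blast)+
  qed
  show ?thesis
  proof (rule antisym; rule ennreal_le_if_le_mult)
    fix K :: real assume K: "1 < K"
    show "emeasure ?M A \<le> ennreal K * emeasure (cone_surface c) A"
    proof (rule emeasure_le_of_local[OF _ _ Z _ A])
      fix z assume "z \<in> {x. G x = 1}"
      from loc[OF K this] show "\<exists>U. open U \<and> z \<in> U \<and> (\<forall>A\<in>sets borel. A \<subseteq> {x. G x = 1} \<inter> U \<longrightarrow>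
        emeasure ?M A \<le> ennreal K * emeasure (cone_surface c) A)" by auto
    qed simp_all
    show "emeasure (cone_surface c) A \<le> ennreal K * emeasure ?M A"
    proof (rule emeasure_le_of_local[OF _ _ Z _ A])
      fix z assume "z \<in> {x. G x = 1}"
      from loc[OF K this] show "\<exists>U. open U \<and> z \<in> U \<and> (\<forall>A\<in>sets borel. A \<subseteq> {x. G x = 1} \<inter> U \<longrightarrow>
        emeasure (cone_surface c) A \<le> ennreal K * emeasure ?M A)" by auto
    qed simp_all
  qed
qed

section \<open>Topology and volume of gauge balls\<close>

lemma continuous_on_G_shift: "continuous_on S (\<lambda>x. G (x - x0))"
  by (rule continuous_on_compose2[OF continuous_on_G[of UNIV]]) (auto intro!: continuous_intros)

lemma open_G_less: "open {x. G (x - x0) < 1}"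
  by (intro open_Collect_less continuous_on_G_shift continuous_on_const)

lemma closed_G_le: "closed {x. G (x - x0) \<le> 1}"
  by (intro closed_Collect_le continuous_on_G_shift continuous_on_const)

lemma closure_G_less: "closure {x. G (x - x0) < 1} = {x. G (x - x0) \<le> 1}"
proof (rule antisym)
  show "closure {x. G (x - x0) < 1} \<subseteq> {x. G (x - x0) \<le> 1}"
    by (intro closure_minimal closed_G_le) auto
  show "{x. G (x - x0) \<le> 1} \<subseteq> closure {x. G (x - x0) < 1}"
  proof
    fix x assume "x \<in> {x. G (x - x0) \<le> 1}"
    then have x: "G (x - x0) \<le> 1" by simp
    have in_D: "x0 + (1 - 1 / real (Suc (Suc k))) *\<^sub>R (x - x0) \<in> {x. G (x - x0) < 1}" for k
    proof -
      have "(1 - 1 / real (Suc (Suc k))) * G (x - x0) \<le> (1 - 1 / real (Suc (Suc k))) * 1"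
        using x by (intro mult_left_mono) auto
      also have "\<dots> < 1" by simp
      finally show ?thesis by (simp add: hom)
    qed
    have "(\<lambda>k. x0 + (1 - 1 / real (Suc (Suc k))) *\<^sub>R (x - x0)) \<longlonglongrightarrow> x0 + (1 - 0) *\<^sub>R (x - x0)"
    proof (intro tendsto_intros)
      have "(\<lambda>k. 1 / real (Suc k)) \<longlonglongrightarrow> 0" using LIMSEQ_inverse_real_of_nat by (simp add: inverse_eq_divide)
      then show "(\<lambda>k. 1 / real (Suc (Suc k))) \<longlonglongrightarrow> 0" by (rule LIMSEQ_Suc)
    qed
    then have "(\<lambda>k. x0 + (1 - 1 / real (Suc (Suc k))) *\<^sub>R (x - x0)) \<longlonglongrightarrow> x" by simp
    show "x \<in> closure {x. G (x - x0) < 1}"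
      unfolding closure_sequential
    proof (intro exI conjI allI)
      show "x0 + (1 - 1 / real (Suc (Suc k))) *\<^sub>R (x - x0) \<in> {x. G (x - x0) < 1}" for k by (rule in_D)
    qed fact
  qed
qed

lemma compact_closure_G_less: "compact (closure {x. G (x - x0) < 1})"
proof -
  have "norm x \<le> norm x0 + 1 / m" if "G (x - x0) \<le> 1" for x
  proof -
    have "m * norm (x - x0) \<le> 1" using lower[of "x - x0"] that by simp
    then have "norm (x - x0) \<le> 1 / m" using m_pos by (simp add: field_simps)
    then show ?thesis using norm_triangle_sub[of x x0] by linarith
  qed
  then have "bounded {x. G (x - x0) \<le> 1}" by (intro boundedI) auto
  then show ?thesis unfolding closure_G_less by (simp add: compact_eq_bounded_closed closed_G_le)
qed

lemma frontier_G_less: "frontier {x. G (x - x0) < 1} = {x. G (x - x0) = 1}"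
  unfolding frontier_def closure_G_less interior_open[OF open_G_less] by auto

lemma emeasure_lborel_G_le_finite: "emeasure lborel {x. G x \<le> 1} < \<infinity>"
proof -
  have "{x. G x \<le> 1} \<subseteq> cball 0 (1 / m)"
  proof
    fix x assume "x \<in> {x. G x \<le> 1}"
    then have "m * norm x \<le> 1" using lower[of x] by simp
    then show "x \<in> cball 0 (1 / m)" using m_pos by (simp add: field_simps)
  qed
  then have "emeasure lborel {x. G x \<le> 1} \<le> emeasure lborel (cball 0 (1 / m) :: (real^'n) set)"
    by (intro emeasure_mono) auto
  then show ?thesis using emeasure_lborel_cball_finite[of "0 :: real^'n" "1 / m"] by (rule le_less_trans)
qed

lemma emeasure_lborel_G_eq_1: "emeasure lborel {x. G x = 1} = 0"
proof -
  have "negligible (frontier {x. G (x - 0) < 1})"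
  proof (rule negligible_convex_frontier)
    have "G (x + y) \<le> G x + G y" for x y
    proof (cases "x + y = 0")
      case False
      have "G (x + y) = dG (x + y) \<bullet> x + dG (x + y) \<bullet> y"
        using dG_self[OF False] by (simp add: inner_add_right)
      then show ?thesis using dG_le[OF False, of x] dG_le[OF False, of y] by linarith
    qed (simp add: G_nonneg)
    note sub = this
    show "convex {x. G (x - 0) < 1}"
    proof (rule convexI)
      fix x y and u v :: real
      assume xy: "x \<in> {x. G (x - 0) < 1}" "y \<in> {x. G (x - 0) < 1}" and uv: "0 \<le> u" "0 \<le> v" "u + v = 1"
      have "G (u *\<^sub>R x + v *\<^sub>R y) \<le> u * G x + v * G y"
        using sub[of "u *\<^sub>R x" "v *\<^sub>R y"] uv by (simp add: hom)
      also have "\<dots> < 1" by (rule convex_bound_lt) (use xy uv in auto)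
      finally show "u *\<^sub>R x + v *\<^sub>R y \<in> {x. G (x - 0) < 1}" by simp
    qed
  qed
  then have "{x. G x = 1} \<in> null_sets lebesgue"
    unfolding frontier_G_less by (simp add: negligible_iff_null_sets)
  then show ?thesis by (simp add: null_sets_def)
qed

end

text \<open>The constant is not identified.  If the outer measure were not countably additive on Borel sets,
  then \<^const>\<open>hausdorff_measure\<close> would be the zero measure; this case is covered by \<open>c = 0\<close>.\<close>

lemma surface_measure_formula:
  assumes n: "2 \<le> CARD('n::finite)"
  shows "\<exists>c\<ge>0. \<forall>(G :: real^'n \<Rightarrow> real) dG m M x0 f. smooth_gauge G dG m M \<longrightarrow> f \<in> borel_measurable borel \<longrightarrow>
    (\<integral>\<^sup>+x. f x \<partial>surface_measure {x. G (x - x0) < 1}) =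
    (\<integral>\<^sup>+x. f (x0 + (1 / G x) *\<^sub>R x) * ennreal (c * norm (dG x)) * indicator {x. G x < 1} x \<partial>lborel)"
proof (cases "measure_space UNIV (sets borel) (hausdorff_outer (real CARD('n) - 1) :: (real^'n) set \<Rightarrow> ennreal)")
  case False
  have "(\<integral>\<^sup>+x. f x \<partial>surface_measure D) = 0" for f and D :: "(real^'n) set"
  proof -
    have "emeasure (hausdorff_measure (real CARD('n) - 1)) A = 0" for A :: "(real^'n) set"
      unfolding hausdorff_measure_def using False
      by (subst emeasure_measure_of_conv) (auto simp: sets.sigma_sets_eq[of borel, simplified])
    then have "AE x in hausdorff_measure (real CARD('n) - 1) :: (real^'n) measure. False"
      by (intro AE_I[where N = UNIV]) auto
    then have "AE x in surface_measure D. False"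
      unfolding surface_measure_def by (subst AE_restrict_space_iff) auto
    then have "AE x in surface_measure D. f x = 0" by eventually_elim simp
    then have "(\<integral>\<^sup>+x. f x \<partial>surface_measure D) = (\<integral>\<^sup>+x. 0 \<partial>surface_measure D)" by (rule nn_integral_cong_AE)
    then show ?thesis by simp
  qed
  then show ?thesis by (intro exI[of _ 0]) auto
next
  case True
  from hausdorff_hyperplane_flat_cone[OF n True]
  obtain c where c: "c \<ge> 0" and flat: "\<And>e h A. norm e = 1 \<Longrightarrow> h > 0 \<Longrightarrow> A \<in> sets borel \<Longrightarrow> A \<subseteq> {x::real^'n. x \<bullet> e = 0} \<Longrightarrow>
      hausdorff_outer (real CARD('n) - 1) A = ennreal (c / h) * emeasure lborel (flat_cone e h A)"
    by auto
  let ?H = "hausdorff_measure (real CARD('n) - 1) :: (real^'n) measure"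
  have s: "0 \<le> real CARD('n) - 1" using n by simp
  have "(\<integral>\<^sup>+x. f x \<partial>surface_measure {x. G (x - x0) < 1}) =
    (\<integral>\<^sup>+x. f (x0 + (1 / G x) *\<^sub>R x) * ennreal (c * norm (dG x)) * indicator {x. G x < 1} x \<partial>lborel)"
    if sg: "smooth_gauge G dG m M" and f [measurable]: "f \<in> borel_measurable borel" for G :: "real^'n \<Rightarrow> real" and dG m M x0 f
  proof -
    interpret smooth_gauge G dG m M by (rule sg)
    let ?Z = "{x. G (x - x0) = 1}"
    define g where "g x = x + x0" for x :: "real^'n"
    have [measurable]: "g \<in> borel_measurable borel" unfolding g_def by measurable
    have Zb: "?Z \<in> sets borel" by measurable
    have eq: "surface_measure {x. G (x - x0) < 1} = restrict_space (distr (cone_surface c) borel g) ?Z"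
    proof (rule measure_eqI)
      show "sets (surface_measure {x. G (x - x0) < 1}) = sets (restrict_space (distr (cone_surface c) borel g) ?Z)"
        by (simp add: surface_measure_def frontier_G_less sets_restrict_space)
      fix A assume "A \<in> sets (surface_measure {x. G (x - x0) < 1})"
      then have A: "A \<in> sets borel" "A \<subseteq> ?Z"
        using Zb by (auto simp: surface_measure_def frontier_G_less sets_restrict_space)
      have gA: "g -` A \<in> sets borel" using measurable_sets[of g borel borel A] A by simp
      have gA': "g -` A \<subseteq> {x. G x = 1}" using A(2) by (auto simp: g_def)
      have "emeasure (surface_measure {x. G (x - x0) < 1}) A = emeasure ?H A"
        unfolding surface_measure_def frontier_G_less using A Zb by (subst emeasure_restrict_space) auto
      also have "\<dots> = hausdorff_outer (real CARD('n) - 1) A" by (rule emeasure_hausdorff_measure[OF True A(1)])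
      also have "\<dots> = hausdorff_outer (real CARD('n) - 1) (g ` (g -` A))"
      proof -
        have "surj g" unfolding g_def by (rule surjI[of _ "\<lambda>x. x - x0"]) simp
        then show ?thesis by (simp add: surj_image_vimage_eq)
      qed
      also have "\<dots> = hausdorff_outer (real CARD('n) - 1) (g -` A)"
        by (rule hausdorff_outer_isometry[OF _ s]) (simp add: g_def)
      also have "\<dots> = emeasure ?H (g -` A)" by (rule emeasure_hausdorff_measure[OF True gA, symmetric])
      also have "\<dots> = emeasure (cone_surface c) (g -` A)"
        by (rule emeasure_surface_eq_cone_surface[OF n c True flat gA gA'])
      also have "\<dots> = emeasure (distr (cone_surface c) borel g) A"
        using A by (subst emeasure_distr) (auto simp: sets_eq_imp_space_eq[OF sets_cone_surface])
      also have "\<dots> = emeasure (restrict_space (distr (cone_surface c) borel g) ?Z) A"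
        using A Zb by (subst emeasure_restrict_space) auto
      finally show "emeasure (surface_measure {x. G (x - x0) < 1}) A = emeasure (restrict_space (distr (cone_surface c) borel g) ?Z) A" .
    qed
    have ae: "AE x in lborel. x \<noteq> (0::real^'n) \<and> G x \<noteq> 1"
    proof -
      have "AE x in lborel. x \<noteq> (0::real^'n)" by (rule AE_lborel_singleton)
      moreover have "AE x in lborel. G x \<noteq> 1"
        by (rule AE_I[where N = "{x. G x = 1}"]) (auto simp: emeasure_lborel_G_eq_1)
      ultimately show ?thesis by eventually_elim simp
    qed
    have "(\<integral>\<^sup>+x. f x \<partial>surface_measure {x. G (x - x0) < 1}) = (\<integral>\<^sup>+x. f x * indicator ?Z x \<partial>distr (cone_surface c) borel g)"
      unfolding eq using Zb by (subst nn_integral_restrict_space) auto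
    also have "\<dots> = (\<integral>\<^sup>+x. f (g x) * indicator ?Z (g x) \<partial>cone_surface c)"
      using Zb by (subst nn_integral_distr) auto
    also have "\<dots> = (\<integral>\<^sup>+x. f (g ((1 / G x) *\<^sub>R x)) * indicator ?Z (g ((1 / G x) *\<^sub>R x)) * ennreal (c * norm (dG x))
        * indicator {x. 0 < G x \<and> G x \<le> 1} x \<partial>lborel)"
      by (rule nn_integral_cone_surface) (use Zb in measurable)
    also have "\<dots> = (\<integral>\<^sup>+x. f (x0 + (1 / G x) *\<^sub>R x) * ennreal (c * norm (dG x)) * indicator {x. G x < 1} x \<partial>lborel)"
    proof (rule nn_integral_cong_AE, rule AE_mp[OF ae], intro AE_I2 impI)
      fix x :: "real^'n" assume x: "x \<noteq> 0 \<and> G x \<noteq> 1"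
      then have "0 < G x" using G_pos by simp
      then have "g ((1 / G x) *\<^sub>R x) \<in> ?Z" by (simp add: g_def hom)
      moreover have "indicator {x. 0 < G x \<and> G x \<le> 1} x = (indicator {x. G x < 1} x :: ennreal)"
        using x \<open>0 < G x\<close> by (auto simp: indicator_def)
      ultimately show "f (g ((1 / G x) *\<^sub>R x)) * indicator ?Z (g ((1 / G x) *\<^sub>R x)) * ennreal (c * norm (dG x))
        * indicator {x. 0 < G x \<and> G x \<le> 1} x
        = f (x0 + (1 / G x) *\<^sub>R x) * ennreal (c * norm (dG x)) * indicator {x. G x < 1} x"
        by (simp add: g_def add.commute)
    qed
    finally show ?thesis .
  qed
  then show ?thesis using c by (intro exI[of _ c]) simp
qed

section \<open>Weak gradients along rays\<close>

lemma integral_box_zero_imp_AE_zero: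
  fixes h :: "'a::euclidean_space \<Rightarrow> real"
  assumes h: "integrable lborel h"
    and zero: "\<And>a b. (LINT x|lborel. h x * indicator (box a b) x) = 0"
  shows "AE x in lborel. h x = 0"
proof -
  have [measurable]: "h \<in> borel_measurable borel" using h by auto
  define P where "P = density lborel (\<lambda>x. ennreal (h x))"
  define N where "N = density lborel (\<lambda>x. ennreal (- h x))"
  have fin: "(\<integral>\<^sup>+x. ennreal (h x) \<partial>lborel) < \<infinity>" "(\<integral>\<^sup>+x. ennreal (- h x) \<partial>lborel) < \<infinity>"
  proof -
    have "(\<integral>\<^sup>+x. ennreal (h x) \<partial>lborel) \<le> (\<integral>\<^sup>+x. ennreal (norm (h x)) \<partial>lborel)"
      "(\<integral>\<^sup>+x. ennreal (- h x) \<partial>lborel) \<le> (\<integral>\<^sup>+x. ennreal (norm (h x)) \<partial>lborel)"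
      by (auto intro!: nn_integral_mono ennreal_leI)
    then show "(\<integral>\<^sup>+x. ennreal (h x) \<partial>lborel) < \<infinity>" "(\<integral>\<^sup>+x. ennreal (- h x) \<partial>lborel) < \<infinity>"
      using h unfolding integrable_iff_bounded by (auto intro: le_less_trans)
  qed
  have box: "emeasure P (box a b) = emeasure N (box a b)" for a b
  proof -
    have ib: "integrable lborel (\<lambda>x. h x * indicator (box a b) x)"
      using h by (intro integrable_real_mult_indicator) auto
    have "emeasure P (box a b) = (\<integral>\<^sup>+x. ennreal (h x * indicator (box a b) x) \<partial>lborel)"
      unfolding P_def by (subst emeasure_density) (auto intro!: nn_integral_cong simp: indicator_def)
    moreover have "emeasure N (box a b) = (\<integral>\<^sup>+x. ennreal (- (h x * indicator (box a b) x)) \<partial>lborel)"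
      unfolding N_def by (subst emeasure_density) (auto intro!: nn_integral_cong simp: indicator_def)
    moreover have "(\<integral>\<^sup>+x. ennreal (h x * indicator (box a b) x) \<partial>lborel) < \<infinity>"
      "(\<integral>\<^sup>+x. ennreal (- (h x * indicator (box a b) x)) \<partial>lborel) < \<infinity>"
    proof -
      have "(\<integral>\<^sup>+x. ennreal (h x * indicator (box a b) x) \<partial>lborel) \<le> (\<integral>\<^sup>+x. ennreal (h x) \<partial>lborel)"
        "(\<integral>\<^sup>+x. ennreal (- (h x * indicator (box a b) x)) \<partial>lborel) \<le> (\<integral>\<^sup>+x. ennreal (- h x) \<partial>lborel)"
        by (auto intro!: nn_integral_mono simp: indicator_def)
      then show "(\<integral>\<^sup>+x. ennreal (h x * indicator (box a b) x) \<partial>lborel) < \<infinity>"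
      "(\<integral>\<^sup>+x. ennreal (- (h x * indicator (box a b) x)) \<partial>lborel) < \<infinity>"
        using fin by (auto intro: le_less_trans)
    qed
    moreover have "enn2real (\<integral>\<^sup>+x. ennreal (h x * indicator (box a b) x) \<partial>lborel)
        - enn2real (\<integral>\<^sup>+x. ennreal (- (h x * indicator (box a b) x)) \<partial>lborel) = 0"
      using zero[of a b] unfolding real_lebesgue_integral_def[OF ib] .
    moreover have "A = B" if "A < \<infinity>" "B < \<infinity>" "enn2real A - enn2real B = 0" for A B
      using that by (cases A; cases B) auto
    ultimately show ?thesis by presburger
  qed
  have "P = N"
  proof (rule measure_eqI_generator_eq)
    let ?E = "range (\<lambda>(a, b). box a b :: 'a set)"
    show "Int_stable ?E" by (auto simp: Int_stable_def box_Int_box)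
    show "sets P = sigma_sets UNIV ?E" "sets N = sigma_sets UNIV ?E"
      by (simp_all add: P_def N_def borel_eq_box)
    let ?A = "\<lambda>n::nat. box (- (real n *\<^sub>R One)) (real n *\<^sub>R One) :: 'a set"
    show "range ?A \<subseteq> ?E" "(\<Union>i. ?A i) = UNIV"
      unfolding UN_box_eq_UNIV by auto
    show "emeasure P X = emeasure N X" if "X \<in> ?E" for X
      using that box by auto
    show "emeasure P (?A i) \<noteq> \<infinity>" for i
    proof -
      have "emeasure P (?A i) \<le> emeasure P UNIV" by (intro emeasure_mono) (auto simp: P_def)
      also have "\<dots> < \<infinity>" using fin(1) by (simp add: P_def emeasure_density)
      finally show ?thesis by simp
    qed
  qed auto
  then have "AE x in lborel. ennreal (h x) = ennreal (- h x)"
    unfolding P_def N_def by (intro sigma_finite_measure.density_unique[OF sigma_finite_lborel]) auto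
  then show ?thesis
  proof eventually_elim
    fix x assume *: "ennreal (h x) = ennreal (- h x)"
    show "h x = 0"
    proof (cases "h x > 0")
      case True
      then show ?thesis using * by (simp add: ennreal_neg)
    next
      case False
      then have "ennreal (- h x) = 0" using * by (simp add: ennreal_neg)
      then show ?thesis using False by (simp add: ennreal_eq_0_iff)
    qed
  qed
qed

section \<open>Test functions and the fundamental lemma of the calculus of variations\<close>

lemma DERIV_max_0_square:
  "((\<lambda>t::real. (max 0 t)\<^sup>2) has_real_derivative 2 * max 0 t) (at t)"
proof -
  consider "t > 0" | "t < 0" | "t = 0" by linarith
  then show ?thesis
  proof cases
    case 1
    have "((\<lambda>t::real. t\<^sup>2) has_real_derivative 2 * max 0 t) (at t)"
      using 1 by (auto intro!: derivative_eq_intros)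
    then show ?thesis
      by (rule has_field_derivative_transform_within_open[where S = "{0<..}"]) (use 1 in auto)
  next
    case 2
    have "((\<lambda>t::real. 0) has_real_derivative 2 * max 0 t) (at t)" using 2 by simp
    then show ?thesis
      by (rule has_field_derivative_transform_within_open[where S = "{..<0}"]) (use 2 in auto)
  next
    case 3
    have "((\<lambda>h::real. ((max 0 (0 + h))\<^sup>2 - (max 0 0)\<^sup>2) / h) \<longlongrightarrow> 0) (at 0)"
    proof (rule tendsto_0_le[where f = "\<lambda>h. h" and K = 1])
      show "((\<lambda>h::real. h) \<longlongrightarrow> 0) (at 0)" by (rule tendsto_ident_at)
      show "\<forall>\<^sub>F h in at (0::real). norm (((max 0 (0 + h))\<^sup>2 - (max 0 0)\<^sup>2) / h) \<le> norm h * 1"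
        by (intro always_eventually allI) (auto simp: max_def power2_eq_square)
    qed
    then show ?thesis unfolding DERIV_def using 3 by simp
  qed
qed

text \<open>For k > 0 this is continuously differentiable, vanishes outside the interval from a +
  1/k to b - 1/k, and grows to infinity with k at each point strictly between a and b. Thus c / (1 +
  c) is a bounded cutoff that converges pointwise to the indicator of the open interval.\<close>

definition cutoff :: "real \<Rightarrow> real \<Rightarrow> real \<Rightarrow> real \<Rightarrow> real" where
  "cutoff k a b t = (max 0 (k * (t - a) - 1))\<^sup>2 * (max 0 (k * (b - t) - 1))\<^sup>2"

lemma cutoff_nonneg [simp]: "0 \<le> cutoff k a b t"
  by (simp add: cutoff_def)

lemma cutoff_derivative:
  obtains D where "\<And>t. (cutoff k a b has_real_derivative D t) (at t)" "continuous_on UNIV D"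
proof
  define D where "D t = 2 * max 0 (k * (t - a) - 1) * k * (max 0 (k * (b - t) - 1))\<^sup>2
    + 2 * max 0 (k * (b - t) - 1) * (- k) * (max 0 (k * (t - a) - 1))\<^sup>2" for t
  show "(cutoff k a b has_real_derivative D t) (at t)" for t
  proof -
    have 1: "((\<lambda>t. (max 0 (k * (t - a) - 1))\<^sup>2) has_real_derivative 2 * max 0 (k * (t - a) - 1) * k) (at t)"
      by (rule DERIV_chain2[OF DERIV_max_0_square]) (auto intro!: derivative_eq_intros)
    have 2: "((\<lambda>t. (max 0 (k * (b - t) - 1))\<^sup>2) has_real_derivative 2 * max 0 (k * (b - t) - 1) * (- k)) (at t)"
      by (rule DERIV_chain2[OF DERIV_max_0_square]) (auto intro!: derivative_eq_intros)
    show ?thesis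
      using DERIV_mult[OF 1 2] unfolding cutoff_def[abs_def] D_def by (simp add: mult_ac add.commute)
  qed
  show "continuous_on UNIV D" unfolding D_def by (intro continuous_intros)
qed

lemma box_test_function:
  fixes a b :: "real^'n"
  assumes k: "k > 0" and sub: "box a b \<subseteq> V"
  shows "\<exists>d\<phi>. test_fun V (\<lambda>x. \<Prod>i\<in>UNIV. cutoff k (a $ i) (b $ i) (x $ i) / (1 + cutoff k (a $ i) (b $ i) (x $ i))) d\<phi>"
proof -
  have "\<forall>i. \<exists>D. (\<forall>t. (cutoff k (a $ i) (b $ i) has_real_derivative D t) (at t)) \<and> continuous_on UNIV D"
  proof
    fix i show "\<exists>D. (\<forall>t. (cutoff k (a $ i) (b $ i) has_real_derivative D t) (at t)) \<and> continuous_on UNIV D"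
      by (rule cutoff_derivative[of k "a $ i" "b $ i"]) blast
  qed
  from choice[OF this] obtain D where D: "\<forall>i. (\<forall>t. (cutoff k (a $ i) (b $ i) has_real_derivative D i t) (at t)) \<and> continuous_on UNIV (D i)" ..
  define c where "c i = cutoff k (a $ i) (b $ i)" for i
  have Dc: "(c i has_real_derivative D i t) (at t)" and contD: "continuous_on UNIV (D i)" for i t
    using D by (auto simp: c_def)
  have c0: "0 \<le> c i t" for i t by (simp add: c_def)
  define \<theta> where "\<theta> i t = c i t / (1 + c i t)" for i t
  define \<theta>' where "\<theta>' i t = D i t / (1 + c i t)\<^sup>2" for i t
  have D\<theta>: "(\<theta> i has_real_derivative \<theta>' i t) (at t)" for i t
  proof -
    have ne: "1 + c i t \<noteq> 0" using c0[of i t] by linarith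
    have "((\<lambda>t. c i t / (1 + c i t)) has_real_derivative (D i t * (1 + c i t) - c i t * (0 + D i t)) / ((1 + c i t) * (1 + c i t))) (at t)"
      by (intro DERIV_divide DERIV_add DERIV_const Dc ne)
    then show ?thesis unfolding \<theta>_def[abs_def] \<theta>'_def by (simp add: algebra_simps power2_eq_square)
  qed
  have contc: "continuous_on S (c i)" for i S
    using Dc by (meson DERIV_isCont continuous_at_imp_continuous_on)
  have cont\<theta>: "continuous_on UNIV (\<theta> i)" for i
    using D\<theta> by (meson DERIV_isCont continuous_at_imp_continuous_on)
  have cont\<theta>': "continuous_on UNIV (\<theta>' i)" for i
    unfolding \<theta>'_def[abs_def]
  proof (intro continuous_intros contc contD ballI)
    fix t show "(1 + c i t)\<^sup>2 \<noteq> 0" using c0[of i t] by (simp add: add_nonneg_eq_0_iff)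
  qed
  define \<phi> where "\<phi> x = (\<Prod>i\<in>UNIV. \<theta> i (x $ i))" for x :: "real^'n"
  define d\<phi> where "d\<phi> x = (\<chi> i. \<theta>' i (x $ i) * (\<Prod>j\<in>UNIV - {i}. \<theta> j (x $ j)))" for x :: "real^'n"
  have "(\<phi> has_derivative (\<lambda>h. d\<phi> x \<bullet> h)) (at x)" for x
  proof -
    have 1: "((\<lambda>x. \<theta> i (x $ i)) has_derivative (\<lambda>h. \<theta>' i (x $ i) * h $ i)) (at x)" for i
    proof -
      have "(\<theta> i has_derivative (*) (\<theta>' i (x $ i))) (at (x $ i))"
        using D\<theta> by (simp add: has_field_derivative_def)
      moreover have "((\<lambda>x. x $ i) has_derivative (\<lambda>h. h $ i)) (at x)"
        by (rule bounded_linear_imp_has_derivative) (rule bounded_linear_vec_nth)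
      ultimately show ?thesis using has_derivative_compose by blast
    qed
    have "((\<lambda>x. \<Prod>i\<in>UNIV. \<theta> i (x $ i)) has_derivative
      (\<lambda>h. \<Sum>i\<in>UNIV. (\<theta>' i (x $ i) * h $ i) * (\<Prod>j\<in>UNIV - {i}. \<theta> j (x $ j)))) (at x)"
      by (rule has_derivative_prod) (rule 1)
    then show ?thesis
      unfolding \<phi>_def[abs_def] d\<phi>_def inner_vec_def by (simp add: mult_ac)
  qed
  moreover have "continuous_on UNIV d\<phi>"
  proof -
    have 1: "continuous_on UNIV (\<lambda>x::real^'n. \<theta> i (x $ i))" "continuous_on UNIV (\<lambda>x::real^'n. \<theta>' i (x $ i))" for i
      by (rule continuous_on_compose2[OF cont\<theta>] continuous_on_compose2[OF cont\<theta>'], auto intro!: continuous_intros)+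
    show ?thesis unfolding d\<phi>_def[abs_def]
      by (intro continuous_on_vec_lambda continuous_on_mult continuous_on_prod 1)
  qed
  moreover have "compact (closure {x. \<phi> x \<noteq> 0}) \<and> closure {x. \<phi> x \<noteq> 0} \<subseteq> V"
  proof -
    \<comment> \<open>The margin 1/k keeps the closed support inside the open box.\<close>
    define a' where "a' = (\<chi> i. a $ i + 1 / k)"
    define b' where "b' = (\<chi> i. b $ i - 1 / k)"
    have "{x. \<phi> x \<noteq> 0} \<subseteq> cbox a' b'"
    proof
      fix x assume "x \<in> {x. \<phi> x \<noteq> 0}"
      then have ne: "c i (x $ i) \<noteq> 0" for i by (auto simp: \<phi>_def \<theta>_def)
      have "a $ i + 1 / k \<le> x $ i \<and> x $ i \<le> b $ i - 1 / k" for i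
      proof -
        have "k * (x $ i - a $ i) > 1" "k * (b $ i - x $ i) > 1"
          using ne[of i] by (auto simp: c_def cutoff_def max_def split: if_splits)
        then show ?thesis using k by (auto simp: field_simps)
      qed
      then show "x \<in> cbox a' b'" by (auto simp: mem_box_cart a'_def b'_def)
    qed
    then have cl: "closure {x. \<phi> x \<noteq> 0} \<subseteq> cbox a' b'" by (intro closure_minimal) auto
    moreover have "cbox a' b' \<subseteq> box a b"
    proof
      fix x assume "x \<in> cbox a' b'"
      then have "a $ i + 1 / k \<le> x $ i" "x $ i \<le> b $ i - 1 / k" for i by (auto simp: mem_box_cart a'_def b'_def)
      moreover have "1 / k > 0" using k by simp
      ultimately have "a $ i < x $ i" "x $ i < b $ i" for i by (smt (verit))+
      then show "x \<in> box a b" by (auto simp: mem_box_cart)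
    qed
    moreover have "compact (closure {x. \<phi> x \<noteq> 0})"
      using cl compact_cbox[of a' b'] by (meson bounded_subset closed_closure compact_eq_bounded_closed)
    ultimately show ?thesis using sub by blast
  qed
  ultimately have "test_fun V \<phi> d\<phi>" unfolding test_fun_def by blast
  moreover have "\<phi> = (\<lambda>x. \<Prod>i\<in>UNIV. cutoff k (a $ i) (b $ i) (x $ i) / (1 + cutoff k (a $ i) (b $ i) (x $ i)))"
    by (simp add: \<phi>_def \<theta>_def c_def fun_eq_iff)
  ultimately show ?thesis by auto
qed

text \<open>Products of the one-dimensional cutoffs converge boundedly to indicators of boxes inside
  \<open>V\<close>, so \<open>h\<close> has zero integral over every such box. The open set is a
  countable union of boxes.\<close>

lemma fundamental_lemma_calculus_variations:
  fixes h :: "real^'n \<Rightarrow> real"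
  assumes V: "open V" and h: "integrable lborel h"
    and zero: "\<And>\<phi> d\<phi>. test_fun V \<phi> d\<phi> \<Longrightarrow> (LINT x|lborel. h x * \<phi> x) = 0"
  shows "AE x in lborel. x \<in> V \<longrightarrow> h x = 0"
proof -
  have box0: "(LINT x|lborel. h x * indicator (box a b) x) = 0" if sub: "box a b \<subseteq> V" for a b
  proof -
    define \<theta> where "\<theta> k i t = cutoff (real (Suc k)) (a $ i) (b $ i) t / (1 + cutoff (real (Suc k)) (a $ i) (b $ i) t)" for k i t
    define \<phi> where "\<phi> k x = (\<Prod>i\<in>UNIV. \<theta> k i (x $ i))" for k and x :: "real^'n"
    have \<theta>01: "0 \<le> \<theta> k i t" "\<theta> k i t \<le> 1" for k i t
    proof -
      have "0 \<le> c / (1 + c) \<and> c / (1 + c) \<le> 1" if "0 \<le> c" for c :: real using that by simp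
      from this[OF cutoff_nonneg, of "real (Suc k)" "a $ i" "b $ i" t]
      show "0 \<le> \<theta> k i t" "\<theta> k i t \<le> 1" unfolding \<theta>_def by auto
    qed
    have \<phi>01: "0 \<le> \<phi> k x" "\<phi> k x \<le> 1" for k x
      unfolding \<phi>_def using \<theta>01 by (auto intro!: prod_nonneg prod_le_1)
    have ex: "\<exists>d\<phi>. test_fun V (\<phi> k) d\<phi>" for k
      using box_test_function[of "real (Suc k)", OF _ sub] by (simp add: \<phi>_def[abs_def] \<theta>_def)
    then have z: "(LINT x|lborel. h x * \<phi> k x) = 0" for k using zero by blast
    have \<phi>m [measurable]: "\<phi> k \<in> borel_measurable borel" for k
    proof -
      obtain d\<phi> where "test_fun V (\<phi> k) d\<phi>" using ex by blast
      then have "continuous_on UNIV (\<phi> k)"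
        unfolding test_fun_def by (meson continuous_at_imp_continuous_on has_derivative_continuous)
      then show ?thesis by (rule borel_measurable_continuous_onI)
    qed
    have lim: "(\<lambda>k. \<phi> k x) \<longlonglongrightarrow> indicator (box a b) x" for x
    proof (cases "x \<in> box a b")
      case True
      have "(\<lambda>k. \<theta> k i (x $ i)) \<longlonglongrightarrow> 1" for i
      proof -
        have p: "x $ i - a $ i > 0" "b $ i - x $ i > 0" using True by (auto simp: mem_box_cart)
        have l1: "filterlim (\<lambda>k. (max 0 (real (Suc k) * d - 1))\<^sup>2) at_top sequentially" if "d > 0" for d
        proof -
          have "filterlim (\<lambda>k. - 1 + real (Suc k) * d) at_top sequentially"
            by (intro filterlim_tendsto_add_at_top[OF tendsto_const] filterlim_at_top_mult_tendsto_pos[OF tendsto_const that]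
                filterlim_compose[OF filterlim_real_sequentially filterlim_Suc])
          then have "filterlim (\<lambda>k. real (Suc k) * d - 1) at_top sequentially" by simp
          then have "filterlim (\<lambda>k. max 0 (real (Suc k) * d - 1)) at_top sequentially"
            by (rule filterlim_at_top_mono) auto
          then show ?thesis by (intro filterlim_pow_at_top) auto
        qed
        have "filterlim (\<lambda>k. cutoff (real (Suc k)) (a $ i) (b $ i) (x $ i)) at_top sequentially"
          unfolding cutoff_def by (intro filterlim_at_top_mult_at_top l1 p)
        then have inf: "filterlim (\<lambda>k. 1 + cutoff (real (Suc k)) (a $ i) (b $ i) (x $ i)) at_infinity sequentially"
          by (intro filterlim_at_top_imp_at_infinity filterlim_tendsto_add_at_top[OF tendsto_const])
        have "(\<lambda>k. 1 - 1 / (1 + cutoff (real (Suc k)) (a $ i) (b $ i) (x $ i))) \<longlonglongrightarrow> 1 - 0"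
          by (intro tendsto_diff tendsto_const tendsto_divide_0[OF tendsto_const inf])
        moreover have "1 - 1 / (1 + cutoff (real (Suc k)) (a $ i) (b $ i) (x $ i)) = \<theta> k i (x $ i)" for k
        proof -
          have "1 + cutoff (real (Suc k)) (a $ i) (b $ i) (x $ i) > 0" by (simp add: add_pos_nonneg)
          then show ?thesis by (simp add: \<theta>_def field_simps)
        qed
        ultimately show ?thesis by simp
      qed
      then have "(\<lambda>k. \<phi> k x) \<longlonglongrightarrow> (\<Prod>i\<in>(UNIV::'n set). 1)"
        unfolding \<phi>_def by (intro tendsto_prod) auto
      then show ?thesis using True by simp
    next
      case False
      then obtain i where "\<not> (a $ i < x $ i \<and> x $ i < b $ i)" by (auto simp: mem_box_cart)
      then have "\<theta> k i (x $ i) = 0" for k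
      proof -
        have "real (Suc k) * (x $ i - a $ i) \<le> 0 \<or> real (Suc k) * (b $ i - x $ i) \<le> 0"
          using \<open>\<not> (a $ i < x $ i \<and> x $ i < b $ i)\<close> by (auto simp: mult_le_0_iff)
        then show ?thesis by (auto simp: \<theta>_def cutoff_def max_def)
      qed
      then have "\<phi> k x = 0" for k unfolding \<phi>_def by (intro prod_zero) auto
      then show ?thesis using False by simp
    qed
    have "(\<lambda>k. LINT x|lborel. h x * \<phi> k x) \<longlonglongrightarrow> (LINT x|lborel. h x * indicator (box a b) x)"
    proof (rule integral_dominated_convergence[where w = "\<lambda>x. norm (h x)"])
      show "AE x in lborel. (\<lambda>k. h x * \<phi> k x) \<longlonglongrightarrow> h x * indicator (box a b) x"
        by (intro AE_I2 tendsto_mult tendsto_const lim)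
      show "AE x in lborel. norm (h x * \<phi> k x) \<le> norm (h x)" for k
        using \<phi>01 by (intro AE_I2) (simp add: abs_mult mult_left_le)
    qed (use h in auto)
    then show ?thesis using z by (simp add: LIMSEQ_const_iff)
  qed
  obtain \<D> where \<D>: "countable \<D>" "\<D> \<subseteq> Pow V" "\<And>X. X \<in> \<D> \<Longrightarrow> \<exists>a b. X = box a b" "\<Union>\<D> = V"
    by (rule open_countable_Union_open_box[OF V]) blast
  have "AE x in lborel. x \<in> X \<longrightarrow> h x = 0" if X: "X \<in> \<D>" for X
  proof -
    obtain a b where ab: "X = box a b" using \<D>(3)[OF X] by blast
    have "AE x in lborel. h x * indicator (box a b) x = 0"
    proof (rule integral_box_zero_imp_AE_zero)
      show "integrable lborel (\<lambda>x. h x * indicator (box a b) x)"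
        using h by (intro integrable_real_mult_indicator) auto
      fix a' b' :: "real^'n"
      obtain a'' b'' where ab'': "box a b \<inter> box a' b' = box a'' b''" using box_Int_box by blast
      then have "box a'' b'' \<subseteq> V" using X \<D>(2) ab by blast
      then have "(LINT x|lborel. h x * indicator (box a'' b'') x) = 0" by (rule box0)
      moreover have "h x * indicator (box a b) x * indicator (box a' b') x = h x * indicator (box a'' b'') x" for x
        unfolding ab''[symmetric] by (simp add: indicator_def)
      ultimately show "(LINT x|lborel. h x * indicator (box a b) x * indicator (box a' b') x) = 0" by (simp only:)
    qed
    then show ?thesis by eventually_elim (auto simp: ab)
  qed
  then have "AE x in lborel. \<forall>X\<in>\<D>. x \<in> X \<longrightarrow> h x = 0"
    unfolding AE_ball_countable[OF \<D>(1)] by blast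
  then show ?thesis by eventually_elim (use \<D>(4) in blast)
qed

section \<open>Dilations and the restriction of weak gradients to rays\<close>

lemma nn_integral_lborel_affine:
  fixes f :: "'a::euclidean_space \<Rightarrow> ennreal"
  assumes [measurable]: "f \<in> borel_measurable borel" and s: "0 < s"
  shows "(\<integral>\<^sup>+x. f (t + s *\<^sub>R x) \<partial>lborel) = ennreal (1 / s ^ DIM('a)) * (\<integral>\<^sup>+x. f x \<partial>lborel)"
proof -
  have "(\<integral>\<^sup>+x. f x \<partial>lborel) = (\<integral>\<^sup>+x. f x \<partial>density (distr lborel borel (\<lambda>x. t + s *\<^sub>R x)) (\<lambda>_. \<bar>s\<bar> ^ DIM('a)))"
    using lborel_affine[of s t] s by simp
  also have "\<dots> = ennreal (s ^ DIM('a)) * (\<integral>\<^sup>+x. f (t + s *\<^sub>R x) \<partial>lborel)"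
    using s by (simp add: nn_integral_density nn_integral_distr nn_integral_cmult)
  finally have "ennreal (1 / s ^ DIM('a)) * (\<integral>\<^sup>+x. f x \<partial>lborel) =
    (ennreal (1 / s ^ DIM('a)) * ennreal (s ^ DIM('a))) * (\<integral>\<^sup>+x. f (t + s *\<^sub>R x) \<partial>lborel)"
    by (simp add: mult.assoc)
  also have "ennreal (1 / s ^ DIM('a)) * ennreal (s ^ DIM('a)) = 1"
    using s by (simp flip: ennreal_mult)
  finally show ?thesis by simp
qed

lemma integral_lborel_affine:
  fixes f :: "'a::euclidean_space \<Rightarrow> real"
  assumes [measurable]: "f \<in> borel_measurable borel" and s: "0 < s"
  shows "(LINT x|lborel. f x) = s ^ DIM('a) * (LINT x|lborel. f (t + s *\<^sub>R x))"
proof -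
  have "(LINT x|lborel. f x) = (LINT x|density (distr lborel borel (\<lambda>x. t + s *\<^sub>R x)) (\<lambda>_. \<bar>s\<bar> ^ DIM('a)). f x)"
    using lborel_affine[of s t] s by simp
  also have "\<dots> = s ^ DIM('a) * (LINT x|lborel. f (t + s *\<^sub>R x))"
    using s by (simp add: integral_density integral_distr)
  finally show ?thesis .
qed

lemma integrable_lborel_affine:
  fixes f :: "'a::euclidean_space \<Rightarrow> real"
  assumes f: "integrable lborel f" and s: "0 < s"
  shows "integrable lborel (\<lambda>x. f (t + s *\<^sub>R x))"
proof -
  have [measurable]: "f \<in> borel_measurable borel" using f by auto
  have "(\<integral>\<^sup>+x. ennreal (norm (f (t + s *\<^sub>R x))) \<partial>lborel) = ennreal (1 / s ^ DIM('a)) * (\<integral>\<^sup>+x. ennreal (norm (f x)) \<partial>lborel)"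
    by (rule nn_integral_lborel_affine[OF _ s]) measurable
  also have "\<dots> < \<infinity>" using f unfolding integrable_iff_bounded by (simp add: ennreal_mult_less_top)
  finally show ?thesis unfolding integrable_iff_bounded by simp
qed

text \<open>The i-th component of the radial field \<phi>((y - x0) / s) (y - x0), which extracts the
  radial part of a weak gradient. Star-shapedness keeps the contracted support in \<open>W\<close>
  for all s up to b.\<close>

lemma dilated_test_fun:
  fixes W :: "(real^'n) set"
  assumes t: "test_fun {z. x0 + b *\<^sub>R z \<in> W} \<phi> d\<phi>"
    and star: "\<And>z t. x0 + z \<in> W \<Longrightarrow> 0 \<le> t \<Longrightarrow> t \<le> 1 \<Longrightarrow> x0 + t *\<^sub>R z \<in> W"
    and s: "0 < s" "s \<le> b"
  shows "test_fun W (\<lambda>y. \<phi> ((1 / s) *\<^sub>R (y - x0)) * (y - x0) $ i)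
     (\<lambda>y. ((y - x0) $ i / s) *\<^sub>R d\<phi> ((1 / s) *\<^sub>R (y - x0)) + \<phi> ((1 / s) *\<^sub>R (y - x0)) *\<^sub>R axis i 1)"
proof -
  define Z where "Z y = (1 / s) *\<^sub>R (y - x0)" for y
  have D: "(\<phi> has_derivative (\<lambda>h. d\<phi> x \<bullet> h)) (at x)" and cd: "continuous_on UNIV d\<phi>"
    and co: "compact (closure {x. \<phi> x \<noteq> 0})" and su: "closure {x. \<phi> x \<noteq> 0} \<subseteq> {z. x0 + b *\<^sub>R z \<in> W}" for x
    using t by (auto simp: test_fun_def)
  have c\<phi>: "continuous_on UNIV \<phi>"
    using D by (meson continuous_at_imp_continuous_on has_derivative_continuous)
  have Zc: "continuous_on UNIV Z" unfolding Z_def by (intro continuous_intros)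
  have D1: "((\<lambda>y. \<phi> (Z y) * (y - x0) $ i) has_derivative
      (\<lambda>h. \<phi> (Z y) * h $ i + (d\<phi> (Z y) \<bullet> ((1 / s) *\<^sub>R h)) * (y - x0) $ i)) (at y)" for y
  proof -
    have "(Z has_derivative (\<lambda>h. (1 / s) *\<^sub>R h)) (at y)"
      unfolding Z_def by (auto intro!: derivative_eq_intros)
    then have 1: "((\<lambda>y. \<phi> (Z y)) has_derivative (\<lambda>h. d\<phi> (Z y) \<bullet> ((1 / s) *\<^sub>R h))) (at y)"
      by (rule has_derivative_compose) (rule D)
    have 2: "((\<lambda>y. (y - x0) $ i) has_derivative (\<lambda>h. h $ i)) (at y)"
    proof -
      have "((\<lambda>y. y $ i - x0 $ i) has_derivative (\<lambda>h. h $ i - 0)) (at y)"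
        by (intro has_derivative_diff has_derivative_const bounded_linear_imp_has_derivative bounded_linear_vec_nth)
      then show ?thesis by simp
    qed
    show ?thesis by (rule has_derivative_mult[OF 1 2])
  qed
  show ?thesis
    unfolding test_fun_def Z_def[symmetric]
  proof (intro conjI allI)
    fix y
    show "((\<lambda>y. \<phi> (Z y) * (y - x0) $ i) has_derivative
      (\<lambda>h. (((y - x0) $ i / s) *\<^sub>R d\<phi> (Z y) + \<phi> (Z y) *\<^sub>R axis i 1) \<bullet> h)) (at y)"
      using D1[of y] by (rule has_derivative_eq_rhs)
        (simp add: fun_eq_iff inner_add_left inner_axis' mult_ac add.commute)
  next
    show "continuous_on UNIV (\<lambda>y. ((y - x0) $ i / s) *\<^sub>R d\<phi> (Z y) + \<phi> (Z y) *\<^sub>R axis i 1)"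
      by (intro continuous_intros continuous_on_compose2[OF cd Zc] continuous_on_compose2[OF c\<phi> Zc]) (use s in auto)
  next
    define K where "K = (\<lambda>z. x0 + s *\<^sub>R z) ` closure {x. \<phi> x \<noteq> 0}"
    have K: "compact K" unfolding K_def by (intro compact_continuous_image continuous_intros co)
    have KW: "K \<subseteq> W"
    proof
      fix y assume "y \<in> K"
      then obtain z where z: "z \<in> closure {x. \<phi> x \<noteq> 0}" "y = x0 + s *\<^sub>R z" by (auto simp: K_def)
      then have "x0 + b *\<^sub>R z \<in> W" using su by auto
      from star[OF this, of "s / b"] show "y \<in> W" using s z by simp
    qed
    have sub: "{y. \<phi> (Z y) * (y - x0) $ i \<noteq> 0} \<subseteq> K"
    proof
      fix y assume "y \<in> {y. \<phi> (Z y) * (y - x0) $ i \<noteq> 0}"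
      then have "Z y \<in> closure {x. \<phi> x \<noteq> 0}" using closure_subset by fastforce
      moreover have "y = x0 + s *\<^sub>R Z y" using s by (simp add: Z_def)
      ultimately show "y \<in> K" unfolding K_def by blast
    qed
    then have cl: "closure {y. \<phi> (Z y) * (y - x0) $ i \<noteq> 0} \<subseteq> K"
      by (intro closure_minimal compact_imp_closed K)
    then show "closure {y. \<phi> (Z y) * (y - x0) $ i \<noteq> 0} \<subseteq> W" using KW by blast
    show "compact (closure {y. \<phi> (Z y) * (y - x0) $ i \<noteq> 0})"
      using cl K by (meson bounded_subset closed_closure compact_eq_bounded_closed)
  qed
qed

text \<open>The numerator is the divergence in \<open>w\<close> of the field \<phi>(w / s) w; this
  is what links a derivative in the ray parameter with a test of the weak gradient.\<close>

lemma has_derivative_test_fun_ray: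
  fixes w :: "real^'n"
  assumes D: "\<And>x. (\<phi> has_derivative (\<lambda>h. d\<phi> x \<bullet> h)) (at x)" and s: "0 < s"
  shows "((\<lambda>s. \<phi> ((1 / s) *\<^sub>R w) / s ^ CARD('n)) has_real_derivative
    - (real CARD('n) * \<phi> ((1 / s) *\<^sub>R w) + d\<phi> ((1 / s) *\<^sub>R w) \<bullet> ((1 / s) *\<^sub>R w)) / s ^ (CARD('n) + 1)) (at s)"
proof -
  have "((\<lambda>s. (1 / s) *\<^sub>R w) has_derivative (\<lambda>h. (- h / (s * s)) *\<^sub>R w)) (at s)"
    using s by (auto intro!: derivative_eq_intros simp: divide_simps)
  then have "((\<lambda>s. \<phi> ((1 / s) *\<^sub>R w)) has_derivative (\<lambda>h. d\<phi> ((1 / s) *\<^sub>R w) \<bullet> ((- h / (s * s)) *\<^sub>R w))) (at s)"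
    by (rule has_derivative_compose) (rule D)
  then have 1: "((\<lambda>s. \<phi> ((1 / s) *\<^sub>R w)) has_real_derivative - (d\<phi> ((1 / s) *\<^sub>R w) \<bullet> ((1 / s) *\<^sub>R w)) / s) (at s)"
    unfolding has_field_derivative_def by (rule has_derivative_eq_rhs) (auto simp: fun_eq_iff field_simps)
  have 2: "((\<lambda>s. inverse (s ^ CARD('n))) has_real_derivative - real CARD('n) / s ^ (CARD('n) + 1)) (at s)"
  proof -
    obtain k where k: "CARD('n) = Suc k" using zero_less_card_finite[where 'a='n] gr0_implies_Suc by blast
    have "((\<lambda>s. inverse (s ^ Suc k)) has_real_derivative - (inverse (s ^ Suc k) * (real (Suc k) * s ^ k) * inverse (s ^ Suc k))) (at s)"
      by (rule DERIV_inverse', use DERIV_pow[of "Suc k" s] in simp) (use s in simp)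
    moreover have "- (inverse (s ^ Suc k) * (real (Suc k) * s ^ k) * inverse (s ^ Suc k)) = - real (Suc k) / s ^ (Suc k + 1)"
      using s by (simp add: field_simps)
    ultimately show ?thesis unfolding k by simp
  qed
  have "((\<lambda>s. \<phi> ((1 / s) *\<^sub>R w) * inverse (s ^ CARD('n))) has_real_derivative
     - (d\<phi> ((1 / s) *\<^sub>R w) \<bullet> ((1 / s) *\<^sub>R w)) / s * inverse (s ^ CARD('n)) + - real CARD('n) / s ^ (CARD('n) + 1) * \<phi> ((1 / s) *\<^sub>R w)) (at s)"
    by (rule DERIV_mult[OF 1 2])
  moreover have "- (d\<phi> ((1 / s) *\<^sub>R w) \<bullet> ((1 / s) *\<^sub>R w)) / s * inverse (s ^ CARD('n)) + - real CARD('n) / s ^ (CARD('n) + 1) * \<phi> ((1 / s) *\<^sub>R w)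
    = - (real CARD('n) * \<phi> ((1 / s) *\<^sub>R w) + d\<phi> ((1 / s) *\<^sub>R w) \<bullet> ((1 / s) *\<^sub>R w)) / s ^ (CARD('n) + 1)"
    using s by (simp add: field_simps)
  ultimately show ?thesis unfolding divide_inverse[symmetric] by simp
qed

lemma integrable_lborel_bounded_support:
  fixes f :: "'a::euclidean_space \<Rightarrow> real"
  assumes f: "f \<in> borel_measurable borel" and le: "\<And>x. \<bar>f x\<bar> \<le> C * indicator (cball 0 r) x"
  shows "integrable lborel f"
proof (rule Bochner_Integration.integrable_bound)
  show "integrable lborel (\<lambda>x::'a. C * indicator (cball 0 r) x :: real)"
    using emeasure_lborel_cball_finite[of "0::'a" r] by (intro integrable_mult_right integrable_real_indicator) auto
  show "AE x in lborel. norm (f x) \<le> norm (C * indicator (cball 0 r) x)"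
  proof (rule AE_I2)
    fix x
    show "norm (f x) \<le> norm (C * indicator (cball 0 r) x)"
      using le[of x] abs_ge_self[of "C * indicator (cball 0 r) x"] by simp
  qed
qed (use f in simp)

lemma borel_measurable_vec_nth' [measurable (raw)]:
  fixes f :: "'a \<Rightarrow> real^'n"
  assumes "f \<in> borel_measurable M"
  shows "(\<lambda>x. f x $ i) \<in> borel_measurable M"
  by (rule measurable_compose[OF assms])
    (intro borel_measurable_continuous_onI continuous_intros)

lemma test_fun_bounded:
  assumes t: "test_fun V \<phi> d\<phi>"
  shows "\<exists>C r. (\<forall>x. \<bar>\<phi> x\<bar> \<le> C * indicator (cball 0 r) x) \<and> (\<forall>x. norm (d\<phi> x) \<le> C * indicator (cball 0 r) x) \<and>
    0 \<le> C \<and> 0 < r \<and> continuous_on UNIV \<phi> \<and> continuous_on UNIV d\<phi> \<and> (\<forall>x. x \<notin> V \<longrightarrow> \<phi> x = 0)"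
proof -
  define K where "K = closure {x. \<phi> x \<noteq> 0}"
  have D: "(\<phi> has_derivative (\<lambda>h. d\<phi> x \<bullet> h)) (at x)" and cd: "continuous_on UNIV d\<phi>"
    and co: "compact K" and su: "K \<subseteq> V" for x
    using t by (auto simp: test_fun_def K_def)
  have c\<phi>: "continuous_on UNIV \<phi>"
    using D by (meson continuous_at_imp_continuous_on has_derivative_continuous)
  have out: "\<phi> x = 0" "d\<phi> x = 0" if "x \<notin> K" for x
  proof -
    have z: "\<phi> y = 0" if "y \<in> - K" for y
    proof (rule ccontr)
      assume "\<phi> y \<noteq> 0"
      then have "y \<in> K" using closure_subset[of "{x. \<phi> x \<noteq> 0}"] by (auto simp: K_def)
      then show False using that by simp
    qed
    then show "\<phi> x = 0" using that by simp
    have "((\<lambda>_. 0) has_derivative (\<lambda>h. d\<phi> x \<bullet> h)) (at x)"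
    proof (rule has_derivative_transform_within_open[OF D])
      show "open (- K)" using co by (simp add: compact_imp_closed open_Compl)
    qed (use that z in simp_all)
    moreover have "((\<lambda>_. 0) has_derivative (\<lambda>h. 0 :: real)) (at x)" by (rule has_derivative_const)
    ultimately have "(\<lambda>h. d\<phi> x \<bullet> h) = (\<lambda>h. 0)" by (rule has_derivative_unique)
    then have "d\<phi> x \<bullet> d\<phi> x = 0" by (rule fun_cong)
    then show "d\<phi> x = 0" by simp
  qed
  obtain C1 where C1: "\<And>x. x \<in> K \<Longrightarrow> norm (\<phi> x) \<le> C1"
    using compact_imp_bounded[OF compact_continuous_image[OF continuous_on_subset[OF c\<phi>] co]]
    unfolding bounded_iff by auto
  obtain C2 where C2: "\<And>x. x \<in> K \<Longrightarrow> norm (d\<phi> x) \<le> C2"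
    using compact_imp_bounded[OF compact_continuous_image[OF continuous_on_subset[OF cd] co]]
    unfolding bounded_iff by auto
  obtain r where r: "0 < r" "\<And>x. x \<in> K \<Longrightarrow> norm x \<le> r"
    using compact_imp_bounded[OF co] unfolding bounded_pos by auto
  define C where "C = max 0 (max C1 C2)"
  show ?thesis
  proof (rule exI[of _ C], rule exI[of _ r], intro conjI allI impI)
    show "\<bar>\<phi> x\<bar> \<le> C * indicator (cball 0 r) x" "norm (d\<phi> x) \<le> C * indicator (cball 0 r) x" for x
      using C1[of x] C2[of x] r(2)[of x] out[of x] by (cases "x \<in> K"; simp add: C_def indicator_def)+
    show "\<phi> x = 0" if "x \<notin> V" for x using that su out(1)[of x] by blast
    show "0 \<le> C" by (simp add: C_def)
  qed (fact r(1) c\<phi> cd)+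
qed

text \<open>Testing with all components of the radial field and summing gives its divergence on one
  side and the radial part of \<open>g\<close> on the other.\<close>

lemma weak_ray_identity:
  fixes u :: "real^'n \<Rightarrow> real" and g :: "real^'n \<Rightarrow> real^'n"
  assumes star: "\<And>z t. x0 + z \<in> W \<Longrightarrow> 0 \<le> t \<Longrightarrow> t \<le> 1 \<Longrightarrow> x0 + t *\<^sub>R z \<in> W"
    and u [measurable]: "u \<in> borel_measurable borel" and uB: "\<And>x. \<bar>u x\<bar> \<le> B"
    and g [measurable]: "g \<in> borel_measurable borel" and gi: "integrable lborel (\<lambda>x. norm (g x))"
    and weak: "\<And>\<phi> d\<phi> i. test_fun W \<phi> d\<phi> \<Longrightarrow> (LINT x|lborel. u x * d\<phi> x $ i) = - (LINT x|lborel. g x $ i * \<phi> x)"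
    and t: "test_fun {z. x0 + b *\<^sub>R z \<in> W} \<phi> d\<phi>" and s: "0 < s" "s \<le> b"
  shows "(LINT y|lborel. u y * (real CARD('n) * \<phi> ((1 / s) *\<^sub>R (y - x0)) + d\<phi> ((1 / s) *\<^sub>R (y - x0)) \<bullet> ((1 / s) *\<^sub>R (y - x0))))
    = - (LINT y|lborel. (g y \<bullet> (y - x0)) * \<phi> ((1 / s) *\<^sub>R (y - x0)))"
proof -
  define Z where "Z y = (1 / s) *\<^sub>R (y - x0)" for y
  define f where "f i y = \<phi> (Z y) * (y - x0) $ i" for i y
  define df where "df i y = ((y - x0) $ i / s) *\<^sub>R d\<phi> (Z y) + \<phi> (Z y) *\<^sub>R axis i 1" for i y
  have tf: "test_fun W (f i) (df i)" for i
    using dilated_test_fun[OF t star s, of i] unfolding f_def df_def Z_def .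
  have int1: "integrable lborel (\<lambda>y. u y * df i y $ i)" and int2: "integrable lborel (\<lambda>y. g y $ i * f i y)" for i
  proof -
    obtain C r where C: "\<And>x. \<bar>f i x\<bar> \<le> C * indicator (cball 0 r) x" "\<And>x. norm (df i x) \<le> C * indicator (cball 0 r) x"
      "0 \<le> C" "0 < r" "continuous_on UNIV (f i)" "continuous_on UNIV (df i)"
      using test_fun_bounded[OF tf[of i]] by auto
    have [measurable]: "f i \<in> borel_measurable borel" "df i \<in> borel_measurable borel"
      using C(5,6) by (auto intro: borel_measurable_continuous_onI)
    have B0: "0 \<le> B" using uB[of 0] by linarith
    show "integrable lborel (\<lambda>y. u y * df i y $ i)"
    proof (rule integrable_lborel_bounded_support[where C = "B * C" and r = r])
      show "\<bar>u y * df i y $ i\<bar> \<le> B * C * indicator (cball 0 r) y" for y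
      proof -
        have "\<bar>df i y $ i\<bar> \<le> C * indicator (cball 0 r) y" using C(2)[of y] component_le_norm_cart[of "df i y" i] by linarith
        then have "\<bar>u y\<bar> * \<bar>df i y $ i\<bar> \<le> B * (C * indicator (cball 0 r) y)"
          using uB[of y] B0 by (intro mult_mono) auto
        then show ?thesis by (simp add: abs_mult mult.assoc)
      qed
    qed measurable
    show "integrable lborel (\<lambda>y. g y $ i * f i y)"
    proof (rule Bochner_Integration.integrable_bound[OF integrable_mult_left[OF gi, of C]])
      show "AE y in lborel. norm (g y $ i * f i y) \<le> norm (norm (g y) * C)"
      proof (rule AE_I2)
        fix y
        have "\<bar>f i y\<bar> \<le> C" using C(1)[of y] C(3) by (cases "y \<in> cball 0 r") (auto simp del: mem_cball)
        then have "\<bar>g y $ i\<bar> * \<bar>f i y\<bar> \<le> norm (g y) * C"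
          using component_le_norm_cart[of "g y" i] by (intro mult_mono) auto
        then show "norm (g y $ i * f i y) \<le> norm (norm (g y) * C)" using C(3) by (simp add: abs_mult)
      qed
    qed measurable
  qed
  have "(LINT y|lborel. u y * (real CARD('n) * \<phi> (Z y) + d\<phi> (Z y) \<bullet> Z y)) = (LINT y|lborel. (\<Sum>i\<in>UNIV. u y * df i y $ i))"
  proof (rule Bochner_Integration.integral_cong[OF refl])
    fix y
    have "(\<Sum>i\<in>UNIV. df i y $ i) = (\<Sum>i\<in>UNIV. d\<phi> (Z y) $ i * Z y $ i + \<phi> (Z y))"
      by (intro sum.cong) (auto simp: df_def Z_def)
    also have "\<dots> = real CARD('n) * \<phi> (Z y) + d\<phi> (Z y) \<bullet> Z y"
      by (simp add: sum.distrib inner_vec_def)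
    finally show "u y * (real CARD('n) * \<phi> (Z y) + d\<phi> (Z y) \<bullet> Z y) = (\<Sum>i\<in>UNIV. u y * df i y $ i)"
      by (simp add: sum_distrib_left[symmetric])
  qed
  also have "\<dots> = (\<Sum>i\<in>UNIV. (LINT y|lborel. u y * df i y $ i))"
    by (rule Bochner_Integration.integral_sum) (rule int1)
  also have "\<dots> = (\<Sum>i\<in>UNIV. - (LINT y|lborel. g y $ i * f i y))"
    by (intro sum.cong refl weak tf)
  also have "\<dots> = - (LINT y|lborel. (\<Sum>i\<in>UNIV. g y $ i * f i y))"
    by (subst Bochner_Integration.integral_sum) (auto intro: int2 simp: sum_negf)
  also have "(LINT y|lborel. (\<Sum>i\<in>UNIV. g y $ i * f i y)) = (LINT y|lborel. (g y \<bullet> (y - x0)) * \<phi> (Z y))"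
    by (intro Bochner_Integration.integral_cong refl)
      (simp add: inner_vec_def f_def sum_distrib_left mult_ac)
  finally show ?thesis unfolding Z_def .
qed

text \<open>The difference is tested against \<phi>(z). Substituting y = x0 + s z moves the ray
  parameter from \<open>u\<close>, which need not be differentiable, into the test function, where
  it can be differentiated. The weak identity then replaces the divergence by the radial part of
  \<open>g\<close>, and the substitution is undone. The exceptional set may depend on
  \<open>a\<close> and \<open>b\<close>.\<close>

lemma weak_gradient_along_rays:
  fixes u :: "real^'n \<Rightarrow> real" and g :: "real^'n \<Rightarrow> real^'n"
  assumes W: "open W" "bounded W"
    and star: "\<And>z t. x0 + z \<in> W \<Longrightarrow> 0 \<le> t \<Longrightarrow> t \<le> 1 \<Longrightarrow> x0 + t *\<^sub>R z \<in> W"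
    and u [measurable]: "u \<in> borel_measurable borel" and uB: "\<And>x. \<bar>u x\<bar> \<le> B"
    and g [measurable]: "g \<in> borel_measurable borel" and gi: "integrable lborel (\<lambda>x. norm (g x))"
    and weak: "\<And>\<phi> d\<phi> i. test_fun W \<phi> d\<phi> \<Longrightarrow> (LINT x|lborel. u x * d\<phi> x $ i) = - (LINT x|lborel. g x $ i * \<phi> x)"
    and ab: "0 < a" "a < b"
  shows "AE z in lborel. x0 + b *\<^sub>R z \<in> W \<longrightarrow>
    u (x0 + b *\<^sub>R z) - u (x0 + a *\<^sub>R z) = (LINT s|lborel. indicator {a..b} s * (g (x0 + s *\<^sub>R z) \<bullet> z))"
proof -
  have b: "0 < b" using ab by simp
  have B0: "0 \<le> B" using uB[of 0] by linarith
  \<comment> \<open>For z in \<open>V\<close> the far endpoint lies in \<open>W\<close>, hence by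
    star-shapedness so does the whole segment.\<close>
  define V where "V = {z. x0 + b *\<^sub>R z \<in> W}"
  have V: "open V"
  proof -
    have "V = (\<lambda>z. x0 + b *\<^sub>R z) -` W" by (auto simp: V_def)
    then show ?thesis by (simp only:) (intro open_vimage W(1) continuous_intros)
  qed
  then have [measurable]: "V \<in> sets borel" by simp
  obtain \<rho> where \<rho>: "0 < \<rho>" "\<And>z. z \<in> V \<Longrightarrow> norm z \<le> \<rho>"
  proof -
    obtain r where r: "0 < r" "\<And>x. x \<in> W \<Longrightarrow> norm x \<le> r" using W(2) unfolding bounded_pos by auto
    show ?thesis
    proof (rule that[of "(r + norm x0) / b"])
      show "0 < (r + norm x0) / b" using r b by (simp add: add_pos_nonneg)
      fix z assume "z \<in> V"
      then have "norm (x0 + b *\<^sub>R z) \<le> r" using r(2) by (simp add: V_def)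
      moreover have "norm (b *\<^sub>R z) \<le> norm (x0 + b *\<^sub>R z) + norm x0"
        using norm_triangle_ineq4[of "x0 + b *\<^sub>R z" x0] by simp
      ultimately show "norm z \<le> (r + norm x0) / b" using b by (simp add: field_simps)
    qed
  qed
  define k where "k s z = indicator V z * indicator {a..b} s * (g (x0 + s *\<^sub>R z) \<bullet> z)" for s :: real and z
  have km [measurable]: "(\<lambda>(s, z). k s z) \<in> borel_measurable (borel \<Otimes>\<^sub>M borel)"
    unfolding k_def by measurable
  have kint: "integrable (lborel \<Otimes>\<^sub>M lborel) (\<lambda>(s, z). k s z)"
    unfolding integrable_iff_bounded
  proof
    define N where "N = (\<integral>\<^sup>+x. ennreal (norm (g x)) \<partial>lborel)"
    have N: "N < \<infinity>" using gi unfolding integrable_iff_bounded N_def by simp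
    have "(\<integral>\<^sup>+p. ennreal (norm (case p of (s, z) \<Rightarrow> k s z)) \<partial>(lborel \<Otimes>\<^sub>M lborel))
      = (\<integral>\<^sup>+s. (\<integral>\<^sup>+z. ennreal (norm (k s z)) \<partial>lborel) \<partial>lborel)"
      by (subst lborel.nn_integral_fst[symmetric]) (auto simp: case_prod_beta')
    also have "\<dots> \<le> (\<integral>\<^sup>+s. ennreal (\<rho> / a ^ CARD('n)) * N * indicator {a..b} s \<partial>lborel)"
    proof (rule nn_integral_mono)
      fix s :: real
      show "(\<integral>\<^sup>+z. ennreal (norm (k s z)) \<partial>lborel) \<le> ennreal (\<rho> / a ^ CARD('n)) * N * indicator {a..b} s"
      proof (cases "s \<in> {a..b}")
        case True
        then have s: "0 < s" "a \<le> s" using ab by auto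
        have "(\<integral>\<^sup>+z. ennreal (norm (k s z)) \<partial>lborel) \<le> (\<integral>\<^sup>+z. ennreal \<rho> * ennreal (norm (g (x0 + s *\<^sub>R z))) \<partial>lborel)"
        proof (rule nn_integral_mono)
          fix z
          have "norm (k s z) \<le> \<rho> * norm (g (x0 + s *\<^sub>R z))"
          proof (cases "z \<in> V")
            case True
            have "\<bar>g (x0 + s *\<^sub>R z) \<bullet> z\<bar> \<le> norm (g (x0 + s *\<^sub>R z)) * norm z" by (rule Cauchy_Schwarz_ineq2)
            also have "\<dots> \<le> norm (g (x0 + s *\<^sub>R z)) * \<rho>" using \<rho>(2)[OF True] by (intro mult_left_mono) auto
            finally show ?thesis using True \<open>s \<in> {a..b}\<close> by (simp add: k_def mult.commute)
          next
            case False
            then show ?thesis using \<rho>(1) by (simp add: k_def)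
          qed
          then show "ennreal (norm (k s z)) \<le> ennreal \<rho> * ennreal (norm (g (x0 + s *\<^sub>R z)))"
            using \<rho>(1) by (simp add: ennreal_mult[symmetric] ennreal_leI)
        qed
        also have "\<dots> = ennreal \<rho> * (ennreal (1 / s ^ DIM(real^'n)) * N)"
          unfolding N_def by (subst nn_integral_lborel_affine[OF _ s(1), symmetric]) (auto simp: nn_integral_cmult)
        also have "\<dots> \<le> ennreal \<rho> * (ennreal (1 / a ^ CARD('n)) * N)"
        proof (intro mult_left_mono mult_right_mono ennreal_leI)
          show "1 / s ^ DIM(real^'n) \<le> 1 / a ^ CARD('n)"
            using s ab by (simp add: frac_le power_mono)
        qed auto
        also have "\<dots> = ennreal (\<rho> / a ^ CARD('n)) * N"
          using \<rho> ab by (simp add: mult.assoc[symmetric] ennreal_mult[symmetric])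
        finally show ?thesis using True by simp
      qed (simp add: k_def)
    qed
    also have "\<dots> = ennreal (\<rho> / a ^ CARD('n)) * N * ennreal (b - a)"
      using ab by (subst nn_integral_cmult_indicator) auto
    also have "\<dots> < \<infinity>" using N by (simp add: ennreal_mult_less_top)
    finally show "(\<integral>\<^sup>+p. ennreal (norm (case p of (s, z) \<Rightarrow> k s z)) \<partial>(lborel \<Otimes>\<^sub>M lborel)) < \<infinity>" .
  qed simp
  define J where "J z = (LINT s|lborel. indicator {a..b} s * (g (x0 + s *\<^sub>R z) \<bullet> z))" for z
  have kJ: "(LINT s|lborel. k s z) = indicator V z * J z" for z
    unfolding k_def J_def by (simp add: mult.assoc)
  have Jint: "integrable lborel (\<lambda>z. indicator V z * J z)"
    using lborel_pair.integrable_snd[OF kint] by (simp add: kJ)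
  \<comment> \<open>The defect of the claimed identity; it is integrable and has to vanish against
    all test functions.\<close>
  define h where "h z = indicator V z * (u (x0 + b *\<^sub>R z) - u (x0 + a *\<^sub>R z)) - indicator V z * J z" for z
  have hint: "integrable lborel h"
  proof -
    have "integrable lborel (\<lambda>z. indicator V z * (u (x0 + b *\<^sub>R z) - u (x0 + a *\<^sub>R z)))"
    proof (rule integrable_lborel_bounded_support[where C = "2 * B" and r = \<rho>])
      show "\<bar>indicator V z * (u (x0 + b *\<^sub>R z) - u (x0 + a *\<^sub>R z))\<bar> \<le> 2 * B * indicator (cball 0 \<rho>) z" for z
        using \<rho>(2)[of z] uB[of "x0 + b *\<^sub>R z"] uB[of "x0 + a *\<^sub>R z"] B0 by (auto simp: indicator_def)
    qed measurable
    then show ?thesis unfolding h_def[abs_def] by (intro Bochner_Integration.integrable_diff Jint)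
  qed
  have "AE z in lborel. z \<in> V \<longrightarrow> h z = 0"
  proof (rule fundamental_lemma_calculus_variations[OF V hint])
    fix \<phi> d\<phi> assume t: "test_fun V \<phi> d\<phi>"
    have D: "(\<phi> has_derivative (\<lambda>h. d\<phi> x \<bullet> h)) (at x)" for x using t by (simp add: test_fun_def)
    obtain C r where C: "\<And>x. \<bar>\<phi> x\<bar> \<le> C * indicator (cball 0 r) x" "\<And>x. norm (d\<phi> x) \<le> C * indicator (cball 0 r) x"
      "0 \<le> C" "0 < r" "continuous_on UNIV \<phi>" "continuous_on UNIV d\<phi>" "\<And>x. x \<notin> V \<Longrightarrow> \<phi> x = 0"
      using test_fun_bounded[OF t] by auto
    have [measurable]: "\<phi> \<in> borel_measurable borel" "d\<phi> \<in> borel_measurable borel"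
      using C(5,6) by (auto intro: borel_measurable_continuous_onI)
    have \<phi>C: "\<bar>\<phi> x\<bar> \<le> C" for x using C(1)[of x] C(3) by (cases "x \<in> cball 0 r") (auto simp del: mem_cball)
    have \<phi>V: "indicator V x * \<phi> x = \<phi> x" for x using C(7)[of x] by (cases "x \<in> V") auto
    define \<Psi> where "\<Psi> s y = real CARD('n) * \<phi> ((1 / s) *\<^sub>R (y - x0)) + d\<phi> ((1 / s) *\<^sub>R (y - x0)) \<bullet> ((1 / s) *\<^sub>R (y - x0))" for s y
    have \<Psi>m [measurable]: "(\<lambda>(s, y). \<Psi> s y) \<in> borel_measurable (borel \<Otimes>\<^sub>M borel)"
      unfolding \<Psi>_def by measurable
    \<comment> \<open>The derivative in s of \<phi>((y - x0) / s) / s^n, the factor s^(-n) being the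
      Jacobian of the substitution.\<close>
    define \<kappa> where "\<kappa> s y = - \<Psi> s y / s ^ (CARD('n) + 1)" for s y
    define C' where "C' = (real CARD('n) * C + C * r) / a ^ (CARD('n) + 1)"
    have \<kappa>_bound: "\<bar>\<kappa> s y\<bar> \<le> C' * indicator (cball 0 (norm x0 + b * r)) y" if s: "s \<in> {a..b}" for s y
    proof (cases "norm ((1 / s) *\<^sub>R (y - x0)) \<le> r")
      case True
      have s0: "0 < s" using s ab by auto
      have "\<bar>d\<phi> ((1 / s) *\<^sub>R (y - x0)) \<bullet> ((1 / s) *\<^sub>R (y - x0))\<bar> \<le> norm (d\<phi> ((1 / s) *\<^sub>R (y - x0))) * norm ((1 / s) *\<^sub>R (y - x0))"
        by (rule Cauchy_Schwarz_ineq2)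
      also have "\<dots> \<le> C * r"
      proof (intro mult_mono)
        show "norm (d\<phi> ((1 / s) *\<^sub>R (y - x0))) \<le> C"
          using C(2)[of "(1 / s) *\<^sub>R (y - x0)"] C(3) by (cases "(1 / s) *\<^sub>R (y - x0) \<in> cball 0 r") (auto simp del: mem_cball)
      qed (use True C(3) in auto)
      finally have 2: "\<bar>d\<phi> ((1 / s) *\<^sub>R (y - x0)) \<bullet> ((1 / s) *\<^sub>R (y - x0))\<bar> \<le> C * r" .
      have 3: "\<bar>real CARD('n) * \<phi> ((1 / s) *\<^sub>R (y - x0))\<bar> \<le> real CARD('n) * C"
        using \<phi>C by (simp add: abs_mult mult_left_mono)
      have 1: "\<bar>\<Psi> s y\<bar> \<le> real CARD('n) * C + C * r"
        unfolding \<Psi>_def by (rule order_trans[OF abs_triangle_ineq add_mono[OF 3 2]])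
      have "\<bar>\<kappa> s y\<bar> = \<bar>\<Psi> s y\<bar> / s ^ (CARD('n) + 1)" using s0 by (simp add: \<kappa>_def)
      also have "\<dots> \<le> C'" unfolding C'_def
        using 1 s ab C(3,4) by (intro frac_le power_mono) auto
      finally have "\<bar>\<kappa> s y\<bar> \<le> C'" .
      moreover have "norm y \<le> norm x0 + b * r"
      proof -
        have "norm (y - x0) \<le> r * s" using True s0 unfolding norm_scaleR by (simp add: pos_divide_le_eq)
        also have "\<dots> \<le> r * b" using s C(4) by (intro mult_left_mono) auto
        finally show ?thesis using norm_triangle_sub[of y x0] by (simp add: mult.commute)
      qed
      ultimately show ?thesis by (simp add: indicator_def)
    next
      case False
      then have "\<phi> ((1 / s) *\<^sub>R (y - x0)) = 0" "d\<phi> ((1 / s) *\<^sub>R (y - x0)) = 0"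
        using C(1)[of "(1 / s) *\<^sub>R (y - x0)"] C(2)[of "(1 / s) *\<^sub>R (y - x0)"] by auto
      moreover have "0 \<le> C'" using C(3,4) ab by (simp add: C'_def)
      ultimately show ?thesis by (simp add: \<kappa>_def \<Psi>_def)
    qed
    \<comment> \<open>Afterwards \<open>u\<close> is evaluated at the fixed point y, and the
      dependence on s sits in the smooth factor alone.\<close>
    have dil: "(LINT z|lborel. u (x0 + s *\<^sub>R z) * \<phi> z) = (LINT y|lborel. u y * (\<phi> ((1 / s) *\<^sub>R (y - x0)) / s ^ CARD('n)))" if s: "0 < s" for s
    proof -
      have "(LINT y|lborel. u y * (\<phi> ((1 / s) *\<^sub>R (y - x0)) / s ^ CARD('n)))
        = s ^ DIM(real^'n) * (LINT z|lborel. u (x0 + s *\<^sub>R z) * (\<phi> ((1 / s) *\<^sub>R (x0 + s *\<^sub>R z - x0)) / s ^ CARD('n)))"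
        by (rule integral_lborel_affine[OF _ s]) measurable
      also have "\<dots> = (LINT z|lborel. u (x0 + s *\<^sub>R z) * \<phi> z)"
        using s by simp
      finally show ?thesis by simp
    qed
    have u\<phi>: "integrable lborel (\<lambda>z. u (x0 + s *\<^sub>R z) * \<phi> z)" for s
    proof (rule integrable_lborel_bounded_support[where C = "B * C" and r = r])
      show "\<bar>u (x0 + s *\<^sub>R z) * \<phi> z\<bar> \<le> B * C * indicator (cball 0 r) z" for z
        using mult_mono[OF uB[of "x0 + s *\<^sub>R z"] C(1)[of z] B0] by (simp add: abs_mult mult.assoc)
    qed measurable
    have u\<phi>': "integrable lborel (\<lambda>y. u y * (\<phi> ((1 / s) *\<^sub>R (y - x0)) / s ^ CARD('n)))" if s: "0 < s" for s
    proof -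
      have "integrable lborel (\<lambda>y. u (x0 + s *\<^sub>R ((- (1 / s)) *\<^sub>R x0 + (1 / s) *\<^sub>R y)) * \<phi> ((- (1 / s)) *\<^sub>R x0 + (1 / s) *\<^sub>R y))"
        by (rule integrable_lborel_affine[OF u\<phi>]) (use s in simp)
      then have "integrable lborel (\<lambda>y. u y * \<phi> ((1 / s) *\<^sub>R (y - x0)))"
        using s by (simp add: scaleR_add_right scaleR_diff_right)
      from integrable_divide[OF this, of "s ^ CARD('n)"] show ?thesis by (simp only: times_divide_eq_right)
    qed
    have FTC: "\<phi> ((1 / b) *\<^sub>R (y - x0)) / b ^ CARD('n) - \<phi> ((1 / a) *\<^sub>R (y - x0)) / a ^ CARD('n)
       = (LINT s|lborel. indicator {a..b} s * \<kappa> s y)" for y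
    proof -
      have "(LINT s|lborel. \<kappa> s y * indicator {a..b} s) = \<phi> ((1 / b) *\<^sub>R (y - x0)) / b ^ CARD('n) - \<phi> ((1 / a) *\<^sub>R (y - x0)) / a ^ CARD('n)"
      proof (rule integral_FTC_Icc_real)
        show "a \<le> b" using ab by simp
        fix s assume s: "a \<le> s" "s \<le> b"
        then have s0: "0 < s" using ab by simp
        show "((\<lambda>s. \<phi> ((1 / s) *\<^sub>R (y - x0)) / s ^ CARD('n)) has_real_derivative \<kappa> s y) (at s)"
          using has_derivative_test_fun_ray[OF D s0, of "y - x0"] unfolding \<kappa>_def \<Psi>_def .
        have "isCont (\<lambda>s. (1 / s) *\<^sub>R (y - x0)) s"
          using s0 by (intro continuous_intros) auto
        note c1 = this
        have c2: "isCont \<phi> z" "isCont d\<phi> z" for z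
          using C(5,6) by (simp_all add: continuous_on_eq_continuous_at)
        have "isCont (\<lambda>s. \<phi> ((1 / s) *\<^sub>R (y - x0))) s" "isCont (\<lambda>s. d\<phi> ((1 / s) *\<^sub>R (y - x0))) s"
          by (rule isCont_o2[OF c1 c2(1)], rule isCont_o2[OF c1 c2(2)])
        then show "isCont (\<lambda>s. \<kappa> s y) s"
          unfolding \<kappa>_def \<Psi>_def using s0 by (intro continuous_intros) auto
      qed
      then show ?thesis by (simp add: mult.commute)
    qed
    have kap_int: "integrable (lborel \<Otimes>\<^sub>M lborel) (\<lambda>(s, y). indicator {a..b} s * (u y * \<kappa> s y))"
    proof (rule Bochner_Integration.integrable_bound)
      show "integrable (lborel \<Otimes>\<^sub>M lborel) (\<lambda>p. (B * C') * indicator ({a..b} \<times> cball (0::real^'n) (norm x0 + b * r)) p :: real)"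
      proof (intro integrable_mult_right integrable_real_indicator)
        show "emeasure (lborel \<Otimes>\<^sub>M lborel) ({a..b} \<times> cball (0::real^'n) (norm x0 + b * r)) < \<infinity>"
          using emeasure_lborel_cball_finite[of "0::real^'n" "norm x0 + b * r"] ab
          by (subst lborel.emeasure_pair_measure_Times) (auto simp: ennreal_mult_less_top)
      qed (intro pair_measureI; simp)
      show "AE p in lborel \<Otimes>\<^sub>M lborel. norm (case p of (s, y) \<Rightarrow> indicator {a..b} s * (u y * \<kappa> s y))
        \<le> norm (B * C' * indicator ({a..b} \<times> cball 0 (norm x0 + b * r)) p)"
      proof (rule AE_I2, clarify)
        fix s :: real and y :: "real^'n"
        have "\<bar>u y\<bar> * \<bar>\<kappa> s y\<bar> \<le> B * (C' * indicator (cball 0 (norm x0 + b * r)) y)" if "s \<in> {a..b}"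
          using uB \<kappa>_bound[OF that] B0 by (intro mult_mono) auto
        moreover have "0 \<le> C'" using C(3,4) ab by (simp add: C'_def)
        ultimately show "norm (indicator {a..b} s * (u y * \<kappa> s y)) \<le> norm (B * C' * indicator ({a..b} \<times> cball 0 (norm x0 + b * r)) (s, y))"
          using B0 by (auto simp: indicator_def abs_mult split: if_splits)
      qed
      have "(\<lambda>(s, y). indicator {a..b} s * (u y * \<kappa> s y)) \<in> borel_measurable (borel \<Otimes>\<^sub>M borel)"
        unfolding \<kappa>_def by measurable
      then show "(\<lambda>(s, y). indicator {a..b} s * (u y * \<kappa> s y)) \<in> borel_measurable (lborel \<Otimes>\<^sub>M lborel)" by simp
    qed
    have g\<phi>: "(LINT y|lborel. u y * \<kappa> s y) = (LINT z|lborel. (g (x0 + s *\<^sub>R z) \<bullet> z) * \<phi> z)" if s: "s \<in> {a..b}" for s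
    proof -
      have s0: "0 < s" "s \<le> b" using s ab by auto
      have t': "test_fun {z. x0 + b *\<^sub>R z \<in> W} \<phi> d\<phi>" using t by (simp add: V_def)
      have "(LINT y|lborel. u y * \<kappa> s y) = (LINT y|lborel. (- 1 / s ^ (CARD('n) + 1)) * (u y * \<Psi> s y))"
        by (simp add: \<kappa>_def)
      also have "\<dots> = (- 1 / s ^ (CARD('n) + 1)) * (LINT y|lborel. u y * \<Psi> s y)"
        by (rule integral_mult_right_zero)
      also have "\<dots> = (1 / s ^ (CARD('n) + 1)) * (LINT y|lborel. (g y \<bullet> (y - x0)) * \<phi> ((1 / s) *\<^sub>R (y - x0)))"
        using weak_ray_identity[OF star u uB g gi weak t' s0] unfolding \<Psi>_def by simp
      also have "(LINT y|lborel. (g y \<bullet> (y - x0)) * \<phi> ((1 / s) *\<^sub>R (y - x0)))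
        = s ^ DIM(real^'n) * (LINT z|lborel. (g (x0 + s *\<^sub>R z) \<bullet> (x0 + s *\<^sub>R z - x0)) * \<phi> ((1 / s) *\<^sub>R (x0 + s *\<^sub>R z - x0)))"
        by (rule integral_lborel_affine[OF _ s0(1)]) measurable
      also have "(LINT z|lborel. (g (x0 + s *\<^sub>R z) \<bullet> (x0 + s *\<^sub>R z - x0)) * \<phi> ((1 / s) *\<^sub>R (x0 + s *\<^sub>R z - x0)))
        = s * (LINT z|lborel. (g (x0 + s *\<^sub>R z) \<bullet> z) * \<phi> z)"
        using s0 by (subst integral_mult_right_zero[symmetric]) (simp add: mult.assoc)
      finally show ?thesis using s0 by simp
    qed
    have k\<phi>_int: "integrable (lborel \<Otimes>\<^sub>M lborel) (\<lambda>(s, z). k s z * \<phi> z)"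
    proof (rule Bochner_Integration.integrable_bound[OF integrable_mult_left[OF kint, of C]])
      show "AE p in lborel \<Otimes>\<^sub>M lborel. norm (case p of (s, z) \<Rightarrow> k s z * \<phi> z) \<le> norm ((case p of (s, z) \<Rightarrow> k s z) * C)"
        using \<phi>C C(3) by (intro AE_I2) (auto simp: abs_mult intro!: mult_left_mono)
      have "(\<lambda>(s, z). k s z * \<phi> z) \<in> borel_measurable (borel \<Otimes>\<^sub>M borel)" by measurable
      then show "(\<lambda>(s, z). k s z * \<phi> z) \<in> borel_measurable (lborel \<Otimes>\<^sub>M lborel)" by simp
    qed
    have "(LINT z|lborel. u (x0 + b *\<^sub>R z) * \<phi> z) - (LINT z|lborel. u (x0 + a *\<^sub>R z) * \<phi> z)
      = (LINT y|lborel. u y * (\<phi> ((1 / b) *\<^sub>R (y - x0)) / b ^ CARD('n)) - u y * (\<phi> ((1 / a) *\<^sub>R (y - x0)) / a ^ CARD('n)))"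
      unfolding dil[OF b] dil[OF ab(1)]
      by (rule Bochner_Integration.integral_diff[symmetric]) (intro u\<phi>' b ab(1))+
    also have "\<dots> = (LINT y|lborel. LINT s|lborel. indicator {a..b} s * (u y * \<kappa> s y))"
    proof (rule Bochner_Integration.integral_cong[OF refl])
      fix y
      have "u y * (\<phi> ((1 / b) *\<^sub>R (y - x0)) / b ^ CARD('n)) - u y * (\<phi> ((1 / a) *\<^sub>R (y - x0)) / a ^ CARD('n))
        = u y * (LINT s|lborel. indicator {a..b} s * \<kappa> s y)"
        unfolding FTC[symmetric] by (rule right_diff_distrib[symmetric])
      also have "\<dots> = (LINT s|lborel. u y * (indicator {a..b} s * \<kappa> s y))"
        by (rule integral_mult_right_zero[symmetric])
      finally show "u y * (\<phi> ((1 / b) *\<^sub>R (y - x0)) / b ^ CARD('n)) - u y * (\<phi> ((1 / a) *\<^sub>R (y - x0)) / a ^ CARD('n))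
        = (LINT s|lborel. indicator {a..b} s * (u y * \<kappa> s y))" by (simp add: mult.left_commute)
    qed
    also have "\<dots> = (LINT s|lborel. LINT y|lborel. indicator {a..b} s * (u y * \<kappa> s y))"
      by (rule lborel_pair.Fubini_integral[OF kap_int])
    also have "\<dots> = (LINT s|lborel. LINT z|lborel. k s z * \<phi> z)"
    proof (rule Bochner_Integration.integral_cong[OF refl])
      fix s :: real
      have "(LINT z|lborel. k s z * \<phi> z) = (LINT z|lborel. indicator {a..b} s * ((g (x0 + s *\<^sub>R z) \<bullet> z) * \<phi> z))"
        by (intro Bochner_Integration.integral_cong refl) (use \<phi>V in \<open>simp add: k_def indicator_def split: if_splits\<close>)
      also have "\<dots> = indicator {a..b} s * (LINT z|lborel. (g (x0 + s *\<^sub>R z) \<bullet> z) * \<phi> z)"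
        by (rule integral_mult_right_zero)
      also have "\<dots> = indicator {a..b} s * (LINT y|lborel. u y * \<kappa> s y)"
        using g\<phi>[of s] by (cases "s \<in> {a..b}") auto
      also have "\<dots> = (LINT y|lborel. indicator {a..b} s * (u y * \<kappa> s y))"
        by (rule integral_mult_right_zero[symmetric])
      finally show "(LINT y|lborel. indicator {a..b} s * (u y * \<kappa> s y)) = (LINT z|lborel. k s z * \<phi> z)" by simp
    qed
    also have "\<dots> = (LINT z|lborel. LINT s|lborel. k s z * \<phi> z)"
      by (rule lborel_pair.Fubini_integral[OF k\<phi>_int, symmetric])
    also have "\<dots> = (LINT z|lborel. indicator V z * J z * \<phi> z)"
      by (simp add: kJ)
    finally have main: "(LINT z|lborel. u (x0 + b *\<^sub>R z) * \<phi> z) - (LINT z|lborel. u (x0 + a *\<^sub>R z) * \<phi> z)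
      = (LINT z|lborel. indicator V z * J z * \<phi> z)" .
    have J\<phi>: "integrable lborel (\<lambda>z. indicator V z * J z * \<phi> z)"
    proof (rule Bochner_Integration.integrable_bound[OF integrable_mult_left[OF Jint, of C]])
      show "AE z in lborel. norm (indicator V z * J z * \<phi> z) \<le> norm (indicator V z * J z * C)"
        using \<phi>C C(3) by (intro AE_I2) (auto simp: abs_mult intro!: mult_left_mono)
    qed (use Jint in measurable)
    have "(LINT z|lborel. h z * \<phi> z) = (LINT z|lborel. (u (x0 + b *\<^sub>R z) * \<phi> z - u (x0 + a *\<^sub>R z) * \<phi> z) - indicator V z * J z * \<phi> z)"
    proof (rule Bochner_Integration.integral_cong[OF refl])
      fix z
      have "h z * \<phi> z = (u (x0 + b *\<^sub>R z) - u (x0 + a *\<^sub>R z)) * (indicator V z * \<phi> z) - indicator V z * J z * \<phi> z"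
        by (simp add: h_def algebra_simps)
      then show "h z * \<phi> z = (u (x0 + b *\<^sub>R z) * \<phi> z - u (x0 + a *\<^sub>R z) * \<phi> z) - indicator V z * J z * \<phi> z"
        unfolding \<phi>V by (simp add: left_diff_distrib)
    qed
    also have "\<dots> = (LINT z|lborel. u (x0 + b *\<^sub>R z) * \<phi> z - u (x0 + a *\<^sub>R z) * \<phi> z) - (LINT z|lborel. indicator V z * J z * \<phi> z)"
      by (intro Bochner_Integration.integral_diff Bochner_Integration.integrable_diff u\<phi> J\<phi>)
    also have "(LINT z|lborel. u (x0 + b *\<^sub>R z) * \<phi> z - u (x0 + a *\<^sub>R z) * \<phi> z) = (LINT z|lborel. indicator V z * J z * \<phi> z)"
      unfolding main[symmetric] by (intro Bochner_Integration.integral_diff u\<phi>)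
    finally show "(LINT z|lborel. h z * \<phi> z) = 0" by simp
  qed
  then show ?thesis
    by eventually_elim (auto simp: V_def h_def J_def)
qed

section \<open>Approximation of one-dimensional profiles\<close>

text \<open>The tangent line of the convex function x^p at m, rearranged without subtraction so that
  it can be integrated with values in \<open>ennreal\<close>.\<close>

lemma powr_tangent:
  fixes x m p :: real
  assumes p: "1 \<le> p" and x: "0 \<le> x" and m: "0 < m"
  shows "m powr p + p * m powr (p - 1) * x \<le> x powr p + p * m powr p"
proof (cases "x = 0")
  case True
  then show ?thesis using p m by (simp add: mult_right_mono)
next
  case False
  then have x: "0 < x" using x by simp
  have "x powr p - m powr p \<ge> (p * m powr (p - 1)) * (x - m)"
  proof (rule convex_on_imp_above_tangent[where A = "{0<..}"])
    show "convex_on {0<..} (\<lambda>x. x powr p)" by (rule powr_convex[OF p])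
    have "((\<lambda>x. x powr p) has_real_derivative p * m powr (p - 1)) (at m)"
      using m by (auto intro!: derivative_eq_intros)
    then show "((\<lambda>x. x powr p) has_real_derivative p * m powr (p - 1)) (at m within {0<..})"
      by (rule DERIV_subset) simp
  qed (use x m in \<open>auto simp: interior_open\<close>)
  moreover have "m powr (p - 1) * m = m powr p"
    using m powr_add[of m "p - 1" 1] by simp
  then have "p * m powr (p - 1) * m = p * m powr p" by simp
  ultimately show ?thesis by (simp add: right_diff_distrib)
qed

text \<open>The tangent inequality, taken at the mean of |h|, is integrated over the interval. The
  right-hand side may be infinite.\<close>

lemma jensen_interval:
  fixes h :: "real \<Rightarrow> real"
  assumes p: "1 \<le> p" and e: "0 < e"
    and h: "integrable lborel (\<lambda>t. indicator {a..a + e} t * h t)"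
  shows "ennreal (\<bar>(LINT t|lborel. indicator {a..a + e} t * h t) / e\<bar> powr p)
     \<le> (\<integral>\<^sup>+t. ennreal (1 / e * \<bar>h t\<bar> powr p) * indicator {a..a + e} t \<partial>lborel)"
proof -
  let ?I = "{a..a + e}"
  define m where "m = (LINT t|lborel. indicator ?I t * \<bar>h t\<bar>) / e"
  have hm [measurable]: "(\<lambda>t. indicator ?I t * h t) \<in> borel_measurable borel" using h by auto
  have abs_h: "\<bar>indicator ?I t * h t\<bar> = indicator ?I t * \<bar>h t\<bar>" for t by (simp add: abs_mult)
  have habs: "integrable lborel (\<lambda>t. indicator ?I t * \<bar>h t\<bar>)"
    using integrable_abs[OF h] unfolding abs_h .
  have "\<bar>LINT t|lborel. indicator ?I t * h t\<bar> \<le> (LINT t|lborel. \<bar>indicator ?I t * h t\<bar>)"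
    by (rule integral_abs_bound)
  then have "\<bar>(LINT t|lborel. indicator ?I t * h t) / e\<bar> \<le> m"
    unfolding abs_h m_def using e by (simp add: divide_right_mono)
  then have le: "\<bar>(LINT t|lborel. indicator ?I t * h t) / e\<bar> powr p \<le> m powr p"
    using p by (intro powr_mono2) auto
  have m0: "0 \<le> m" unfolding m_def using e by (intro divide_nonneg_pos integral_nonneg_AE) auto
  define X where "X = (\<integral>\<^sup>+t. ennreal (\<bar>h t\<bar> powr p) * indicator ?I t \<partial>lborel)"
  have pm [measurable]: "(\<lambda>t. ennreal (\<bar>h t\<bar> powr p) * indicator ?I t) \<in> borel_measurable borel"
  proof -
    have "(\<lambda>t. ennreal (\<bar>indicator ?I t * h t\<bar> powr p) * indicator ?I t) \<in> borel_measurable borel" by measurable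
    moreover have "(\<lambda>t. ennreal (\<bar>indicator ?I t * h t\<bar> powr p) * indicator ?I t) = (\<lambda>t. ennreal (\<bar>h t\<bar> powr p) * indicator ?I t)"
      by (auto simp: fun_eq_iff indicator_def)
    ultimately show ?thesis by simp
  qed
  have "ennreal (e * m powr p) \<le> X"
  proof (cases "m = 0")
    case False
    then have m: "0 < m" using m0 by simp
    have "(\<integral>\<^sup>+t. ennreal (m powr p * indicator ?I t + p * m powr (p - 1) * (indicator ?I t * \<bar>h t\<bar>)) \<partial>lborel)
      \<le> (\<integral>\<^sup>+t. ennreal (\<bar>h t\<bar> powr p) * indicator ?I t + ennreal (p * m powr p) * indicator ?I t \<partial>lborel)"
    proof (rule nn_integral_mono)
      fix t
      show "ennreal (m powr p * indicator ?I t + p * m powr (p - 1) * (indicator ?I t * \<bar>h t\<bar>))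
        \<le> ennreal (\<bar>h t\<bar> powr p) * indicator ?I t + ennreal (p * m powr p) * indicator ?I t"
        using powr_tangent[OF p abs_ge_zero m, of "h t"] p m
        by (cases "t \<in> ?I") (auto simp flip: ennreal_plus intro!: ennreal_leI)
    qed
    also have "\<dots> = X + ennreal (p * m powr p) * ennreal e"
      unfolding X_def using e by (subst nn_integral_add) (auto simp: nn_integral_cmult_indicator)
    also have "ennreal (p * m powr p) * ennreal e = ennreal (p * m powr p * e)"
      using e p m by (simp add: ennreal_mult)
    also have "(\<integral>\<^sup>+t. ennreal (m powr p * indicator ?I t + p * m powr (p - 1) * (indicator ?I t * \<bar>h t\<bar>)) \<partial>lborel)
      = ennreal (LINT t|lborel. m powr p * indicator ?I t + p * m powr (p - 1) * (indicator ?I t * \<bar>h t\<bar>))"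
      using habs p m e
      by (intro nn_integral_eq_integral Bochner_Integration.integrable_add integrable_mult_right integrable_real_indicator)
        (auto intro!: AE_I2 add_nonneg_nonneg)
    also have "(LINT t|lborel. m powr p * indicator ?I t + p * m powr (p - 1) * (indicator ?I t * \<bar>h t\<bar>))
       = m powr p * e + p * m powr (p - 1) * (e * m)"
      using habs e unfolding m_def
      by (subst Bochner_Integration.integral_add) (auto intro!: integrable_mult_right integrable_real_indicator)
    also have "p * m powr (p - 1) * (e * m) = p * m powr p * e"
    proof -
      have "m powr (p - 1) * m = m powr p" using m powr_add[of m "p - 1" 1] by simp
      then show ?thesis by (metis mult.assoc mult.commute)
    qed
    finally have "ennreal (m powr p * e) + ennreal (p * m powr p * e) \<le> X + ennreal (p * m powr p * e)"
      using p m e by (simp add: ennreal_plus)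
    then have "ennreal (p * m powr p * e) + ennreal (m powr p * e) \<le> ennreal (p * m powr p * e) + X"
      by (simp only: add.commute)
    then show ?thesis by (simp add: mult.commute[of e])
  qed simp
  then have "ennreal (1 / e) * ennreal (e * m powr p) \<le> ennreal (1 / e) * X"
    by (intro mult_left_mono) auto
  also have "ennreal (1 / e) * ennreal (e * m powr p) = ennreal (m powr p)"
    using e by (simp flip: ennreal_mult)
  also have "ennreal (1 / e) * X = (\<integral>\<^sup>+t. ennreal (1 / e * \<bar>h t\<bar> powr p) * indicator ?I t \<partial>lborel)"
  proof -
    have "ennreal (1 / e) * (ennreal (\<bar>h t\<bar> powr p) * indicator ?I t) = ennreal (1 / e * \<bar>h t\<bar> powr p) * indicator ?I t" for t
      using e by (subst ennreal_mult') (auto simp: mult.assoc)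
    then show ?thesis unfolding X_def by (subst nn_integral_cmult[symmetric]) auto
  qed
  finally show ?thesis using le by (meson ennreal_leI order_trans)
qed

lemma integrable_of_powr_integrable:
  fixes h :: "real \<Rightarrow> real"
  assumes [measurable]: "h \<in> borel_measurable borel" "A \<in> sets borel" and p: "1 \<le> p"
    and A: "emeasure lborel A < \<infinity>" and fin: "(\<integral>\<^sup>+t. ennreal (\<bar>h t\<bar> powr p) * indicator A t \<partial>lborel) < \<infinity>"
  shows "integrable lborel (\<lambda>t. indicator A t * h t)"
  unfolding integrable_iff_bounded
proof
  have "(\<integral>\<^sup>+t. ennreal (norm (indicator A t * h t)) \<partial>lborel) \<le> (\<integral>\<^sup>+t. indicator A t + ennreal (\<bar>h t\<bar> powr p) * indicator A t \<partial>lborel)"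
  proof (rule nn_integral_mono)
    fix t
    have "\<bar>h t\<bar> \<le> 1 + \<bar>h t\<bar> powr p"
    proof (cases "\<bar>h t\<bar> \<le> 1")
      case False
      then have "\<bar>h t\<bar> powr 1 \<le> \<bar>h t\<bar> powr p" using p by (intro powr_mono) auto
      then show ?thesis using False by simp
    qed (simp add: add_increasing2)
    then have "ennreal \<bar>h t\<bar> \<le> ennreal (1 + \<bar>h t\<bar> powr p)" by (rule ennreal_leI)
    then show "ennreal (norm (indicator A t * h t)) \<le> indicator A t + ennreal (\<bar>h t\<bar> powr p) * indicator A t"
      by (cases "t \<in> A") auto
  qed
  also have "\<dots> < \<infinity>" using A fin by (subst nn_integral_add) auto
  finally show "(\<integral>\<^sup>+t. ennreal (norm (indicator A t * h t)) \<partial>lborel) < \<infinity>" .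
qed measurable

text \<open>The derivative of a forward average at \<open>\<sigma>\<close> is an average of \<open>h\<close> over \<open>[\<sigma>, \<sigma> + e]\<close>.  Since
  the weight \<open>s\<^sup>k\<close> is nondecreasing, such averaging does not increase the weighted energy.\<close>

lemma forward_average_energy_le:
  fixes h :: "real \<Rightarrow> real"
  assumes [measurable]: "h \<in> borel_measurable borel" and p: "1 \<le> p" and e: "0 < e"
    and h: "\<And>\<sigma>. integrable lborel (\<lambda>t. indicator {\<sigma>..\<sigma> + e} t * h t)"
    and supp: "\<And>t. t \<le> 0 \<or> 1 \<le> t \<Longrightarrow> h t = 0"
  shows "(\<integral>\<^sup>+\<sigma>. ennreal (\<sigma> ^ k * \<bar>(LINT t|lborel. indicator {\<sigma>..\<sigma> + e} t * h t) / e\<bar> powr p) * indicator {0<..<1} \<sigma> \<partial>lborel)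
    \<le> (\<integral>\<^sup>+t. ennreal (t ^ k * \<bar>h t\<bar> powr p) * indicator {0<..<1} t \<partial>lborel)"
proof -
  have "(\<integral>\<^sup>+\<sigma>. ennreal (\<sigma> ^ k * \<bar>(LINT t|lborel. indicator {\<sigma>..\<sigma> + e} t * h t) / e\<bar> powr p) * indicator {0<..<1} \<sigma> \<partial>lborel)
    \<le> (\<integral>\<^sup>+\<sigma>. (\<integral>\<^sup>+t. ennreal (\<sigma> ^ k) * indicator {0<..<1} \<sigma> * (ennreal (1 / e * \<bar>h t\<bar> powr p) * indicator {\<sigma>..\<sigma> + e} t) \<partial>lborel) \<partial>lborel)"
  proof (rule nn_integral_mono)
    fix \<sigma> :: real
    show "ennreal (\<sigma> ^ k * \<bar>(LINT t|lborel. indicator {\<sigma>..\<sigma> + e} t * h t) / e\<bar> powr p) * indicator {0<..<1} \<sigma>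
      \<le> (\<integral>\<^sup>+t. ennreal (\<sigma> ^ k) * indicator {0<..<1} \<sigma> * (ennreal (1 / e * \<bar>h t\<bar> powr p) * indicator {\<sigma>..\<sigma> + e} t) \<partial>lborel)"
    proof (cases "\<sigma> \<in> {0<..<1}")
      case True
      have "ennreal (\<sigma> ^ k * \<bar>(LINT t|lborel. indicator {\<sigma>..\<sigma> + e} t * h t) / e\<bar> powr p)
        = ennreal (\<sigma> ^ k) * ennreal (\<bar>(LINT t|lborel. indicator {\<sigma>..\<sigma> + e} t * h t) / e\<bar> powr p)"
        using True by (intro ennreal_mult) auto
      also have "\<dots> \<le> ennreal (\<sigma> ^ k) * (\<integral>\<^sup>+t. ennreal (1 / e * \<bar>h t\<bar> powr p) * indicator {\<sigma>..\<sigma> + e} t \<partial>lborel)"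
        by (intro mult_left_mono jensen_interval p e h) simp
      also have "\<dots> = (\<integral>\<^sup>+t. ennreal (\<sigma> ^ k) * (ennreal (1 / e * \<bar>h t\<bar> powr p) * indicator {\<sigma>..\<sigma> + e} t) \<partial>lborel)"
        by (rule nn_integral_cmult[symmetric]) measurable
      finally show ?thesis using True by simp
    qed simp
  qed
  also have "\<dots> = (\<integral>\<^sup>+t. (\<integral>\<^sup>+\<sigma>. ennreal (\<sigma> ^ k) * indicator {0<..<1} \<sigma> * (ennreal (1 / e * \<bar>h t\<bar> powr p) * indicator {\<sigma>..\<sigma> + e} t) \<partial>lborel) \<partial>lborel)"
  proof (rule lborel_pair.Fubini')
    have "(\<lambda>(t, \<sigma>). indicator {x :: real \<times> real. snd x \<le> fst x \<and> fst x \<le> snd x + e} (t, \<sigma>) :: ennreal) \<in> borel_measurable (borel \<Otimes>\<^sub>M borel)"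
      by measurable
    then have [measurable]: "(\<lambda>(t, \<sigma>). indicator {\<sigma>..\<sigma> + e} t :: ennreal) \<in> borel_measurable (borel \<Otimes>\<^sub>M borel)"
      by (simp add: indicator_def case_prod_beta')
    show "(\<lambda>(t, \<sigma>). ennreal (\<sigma> ^ k) * indicator {0<..<1} \<sigma> * (ennreal (1 / e * \<bar>h t\<bar> powr p) * indicator {\<sigma>..\<sigma> + e} t))
        \<in> borel_measurable (lborel \<Otimes>\<^sub>M lborel)"
      by measurable
  qed
  also have "\<dots> \<le> (\<integral>\<^sup>+t. ennreal (t ^ k * \<bar>h t\<bar> powr p) * indicator {0<..<1} t \<partial>lborel)"
  proof (rule nn_integral_mono)
    fix t :: real
    show "(\<integral>\<^sup>+\<sigma>. ennreal (\<sigma> ^ k) * indicator {0<..<1} \<sigma> * (ennreal (1 / e * \<bar>h t\<bar> powr p) * indicator {\<sigma>..\<sigma> + e} t) \<partial>lborel)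
      \<le> ennreal (t ^ k * \<bar>h t\<bar> powr p) * indicator {0<..<1} t"
    proof (cases "t \<in> {0<..<1}")
      case True
      have "(\<integral>\<^sup>+\<sigma>. ennreal (\<sigma> ^ k) * indicator {0<..<1} \<sigma> * (ennreal (1 / e * \<bar>h t\<bar> powr p) * indicator {\<sigma>..\<sigma> + e} t) \<partial>lborel)
        \<le> (\<integral>\<^sup>+\<sigma>. ennreal (t ^ k * (1 / e * \<bar>h t\<bar> powr p)) * indicator {t - e..t} \<sigma> \<partial>lborel)"
      proof (rule nn_integral_mono)
        fix \<sigma> :: real
        show "ennreal (\<sigma> ^ k) * indicator {0<..<1} \<sigma> * (ennreal (1 / e * \<bar>h t\<bar> powr p) * indicator {\<sigma>..\<sigma> + e} t)
          \<le> ennreal (t ^ k * (1 / e * \<bar>h t\<bar> powr p)) * indicator {t - e..t} \<sigma>"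
        proof (cases "\<sigma> \<in> {0<..<1} \<and> t \<in> {\<sigma>..\<sigma> + e}")
          case True
          then have "\<sigma> ^ k \<le> t ^ k" by (intro power_mono) auto
          then have "\<sigma> ^ k * (1 / e * \<bar>h t\<bar> powr p) \<le> t ^ k * (1 / e * \<bar>h t\<bar> powr p)"
            using e by (intro mult_right_mono) auto
          moreover have "ennreal (\<sigma> ^ k) * ennreal (1 / e * \<bar>h t\<bar> powr p) = ennreal (\<sigma> ^ k * (1 / e * \<bar>h t\<bar> powr p))"
            using e True by (intro ennreal_mult[symmetric]) auto
          ultimately show ?thesis using True by (auto simp: ennreal_leI)
        qed auto
      qed
      also have "\<dots> = ennreal (t ^ k * (1 / e * \<bar>h t\<bar> powr p)) * ennreal e"
        using e by (subst nn_integral_cmult_indicator) auto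
      also have "\<dots> = ennreal (t ^ k * \<bar>h t\<bar> powr p)"
        using e True by (subst ennreal_mult[symmetric]) auto
      finally show ?thesis using True by simp
    next
      case False
      then have "h t = 0" by (intro supp) auto
      then show ?thesis by simp
    qed
  qed
  finally show ?thesis .
qed

lemma isCont_indefinite_integral:
  fixes h :: "real \<Rightarrow> real"
  assumes h: "integrable lborel h"
  shows "isCont (\<lambda>x. LINT t|lborel. indicator {..x} t * h t) x"
  unfolding continuous_at_sequentially comp_def
proof (intro allI impI)
  fix X :: "nat \<Rightarrow> real" assume X: "X \<longlonglongrightarrow> x"
  have [measurable]: "h \<in> borel_measurable borel" using h by auto
  show "(\<lambda>n. LINT t|lborel. indicator {..X n} t * h t) \<longlonglongrightarrow> (LINT t|lborel. indicator {..x} t * h t)"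
  proof (rule integral_dominated_convergence[where w = "\<lambda>t. norm (h t)"])
    have "AE t in lborel. t \<noteq> x" by (rule AE_lborel_singleton)
    then show "AE t in lborel. (\<lambda>n. indicator {..X n} t * h t) \<longlonglongrightarrow> indicator {..x} t * h t"
    proof eventually_elim
      fix t assume "t \<noteq> x"
      then consider "t < x" | "x < t" by linarith
      then have "\<forall>\<^sub>F n in sequentially. indicator {..X n} t = (indicator {..x} t :: real)"
      proof cases
        case 1
        then show ?thesis using order_tendstoD(1)[OF X 1] by (auto elim!: eventually_mono)
      next
        case 2
        then show ?thesis using order_tendstoD(2)[OF X 2] by (auto elim!: eventually_mono)
      qed
      then have "\<forall>\<^sub>F n in sequentially. indicator {..X n} t * h t = indicator {..x} t * h t"
        by eventually_elim simp
      then show "(\<lambda>n. indicator {..X n} t * h t) \<longlonglongrightarrow> indicator {..x} t * h t"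
        by (rule tendsto_eventually)
    qed
    show "AE t in lborel. norm (indicator {..X n} t * h t) \<le> norm (h t)" for n
      by (intro AE_I2) (auto simp: indicator_def)
  qed (use h in auto)
qed

text \<open>The weight t^k may vanish at 0, so the energy controls \<open>h\<close> only on
  intervals bounded away from 0.\<close>

lemma powr_energy_integrable:
  fixes h :: "real \<Rightarrow> real"
  assumes [measurable]: "h \<in> borel_measurable borel" and p: "1 \<le> p" and \<delta>: "0 < \<delta>"
    and E: "(\<integral>\<^sup>+t. ennreal (t ^ k * \<bar>h t\<bar> powr p) * indicator {0<..<1} t \<partial>lborel) < \<infinity>"
  shows "integrable lborel (\<lambda>t. indicator {\<delta><..<1} t * h t)"
proof (rule integrable_of_powr_integrable[OF _ _ p])
  have "(\<integral>\<^sup>+t. ennreal (\<bar>h t\<bar> powr p) * indicator {\<delta><..<1} t \<partial>lborel)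
    \<le> (\<integral>\<^sup>+t. ennreal (1 / \<delta> ^ k) * (ennreal (t ^ k * \<bar>h t\<bar> powr p) * indicator {0<..<1} t) \<partial>lborel)"
  proof (rule nn_integral_mono)
    fix t
    show "ennreal (\<bar>h t\<bar> powr p) * indicator {\<delta><..<1} t \<le> ennreal (1 / \<delta> ^ k) * (ennreal (t ^ k * \<bar>h t\<bar> powr p) * indicator {0<..<1} t)"
    proof (cases "t \<in> {\<delta><..<1}")
      case True
      then have "1 \<le> 1 / \<delta> ^ k * t ^ k" using \<delta> by (simp add: power_mono)
      then have "1 * \<bar>h t\<bar> powr p \<le> (1 / \<delta> ^ k * t ^ k) * \<bar>h t\<bar> powr p" by (rule mult_right_mono) simp
      then have "ennreal (\<bar>h t\<bar> powr p) \<le> ennreal (1 / \<delta> ^ k * (t ^ k * \<bar>h t\<bar> powr p))"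
        by (intro ennreal_leI) (simp add: mult.assoc)
      also have "\<dots> = ennreal (1 / \<delta> ^ k) * ennreal (t ^ k * \<bar>h t\<bar> powr p)"
        using \<delta> True by (intro ennreal_mult) auto
      finally show ?thesis using True \<delta> by simp
    qed simp
  qed
  also have "\<dots> < \<infinity>" using E by (simp add: nn_integral_cmult ennreal_mult_less_top)
  finally show "(\<integral>\<^sup>+t. ennreal (\<bar>h t\<bar> powr p) * indicator {\<delta><..<1} t \<partial>lborel) < \<infinity>" .
  have "emeasure lborel {\<delta><..<1} \<le> emeasure lborel {\<delta>..1}"
    by (intro emeasure_mono) auto
  also have "\<dots> < \<infinity>" by (simp add: emeasure_lborel_Icc_eq)
  finally show "emeasure lborel {\<delta><..<1} < \<infinity>" .
qed auto

lemma smooth_profile_step: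
  fixes w h :: "real \<Rightarrow> real"
  assumes w: "continuous_on {0..1} w" and hm [measurable]: "h \<in> borel_measurable borel" and p: "1 \<le> p"
    and E: "(\<integral>\<^sup>+t. ennreal (t ^ k * \<bar>h t\<bar> powr p) * indicator {0<..<1} t \<partial>lborel) < \<infinity>"
    and Q: "closure Q = UNIV"
    and ftc: "\<And>a b. a \<in> Q \<Longrightarrow> b \<in> Q \<Longrightarrow> 0 < a \<Longrightarrow> a < b \<Longrightarrow> b < 1 \<Longrightarrow>
      w b - w a = (LINT t|lborel. indicator {a..b} t * h t)"
    and \<delta>: "0 < \<delta>" "\<delta> < 1"
  shows "\<exists>W W'. (\<forall>s\<in>{-1<..<2}. (W has_real_derivative W' s) (at s)) \<and> continuous_on UNIV W' \<and>
    (\<forall>s\<in>{-1<..\<delta>/2}. W s = w \<delta> \<and> W' s = 0) \<and> W 1 = w 1 \<and>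
    (\<forall>s\<in>{0..1}. \<exists>\<xi>\<in>{s..s + \<delta>}. W s = w (max \<delta> (min 1 \<xi>))) \<and>
    (\<integral>\<^sup>+t. ennreal (t ^ k * \<bar>W' t\<bar> powr p) * indicator {0<..<1} t \<partial>lborel)
      \<le> (\<integral>\<^sup>+t. ennreal (t ^ k * \<bar>h t\<bar> powr p) * indicator {0<..<1} t \<partial>lborel)"
proof -
  define hc where "hc t = indicator {\<delta><..<1} t * h t" for t
  have hcm [measurable]: "hc \<in> borel_measurable borel" unfolding hc_def by measurable
  have hci: "integrable lborel hc"
    unfolding hc_def[abs_def] by (rule powr_energy_integrable[OF hm p \<delta>(1) E])
  define wc where "wc t = w (max \<delta> (min 1 t))" for t
  have wc_cont: "continuous_on S wc" for S
    unfolding wc_def[abs_def]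
    by (rule continuous_on_compose2[OF w]) (use \<delta> in \<open>auto intro!: continuous_intros\<close>)
  define H where "H x = (LINT t|lborel. indicator {..x} t * hc t)" for x
  have Hcont: "continuous_on S H" for S
    unfolding H_def[abs_def] by (intro continuous_at_imp_continuous_on ballI isCont_indefinite_integral hci)
  have Hint: "integrable lborel (\<lambda>t. indicator A t * hc t)" if "A \<in> sets borel" for A
    using integrable_real_mult_indicator[OF _ hci, of A] that by (simp add: mult.commute)
  have cl: "closure ({\<delta><..<1} \<inter> Q) = {\<delta>..1}"
    using closure_open_Int_superset[of "{\<delta><..<1}" Q] \<delta> Q by simp
  have cont: "continuous_on (closure ({\<delta><..<1} \<inter> Q)) (\<lambda>x. w x - H x)"
    unfolding cl using \<delta> by (intro continuous_on_diff Hcont continuous_on_subset[OF w]) auto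
  have H\<delta>: "H x = 0" if "x \<le> \<delta>" for x
  proof -
    have "(\<lambda>t. indicator {..x} t * hc t) = (\<lambda>t. 0)"
      using that by (auto simp: fun_eq_iff hc_def indicator_def)
    then show ?thesis by (simp add: H_def)
  qed
  have step: "w y - w x = H y - H x" if xy: "x \<in> {\<delta><..<1} \<inter> Q" "y \<in> {\<delta><..<1} \<inter> Q" "x < y" for x y
  proof -
    have "w y - w x = (LINT t|lborel. indicator {x..y} t * h t)"
      using xy \<delta> by (intro ftc) auto
    also have "\<dots> = (LINT t|lborel. indicator {..y} t * hc t - indicator {..x} t * hc t)"
    proof (rule integral_cong_AE)
      have "AE t in lborel. t \<noteq> x" by (rule AE_lborel_singleton)
      then show "AE t in lborel. indicator {x..y} t * h t = indicator {..y} t * hc t - indicator {..x} t * hc t"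
        by eventually_elim (use xy in \<open>auto simp: hc_def indicator_def\<close>)
    qed measurable
    also have "\<dots> = H y - H x"
      unfolding H_def by (intro Bochner_Integration.integral_diff Hint) auto
    finally show ?thesis .
  qed
  have "{\<delta><..<1} \<inter> Q \<noteq> {}" using cl \<delta> by auto
  then obtain q where q: "q \<in> {\<delta><..<1} \<inter> Q" by blast
  \<comment> \<open>The integral formula is known for endpoints in the dense set only; continuity of
    both functions extends it to all of [\<delta>, 1].\<close>
  have const: "w x - H x = w q - H q" if x: "x \<in> closure ({\<delta><..<1} \<inter> Q)" for x
  proof (rule continuous_constant_on_closure[OF cont _ x])
    fix x assume x: "x \<in> {\<delta><..<1} \<inter> Q"
    consider "x < q" | "x = q" | "q < x" by linarith
    then show "w x - H x = w q - H q"
      using step[OF x q] step[OF q x] by cases auto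
  qed
  have wH: "wc x = w \<delta> + H x" for x
  proof -
    have in01: "w x - H x = w \<delta>" if x: "x \<in> {\<delta>..1}" for x
    proof -
      have "w x - H x = w \<delta> - H \<delta>" using const[of x] const[of \<delta>] x \<delta> unfolding cl by simp
      then show ?thesis using H\<delta>[of \<delta>] by simp
    qed
    consider "x \<le> \<delta>" | "\<delta> \<le> x" "x \<le> 1" | "1 \<le> x" by linarith
    then show ?thesis
    proof cases
      case 1
      then have "H x = 0" by (rule H\<delta>)
      then show ?thesis using 1 \<delta> by (simp add: wc_def)
    next
      case 2
      then show ?thesis using in01[of x] \<delta> by (simp add: wc_def)
    next
      case 3
      have "(\<lambda>t. indicator {..x} t * hc t) = (\<lambda>t. indicator {..1} t * hc t)"
        using 3 by (auto simp: fun_eq_iff hc_def indicator_def)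
      then have "H x = H 1" by (simp add: H_def)
      then show ?thesis using in01[of 1] 3 \<delta> by (simp add: wc_def)
    qed
  qed
  have wdiff: "wc b - wc a = (LINT t|lborel. indicator {a..b} t * hc t)" if "a \<le> b" for a b
  proof -
    have "wc b - wc a = H b - H a" by (simp add: wH)
    also have "\<dots> = (LINT t|lborel. indicator {..b} t * hc t - indicator {..a} t * hc t)"
      unfolding H_def by (intro Bochner_Integration.integral_diff[symmetric] Hint) auto
    also have "\<dots> = (LINT t|lborel. indicator {a..b} t * hc t)"
    proof (rule integral_cong_AE)
      have "AE t in lborel. t \<noteq> a" by (rule AE_lborel_singleton)
      then show "AE t in lborel. indicator {..b} t * hc t - indicator {..a} t * hc t = indicator {a..b} t * hc t"
        by eventually_elim (use that in \<open>auto simp: indicator_def\<close>)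
    qed measurable
    finally show ?thesis .
  qed
  \<comment> \<open>For s up to \<delta>/2 the window from s to s + e stays where the profile is
    frozen.\<close>
  define e where "e = \<delta> / 2"
  have e: "0 < e" "e < 1" using \<delta> by (auto simp: e_def)
  \<comment> \<open>A primitive on [-1, 3], large enough for the windows of all s in (-1, 2), since
    e < 1.\<close>
  define F where "F x = integral {-1..x} wc" for x
  have F: "(F has_vector_derivative wc x) (at x within {-1..3})" if "x \<in> {-1..3}" for x
    unfolding F_def[abs_def] by (rule integral_has_vector_derivative[OF wc_cont that])
  have DF: "(F has_real_derivative wc x) (at x)" if "x \<in> {-1<..<3}" for x
  proof -
    have "(F has_vector_derivative wc x) (at x within {-1<..<3})"
      by (rule has_vector_derivative_within_subset[OF F]) (use that in auto)
    then show ?thesis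
      unfolding has_real_derivative_iff_has_vector_derivative at_within_open[OF that open_greaterThanLessThan] .
  qed
  define W where "W s = (F (s + e) - F s) / e" for s
  define W' where "W' s = (wc (s + e) - wc s) / e" for s
  have mv: "\<exists>\<xi>\<in>{s..s + e}. W s = wc \<xi>" if s: "s \<in> {-1<..<2}" for s
  proof -
    have "\<exists>z. s < z \<and> z < s + e \<and> F (s + e) - F s = (s + e - s) * wc z"
    proof (rule MVT2[of s "s + e" F wc])
      show "(F has_real_derivative wc x) (at x)" if "s \<le> x" "x \<le> s + e" for x
        by (rule DF) (use that s e in auto)
    qed (use e in simp)
    then obtain z where "s < z" "z < s + e" "F (s + e) - F s = e * wc z" by auto
    then show ?thesis using e by (intro bexI[of _ z]) (auto simp: W_def)
  qed
  show ?thesis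
  proof (rule exI[of _ W], rule exI[of _ W'], intro conjI ballI)
    fix s :: real assume s: "s \<in> {-1<..<2}"
    have "((\<lambda>s. F (s + e)) has_real_derivative wc (s + e) * 1) (at s)"
      by (rule DERIV_chain2[OF DF]) (use s e in \<open>auto intro!: derivative_eq_intros\<close>)
    moreover have "(F has_real_derivative wc s) (at s)" using s by (intro DF) auto
    ultimately have "((\<lambda>s. (F (s + e) - F s) / e) has_real_derivative (wc (s + e) * 1 - wc s) / e) (at s)"
      by (intro DERIV_cdivide DERIV_diff)
    then show "(W has_real_derivative W' s) (at s)" by (simp add: W_def[abs_def] W'_def)
  next
    have "continuous_on UNIV (\<lambda>s. wc (s + e))"
      by (rule continuous_on_compose2[OF wc_cont[of UNIV]]) (auto intro!: continuous_intros)
    then show "continuous_on UNIV W'" unfolding W'_def[abs_def]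
      using e by (intro continuous_on_divide continuous_on_diff wc_cont continuous_on_const) auto
  next
    fix s assume s: "s \<in> {-1<..\<delta>/2}"
    then obtain \<xi> where \<xi>: "\<xi> \<in> {s..s + e}" "W s = wc \<xi>" using mv[of s] \<delta> by auto
    then show "W s = w \<delta>" using s \<delta> by (auto simp: wc_def e_def)
    show "W' s = 0" using s \<delta> by (auto simp: W'_def wc_def e_def)
  next
    obtain \<xi> where \<xi>: "\<xi> \<in> {1..1 + e}" "W 1 = wc \<xi>" using mv[of 1] by auto
    then show "W 1 = w 1" using \<delta> by (auto simp: wc_def)
  next
    fix s :: real assume "s \<in> {0..1}"
    then obtain \<xi> where "\<xi> \<in> {s..s + e}" "W s = wc \<xi>" using mv[of s] by auto
    then show "\<exists>\<xi>\<in>{s..s + \<delta>}. W s = w (max \<delta> (min 1 \<xi>))"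
      using \<delta> by (intro bexI[of _ \<xi>]) (auto simp: wc_def e_def)
  next
    have "(\<integral>\<^sup>+t. ennreal (t ^ k * \<bar>W' t\<bar> powr p) * indicator {0<..<1} t \<partial>lborel)
      \<le> (\<integral>\<^sup>+t. ennreal (t ^ k * \<bar>hc t\<bar> powr p) * indicator {0<..<1} t \<partial>lborel)"
    proof -
      have W'_eq: "W' s = (LINT t|lborel. indicator {s..s + e} t * hc t) / e" for s
        unfolding W'_def using wdiff[of s "s + e"] e by simp
      show ?thesis unfolding W'_eq
      proof (rule forward_average_energy_le[OF hcm p e(1)])
        show "integrable lborel (\<lambda>t. indicator {s..s + e} t * hc t)" for s by (rule Hint) simp
        show "hc t = 0" if "t \<le> 0 \<or> 1 \<le> t" for t using that \<delta> by (auto simp: hc_def)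
      qed
    qed
    also have "\<dots> \<le> (\<integral>\<^sup>+t. ennreal (t ^ k * \<bar>h t\<bar> powr p) * indicator {0<..<1} t \<partial>lborel)"
      using p by (intro nn_integral_mono) (auto simp: hc_def indicator_def)
    finally show "(\<integral>\<^sup>+t. ennreal (t ^ k * \<bar>W' t\<bar> powr p) * indicator {0<..<1} t \<partial>lborel)
      \<le> (\<integral>\<^sup>+t. ennreal (t ^ k * \<bar>h t\<bar> powr p) * indicator {0<..<1} t \<partial>lborel)" .
  qed
qed

text \<open>Constancy near 0 makes the composition with a gauge continuously differentiable at the
  centre. The interval (-1, 2) leaves a margin around [0, 1], so that the composition is
  differentiable in a neighbourhood of the closed ball.\<close>

definition smooth_profile :: "(real \<Rightarrow> real) \<Rightarrow> (real \<Rightarrow> real) \<Rightarrow> bool" where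
  "smooth_profile W W' \<longleftrightarrow> (\<forall>s\<in>{-1<..<2}. (W has_real_derivative W' s) (at s)) \<and> continuous_on UNIV W' \<and>
    (\<exists>d>0. \<forall>s\<in>{-1<..d}. W s = W 0 \<and> W' s = 0)"

text \<open>The boundary value is kept exactly and the energy does not increase; only the mass is
  approximated, by dominated convergence as \<delta> tends to 0. Hence the lower bound
  \<open>L\<close> is strict.\<close>

lemma smooth_profile_approximation:
  fixes w h :: "real \<Rightarrow> real"
  assumes w: "continuous_on {0..1} w" and hm: "h \<in> borel_measurable borel" and p: "1 \<le> p"
    and E: "(\<integral>\<^sup>+t. ennreal (t ^ k * \<bar>h t\<bar> powr p) * indicator {0<..<1} t \<partial>lborel) = ennreal E"
    and Q: "closure Q = UNIV"
    and ftc: "\<And>a b. a \<in> Q \<Longrightarrow> b \<in> Q \<Longrightarrow> 0 < a \<Longrightarrow> a < b \<Longrightarrow> b < 1 \<Longrightarrow>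
      w b - w a = (LINT t|lborel. indicator {a..b} t * h t)"
    and mass: "L < (LINT t|lborel. indicator {0<..<1} t * (t ^ k * \<bar>w t\<bar> powr p))"
  shows "\<exists>W W'. smooth_profile W W' \<and> W 1 = w 1 \<and>
    (\<integral>\<^sup>+t. ennreal (t ^ k * \<bar>W' t\<bar> powr p) * indicator {0<..<1} t \<partial>lborel) \<le> ennreal E \<and>
    L < (LINT t|lborel. indicator {0<..<1} t * (t ^ k * \<bar>W t\<bar> powr p))"
proof -
  \<comment> \<open>The shift by 2 keeps all values strictly below 1.\<close>
  define d where "d j = 1 / real (Suc (Suc j))" for j :: nat
  have d: "0 < d j" "d j < 1" for j by (auto simp: d_def)
  have Efin: "(\<integral>\<^sup>+t. ennreal (t ^ k * \<bar>h t\<bar> powr p) * indicator {0<..<1} t \<partial>lborel) < \<infinity>"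
    unfolding E by simp
  have "\<forall>j. \<exists>W W'. (\<forall>s\<in>{-1<..<2}. (W has_real_derivative W' s) (at s)) \<and> continuous_on UNIV W' \<and>
    (\<forall>s\<in>{-1<..d j/2}. W s = w (d j) \<and> W' s = 0) \<and> W 1 = w 1 \<and>
    (\<forall>s\<in>{0..1}. \<exists>\<xi>\<in>{s..s + d j}. W s = w (max (d j) (min 1 \<xi>))) \<and>
    (\<integral>\<^sup>+t. ennreal (t ^ k * \<bar>W' t\<bar> powr p) * indicator {0<..<1} t \<partial>lborel)
      \<le> (\<integral>\<^sup>+t. ennreal (t ^ k * \<bar>h t\<bar> powr p) * indicator {0<..<1} t \<partial>lborel)"
    by (intro allI smooth_profile_step[OF w hm p Efin Q ftc d])
  from choice[OF this] obtain W where "\<forall>j. \<exists>W'. (\<forall>s\<in>{-1<..<2}. (W j has_real_derivative W' s) (at s)) \<and> continuous_on UNIV W' \<and>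
    (\<forall>s\<in>{-1<..d j/2}. W j s = w (d j) \<and> W' s = 0) \<and> W j 1 = w 1 \<and>
    (\<forall>s\<in>{0..1}. \<exists>\<xi>\<in>{s..s + d j}. W j s = w (max (d j) (min 1 \<xi>))) \<and>
    (\<integral>\<^sup>+t. ennreal (t ^ k * \<bar>W' t\<bar> powr p) * indicator {0<..<1} t \<partial>lborel)
      \<le> (\<integral>\<^sup>+t. ennreal (t ^ k * \<bar>h t\<bar> powr p) * indicator {0<..<1} t \<partial>lborel)" ..
  from choice[OF this] obtain W' where WW: "\<forall>j. (\<forall>s\<in>{-1<..<2}. (W j has_real_derivative W' j s) (at s)) \<and> continuous_on UNIV (W' j) \<and>
    (\<forall>s\<in>{-1<..d j/2}. W j s = w (d j) \<and> W' j s = 0) \<and> W j 1 = w 1 \<and>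
    (\<forall>s\<in>{0..1}. \<exists>\<xi>\<in>{s..s + d j}. W j s = w (max (d j) (min 1 \<xi>))) \<and>
    (\<integral>\<^sup>+t. ennreal (t ^ k * \<bar>W' j t\<bar> powr p) * indicator {0<..<1} t \<partial>lborel)
      \<le> (\<integral>\<^sup>+t. ennreal (t ^ k * \<bar>h t\<bar> powr p) * indicator {0<..<1} t \<partial>lborel)" ..
  have DW: "(W j has_real_derivative W' j s) (at s)" if "s \<in> {-1<..<2}" for j s using WW that by simp
  have xi: "\<exists>\<xi>\<in>{s..s + d j}. W j s = w (max (d j) (min 1 \<xi>))" if "s \<in> {0..1}" for j s using WW that by simp
  obtain B where B: "0 < B" "\<And>s. s \<in> {0..1} \<Longrightarrow> \<bar>w s\<bar> \<le> B"
    using compact_imp_bounded[OF compact_continuous_image[OF w compact_Icc]] unfolding bounded_pos by auto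
  have lim: "(\<lambda>j. W j s) \<longlonglongrightarrow> w s" if s: "s \<in> {0<..<1}" for s
  proof -
    define \<xi> where "\<xi> j = (SOME \<xi>. \<xi> \<in> {s..s + d j} \<and> W j s = w (max (d j) (min 1 \<xi>)))" for j
    have \<xi>: "\<xi> j \<in> {s..s + d j} \<and> W j s = w (max (d j) (min 1 (\<xi> j)))" for j
      unfolding \<xi>_def by (rule someI_ex) (use xi[of s j] s in auto)
    have d0: "d \<longlonglongrightarrow> 0"
    proof -
      have "(\<lambda>k. 1 / real (Suc k)) \<longlonglongrightarrow> 0" using LIMSEQ_inverse_real_of_nat by (simp add: inverse_eq_divide)
      then show ?thesis unfolding d_def[abs_def] by (rule LIMSEQ_Suc)
    qed
    have x0: "\<xi> \<longlonglongrightarrow> s"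
    proof (rule tendsto_sandwich[of "\<lambda>_. s" _ _ "\<lambda>j. s + d j"])
      show "(\<lambda>j. s + d j) \<longlonglongrightarrow> s" using tendsto_add[OF tendsto_const d0, of s] by simp
    qed (use \<xi> in auto)
    have "(\<lambda>j. max (d j) (min 1 (\<xi> j))) \<longlonglongrightarrow> max 0 (min 1 s)"
      by (intro tendsto_max tendsto_min tendsto_const d0 x0)
    then have "(\<lambda>j. max (d j) (min 1 (\<xi> j))) \<longlonglongrightarrow> s" using s by simp
    then have "(\<lambda>j. w (max (d j) (min 1 (\<xi> j)))) \<longlonglongrightarrow> w s"
      by (rule continuous_on_tendsto_compose[OF w]) (use s d(1,2) in \<open>auto simp: less_imp_le le_max_iff_disj\<close>)
    then show ?thesis using \<xi> by simp
  qed
  have bd: "\<bar>W j s\<bar> \<le> B" if s: "s \<in> {0..1}" for j s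
  proof -
    obtain \<xi> where "\<xi> \<in> {s..s + d j}" "W j s = w (max (d j) (min 1 \<xi>))" using xi[OF s] by blast
    then show ?thesis using B(2)[of "max (d j) (min 1 \<xi>)"] d(1,2)[of j] by (simp add: less_imp_le le_max_iff_disj)
  qed
  have meas: "(\<lambda>t. indicator {0<..<1} t * (t ^ k * \<bar>f t\<bar> powr p)) \<in> borel_measurable borel"
    if "continuous_on {0<..<1} f" for f :: "real \<Rightarrow> real"
  proof -
    have "continuous_on {0<..<1} (\<lambda>t. t ^ k * \<bar>f t\<bar> powr p)"
      using p by (intro continuous_intros that continuous_on_powr') auto
    from borel_measurable_continuous_on_indicator[OF _ this] show ?thesis by simp
  qed
  have Wc: "continuous_on {0<..<1} (W j)" for j
    by (intro continuous_at_imp_continuous_on ballI DERIV_isCont[OF DW]) auto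
  have "(\<lambda>j. LINT t|lborel. indicator {0<..<1} t * (t ^ k * \<bar>W j t\<bar> powr p)) \<longlonglongrightarrow>
    (LINT t|lborel. indicator {0<..<1} t * (t ^ k * \<bar>w t\<bar> powr p))"
  proof (rule integral_dominated_convergence[where w = "\<lambda>t. B powr p * indicator {0<..<1} t"])
    show "AE t in lborel. (\<lambda>j. indicator {0<..<1} t * (t ^ k * \<bar>W j t\<bar> powr p)) \<longlonglongrightarrow> indicator {0<..<1} t * (t ^ k * \<bar>w t\<bar> powr p)"
    proof (rule AE_I2)
      fix t :: real
      show "(\<lambda>j. indicator {0<..<1} t * (t ^ k * \<bar>W j t\<bar> powr p)) \<longlonglongrightarrow> indicator {0<..<1} t * (t ^ k * \<bar>w t\<bar> powr p)"
      proof (cases "t \<in> {0<..<1}")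
        case True
        have "(\<lambda>j. \<bar>W j t\<bar> powr p) \<longlonglongrightarrow> \<bar>w t\<bar> powr p"
          using p by (intro tendsto_powr' tendsto_rabs lim[OF True] tendsto_const) auto
        then show ?thesis by (intro tendsto_mult tendsto_const)
      qed simp
    qed
    show "AE t in lborel. norm (indicator {0<..<1} t * (t ^ k * \<bar>W j t\<bar> powr p)) \<le> B powr p * indicator {0<..<1} t" for j
    proof (rule AE_I2)
      fix t :: real
      show "norm (indicator {0<..<1} t * (t ^ k * \<bar>W j t\<bar> powr p)) \<le> B powr p * indicator {0<..<1} t"
      proof (cases "t \<in> {0<..<1}")
        case True
        have "t ^ k * \<bar>W j t\<bar> powr p \<le> 1 * B powr p"
          using True bd[of t j] p by (intro mult_mono power_le_one powr_mono2) auto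
        then show ?thesis using True by (simp add: abs_mult)
      qed simp
    qed
    show "integrable lborel (\<lambda>t::real. B powr p * indicator {0<..<1} t)"
      by (intro integrable_mult_right integrable_real_indicator) auto
    show "(\<lambda>t. indicator {0<..<1} t * (t ^ k * \<bar>w t\<bar> powr p)) \<in> borel_measurable lborel"
      using meas[OF continuous_on_subset[OF w]] by force
    show "(\<lambda>t. indicator {0<..<1} t * (t ^ k * \<bar>W j t\<bar> powr p)) \<in> borel_measurable lborel" for j
      using meas[OF Wc] by simp
  qed
  from order_tendstoD(1)[OF this mass] obtain j where
    j: "L < (LINT t|lborel. indicator {0<..<1} t * (t ^ k * \<bar>W j t\<bar> powr p))"
    unfolding eventually_sequentially by auto
  have c: "W j s = w (d j) \<and> W' j s = 0" if "s \<in> {-1<..d j/2}" for s using WW that by simp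
  have "smooth_profile (W j) (W' j)"
    unfolding smooth_profile_def
  proof (intro conjI ballI exI[of _ "d j / 2"])
    show "W j s = W j 0" "W' j s = 0" if "s \<in> {-1<..d j/2}" for s
      using c[OF that] c[of 0] d(1)[of j] by auto
  qed (use WW DW d(1)[of j] in auto)
  moreover have "W j 1 = w 1" "(\<integral>\<^sup>+t. ennreal (t ^ k * \<bar>W' j t\<bar> powr p) * indicator {0<..<1} t \<partial>lborel) \<le> ennreal E"
    using WW unfolding E[symmetric] by simp_all
  ultimately show ?thesis using j by blast
qed

section \<open>Radial competitors\<close>

lemma nn_integral_lebesgue_on_borel:
  assumes "D \<in> sets borel"
  shows "(\<integral>\<^sup>+x. f x \<partial>lebesgue_on D) = (\<integral>\<^sup>+x. f x * indicator D x \<partial>lborel)"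
  using assms by (subst nn_integral_restrict_space) (auto simp: nn_integral_completion)

text \<open>Translation by a unit vector does not change the integral of \<open>\<psi>\<close>. The
  difference is the integral of the partial derivative over a unit segment, and every shift
  contributes the same amount after Fubini.\<close>

lemma integral_test_fun_gradient:
  assumes t: "test_fun V \<psi> d\<psi>"
  shows "(LINT x|lborel. d\<psi> x $ i) = 0"
proof -
  have D: "(\<psi> has_derivative (\<lambda>h. d\<psi> x \<bullet> h)) (at x)" for x using t by (simp add: test_fun_def)
  obtain C r where C: "\<And>x. \<bar>\<psi> x\<bar> \<le> C * indicator (cball 0 r) x" "\<And>x. norm (d\<psi> x) \<le> C * indicator (cball 0 r) x"
      "0 \<le> C" "0 < r" "continuous_on UNIV \<psi>" "continuous_on UNIV d\<psi>"
    using test_fun_bounded[OF t] by auto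
  have [measurable]: "\<psi> \<in> borel_measurable borel" "d\<psi> \<in> borel_measurable borel"
    using C(5,6) by (auto intro: borel_measurable_continuous_onI)
  let ?e = "axis i 1 :: real^'a"
  have int\<psi>: "integrable lborel \<psi>" by (rule integrable_lborel_bounded_support[OF _ C(1)]) simp
  have shift: "(LINT x|lborel. f (s *\<^sub>R ?e + x)) = (LINT x|lborel. f x)" if "f \<in> borel_measurable borel" for f :: "real^'a \<Rightarrow> real" and s
    using integral_lborel_affine[OF that, of 1 "s *\<^sub>R ?e"] by simp
  have FTC: "\<psi> (1 *\<^sub>R ?e + x) - \<psi> x = (LINT s|lborel. indicator {0..1} s * d\<psi> (s *\<^sub>R ?e + x) $ i)" for x
  proof -
    have "(LINT s|lborel. d\<psi> (s *\<^sub>R ?e + x) $ i * indicator {0..1} s) = \<psi> (1 *\<^sub>R ?e + x) - \<psi> (0 *\<^sub>R ?e + x)"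
    proof (rule integral_FTC_Icc_real)
      fix s :: real
      have 1: "((\<lambda>s. s *\<^sub>R ?e + x) has_derivative (\<lambda>h. h *\<^sub>R ?e)) (at s)"
        by (auto intro!: derivative_eq_intros)
      have "((\<lambda>s. \<psi> (s *\<^sub>R ?e + x)) has_derivative (\<lambda>h. d\<psi> (s *\<^sub>R ?e + x) \<bullet> (h *\<^sub>R ?e))) (at s)"
        by (rule has_derivative_compose[OF 1 D])
      then show "((\<lambda>s. \<psi> (s *\<^sub>R ?e + x)) has_real_derivative d\<psi> (s *\<^sub>R ?e + x) $ i) (at s)"
        unfolding has_field_derivative_def by (rule has_derivative_eq_rhs) (auto simp: fun_eq_iff inner_axis)
      have "isCont (\<lambda>s. s *\<^sub>R ?e + x) s" by (intro continuous_intros)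
      moreover have "isCont d\<psi> z" for z using C(6) by (simp add: continuous_on_eq_continuous_at)
      ultimately have "isCont (\<lambda>s. d\<psi> (s *\<^sub>R ?e + x)) s" by (rule isCont_o2)
      then show "isCont (\<lambda>s. d\<psi> (s *\<^sub>R ?e + x) $ i) s" by (rule isCont_vec_nth)
    qed simp
    then show ?thesis by (simp add: mult.commute)
  qed
  have dint: "integrable (lborel \<Otimes>\<^sub>M lborel) (\<lambda>(s, x). indicator {0..1} s * d\<psi> (s *\<^sub>R ?e + x) $ i)"
  proof (rule Bochner_Integration.integrable_bound)
    show "integrable (lborel \<Otimes>\<^sub>M lborel) (\<lambda>p. C * indicator ({0..1::real} \<times> cball (0::real^'a) (r + 1)) p :: real)"
    proof (intro integrable_mult_right integrable_real_indicator)
      show "emeasure (lborel \<Otimes>\<^sub>M lborel) ({0..1::real} \<times> cball (0::real^'a) (r + 1)) < \<infinity>"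
        using emeasure_lborel_cball_finite[of "0::real^'a" "r + 1"]
        by (subst lborel.emeasure_pair_measure_Times) (auto simp: ennreal_mult_less_top)
    qed (intro pair_measureI; simp)
    show "AE p in lborel \<Otimes>\<^sub>M lborel. norm (case p of (s, x) \<Rightarrow> indicator {0..1} s * d\<psi> (s *\<^sub>R ?e + x) $ i)
        \<le> norm (C * indicator ({0..1::real} \<times> cball (0::real^'a) (r + 1)) p)"
    proof (rule AE_I2, clarify)
      fix s :: real and x :: "real^'a"
      show "norm (indicator {0..1} s * d\<psi> (s *\<^sub>R ?e + x) $ i) \<le> norm (C * indicator ({0..1::real} \<times> cball (0::real^'a) (r + 1)) (s, x))"
      proof (cases "s \<in> {0..1}")
        case True
        have "\<bar>d\<psi> (s *\<^sub>R ?e + x) $ i\<bar> \<le> C * indicator (cball 0 r) (s *\<^sub>R ?e + x)"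
          using C(2)[of "s *\<^sub>R ?e + x"] component_le_norm_cart[of "d\<psi> (s *\<^sub>R ?e + x)" i] by linarith
        also have "\<dots> \<le> C * indicator (cball 0 (r + 1)) x"
        proof (intro mult_left_mono C(3))
          have "norm x \<le> r + 1" if "norm (s *\<^sub>R ?e + x) \<le> r"
            using that norm_triangle_ineq4[of "s *\<^sub>R ?e + x" "s *\<^sub>R ?e"] True by simp
          then show "indicator (cball 0 r) (s *\<^sub>R ?e + x) \<le> (indicator (cball 0 (r + 1)) x :: real)"
            by (auto simp: indicator_def)
        qed
        finally show ?thesis using True C(3) by (simp add: indicator_times)
      qed simp
    qed
    have "(\<lambda>(s, x). indicator {0..1} s * d\<psi> (s *\<^sub>R ?e + x) $ i) \<in> borel_measurable (borel \<Otimes>\<^sub>M borel)" by measurable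
    then show "(\<lambda>(s, x). indicator {0..1} s * d\<psi> (s *\<^sub>R ?e + x) $ i) \<in> borel_measurable (lborel \<Otimes>\<^sub>M lborel)" by simp
  qed
  have "0 = (LINT x|lborel. \<psi> (1 *\<^sub>R ?e + x)) - (LINT x|lborel. \<psi> x)"
    by (subst shift) auto
  also have "\<dots> = (LINT x|lborel. \<psi> (1 *\<^sub>R ?e + x) - \<psi> x)"
    by (rule Bochner_Integration.integral_diff[symmetric])
      (use integrable_lborel_affine[OF int\<psi>, of 1 "1 *\<^sub>R ?e"] int\<psi> in simp_all)
  also have "\<dots> = (LINT x|lborel. LINT s|lborel. indicator {0..1} s * d\<psi> (s *\<^sub>R ?e + x) $ i)"
    by (simp only: FTC)
  also have "\<dots> = (LINT s|lborel. LINT x|lborel. indicator {0..1} s * d\<psi> (s *\<^sub>R ?e + x) $ i)"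
    by (rule lborel_pair.Fubini_integral[OF dint])
  also have "\<dots> = (LINT s|lborel. indicator {0..1::real} s * (LINT x|lborel. d\<psi> x $ i))"
  proof (rule Bochner_Integration.integral_cong[OF refl])
    fix s :: real
    have "(LINT x|lborel. indicator {0..1} s * d\<psi> (s *\<^sub>R ?e + x) $ i) = indicator {0..1} s * (LINT x|lborel. d\<psi> (s *\<^sub>R ?e + x) $ i)"
      by (rule integral_mult_right_zero)
    also have "(LINT x|lborel. d\<psi> (s *\<^sub>R ?e + x) $ i) = (LINT x|lborel. d\<psi> x $ i)"
      by (rule shift[of "\<lambda>x. d\<psi> x $ i"]) measurable
    finally show "(LINT x|lborel. indicator {0..1} s * d\<psi> (s *\<^sub>R ?e + x) $ i) = indicator {0..1} s * (LINT x|lborel. d\<psi> x $ i)" .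
  qed
  also have "\<dots> = (LINT x|lborel. d\<psi> x $ i)" by simp
  finally show ?thesis by simp
qed

section \<open>Outer normals and radial integrals\<close>

lemma is_outer_normal_unique:
  assumes "is_outer_normal D x \<nu>" "is_outer_normal D x \<nu>'"
  shows "\<nu> = \<nu>'"
proof (rule ccontr)
  assume ne: "\<nu> \<noteq> \<nu>'"
  have n: "norm \<nu> = 1" "norm \<nu>' = 1" using assms by (auto simp: is_outer_normal_def)
  \<comment> \<open>Moving from x along the difference of the two normals goes into D according to
    the first and out of D according to the second.\<close>
  define w where "w = \<nu>' - \<nu>"
  have w: "w \<noteq> 0" using ne by (simp add: w_def)
  have inn: "\<nu> \<bullet> \<nu> = 1" "\<nu>' \<bullet> \<nu>' = 1" using n by (simp_all add: norm_eq_1)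
  define k where "k = w \<bullet> \<nu>'"
  have ww: "w \<bullet> w = 2 * k" "w \<bullet> \<nu> = - k"
    by (simp_all add: k_def w_def inner_diff_left inner_diff_right inn inner_commute)
  then have k: "k > 0" using w by (metis inner_gt_zero_iff mult_pos_pos zero_less_mult_pos zero_less_numeral)
  \<comment> \<open>Half the slope of \<open>w\<close> against either normal, so that both cone
    conditions hold strictly.\<close>
  define \<epsilon> where "\<epsilon> = k / (2 * norm w)"
  have \<epsilon>: "\<epsilon> > 0" "\<epsilon> * norm w < k" using k w by (auto simp: \<epsilon>_def)
  obtain r1 where r1: "r1 > 0" "\<And>y. y \<in> ball x r1 \<Longrightarrow> (y - x) \<bullet> \<nu> < - \<epsilon> * norm (y - x) \<Longrightarrow> y \<in> D"
    using assms(1) \<epsilon>(1) unfolding is_outer_normal_def by metis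
  obtain r2 where r2: "r2 > 0" "\<And>y. y \<in> ball x r2 \<Longrightarrow> (y - x) \<bullet> \<nu>' > \<epsilon> * norm (y - x) \<Longrightarrow> y \<notin> D"
    using assms(2) \<epsilon>(1) unfolding is_outer_normal_def by metis
  define t where "t = min r1 r2 / (2 * norm w)"
  have t: "t > 0" using r1(1) r2(1) w by (simp add: t_def)
  have tw: "t * norm w < min r1 r2"
  proof -
    have "t * norm w = min r1 r2 / 2" using w by (simp add: t_def)
    moreover have "0 < min r1 r2" using r1(1) r2(1) by simp
    ultimately show ?thesis by linarith
  qed
  define y where "y = x + t *\<^sub>R w"
  have yb: "y \<in> ball x r1" "y \<in> ball x r2" using tw t by (auto simp: y_def dist_norm)
  have "(y - x) \<bullet> \<nu> < - \<epsilon> * norm (y - x)" "(y - x) \<bullet> \<nu>' > \<epsilon> * norm (y - x)"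
    using \<epsilon>(2) t by (simp_all add: y_def ww(2) k_def[symmetric] mult.left_commute)
  then show False using r1(2)[OF yb(1)] r2(2)[OF yb(2)] by blast
qed

context smooth_gauge
begin

lemma dG_nonzero: "x \<noteq> 0 \<Longrightarrow> dG x \<noteq> 0"
  using dG_self[of x] G_pos[of x] by auto

lemma is_outer_normal_dG:
  assumes y: "G (y - x0) = 1"
  shows "is_outer_normal {x. G (x - x0) < 1} y ((1 / norm (dG (y - x0))) *\<^sub>R dG (y - x0))"
proof -
  define z where "z = y - x0"
  have z: "z \<noteq> 0" "G z = 1" using y by (auto simp: z_def)
  define q where "q = norm (dG z)"
  have q: "q > 0" using dG_nonzero[OF z(1)] by (simp add: q_def)
  show ?thesis
    unfolding is_outer_normal_def z_def[symmetric] q_def[symmetric]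
  proof (intro conjI allI impI)
    show "norm ((1 / q) *\<^sub>R dG z) = 1" using q by (simp add: q_def)
    fix \<epsilon> :: real assume \<epsilon>: "\<epsilon> > 0"
    have "\<exists>d>0. \<forall>u. norm (u - z) < d \<longrightarrow> norm (G u - G z - dG z \<bullet> (u - z)) \<le> (\<epsilon> * q) * norm (u - z)"
      using has_derivative_G[OF z(1)] \<epsilon> q unfolding has_derivative_at_alt by simp
    then obtain d where d: "d > 0" "\<And>u. norm (u - z) < d \<Longrightarrow> \<bar>G u - 1 - dG z \<bullet> (u - z)\<bar> \<le> \<epsilon> * q * norm (u - z)"
      using z(2) by auto
    show "\<exists>r>0. \<forall>x\<in>ball y r. ((x - y) \<bullet> (1 / q) *\<^sub>R dG z < - \<epsilon> * norm (x - y) \<longrightarrow> x \<in> {x. G (x - x0) < 1}) \<and>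
        (\<epsilon> * norm (x - y) < (x - y) \<bullet> (1 / q) *\<^sub>R dG z \<longrightarrow> x \<notin> {x. G (x - x0) < 1})"
    proof (rule exI[of _ d], intro conjI ballI impI d(1))
      fix x assume "x \<in> ball y d"
      then have "norm (x - y) < d" by (simp add: dist_norm norm_minus_commute)
      moreover have xz: "(x - x0) - z = x - y" by (simp add: z_def)
      ultimately have *: "\<bar>G (x - x0) - 1 - dG z \<bullet> (x - y)\<bar> \<le> \<epsilon> * q * norm (x - y)"
        using d(2)[of "x - x0"] unfolding xz by simp
      have i: "(x - y) \<bullet> (1 / q) *\<^sub>R dG z = (dG z \<bullet> (x - y)) / q" by (simp add: inner_commute)
      show "x \<in> {x. G (x - x0) < 1}" if "(x - y) \<bullet> (1 / q) *\<^sub>R dG z < - \<epsilon> * norm (x - y)"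
      proof -
        have "dG z \<bullet> (x - y) < - \<epsilon> * norm (x - y) * q" using that q unfolding i by (simp add: pos_divide_less_eq)
        then show ?thesis using * by (simp add: abs_le_iff mult_ac)
      qed
      show "x \<notin> {x. G (x - x0) < 1}" if "\<epsilon> * norm (x - y) < (x - y) \<bullet> (1 / q) *\<^sub>R dG z"
      proof -
        have "\<epsilon> * norm (x - y) * q < dG z \<bullet> (x - y)" using that q unfolding i by (simp add: pos_less_divide_eq)
        then show ?thesis using * by (simp add: abs_le_iff mult_ac)
      qed
    qed
  qed
qed

lemma outer_normal_eq:
  assumes y: "G (y - x0) = 1"
  shows "outer_normal {x. G (x - x0) < 1} y = (1 / norm (dG (y - x0))) *\<^sub>R dG (y - x0)"
proof -
  note n = is_outer_normal_dG[OF y]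
  have "is_outer_normal {x. G (x - x0) < 1} y (SOME \<nu>. is_outer_normal {x. G (x - x0) < 1} y \<nu>)"
    using n by (rule someI)
  then show ?thesis
    unfolding outer_normal_def using n is_outer_normal_unique[OF _ n] by auto
qed

lemma nn_integral_shift:
  assumes f: "f \<in> borel_measurable borel"
  shows "(\<integral>\<^sup>+x. f x * indicator {x. G (x - x0) < 1} x \<partial>lborel) = (\<integral>\<^sup>+x. f (x0 + x) * indicator {x. G x < 1} x \<partial>lborel)"
proof -
  have D: "{x. G (x - x0) < 1} \<in> sets borel" using open_G_less by auto
  have "(\<integral>\<^sup>+x. f (x0 + 1 *\<^sub>R x) * indicator {x. G (x - x0) < 1} (x0 + 1 *\<^sub>R x) \<partial>lborel)
    = ennreal (1 / 1 ^ DIM(real^'n)) * (\<integral>\<^sup>+x. f x * indicator {x. G (x - x0) < 1} x \<partial>lborel)"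
    by (rule nn_integral_lborel_affine) (use f D in auto)
  then show ?thesis by (simp add: indicator_def)
qed

lemma radial_integral:
  fixes f :: "real \<Rightarrow> ennreal"
  assumes [measurable]: "f \<in> borel_measurable borel"
  shows "(\<integral>\<^sup>+x. f (G x) * indicator {x. G x < 1} x \<partial>lborel) =
    (\<integral>\<^sup>+s. ennreal (real CARD('n) * s ^ (CARD('n) - 1)) * f s * indicator {0<..<1} s \<partial>lborel) * emeasure lborel {x. G x < 1}"
proof -
  have "(\<integral>\<^sup>+x. f (G x) * indicator {x. G x < 1} x \<partial>lborel) =
    (\<integral>\<^sup>+x. (\<integral>\<^sup>+s. ennreal (real CARD('n) * s ^ (CARD('n) - 1)) * f (G ((s / G x) *\<^sub>R x)) * indicator {0<..<1} s \<partial>lborel)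
        * indicator {x. G x < 1} x \<partial>lborel)"
    by (rule polar_formula) measurable
  also have "\<dots> = (\<integral>\<^sup>+x. (\<integral>\<^sup>+s. ennreal (real CARD('n) * s ^ (CARD('n) - 1)) * f s * indicator {0<..<1} s \<partial>lborel)
        * indicator {x. G x < 1} x \<partial>lborel)"
  proof (rule nn_integral_cong_AE, rule AE_mp[OF AE_lborel_singleton[of 0]], intro AE_I2 impI)
    fix x :: "real^'n" assume x: "x \<noteq> 0"
    have "ennreal (real CARD('n) * s ^ (CARD('n) - 1)) * f (G ((s / G x) *\<^sub>R x)) * indicator {0<..<1} s
      = ennreal (real CARD('n) * s ^ (CARD('n) - 1)) * f s * indicator {0<..<1} s" for s
      using G_ray[OF x, of s] by (cases "s \<in> {0<..<1}") auto
    then show "(\<integral>\<^sup>+s. ennreal (real CARD('n) * s ^ (CARD('n) - 1)) * f (G ((s / G x) *\<^sub>R x)) * indicator {0<..<1} s \<partial>lborel)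
        * indicator {x. G x < 1} x = (\<integral>\<^sup>+s. ennreal (real CARD('n) * s ^ (CARD('n) - 1)) * f s * indicator {0<..<1} s \<partial>lborel)
        * indicator {x. G x < 1} x" by (simp only:)
  qed
  also have "\<dots> = (\<integral>\<^sup>+s. ennreal (real CARD('n) * s ^ (CARD('n) - 1)) * f s * indicator {0<..<1} s \<partial>lborel) * emeasure lborel {x. G x < 1}"
    by (subst nn_integral_cmult_indicator) auto
  finally show ?thesis .
qed

end

text \<open>\<open>T\<close> is only known to be differentiable inside \<open>D\<close>; multiplying
  by a function with compact support in \<open>D\<close> and gluing with zero gives a test function
  on the whole space.\<close>

lemma test_fun_C1_mult:
  fixes T :: "real^'n \<Rightarrow> real"
  assumes D: "open D" and T: "\<And>x. x \<in> D \<Longrightarrow> (T has_derivative (\<lambda>h. dT x \<bullet> h)) (at x)" and dT: "continuous_on D dT"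
    and t: "test_fun D \<phi> d\<phi>"
  shows "test_fun D (\<lambda>x. T x * \<phi> x) (\<lambda>x. \<phi> x *\<^sub>R dT x + T x *\<^sub>R d\<phi> x)"
proof -
  define K where "K = closure {x. \<phi> x \<noteq> 0}"
  have D\<phi>: "(\<phi> has_derivative (\<lambda>h. d\<phi> x \<bullet> h)) (at x)" and cd: "continuous_on UNIV d\<phi>"
    and co: "compact K" and su: "K \<subseteq> D" for x
    using t by (auto simp: test_fun_def K_def)
  have c\<phi>: "continuous_on UNIV \<phi>"
    using D\<phi> by (meson continuous_at_imp_continuous_on has_derivative_continuous)
  have oK: "open (- K)" using co by (simp add: compact_imp_closed open_Compl)
  have z: "\<phi> y = 0" if "y \<notin> K" for y
  proof (rule ccontr)
    assume "\<phi> y \<noteq> 0"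
    then have "y \<in> K" using closure_subset[of "{x. \<phi> x \<noteq> 0}"] by (auto simp: K_def)
    then show False using that by simp
  qed
  have dz: "d\<phi> x = 0" if x: "x \<notin> K" for x
  proof -
    have "((\<lambda>_. 0) has_derivative (\<lambda>h. d\<phi> x \<bullet> h)) (at x)"
      by (rule has_derivative_transform_within_open[OF D\<phi> oK]) (use x z in auto)
    moreover have "((\<lambda>_. 0) has_derivative (\<lambda>h. 0 :: real)) (at x)" by (rule has_derivative_const)
    ultimately have "(\<lambda>h. d\<phi> x \<bullet> h) = (\<lambda>h. 0)" by (rule has_derivative_unique)
    then have "d\<phi> x \<bullet> d\<phi> x = 0" by (rule fun_cong)
    then show ?thesis by simp
  qed
  have cT: "continuous_on D T"
    using T by (meson continuous_at_imp_continuous_on has_derivative_continuous)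
  show ?thesis
    unfolding test_fun_def
  proof (intro conjI allI)
    fix x
    show "((\<lambda>x. T x * \<phi> x) has_derivative (\<lambda>h. (\<phi> x *\<^sub>R dT x + T x *\<^sub>R d\<phi> x) \<bullet> h)) (at x)"
    proof (cases "x \<in> K")
      case True
      then have "x \<in> D" using su by auto
      from has_derivative_mult[OF T[OF this] D\<phi>[of x]] show ?thesis
        by (rule has_derivative_eq_rhs) (auto simp: fun_eq_iff inner_add_left)
    next
      case False
      have "((\<lambda>x. 0::real) has_derivative (\<lambda>h. 0)) (at x)" by (rule has_derivative_const)
      then have "((\<lambda>x. T x * \<phi> x) has_derivative (\<lambda>h. 0)) (at x)"
        by (rule has_derivative_transform_within_open[OF _ oK]) (use False z in auto)
      then show ?thesis using z[OF False] dz[OF False] by simp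
    qed
  next
    have "continuous_on (D \<union> - K) (\<lambda>x. \<phi> x *\<^sub>R dT x + T x *\<^sub>R d\<phi> x)"
    proof (rule continuous_on_open_Un[OF D oK])
      show "continuous_on D (\<lambda>x. \<phi> x *\<^sub>R dT x + T x *\<^sub>R d\<phi> x)"
        by (intro continuous_on_add continuous_on_scaleR dT cT continuous_on_subset[OF c\<phi>] continuous_on_subset[OF cd]) auto
      have "continuous_on (- K) (\<lambda>x. 0 :: real^'n)" by (rule continuous_on_const)
      then show "continuous_on (- K) (\<lambda>x. \<phi> x *\<^sub>R dT x + T x *\<^sub>R d\<phi> x)"
        by (rule continuous_on_eq) (use z dz in simp)
    qed
    moreover have "D \<union> - K = UNIV" using su by auto
    ultimately show "continuous_on UNIV (\<lambda>x. \<phi> x *\<^sub>R dT x + T x *\<^sub>R d\<phi> x)" by simp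
  next
    have "{x. T x * \<phi> x \<noteq> 0} \<subseteq> {x. \<phi> x \<noteq> 0}" by auto
    then have cl: "closure {x. T x * \<phi> x \<noteq> 0} \<subseteq> K" unfolding K_def by (rule closure_mono)
    then show "closure {x. T x * \<phi> x \<noteq> 0} \<subseteq> D" using su by auto
    show "compact (closure {x. T x * \<phi> x \<noteq> 0})"
      using cl compact_Int_closed[OF co closed_closure, of "{x. T x * \<phi> x \<noteq> 0}"]
      by (simp add: Int_absorb1)
  qed
qed

lemma Lp_fun_bounded:
  fixes v :: "real^'n \<Rightarrow> real"
  assumes D: "D \<in> sets borel" "emeasure lborel D < \<infinity>" and p: "0 \<le> p"
    and v: "v \<in> borel_measurable (lebesgue_on D)" and B: "\<And>x. x \<in> D \<Longrightarrow> \<bar>v x\<bar> \<le> B"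
  shows "Lp_fun D p v"
  unfolding Lp_fun_def
proof
  interpret finite_measure "lebesgue_on D"
    by (rule finite_measureI) (use D in \<open>simp add: emeasure_restrict_space\<close>)
  show "integrable (lebesgue_on D) (\<lambda>x. \<bar>v x\<bar> powr p)"
  proof (rule integrable_const_bound[where B = "B powr p"])
    show "AE x in lebesgue_on D. norm (\<bar>v x\<bar> powr p) \<le> B powr p"
      using B p by (intro AE_I2) (auto intro!: powr_mono2)
    show "(\<lambda>x. \<bar>v x\<bar> powr p) \<in> borel_measurable (lebesgue_on D)" using v by measurable
  qed
qed (rule v)

text \<open>Integration by parts without boundary: the product of \<open>T\<close> with a test
  function is again a test function, so the integral of its gradient vanishes.\<close>

lemma weak_gradient_C1:
  fixes T :: "real^'n \<Rightarrow> real"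
  assumes D: "open D" "emeasure lborel D < \<infinity>" and p: "0 \<le> p"
    and T: "\<And>x. x \<in> D \<Longrightarrow> (T has_derivative (\<lambda>h. dT x \<bullet> h)) (at x)" and dT: "continuous_on D dT"
    and B: "\<And>x. x \<in> D \<Longrightarrow> \<bar>T x\<bar> \<le> B" "\<And>x. x \<in> D \<Longrightarrow> norm (dT x) \<le> B"
  shows "weak_gradient D p T dT"
  unfolding weak_gradient_def
proof (intro conjI allI impI)
  have Db: "D \<in> sets borel" using D by simp
  have cT: "continuous_on D T"
    using T by (meson continuous_at_imp_continuous_on has_derivative_continuous)
  have mT: "T \<in> borel_measurable (lebesgue_on D)" "dT \<in> borel_measurable (lebesgue_on D)"
    using Db by (auto intro!: continuous_imp_measurable_on_sets_lebesgue cT dT)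
  show "Lp_fun D p T" by (rule Lp_fun_bounded[OF Db D(2) p mT(1) B(1)])
  show "Lp_fun D p (\<lambda>x. dT x $ i)" for i
  proof (rule Lp_fun_bounded[OF Db D(2) p])
    show "(\<lambda>x. dT x $ i) \<in> borel_measurable (lebesgue_on D)" using mT(2) by measurable
    show "\<bar>dT x $ i\<bar> \<le> B" if "x \<in> D" for x using B(2)[OF that] component_le_norm_cart[of "dT x" i] by linarith
  qed
  fix \<phi> d\<phi> i assume t: "test_fun D \<phi> d\<phi>"
  note t2 = test_fun_C1_mult[OF D(1) T dT t]
  obtain C r where C: "\<And>x. \<bar>\<phi> x\<bar> \<le> C * indicator (cball 0 r) x" "\<And>x. norm (d\<phi> x) \<le> C * indicator (cball 0 r) x"
      "0 \<le> C" "0 < r" "continuous_on UNIV \<phi>" "continuous_on UNIV d\<phi>"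
    using test_fun_bounded[OF t] by auto
  have \<phi>m: "\<phi> \<in> borel_measurable (lebesgue_on D)" "d\<phi> \<in> borel_measurable (lebesgue_on D)"
    using Db C(5,6) by (auto intro!: continuous_imp_measurable_on_sets_lebesgue intro: continuous_on_subset)
  interpret fm: finite_measure "lebesgue_on D"
    by (rule finite_measureI) (use D Db in \<open>simp add: emeasure_restrict_space\<close>)
  have bC: "\<bar>\<phi> x\<bar> \<le> C" "norm (d\<phi> x) \<le> C" for x
    using C(1)[of x] C(2)[of x] C(3) by (cases "x \<in> cball 0 r"; simp del: mem_cball)+
  have B0: "0 \<le> B" if "x \<in> D" for x using B(1)[OF that] by linarith
  have i1: "integrable (lebesgue_on D) (\<lambda>x. T x * d\<phi> x $ i)"
  proof (rule fm.integrable_const_bound[where B = "B * C"])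
    show "AE x in lebesgue_on D. norm (T x * d\<phi> x $ i) \<le> B * C"
    proof (rule AE_I2)
      fix x assume "x \<in> space (lebesgue_on D)"
      then have x: "x \<in> D" using Db by (simp add: space_restrict_space)
      have "\<bar>T x\<bar> * \<bar>d\<phi> x $ i\<bar> \<le> B * C"
        using B(1)[OF x] B0[OF x] bC(2)[of x] component_le_norm_cart[of "d\<phi> x" i] by (intro mult_mono) auto
      then show "norm (T x * d\<phi> x $ i) \<le> B * C" by (simp add: abs_mult)
    qed
    show "(\<lambda>x. T x * d\<phi> x $ i) \<in> borel_measurable (lebesgue_on D)" using mT(1) \<phi>m(2) by measurable
  qed
  have i2: "integrable (lebesgue_on D) (\<lambda>x. dT x $ i * \<phi> x)"
  proof (rule fm.integrable_const_bound[where B = "B * C"])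
    show "AE x in lebesgue_on D. norm (dT x $ i * \<phi> x) \<le> B * C"
    proof (rule AE_I2)
      fix x assume "x \<in> space (lebesgue_on D)"
      then have x: "x \<in> D" using Db by (simp add: space_restrict_space)
      have "\<bar>dT x $ i\<bar> * \<bar>\<phi> x\<bar> \<le> B * C"
        using B(2)[OF x] B0[OF x] bC(1)[of x] component_le_norm_cart[of "dT x" i] by (intro mult_mono) auto
      then show "norm (dT x $ i * \<phi> x) \<le> B * C" by (simp add: abs_mult)
    qed
    show "(\<lambda>x. dT x $ i * \<phi> x) \<in> borel_measurable (lebesgue_on D)" using mT(2) \<phi>m(1) by measurable
  qed
  let ?d = "\<lambda>x. \<phi> x *\<^sub>R dT x + T x *\<^sub>R d\<phi> x"
  have dm: "?d \<in> borel_measurable borel"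
    using t2 by (intro borel_measurable_continuous_onI) (simp add: test_fun_def)
  have z: "?d x $ i = 0" if "x \<notin> D" for x
  proof -
    have "\<phi> x = 0" "d\<phi> x = 0"
    proof -
      define K where "K = closure {x. \<phi> x \<noteq> 0}"
      have K: "K \<subseteq> D" "compact K" using t by (auto simp: test_fun_def K_def)
      have x: "x \<in> - K" using that K by auto
      have zz: "\<phi> y = 0" if "y \<in> - K" for y
        using that closure_subset[of "{x. \<phi> x \<noteq> 0}"] by (auto simp: K_def)
      show "\<phi> x = 0" by (rule zz[OF x])
      have "((\<lambda>_. 0) has_derivative (\<lambda>h. d\<phi> x \<bullet> h)) (at x)"
      proof (rule has_derivative_transform_within_open)
        show "(\<phi> has_derivative (\<lambda>h. d\<phi> x \<bullet> h)) (at x)" using t by (simp add: test_fun_def)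
        show "open (- K)" using K(2) by (simp add: compact_imp_closed open_Compl)
      qed (use x zz in simp_all)
      moreover have "((\<lambda>_. 0) has_derivative (\<lambda>h. 0 :: real)) (at x)" by (rule has_derivative_const)
      ultimately have "(\<lambda>h. d\<phi> x \<bullet> h) = (\<lambda>h. 0)" by (rule has_derivative_unique)
      then have "d\<phi> x \<bullet> d\<phi> x = 0" by (rule fun_cong)
      then show "d\<phi> x = 0" by simp
    qed
    then show ?thesis by simp
  qed
  have "0 = (LINT x|lborel. ?d x $ i)" by (rule integral_test_fun_gradient[OF t2, symmetric])
  also have "\<dots> = (LINT x|lebesgue. ?d x $ i)"
    by (rule integral_completion[symmetric]) (use dm in measurable)
  also have "\<dots> = (LINT x|lebesgue. indicator D x *\<^sub>R (?d x $ i))"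
    by (intro Bochner_Integration.integral_cong refl) (use z in \<open>auto simp: indicator_def\<close>)
  also have "\<dots> = (LINT x|lebesgue_on D. ?d x $ i)"
    by (rule integral_restrict_space[symmetric]) (use Db in simp)
  also have "\<dots> = (LINT x|lebesgue_on D. dT x $ i * \<phi> x + T x * d\<phi> x $ i)"
    by (simp add: mult.commute)
  also have "\<dots> = (LINT x|lebesgue_on D. dT x $ i * \<phi> x) + (LINT x|lebesgue_on D. T x * d\<phi> x $ i)"
    by (rule Bochner_Integration.integral_add[OF i2 i1])
  finally show "(LINT x|lebesgue_on D. T x * d\<phi> x $ i) = - (LINT x|lebesgue_on D. dT x $ i * \<phi> x)" by simp
qed

context smooth_gauge
begin

section \<open>Functions of a gauge as competitors\<close>

definition radial :: "real^'n \<Rightarrow> (real \<Rightarrow> real) \<Rightarrow> real^'n \<Rightarrow> real" where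
  "radial x0 W x = W (G (x - x0))"

definition radial_gradient :: "real^'n \<Rightarrow> (real \<Rightarrow> real) \<Rightarrow> real^'n \<Rightarrow> real^'n" where
  "radial_gradient x0 W' x = W' (G (x - x0)) *\<^sub>R dG (x - x0)"

lemma radial_has_derivative:
  assumes prof: "smooth_profile W W'" and x: "G (x - x0) < 2"
  shows "(radial x0 W has_derivative (\<lambda>h. radial_gradient x0 W' x \<bullet> h)) (at x)"
proof (cases "x = x0")
  case False
  then have ne: "x - x0 \<noteq> 0" by simp
  have "G (x - x0) \<in> {-1<..<2}" using G_nonneg[of "x - x0"] x by simp
  then have "(W has_real_derivative W' (G (x - x0))) (at (G (x - x0)))"
    using prof by (simp add: smooth_profile_def)
  then have 1: "(W has_derivative (\<lambda>h. W' (G (x - x0)) * h)) (at (G (x - x0)))"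
    by (simp add: has_field_derivative_def)
  have sh: "((\<lambda>x. x - x0) has_derivative (\<lambda>h. h)) (at x)"
    by (auto intro!: derivative_eq_intros)
  have "((\<lambda>x. G (x - x0)) has_derivative (\<lambda>h. dG (x - x0) \<bullet> h)) (at x)"
    by (rule has_derivative_compose[OF sh has_derivative_G[OF ne]])
  from has_derivative_compose[OF this 1] show ?thesis
    unfolding radial_def[abs_def] radial_gradient_def by simp
next
  case True
  obtain d where d: "0 < d" "\<forall>s\<in>{-1<..d}. W s = W 0 \<and> W' s = 0"
    using prof unfolding smooth_profile_def by blast
  let ?U = "{x. G (x - x0) < d}"
  have U: "open ?U" by (intro open_Collect_less continuous_on_G_shift continuous_on_const)
  have "((\<lambda>x. W 0) has_derivative (\<lambda>h. 0)) (at x)" by (rule has_derivative_const)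
  then have "(radial x0 W has_derivative (\<lambda>h. 0)) (at x)"
  proof (rule has_derivative_transform_within_open[OF _ U])
    show "x \<in> ?U" using True d(1) by simp
    fix y assume "y \<in> ?U"
    then have "G (y - x0) \<in> {-1<..d}" using G_nonneg[of "y - x0"] by simp
    then show "W 0 = radial x0 W y" using d(2) by (simp add: radial_def)
  qed
  moreover have "radial_gradient x0 W' x = 0" using True by (simp add: radial_gradient_def dG_zero)
  ultimately show ?thesis by simp
qed

lemma continuous_on_radial_gradient:
  assumes prof: "smooth_profile W W'"
  shows "continuous_on UNIV (radial_gradient x0 W')"
proof -
  obtain d where d: "0 < d" "\<forall>s\<in>{-1<..d}. W s = W 0 \<and> W' s = 0"
    using prof unfolding smooth_profile_def by blast
  have cW': "continuous_on UNIV W'" using prof by (simp add: smooth_profile_def)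
  let ?U = "{x. G (x - x0) < d}"
  have U: "open ?U" by (intro open_Collect_less continuous_on_G_shift continuous_on_const)
  have "continuous_on (?U \<union> - {x0}) (radial_gradient x0 W')"
  proof (rule continuous_on_open_Un[OF U])
    have "continuous_on ?U (\<lambda>x. 0 :: real^'n)" by (rule continuous_on_const)
    then show "continuous_on ?U (radial_gradient x0 W')"
    proof (rule continuous_on_eq)
      fix x assume "x \<in> ?U"
      then have "G (x - x0) \<in> {-1<..d}" using G_nonneg[of "x - x0"] by simp
      then show "0 = radial_gradient x0 W' x" using d(2) by (simp add: radial_gradient_def)
    qed
    have "continuous_on (- {x0}) (\<lambda>x. dG (x - x0))"
      by (rule continuous_on_compose2[OF continuous_on_dG]) (auto intro!: continuous_intros)
    moreover have "continuous_on (- {x0}) (\<lambda>x. W' (G (x - x0)))"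
      by (rule continuous_on_compose2[OF cW' continuous_on_G_shift]) auto
    ultimately show "continuous_on (- {x0}) (radial_gradient x0 W')"
      unfolding radial_gradient_def[abs_def] by (intro continuous_on_scaleR)
    show "open (- {x0})" by (simp add: open_Compl)
  qed
  moreover have "?U \<union> - {x0} = UNIV" using d(1) by auto
  ultimately show ?thesis by simp
qed

lemma emeasure_lborel_gauge_ball:
  "emeasure lborel {x. G (x - x0) < 1} = emeasure lborel {x. G x < 1}"
  "emeasure lborel {x. G x < 1} = ennreal (measure lborel {x. G x < 1})"
  "0 < measure lborel {x. G x < 1}"
proof -
  have "{x. G (x - x0) < 1} \<in> sets borel" "{x. G x < 1} \<in> sets borel" using open_G_less[of x0] by auto
  then show "emeasure lborel {x. G (x - x0) < 1} = emeasure lborel {x. G x < 1}"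
    using nn_integral_shift[of "\<lambda>_. 1" x0] by simp
  have "emeasure lborel {x. G x < 1} \<le> emeasure lborel {x. G x \<le> 1}" by (intro emeasure_mono) auto
  then have fin: "emeasure lborel {x. G x < 1} < \<infinity>" using emeasure_lborel_G_le_finite by (rule le_less_trans)
  then show eq: "emeasure lborel {x. G x < 1} = ennreal (measure lborel {x. G x < 1})"
    by (intro emeasure_eq_ennreal_measure) auto
  have "open {x. G x < 1}" using open_G_less[of 0] by simp
  moreover have "0 \<in> {x. G x < 1}" by simp
  then have "{x. G x < 1} \<noteq> {}" by blast
  ultimately have "\<not> negligible {x. G x < 1}" by (rule open_not_negligible)
  then have "emeasure lborel {x. G x < 1} \<noteq> 0"
    by (auto simp: negligible_iff_null_sets null_sets_def)
  then show "0 < measure lborel {x. G x < 1}"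
    unfolding eq by (cases "measure lborel {x. G x < 1} > 0") (auto simp: ennreal_neg)
qed

lemma nn_integral_radial_D:
  fixes f :: "real \<Rightarrow> real"
  assumes [measurable]: "f \<in> borel_measurable borel" and f0: "\<And>s. 0 \<le> f s"
  shows "(\<integral>\<^sup>+x. ennreal (f (G (x - x0))) \<partial>lebesgue_on {x. G (x - x0) < 1}) =
    ennreal (real CARD('n)) * (\<integral>\<^sup>+s. ennreal (s ^ (CARD('n) - 1) * f s) * indicator {0<..<1} s \<partial>lborel) * ennreal (measure lborel {x. G x < 1})"
proof -
  have "(\<integral>\<^sup>+x. ennreal (f (G (x - x0))) \<partial>lebesgue_on {x. G (x - x0) < 1})
    = (\<integral>\<^sup>+x. ennreal (f (G (x - x0))) * indicator {x. G (x - x0) < 1} x \<partial>lborel)"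
    by (rule nn_integral_lebesgue_on_borel) (use open_G_less in auto)
  also have "\<dots> = (\<integral>\<^sup>+x. ennreal (f (G (x0 + x - x0))) * indicator {x. G x < 1} x \<partial>lborel)"
    by (rule nn_integral_shift) measurable
  also have "\<dots> = (\<integral>\<^sup>+x. ennreal (f (G x)) * indicator {x. G x < 1} x \<partial>lborel)" by simp
  also have "\<dots> = (\<integral>\<^sup>+s. ennreal (real CARD('n) * s ^ (CARD('n) - 1)) * ennreal (f s) * indicator {0<..<1} s \<partial>lborel) * emeasure lborel {x. G x < 1}"
    by (rule radial_integral) measurable
  also have "(\<integral>\<^sup>+s. ennreal (real CARD('n) * s ^ (CARD('n) - 1)) * ennreal (f s) * indicator {0<..<1} s \<partial>lborel)
    = (\<integral>\<^sup>+s. ennreal (real CARD('n)) * (ennreal (s ^ (CARD('n) - 1) * f s) * indicator {0<..<1} s) \<partial>lborel)"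
  proof (rule nn_integral_cong)
    fix s :: real
    show "ennreal (real CARD('n) * s ^ (CARD('n) - 1)) * ennreal (f s) * indicator {0<..<1} s
      = ennreal (real CARD('n)) * (ennreal (s ^ (CARD('n) - 1) * f s) * indicator {0<..<1} s)"
    proof (cases "s \<in> {0<..<1}")
      case True
      then have "0 \<le> s ^ (CARD('n) - 1)" by simp
      then show ?thesis using f0[of s] by (simp add: ennreal_mult mult.assoc)
    qed simp
  qed
  also have "\<dots> = ennreal (real CARD('n)) * (\<integral>\<^sup>+s. ennreal (s ^ (CARD('n) - 1) * f s) * indicator {0<..<1} s \<partial>lborel)"
    by (rule nn_integral_cmult) measurable
  finally show ?thesis using emeasure_lborel_gauge_ball(2) by simp
qed

lemma finite_surface_measure:
  assumes c: "0 \<le> c"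
    and S: "\<And>f. f \<in> borel_measurable borel \<Longrightarrow> (\<integral>\<^sup>+x. f x \<partial>surface_measure {x. G (x - x0) < 1}) =
      (\<integral>\<^sup>+x. f (x0 + (1 / G x) *\<^sub>R x) * ennreal (c * norm (dG x)) * indicator {x. G x < 1} x \<partial>lborel)"
  shows "finite_measure (surface_measure {x. G (x - x0) < 1})"
proof (rule finite_measureI)
  have "(\<integral>\<^sup>+x. 1 \<partial>surface_measure {x. G (x - x0) < 1}) = (\<integral>\<^sup>+x. 1 * ennreal (c * norm (dG x)) * indicator {x. G x < 1} x \<partial>lborel)"
    by (rule S) simp
  also have "\<dots> \<le> (\<integral>\<^sup>+x. ennreal (c * M) * indicator {x. G x < 1} x \<partial>lborel)"
    using norm_dG_le c by (intro nn_integral_mono) (auto simp: indicator_def intro!: ennreal_leI mult_left_mono)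
  also have "\<dots> = ennreal (c * M) * ennreal (measure lborel {x. G x < 1})"
    using emeasure_lborel_gauge_ball(2) by (subst nn_integral_cmult_indicator) auto
  also have "\<dots> < \<infinity>" by (simp add: ennreal_mult_less_top)
  finally have "emeasure (surface_measure {x. G (x - x0) < 1}) (space (surface_measure {x. G (x - x0) < 1})) < \<infinity>" by simp
  then show "emeasure (surface_measure {x. G (x - x0) < 1}) (space (surface_measure {x. G (x - x0) < 1})) \<noteq> \<infinity>" by simp
qed

text \<open>All three integrals are multiples of the volume of the ball, which cancels, so the bound
  does not see the domain. The gradient of \<open>W\<close> composed with the gauge is
  \<open>W'\<close> times \<open>dG\<close>. In the boundary term the density c |dG| of surface
  measure undoes the normalisation of the normal and leaves \<open>c\<close> times \<open>F\<close>
  of \<open>dG\<close>; division by the mass factor n gives c / (n R).\<close>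

lemma radial_competitor:
  assumes p: "1 \<le> p" and F0: "\<And>\<xi>. 0 \<le> F \<xi>" and Fhom: "\<And>t \<xi>. F (t *\<^sub>R \<xi>) = \<bar>t\<bar> * F \<xi>"
    and Fm [measurable]: "F \<in> borel_measurable borel" and FdG: "\<And>x. F (dG x) \<le> 1 / R" and R: "0 < R"
    and \<beta>: "0 \<le> \<beta>" and c: "0 \<le> c"
    and S: "\<And>f. f \<in> borel_measurable borel \<Longrightarrow> (\<integral>\<^sup>+x. f x \<partial>surface_measure {x. G (x - x0) < 1}) =
      (\<integral>\<^sup>+x. f (x0 + (1 / G x) *\<^sub>R x) * ennreal (c * norm (dG x)) * indicator {x. G x < 1} x \<partial>lborel)"
    and prof: "smooth_profile W W'"
    and en: "(\<integral>\<^sup>+t. ennreal (t ^ (CARD('n) - 1) * \<bar>W' t\<bar> powr p) * indicator {0<..<1} t \<partial>lborel) \<le> ennreal E" and E: "0 \<le> E"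
    and mass: "M0 = (LINT t|lborel. indicator {0<..<1} t * (t ^ (CARD('n) - 1) * \<bar>W t\<bar> powr p))" and M0: "0 < M0"
  shows "\<exists>v g t. weak_gradient {x. G (x - x0) < 1} p v g \<and> boundary_trace {x. G (x - x0) < 1} p v g t \<and>
      \<not> (AE x in lebesgue_on {x. G (x - x0) < 1}. v x = 0) \<and>
      ((LINT x|lebesgue_on {x. G (x - x0) < 1}. F (g x) powr p)
        + \<beta> * (LINT x|surface_measure {x. G (x - x0) < 1}. \<bar>t x\<bar> powr p * F (outer_normal {x. G (x - x0) < 1} x))) / (LINT x|lebesgue_on {x. G (x - x0) < 1}. \<bar>v x\<bar> powr p)
      \<le> (E * (1 / R) powr p + \<beta> * c / (real CARD('n) * R) * \<bar>W 1\<bar> powr p) / M0"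
proof -
  let ?n = "real CARD('n)"
  define D where "D = {x. G (x - x0) < 1}"
  define V where "V = measure lborel {x. G x < 1}"
  define T where "T = radial x0 W"
  define dT where "dT = radial_gradient x0 W'"
  have V: "0 < V" using emeasure_lborel_gauge_ball(3) by (simp add: V_def)
  have D: "open D" "D \<in> sets borel" using open_G_less[of x0] by (auto simp: D_def)
  have eD: "emeasure lborel D = ennreal V"
    using emeasure_lborel_gauge_ball(1)[of x0] emeasure_lborel_gauge_ball(2) by (simp add: D_def V_def)
  have fr: "frontier D = {x. G (x - x0) = 1}" and cl: "closure D = {x. G (x - x0) \<le> 1}"
    unfolding D_def by (rule frontier_G_less closure_G_less)+
  have DT: "(T has_derivative (\<lambda>h. dT x \<bullet> h)) (at x)" if "G (x - x0) < 2" for x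
    unfolding T_def dT_def by (rule radial_has_derivative[OF prof that])
  have cT: "continuous_on (closure D) T"
    unfolding cl by (intro continuous_at_imp_continuous_on ballI has_derivative_continuous[OF DT]) auto
  have cdT: "continuous_on A dT" for A
    unfolding dT_def by (rule continuous_on_subset[OF continuous_on_radial_gradient[OF prof]]) simp
  have cmp: "compact (closure D)" unfolding D_def by (rule compact_closure_G_less)
  obtain B1 where B1: "\<And>x. x \<in> closure D \<Longrightarrow> norm (T x) \<le> B1"
    using compact_imp_bounded[OF compact_continuous_image[OF cT cmp]] unfolding bounded_iff by auto
  obtain B2 where B2: "\<And>x. x \<in> closure D \<Longrightarrow> norm (dT x) \<le> B2"
    using compact_imp_bounded[OF compact_continuous_image[OF cdT cmp]] unfolding bounded_iff by auto
  have wg: "weak_gradient D p T dT"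
  proof (rule weak_gradient_C1[OF D(1)])
    show "emeasure lborel D < \<infinity>" by (simp add: eD)
    show "\<bar>T x\<bar> \<le> max B1 B2" "norm (dT x) \<le> max B1 B2" if "x \<in> D" for x
      using B1[of x] B2[of x] closure_subset[of D] that by auto
    show "(T has_derivative (\<lambda>h. dT x \<bullet> h)) (at x)" if "x \<in> D" for x
      by (rule DT) (use that in \<open>simp add: D_def\<close>)
  qed (use p cdT in auto)
  have sp: "space (surface_measure D) = frontier D"
    by (simp add: surface_measure_def space_restrict_space)
  have T1: "T x = W 1" if "x \<in> frontier D" for x using that by (simp add: T_def radial_def fr)
  have Tm: "T \<in> borel_measurable (surface_measure D)"
    by (subst measurable_cong[of _ _ "\<lambda>_. W 1"]) (auto simp: sp T1)
  interpret fs: finite_measure "surface_measure D"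
    unfolding D_def by (rule finite_surface_measure[OF c S])
  \<comment> \<open>The function is continuous up to the boundary, so the constant sequence realises
    its own trace.\<close>
  have bt: "boundary_trace D p T dT T"
    unfolding boundary_trace_def
  proof (intro conjI exI[of _ "\<lambda>_. T"] exI[of _ "\<lambda>_. dT"] allI)
    show "integrable (surface_measure D) (\<lambda>x. \<bar>T x\<bar> powr p)"
      by (rule fs.integrable_const_bound[where B = "\<bar>W 1\<bar> powr p"])
        (use Tm in \<open>auto intro!: AE_I2 simp: sp T1\<close>)
  qed (use Tm cT wg in auto)
  \<comment> \<open>The indicator turns \<open>W\<close>, which is controlled only near [0, 1], into
    a Borel function on the line.\<close>
  define fW where "fW s = indicator {0..1} s * \<bar>W s\<bar> powr p" for s
  have fWm: "fW \<in> borel_measurable borel"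
  proof -
    have "continuous_on {0..1} W"
      using prof by (intro continuous_at_imp_continuous_on ballI DERIV_isCont) (auto simp: smooth_profile_def)
    then have "continuous_on {0..1} (\<lambda>s. \<bar>W s\<bar> powr p)"
      using p by (intro continuous_on_powr' continuous_on_rabs continuous_on_const) auto
    from borel_measurable_continuous_on_indicator[OF _ this] show ?thesis by (simp add: fW_def[abs_def])
  qed
  have fW0: "0 \<le> fW s" for s by (simp add: fW_def)
  have TfW: "\<bar>T x\<bar> powr p = fW (G (x - x0))" if "x \<in> D" for x
    using that G_nonneg[of "x - x0"] by (simp add: T_def radial_def fW_def D_def)
  have M0_nn: "(\<integral>\<^sup>+s. ennreal (s ^ (CARD('n) - 1) * fW s) * indicator {0<..<1} s \<partial>lborel) = ennreal M0"
  proof -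
    \<comment> \<open>A non-integrable function has Bochner integral 0 by convention, so positivity
      of \<open>M0\<close> yields integrability.\<close>
    have int: "integrable lborel (\<lambda>t. indicator {0<..<1} t * (t ^ (CARD('n) - 1) * \<bar>W t\<bar> powr p))"
      using M0 not_integrable_integral_eq unfolding mass by fastforce
    have "(\<integral>\<^sup>+s. ennreal (s ^ (CARD('n) - 1) * fW s) * indicator {0<..<1} s \<partial>lborel)
      = (\<integral>\<^sup>+t. ennreal (indicator {0<..<1} t * (t ^ (CARD('n) - 1) * \<bar>W t\<bar> powr p)) \<partial>lborel)"
      by (intro nn_integral_cong) (auto simp: fW_def indicator_def)
    also have "\<dots> = ennreal M0"
      unfolding mass by (rule nn_integral_eq_integral[OF int]) (auto intro!: AE_I2 simp: indicator_def)
    finally show ?thesis .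
  qed
  have den: "(LINT x|lebesgue_on D. \<bar>T x\<bar> powr p) = ?n * M0 * V"
  proof -
    have "(LINT x|lebesgue_on D. \<bar>T x\<bar> powr p) = enn2real (\<integral>\<^sup>+x. ennreal (\<bar>T x\<bar> powr p) \<partial>lebesgue_on D)"
      using wg by (intro integral_eq_nn_integral) (auto simp: weak_gradient_def Lp_fun_def intro!: AE_I2)
    also have "(\<integral>\<^sup>+x. ennreal (\<bar>T x\<bar> powr p) \<partial>lebesgue_on D) = (\<integral>\<^sup>+x. ennreal (fW (G (x - x0))) \<partial>lebesgue_on D)"
      by (intro nn_integral_cong) (simp add: TfW space_restrict_space)
    also have "\<dots> = ennreal ?n * ennreal M0 * ennreal V"
      unfolding D_def V_def nn_integral_radial_D[OF fWm fW0] M0_nn ..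
    also have "\<dots> = ennreal (?n * M0 * V)" using M0 V by (simp add: ennreal_mult)
    finally show ?thesis using M0 V by simp
  qed
  have denpos: "0 < ?n * M0 * V" using M0 V by simp
  have num1: "(LINT x|lebesgue_on D. F (dT x) powr p) \<le> ?n * (E * (1 / R) powr p) * V"
  proof (rule integral_real_bounded)
    let ?fe = "\<lambda>s. (1 / R) powr p * \<bar>W' s\<bar> powr p"
    have W'm [measurable]: "W' \<in> borel_measurable borel"
      using prof by (intro borel_measurable_continuous_onI) (simp add: smooth_profile_def)
    have le: "F (dT x) powr p \<le> ?fe (G (x - x0))" for x
    proof -
      have "F (dT x) = \<bar>W' (G (x - x0))\<bar> * F (dG (x - x0))" by (simp add: dT_def radial_gradient_def Fhom)
      also have "\<dots> \<le> \<bar>W' (G (x - x0))\<bar> * (1 / R)" by (intro mult_left_mono FdG) simp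
      finally have "F (dT x) powr p \<le> (\<bar>W' (G (x - x0))\<bar> * (1 / R)) powr p"
        using F0 p by (intro powr_mono2) auto
      then show ?thesis by (simp only: powr_mult mult.commute)
    qed
    have "(\<integral>\<^sup>+x. ennreal (F (dT x) powr p) \<partial>lebesgue_on D) \<le> (\<integral>\<^sup>+x. ennreal (?fe (G (x - x0))) \<partial>lebesgue_on D)"
      by (intro nn_integral_mono ennreal_leI le)
    also have "\<dots> = ennreal ?n * (\<integral>\<^sup>+s. ennreal (s ^ (CARD('n) - 1) * ?fe s) * indicator {0<..<1} s \<partial>lborel) * ennreal V"
      unfolding D_def V_def by (rule nn_integral_radial_D) auto
    also have "(\<integral>\<^sup>+s. ennreal (s ^ (CARD('n) - 1) * ?fe s) * indicator {0<..<1} s \<partial>lborel)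
      = (\<integral>\<^sup>+s. ennreal ((1 / R) powr p) * (ennreal (s ^ (CARD('n) - 1) * \<bar>W' s\<bar> powr p) * indicator {0<..<1} s) \<partial>lborel)"
    proof (rule nn_integral_cong)
      fix s :: real
      have "ennreal (s ^ (CARD('n) - 1) * ?fe s) = ennreal ((1 / R) powr p) * ennreal (s ^ (CARD('n) - 1) * \<bar>W' s\<bar> powr p)"
        if "0 < s" using that by (subst ennreal_mult[symmetric]) (auto simp: mult.left_commute)
      then show "ennreal (s ^ (CARD('n) - 1) * ?fe s) * indicator {0<..<1} s
        = ennreal ((1 / R) powr p) * (ennreal (s ^ (CARD('n) - 1) * \<bar>W' s\<bar> powr p) * indicator {0<..<1} s)"
        by (cases "s \<in> {0<..<1}") auto
    qed
    also have "\<dots> = ennreal ((1 / R) powr p) * (\<integral>\<^sup>+s. ennreal (s ^ (CARD('n) - 1) * \<bar>W' s\<bar> powr p) * indicator {0<..<1} s \<partial>lborel)"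
      by (rule nn_integral_cmult) measurable
    also have "ennreal ?n * (ennreal ((1 / R) powr p) * (\<integral>\<^sup>+s. ennreal (s ^ (CARD('n) - 1) * \<bar>W' s\<bar> powr p) * indicator {0<..<1} s \<partial>lborel)) * ennreal V
      \<le> ennreal ?n * (ennreal ((1 / R) powr p) * ennreal E) * ennreal V"
      by (intro mult_right_mono mult_left_mono en) auto
    also have "\<dots> = ennreal (?n * (E * (1 / R) powr p) * V)"
      using E V by (simp add: ennreal_mult mult_ac)
    finally show "(\<integral>\<^sup>+x. ennreal (F (dT x) powr p) \<partial>lebesgue_on D) \<le> ennreal (?n * (E * (1 / R) powr p) * V)" .
  qed (use E V in simp)
  have num2: "(LINT x|surface_measure D. \<bar>T x\<bar> powr p * F (outer_normal D x)) \<le> c / R * \<bar>W 1\<bar> powr p * V"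
  proof (rule integral_real_bounded)
    let ?N = "\<lambda>x. (1 / norm (dG (x - x0))) *\<^sub>R dG (x - x0)"
    have "(\<integral>\<^sup>+x. ennreal (\<bar>T x\<bar> powr p * F (outer_normal D x)) \<partial>surface_measure D)
      = (\<integral>\<^sup>+x. ennreal (\<bar>W 1\<bar> powr p * F (?N x)) \<partial>surface_measure D)"
    proof (rule nn_integral_cong)
      fix x assume "x \<in> space (surface_measure D)"
      then have x: "x \<in> frontier D" by (simp add: sp)
      then have "G (x - x0) = 1" by (simp add: fr)
      from outer_normal_eq[OF this] show "ennreal (\<bar>T x\<bar> powr p * F (outer_normal D x)) = ennreal (\<bar>W 1\<bar> powr p * F (?N x))"
        by (simp only: T1[OF x] D_def)
    qed
    also have "\<dots> = (\<integral>\<^sup>+x. ennreal (\<bar>W 1\<bar> powr p * F (?N (x0 + (1 / G x) *\<^sub>R x))) * ennreal (c * norm (dG x)) * indicator {x. G x < 1} x \<partial>lborel)"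
      unfolding D_def by (rule S) measurable
    also have "\<dots> \<le> (\<integral>\<^sup>+x. ennreal (c / R * \<bar>W 1\<bar> powr p) * indicator {x. G x < 1} x \<partial>lborel)"
    proof (rule nn_integral_mono_AE, rule AE_mp[OF AE_lborel_singleton[of 0]], intro AE_I2 impI)
      fix x :: "real^'n" assume x: "x \<noteq> 0"
      have q: "norm (dG x) > 0" using dG_nonzero[OF x] by simp
      \<comment> \<open>The unit normal is constant along rays, and |dG| times it is
        \<open>dG\<close>.\<close>
      have eq: "F (?N (x0 + (1 / G x) *\<^sub>R x)) * norm (dG x) = F (dG x)"
        using q G_pos[OF x] by (simp add: dG_scale Fhom)
      have "\<bar>W 1\<bar> powr p * F (?N (x0 + (1 / G x) *\<^sub>R x)) * (c * norm (dG x))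
          = \<bar>W 1\<bar> powr p * c * (F (?N (x0 + (1 / G x) *\<^sub>R x)) * norm (dG x))"
        by (simp only: mult_ac)
      also have "\<dots> = \<bar>W 1\<bar> powr p * c * F (dG x)" by (simp only: eq)
      finally have "\<bar>W 1\<bar> powr p * F (?N (x0 + (1 / G x) *\<^sub>R x)) * (c * norm (dG x)) = \<bar>W 1\<bar> powr p * c * F (dG x)" .
      also have "\<dots> \<le> \<bar>W 1\<bar> powr p * c * (1 / R)" using c by (intro mult_left_mono FdG) simp
      also have "\<dots> = c / R * \<bar>W 1\<bar> powr p" by simp
      finally have "ennreal (\<bar>W 1\<bar> powr p * F (?N (x0 + (1 / G x) *\<^sub>R x))) * ennreal (c * norm (dG x)) \<le> ennreal (c / R * \<bar>W 1\<bar> powr p)"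
        using F0 c by (subst ennreal_mult[symmetric]) (auto intro!: ennreal_leI)
      then show "ennreal (\<bar>W 1\<bar> powr p * F (?N (x0 + (1 / G x) *\<^sub>R x))) * ennreal (c * norm (dG x)) * indicator {x. G x < 1} x
        \<le> ennreal (c / R * \<bar>W 1\<bar> powr p) * indicator {x. G x < 1} x"
        by (rule mult_right_mono) simp
    qed
    also have "\<dots> = ennreal (c / R * \<bar>W 1\<bar> powr p) * ennreal V"
      using emeasure_lborel_gauge_ball(2) by (subst nn_integral_cmult_indicator) (auto simp: V_def)
    also have "\<dots> = ennreal (c / R * \<bar>W 1\<bar> powr p * V)"
      using c R V by (simp add: ennreal_mult[symmetric])
    finally show "(\<integral>\<^sup>+x. ennreal (\<bar>T x\<bar> powr p * F (outer_normal D x)) \<partial>surface_measure D) \<le> ennreal (c / R * \<bar>W 1\<bar> powr p * V)" .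
  qed (use c R V in simp)
  have "((LINT x|lebesgue_on D. F (dT x) powr p) + \<beta> * (LINT x|surface_measure D. \<bar>T x\<bar> powr p * F (outer_normal D x)))
     / (LINT x|lebesgue_on D. \<bar>T x\<bar> powr p)
    \<le> (?n * (E * (1 / R) powr p) * V + \<beta> * (c / R * \<bar>W 1\<bar> powr p * V)) / (?n * M0 * V)"
    unfolding den using denpos \<beta> by (intro divide_right_mono add_mono num1 mult_left_mono num2) auto
  also have "\<dots> = (E * (1 / R) powr p + \<beta> * c / (?n * R) * \<bar>W 1\<bar> powr p) / M0"
  proof -
    have "(n * x * V + \<beta> * (c / R * w * V)) / (n * M0 * V) = (x + \<beta> * c / (n * R) * w) / M0" if "n > 0" for n x w :: real
      using that M0 V R by (simp add: field_simps)
    then show ?thesis by simp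
  qed
  finally have ratio: "((LINT x|lebesgue_on D. F (dT x) powr p) + \<beta> * (LINT x|surface_measure D. \<bar>T x\<bar> powr p * F (outer_normal D x)))
     / (LINT x|lebesgue_on D. \<bar>T x\<bar> powr p) \<le> (E * (1 / R) powr p + \<beta> * c / (?n * R) * \<bar>W 1\<bar> powr p) / M0" .
  have "\<not> (AE x in lebesgue_on D. T x = 0)"
  proof
    assume "AE x in lebesgue_on D. T x = 0"
    then have "AE x in lebesgue_on D. \<bar>T x\<bar> powr p = 0" by eventually_elim simp
    then have "(LINT x|lebesgue_on D. \<bar>T x\<bar> powr p) = 0" by (rule integral_eq_zero_AE)
    then show False using den M0 V by auto
  qed
  with wg bt ratio show ?thesis unfolding D_def by blast
qed

end

lemma robin_eig1_le:
  assumes F0: "\<And>\<xi>. 0 \<le> F \<xi>" and \<beta>: "0 \<le> \<beta>"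
    and "weak_gradient D p v g" "boundary_trace D p v g t" "\<not> (AE x in lebesgue_on D. v x = 0)"
  shows "robin_eig1 F p \<beta> D \<le> ((LINT x|lebesgue_on D. F (g x) powr p)
        + \<beta> * (LINT x|surface_measure D. \<bar>t x\<bar> powr p * F (outer_normal D x))) / (LINT x|lebesgue_on D. \<bar>v x\<bar> powr p)"
  unfolding robin_eig1_def
proof (rule cInf_lower)
  let ?A = "{((LINT x|lebesgue_on D. F (g x) powr p) + \<beta> * (LINT x|surface_measure D. \<bar>t x\<bar> powr p * F (outer_normal D x))) / (LINT x|lebesgue_on D. \<bar>v x\<bar> powr p)
     | v g t. weak_gradient D p v g \<and> boundary_trace D p v g t \<and> \<not> (AE x in lebesgue_on D. v x = 0)}"
  show "bdd_below ?A"
    using \<beta> F0 by (intro bdd_belowI[of _ 0]) (auto intro!: divide_nonneg_nonneg add_nonneg_nonneg mult_nonneg_nonneg Bochner_Integration.integral_nonneg)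
  show "((LINT x|lebesgue_on D. F (g x) powr p) + \<beta> * (LINT x|surface_measure D. \<bar>t x\<bar> powr p * F (outer_normal D x))) / (LINT x|lebesgue_on D. \<bar>v x\<bar> powr p) \<in> ?A"
    using assms(3-5) by blast
qed

section \<open>Restriction of competitors to rays\<close>

lemma borel_version_on:
  fixes f :: "'a::euclidean_space \<Rightarrow> real"
  assumes D: "D \<in> sets borel" and f: "f \<in> borel_measurable (lebesgue_on D)"
  shows "\<exists>f'. f' \<in> borel_measurable borel \<and> (\<forall>x. x \<notin> D \<longrightarrow> f' x = 0) \<and> (AE x in lborel. x \<in> D \<longrightarrow> f' x = f x)"
proof -
  have "(\<lambda>x. indicator D x *\<^sub>R f x) \<in> borel_measurable lebesgue"
    using f D by (subst (asm) borel_measurable_restrict_space_iff) auto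
  from completion_ex_borel_measurable_real[OF this[simplified]]
  obtain h where h: "h \<in> borel_measurable lborel" "AE x in lborel. indicator D x * f x = h x"
    by (auto simp: scaleR_conv_of_real)
  have [measurable]: "h \<in> borel_measurable borel" "D \<in> sets borel" using h D by auto
  show ?thesis
  proof (intro exI[of _ "\<lambda>x. indicator D x * h x"] conjI allI impI)
    show "(\<lambda>x. indicator D x * h x) \<in> borel_measurable borel" by measurable
    show "AE x in lborel. x \<in> D \<longrightarrow> indicator D x * h x = f x"
      using h(2) by eventually_elim auto
  qed auto
qed

lemma lebesgue_on_integral_borel_version:
  fixes f h :: "'a::euclidean_space \<Rightarrow> real"
  assumes D: "D \<in> sets borel" and f: "f \<in> borel_measurable (lebesgue_on D)" and h: "h \<in> borel_measurable borel"
    and out: "\<And>x. x \<notin> D \<Longrightarrow> h x = 0" and eq: "AE x in lborel. x \<in> D \<longrightarrow> h x = f x"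
  shows "(LINT x|lebesgue_on D. f x) = (LINT x|lborel. h x)"
proof -
  have fm: "(\<lambda>x. indicator D x *\<^sub>R f x) \<in> borel_measurable lebesgue"
    using f D by (subst (asm) borel_measurable_restrict_space_iff) auto
  have hm: "h \<in> borel_measurable lebesgue" using h by (intro measurable_completion) simp
  have "AE x in lborel. indicator D x *\<^sub>R f x = h x"
    using eq by eventually_elim (auto simp: out indicator_def)
  then have ae: "AE x in lebesgue. indicator D x *\<^sub>R f x = h x" by (rule AE_completion)
  have "(LINT x|lebesgue_on D. f x) = (LINT x|lebesgue. indicator D x *\<^sub>R f x)"
    by (rule integral_restrict_space) (use D in simp)
  also have "\<dots> = (LINT x|lebesgue. h x)"
    by (rule integral_cong_AE[OF fm hm ae])
  also have "\<dots> = (LINT x|lborel. h x)" by (rule integral_completion) (use h in simp)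
  finally show ?thesis .
qed

text \<open>The argument on rays needs Borel functions on the whole space. The gradient may be
  changed on a null set, but \<open>u\<close> is only extended by zero, since its values on
  individual rays must not be altered.\<close>

lemma borel_version_weak_gradient:
  fixes u :: "real^'n \<Rightarrow> real"
  assumes D: "open D" "emeasure lborel D < \<infinity>" and p: "1 \<le> p"
    and u: "continuous_on D u" and wg: "weak_gradient D p u g"
  shows "\<exists>g'. g' \<in> borel_measurable borel \<and> (AE x in lborel. x \<in> D \<longrightarrow> g' x = g x) \<and>
    integrable lborel (\<lambda>x. norm (g' x)) \<and> (\<lambda>x. indicator D x * u x) \<in> borel_measurable borel \<and>
    (\<forall>\<phi> d\<phi> i. test_fun D \<phi> d\<phi> \<longrightarrow>
      (LINT x|lborel. (indicator D x * u x) * d\<phi> x $ i) = - (LINT x|lborel. g' x $ i * \<phi> x))"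
proof -
  have Db [measurable]: "D \<in> sets borel" using D by simp
  have gm: "(\<lambda>x. g x $ i) \<in> borel_measurable (lebesgue_on D)" for i
    using wg by (simp add: weak_gradient_def Lp_fun_def)
  have gp: "integrable (lebesgue_on D) (\<lambda>x. \<bar>g x $ i\<bar> powr p)" for i
    using wg by (simp add: weak_gradient_def Lp_fun_def)
  have "\<forall>i. \<exists>f'. f' \<in> borel_measurable borel \<and> (\<forall>x. x \<notin> D \<longrightarrow> f' x = 0) \<and> (AE x in lborel. x \<in> D \<longrightarrow> f' x = g x $ i)"
    by (intro allI borel_version_on[OF Db gm])
  from choice[OF this] obtain f' where f': "\<forall>i. f' i \<in> borel_measurable borel \<and> (\<forall>x. x \<notin> D \<longrightarrow> f' i x = 0) \<and> (AE x in lborel. x \<in> D \<longrightarrow> f' i x = g x $ i)" ..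
  have f'm [measurable]: "f' i \<in> borel_measurable borel" and f'0: "x \<notin> D \<Longrightarrow> f' i x = 0"
    and f'eq: "AE x in lborel. x \<in> D \<longrightarrow> f' i x = g x $ i" for i x using f' by auto
  define g' where "g' x = (\<chi> i. f' i x)" for x
  have g'm: "g' \<in> borel_measurable borel"
  proof -
    have "g' = (\<lambda>x. \<Sum>i\<in>UNIV. f' i x *\<^sub>R axis i 1)"
      by (auto simp: g'_def fun_eq_iff vec_eq_iff axis_def if_distrib cong: if_cong)
    also have "\<dots> \<in> borel_measurable borel" by measurable
    finally show ?thesis .
  qed
  have "AE x in lborel. \<forall>i. x \<in> D \<longrightarrow> f' i x = g x $ i"
    using f'eq by (subst AE_all_countable) auto
  then have g'eq: "AE x in lborel. x \<in> D \<longrightarrow> g' x = g x"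
    by eventually_elim (auto simp: g'_def vec_eq_iff)
  have fint: "integrable lborel (f' i)" for i
    unfolding integrable_iff_bounded
  proof
    have "(\<integral>\<^sup>+x. ennreal (norm (f' i x)) \<partial>lborel) \<le> (\<integral>\<^sup>+x. (1 + ennreal (\<bar>g x $ i\<bar> powr p)) * indicator D x \<partial>lborel)"
    proof (rule nn_integral_mono_AE)
      show "AE x in lborel. ennreal (norm (f' i x)) \<le> (1 + ennreal (\<bar>g x $ i\<bar> powr p)) * indicator D x"
        using f'eq[of i]
      proof eventually_elim
        fix x assume eq: "x \<in> D \<longrightarrow> f' i x = g x $ i"
        show "ennreal (norm (f' i x)) \<le> (1 + ennreal (\<bar>g x $ i\<bar> powr p)) * indicator D x"
        proof (cases "x \<in> D")
          case True
          have "\<bar>g x $ i\<bar> \<le> 1 + \<bar>g x $ i\<bar> powr p"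
          proof (cases "\<bar>g x $ i\<bar> \<le> 1")
            case False
            then have "\<bar>g x $ i\<bar> powr 1 \<le> \<bar>g x $ i\<bar> powr p" using p by (intro powr_mono) auto
            then show ?thesis using False by simp
          qed (simp add: add_increasing2)
          then have "ennreal \<bar>g x $ i\<bar> \<le> ennreal (1 + \<bar>g x $ i\<bar> powr p)" by (rule ennreal_leI)
          then show ?thesis using True eq by simp
        qed (simp add: f'0)
      qed
    qed
    also have "\<dots> = (\<integral>\<^sup>+x. 1 + ennreal (\<bar>g x $ i\<bar> powr p) \<partial>lebesgue_on D)"
      by (rule nn_integral_lebesgue_on_borel[OF Db, symmetric])
    also have "\<dots> = (\<integral>\<^sup>+x. 1 \<partial>lebesgue_on D) + (\<integral>\<^sup>+x. ennreal (\<bar>g x $ i\<bar> powr p) \<partial>lebesgue_on D)"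
      using gm[of i] by (intro nn_integral_add) auto
    also have "(\<integral>\<^sup>+x. 1 \<partial>lebesgue_on D) = emeasure lborel D"
      using Db by (subst nn_integral_lebesgue_on_borel) auto
    also have "emeasure lborel D + (\<integral>\<^sup>+x. ennreal (\<bar>g x $ i\<bar> powr p) \<partial>lebesgue_on D) < \<infinity>"
      using D(2) gp[of i] unfolding integrable_iff_bounded by simp
    finally show "(\<integral>\<^sup>+x. ennreal (norm (f' i x)) \<partial>lborel) < \<infinity>" .
  qed simp
  have gint: "integrable lborel (\<lambda>x. norm (g' x))"
  proof (rule Bochner_Integration.integrable_bound)
    show "integrable lborel (\<lambda>x. \<Sum>i\<in>UNIV. \<bar>f' i x\<bar>)"
      by (intro Bochner_Integration.integrable_sum integrable_abs fint)
    show "AE x in lborel. norm (norm (g' x)) \<le> norm (\<Sum>i\<in>UNIV. \<bar>f' i x\<bar>)"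
    proof (rule AE_I2)
      fix x
      have "norm (g' x) \<le> (\<Sum>i\<in>UNIV. \<bar>f' i x\<bar>)" using norm_le_l1_cart[of "g' x"] by (simp add: g'_def)
      then show "norm (norm (g' x)) \<le> norm (\<Sum>i\<in>UNIV. \<bar>f' i x\<bar>)" by simp
    qed
    show "(\<lambda>x. norm (g' x)) \<in> borel_measurable lborel" using g'm by simp
  qed
  have um: "(\<lambda>x. indicator D x * u x) \<in> borel_measurable borel"
    using borel_measurable_continuous_on_indicator[OF Db u] by simp
  show ?thesis
  proof (intro exI[of _ g'] conjI allI impI g'm g'eq gint um)
    fix \<phi> d\<phi> i assume t: "test_fun D \<phi> d\<phi>"
    have "continuous_on UNIV \<phi>" "continuous_on UNIV d\<phi>" using test_fun_bounded[OF t] by auto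
    then have m [measurable]: "\<phi> \<in> borel_measurable borel" "d\<phi> \<in> borel_measurable borel"
      by (auto intro: borel_measurable_continuous_onI)
    have m': "\<phi> \<in> borel_measurable (lebesgue_on D)" "(\<lambda>x. d\<phi> x $ i) \<in> borel_measurable (lebesgue_on D)"
      by (auto intro!: measurable_restrict_space1 measurable_completion)
    have um': "u \<in> borel_measurable (lebesgue_on D)" using wg by (simp add: weak_gradient_def Lp_fun_def)
    have "(LINT x|lebesgue_on D. u x * d\<phi> x $ i) = (LINT x|lborel. (indicator D x * u x) * d\<phi> x $ i)"
      by (rule lebesgue_on_integral_borel_version[OF Db]) (use um um' m' in auto)
    moreover have "(LINT x|lebesgue_on D. g x $ i * \<phi> x) = (LINT x|lborel. g' x $ i * \<phi> x)"
    proof (rule lebesgue_on_integral_borel_version[OF Db])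
      show "(\<lambda>x. g x $ i * \<phi> x) \<in> borel_measurable (lebesgue_on D)" using gm[of i] m' by measurable
      show "(\<lambda>x. g' x $ i * \<phi> x) \<in> borel_measurable borel" using g'm by measurable
      show "AE x in lborel. x \<in> D \<longrightarrow> g' x $ i * \<phi> x = g x $ i * \<phi> x"
        using g'eq by eventually_elim auto
    qed (simp add: g'_def f'0)
    moreover have "(LINT x|lebesgue_on D. u x * d\<phi> x $ i) = - (LINT x|lebesgue_on D. g x $ i * \<phi> x)"
      using wg t by (simp add: weak_gradient_def)
    ultimately show "(LINT x|lborel. (indicator D x * u x) * d\<phi> x $ i) = - (LINT x|lborel. g' x $ i * \<phi> x)" by simp
  qed
qed

context smooth_gauge
begin

text \<open>Countably many pairs of endpoints allow one null set of exceptional rays for all of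
  them.\<close>

lemma weak_gradient_rays_rational:
  assumes p: "1 \<le> p" and u: "continuous_on (closure {x. G (x - x0) < 1}) u" and wg: "weak_gradient {x. G (x - x0) < 1} p u g"
  shows "\<exists>g'. g' \<in> borel_measurable borel \<and> (AE x in lborel. G (x - x0) < 1 \<longrightarrow> g' x = g x) \<and>
    (AE z in lborel. \<forall>a\<in>\<rat>. \<forall>b\<in>\<rat>. 0 < a \<longrightarrow> a < b \<longrightarrow> b * G z < 1 \<longrightarrow>
      u (x0 + b *\<^sub>R z) - u (x0 + a *\<^sub>R z) = (LINT s|lborel. indicator {a..b} s * (g' (x0 + s *\<^sub>R z) \<bullet> z)))"
proof -
  let ?D = "{x. G (x - x0) < 1}"
  have D: "open ?D" by (rule open_G_less)
  have fin: "emeasure lborel ?D < \<infinity>"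
    unfolding emeasure_lborel_gauge_ball(1) using emeasure_lborel_gauge_ball(2) by simp
  have uD: "continuous_on ?D u" by (rule continuous_on_subset[OF u closure_subset])
  from borel_version_weak_gradient[OF D fin p uD wg]
  obtain g' where g': "g' \<in> borel_measurable borel \<and> (AE x in lborel. x \<in> ?D \<longrightarrow> g' x = g x) \<and>
    integrable lborel (\<lambda>x. norm (g' x)) \<and> (\<lambda>x. indicator ?D x * u x) \<in> borel_measurable borel \<and>
    (\<forall>\<phi> d\<phi> i. test_fun ?D \<phi> d\<phi> \<longrightarrow>
      (LINT x|lborel. (indicator ?D x * u x) * d\<phi> x $ i) = - (LINT x|lborel. g' x $ i * \<phi> x))" ..
  have bd: "bounded (closure ?D)"
    unfolding closure_G_less
  proof (rule boundedI[where B = "norm x0 + 1 / m"])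
    fix x assume "x \<in> {x. G (x - x0) \<le> 1}"
    then have "m * norm (x - x0) \<le> 1" using lower[of "x - x0"] by simp
    then have "norm (x - x0) \<le> 1 / m" using m_pos by (simp add: field_simps)
    then show "norm x \<le> norm x0 + 1 / m" using norm_triangle_sub[of x x0] by linarith
  qed
  then have cmp: "compact (closure ?D)" by (simp add: compact_eq_bounded_closed)
  have "bounded (u ` closure ?D)" by (rule compact_imp_bounded[OF compact_continuous_image[OF u cmp]])
  then obtain B where B: "0 < B" "\<And>x. x \<in> closure ?D \<Longrightarrow> \<bar>u x\<bar> \<le> B" unfolding bounded_pos by auto
  have ray: "AE z in lborel. x0 + b *\<^sub>R z \<in> ?D \<longrightarrow>
    indicator ?D (x0 + b *\<^sub>R z) * u (x0 + b *\<^sub>R z) - indicator ?D (x0 + a *\<^sub>R z) * u (x0 + a *\<^sub>R z)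
      = (LINT s|lborel. indicator {a..b} s * (g' (x0 + s *\<^sub>R z) \<bullet> z))" if "0 < a" "a < b" for a b
  proof (rule weak_gradient_along_rays[OF D _ _ _ _ _ _ _ that])
    show "bounded ?D" by (rule bounded_subset[OF bd closure_subset])
    show "x0 + t *\<^sub>R z \<in> ?D" if "x0 + z \<in> ?D" "0 \<le> t" "t \<le> 1" for z t
    proof -
      have "t * G z \<le> 1 * G z" using that G_nonneg[of z] by (intro mult_right_mono) auto
      then show ?thesis using that by (simp add: hom)
    qed
    show "\<bar>indicator ?D x * u x\<bar> \<le> B" for x
      using B(2)[of x] B(1) closure_subset[of ?D] by (cases "x \<in> ?D") (auto simp del: mem_Collect_eq)
  qed (use g' in auto)
  have "AE z in lborel. \<forall>a\<in>\<rat>. \<forall>b\<in>\<rat>. 0 < a \<longrightarrow> a < b \<longrightarrow> x0 + b *\<^sub>R z \<in> ?D \<longrightarrow>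
    indicator ?D (x0 + b *\<^sub>R z) * u (x0 + b *\<^sub>R z) - indicator ?D (x0 + a *\<^sub>R z) * u (x0 + a *\<^sub>R z)
      = (LINT s|lborel. indicator {a..b} s * (g' (x0 + s *\<^sub>R z) \<bullet> z))"
    unfolding AE_ball_countable[OF countable_rat]
  proof (intro ballI)
    fix a b :: real
    show "AE z in lborel. 0 < a \<longrightarrow> a < b \<longrightarrow> x0 + b *\<^sub>R z \<in> ?D \<longrightarrow>
      indicator ?D (x0 + b *\<^sub>R z) * u (x0 + b *\<^sub>R z) - indicator ?D (x0 + a *\<^sub>R z) * u (x0 + a *\<^sub>R z)
      = (LINT s|lborel. indicator {a..b} s * (g' (x0 + s *\<^sub>R z) \<bullet> z))"
      using ray[of a b] by (cases "0 < a \<and> a < b") auto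
  qed
  then have "AE z in lborel. \<forall>a\<in>\<rat>. \<forall>b\<in>\<rat>. 0 < a \<longrightarrow> a < b \<longrightarrow> b * G z < 1 \<longrightarrow>
      u (x0 + b *\<^sub>R z) - u (x0 + a *\<^sub>R z) = (LINT s|lborel. indicator {a..b} s * (g' (x0 + s *\<^sub>R z) \<bullet> z))"
  proof eventually_elim
    fix z
    assume *: "\<forall>a\<in>\<rat>. \<forall>b\<in>\<rat>. 0 < a \<longrightarrow> a < b \<longrightarrow> x0 + b *\<^sub>R z \<in> ?D \<longrightarrow>
    indicator ?D (x0 + b *\<^sub>R z) * u (x0 + b *\<^sub>R z) - indicator ?D (x0 + a *\<^sub>R z) * u (x0 + a *\<^sub>R z)
      = (LINT s|lborel. indicator {a..b} s * (g' (x0 + s *\<^sub>R z) \<bullet> z))"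
    show "\<forall>a\<in>\<rat>. \<forall>b\<in>\<rat>. 0 < a \<longrightarrow> a < b \<longrightarrow> b * G z < 1 \<longrightarrow>
      u (x0 + b *\<^sub>R z) - u (x0 + a *\<^sub>R z) = (LINT s|lborel. indicator {a..b} s * (g' (x0 + s *\<^sub>R z) \<bullet> z))"
    proof (intro ballI impI)
      fix a b :: real assume ab: "a \<in> \<rat>" "b \<in> \<rat>" "0 < a" "a < b" "b * G z < 1"
      have "a * G z \<le> b * G z" using ab G_nonneg[of z] by (intro mult_right_mono) auto
      then have in_D: "x0 + b *\<^sub>R z \<in> ?D" "x0 + a *\<^sub>R z \<in> ?D" using ab by (simp_all add: hom)
      show "u (x0 + b *\<^sub>R z) - u (x0 + a *\<^sub>R z) = (LINT s|lborel. indicator {a..b} s * (g' (x0 + s *\<^sub>R z) \<bullet> z))"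
        using *[rule_format, OF ab(1-4) in_D(1)] unfolding indicator_simps(1)[OF in_D(1)] indicator_simps(1)[OF in_D(2)] by simp
    qed
  qed
  moreover have "AE x in lborel. G (x - x0) < 1 \<longrightarrow> g' x = g x" using g' by simp
  ultimately show ?thesis using g' by blast
qed

text \<open>The ray is parametrised by the gauge, so that it reaches the boundary at t = 1.\<close>

lemma ray_profile:
  assumes p: "1 \<le> p" and u: "continuous_on (closure {x. G (x - x0) < 1}) u"
    and g [measurable]: "g \<in> borel_measurable borel" and z: "z \<noteq> 0"
    and ftc: "\<And>a b. a \<in> \<rat> \<Longrightarrow> b \<in> \<rat> \<Longrightarrow> 0 < a \<Longrightarrow> a < b \<Longrightarrow> b * G z < 1 \<Longrightarrow>
      u (x0 + b *\<^sub>R z) - u (x0 + a *\<^sub>R z) = (LINT s|lborel. indicator {a..b} s * (g (x0 + s *\<^sub>R z) \<bullet> z))"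
    and E: "(\<integral>\<^sup>+t. ennreal (t ^ k * \<bar>g (x0 + (t / G z) *\<^sub>R z) \<bullet> ((1 / G z) *\<^sub>R z)\<bar> powr p) * indicator {0<..<1} t \<partial>lborel) = ennreal E"
    and mass: "L < (LINT t|lborel. indicator {0<..<1} t * (t ^ k * \<bar>u (x0 + (t / G z) *\<^sub>R z)\<bar> powr p))"
  shows "\<exists>W W'. smooth_profile W W' \<and> W 1 = u (x0 + (1 / G z) *\<^sub>R z) \<and>
    (\<integral>\<^sup>+t. ennreal (t ^ k * \<bar>W' t\<bar> powr p) * indicator {0<..<1} t \<partial>lborel) \<le> ennreal E \<and>
    L < (LINT t|lborel. indicator {0<..<1} t * (t ^ k * \<bar>W t\<bar> powr p))"
proof -
  have Gz: "0 < G z" by (rule G_pos[OF z])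
  define w where "w t = u (x0 + (t / G z) *\<^sub>R z)" for t
  define h where "h t = g (x0 + (t / G z) *\<^sub>R z) \<bullet> ((1 / G z) *\<^sub>R z)" for t
  have "\<exists>W W'. smooth_profile W W' \<and> W 1 = w 1 \<and>
    (\<integral>\<^sup>+t. ennreal (t ^ k * \<bar>W' t\<bar> powr p) * indicator {0<..<1} t \<partial>lborel) \<le> ennreal E \<and>
    L < (LINT t|lborel. indicator {0<..<1} t * (t ^ k * \<bar>W t\<bar> powr p))"
  proof (rule smooth_profile_approximation[OF _ _ p])
    show "continuous_on {0..1} w"
      unfolding w_def[abs_def]
    proof (rule continuous_on_compose2[OF u])
      show "continuous_on {0..1} (\<lambda>t. x0 + (t / G z) *\<^sub>R z)" using Gz by (intro continuous_intros) auto
      show "(\<lambda>t. x0 + (t / G z) *\<^sub>R z) ` {0..1} \<subseteq> closure {x. G (x - x0) < 1}"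
        unfolding closure_G_less using G_ray[OF z] by auto
    qed
    show "h \<in> borel_measurable borel" unfolding h_def[abs_def] by measurable
    show "(\<integral>\<^sup>+t. ennreal (t ^ k * \<bar>h t\<bar> powr p) * indicator {0<..<1} t \<partial>lborel) = ennreal E"
      using E by (simp only: h_def)
    show "L < (LINT t|lborel. indicator {0<..<1} t * (t ^ k * \<bar>w t\<bar> powr p))"
      using mass by (simp only: w_def)
    \<comment> \<open>Under this parametrisation the rational endpoints become multiples of
      \<open>G z\<close>, which are still dense.\<close>
    show "closure ((*\<^sub>R) (G z) ` \<rat>) = (UNIV :: real set)"
    proof -
      have "closure ((*\<^sub>R) (G z) ` \<rat>) = (*\<^sub>R) (G z) ` (UNIV :: real set)"
        by (simp only: closure_scaleR[symmetric] Rats_closure_real)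
      also have "\<dots> = UNIV" using Gz by (intro surjI[of _ "\<lambda>x. x / G z"]) simp
      finally show ?thesis .
    qed
    fix a b :: real assume "a \<in> (*\<^sub>R) (G z) ` \<rat>" "b \<in> (*\<^sub>R) (G z) ` \<rat>" and ab: "0 < a" "a < b" "b < 1"
    then obtain a' b' where ab': "a' \<in> \<rat>" "b' \<in> \<rat>" "a = G z * a'" "b = G z * b'" by auto
    have pos: "0 < a'" "a' < b'" "b' * G z < 1" using ab ab' Gz by (auto simp: zero_less_mult_iff mult.commute)
    have "w b - w a = u (x0 + b' *\<^sub>R z) - u (x0 + a' *\<^sub>R z)"
      using ab' Gz by (simp add: w_def)
    also have "\<dots> = (LINT s|lborel. indicator {a'..b'} s * (g (x0 + s *\<^sub>R z) \<bullet> z))"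
      by (rule ftc[OF ab'(1,2) pos])
    also have "\<dots> = \<bar>1 / G z\<bar> *\<^sub>R (LINT s|lborel. indicator {a'..b'} (0 + (1 / G z) * s) * (g (x0 + (0 + (1 / G z) * s) *\<^sub>R z) \<bullet> z))"
      by (rule lborel_integral_real_affine) (use Gz in simp)
    also have "\<dots> = (LINT s|lborel. (1 / G z) * (indicator {a'..b'} (s / G z) * (g (x0 + (s / G z) *\<^sub>R z) \<bullet> z)))"
      using Gz by (subst integral_mult_right_zero) simp
    also have "\<dots> = (LINT s|lborel. indicator {a..b} s * h s)"
    proof (rule Bochner_Integration.integral_cong[OF refl])
      fix s
      have "indicator {a'..b'} (s / G z) = (indicator {a..b} s :: real)"
        using Gz ab' by (auto simp: indicator_def field_simps)
      then show "(1 / G z) * (indicator {a'..b'} (s / G z) * (g (x0 + (s / G z) *\<^sub>R z) \<bullet> z)) = indicator {a..b} s * h s"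
        by (simp add: h_def)
    qed
    finally show "w b - w a = (LINT t|lborel. indicator {a..b} t * h t)" .
  qed
  then show ?thesis by (simp only: w_def)
qed

text \<open>If almost every ray satisfied the reverse inequality, integration over directions would
  contradict \<open>ineq\<close>. The set of good rays is therefore not null and meets the full set
  of rays on which the integral formula holds. The strict inequality on the chosen ray absorbs the
  smoothing.\<close>

lemma profile_of_competitor:
  assumes p: "1 \<le> p" and F0: "\<And>\<xi>. 0 \<le> F \<xi>" and Fhom: "\<And>t \<xi>. F (t *\<^sub>R \<xi>) = \<bar>t\<bar> * F \<xi>"
    and Fm [measurable]: "F \<in> borel_measurable borel" and FdG: "\<And>x. x \<noteq> 0 \<Longrightarrow> F (dG x) = 1 / R" and R: "0 < R"
    and FG: "\<And>\<xi> x. \<bar>\<xi> \<bullet> x\<bar> \<le> R * F \<xi> * G x"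
    and \<beta>: "0 \<le> \<beta>" and c: "0 \<le> c" and lam: "0 < lam"
    and S: "\<And>f. f \<in> borel_measurable borel \<Longrightarrow> (\<integral>\<^sup>+x. f x \<partial>surface_measure {x. G (x - x0) < 1}) =
      (\<integral>\<^sup>+x. f (x0 + (1 / G x) *\<^sub>R x) * ennreal (c * norm (dG x)) * indicator {x. G x < 1} x \<partial>lborel)"
    and u: "continuous_on (closure {x. G (x - x0) < 1}) u" and wg: "weak_gradient {x. G (x - x0) < 1} p u g"
    and ineq: "(\<integral>\<^sup>+x. ennreal (F (g x) powr p) \<partial>lebesgue_on {x. G (x - x0) < 1})
      + ennreal \<beta> * (\<integral>\<^sup>+x. ennreal (\<bar>u x\<bar> powr p * F (outer_normal {x. G (x - x0) < 1} x)) \<partial>surface_measure {x. G (x - x0) < 1})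
      < ennreal lam * (\<integral>\<^sup>+x. ennreal (\<bar>u x\<bar> powr p) \<partial>lebesgue_on {x. G (x - x0) < 1})"
  shows "\<exists>W W' E. smooth_profile W W' \<and> 0 \<le> E \<and>
    (\<integral>\<^sup>+t. ennreal (t ^ (CARD('n) - 1) * \<bar>W' t\<bar> powr p) * indicator {0<..<1} t \<partial>lborel) \<le> ennreal E \<and>
    E * (1 / R) powr p + \<beta> * c / (real CARD('n) * R) * \<bar>W 1\<bar> powr p
      < lam * (LINT t|lborel. indicator {0<..<1} t * (t ^ (CARD('n) - 1) * \<bar>W t\<bar> powr p))"
proof -
  let ?n = "real CARD('n)" and ?D = "{x. G (x - x0) < 1}" and ?k = "CARD('n) - 1"
  have n0: "0 < ?n" by simp
  have D: "?D \<in> sets borel" using open_G_less[of x0] by simp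
  from weak_gradient_rays_rational[OF p u wg]
  obtain g' where g'm [measurable]: "g' \<in> borel_measurable borel" and g'eq: "AE x in lborel. G (x - x0) < 1 \<longrightarrow> g' x = g x"
    and rays: "AE z in lborel. \<forall>a\<in>\<rat>. \<forall>b\<in>\<rat>. 0 < a \<longrightarrow> a < b \<longrightarrow> b * G z < 1 \<longrightarrow>
      u (x0 + b *\<^sub>R z) - u (x0 + a *\<^sub>R z) = (LINT s|lborel. indicator {a..b} s * (g' (x0 + s *\<^sub>R z) \<bullet> z))"
    by auto
  \<comment> \<open>Extension by zero from the closed ball: the function becomes Borel and keeps its
    boundary values.\<close>
  define v where "v x = indicator {x. G (x - x0) \<le> 1} x * u x" for x
  have vm [measurable]: "v \<in> borel_measurable borel"
    using borel_measurable_continuous_on_indicator[OF _ u] closed_G_le[of x0]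
    by (simp add: v_def[abs_def] closure_G_less)
  \<comment> \<open>\<open>Ee\<close>, \<open>Me\<close> and \<open>Be\<close> are the energy, the
    mass and the boundary value of the restriction to the ray through x, hence functions of the
    direction only.\<close>
  define Ee where "Ee x = (\<integral>\<^sup>+t. ennreal (t ^ ?k * \<bar>g' (x0 + (t / G x) *\<^sub>R x) \<bullet> ((1 / G x) *\<^sub>R x)\<bar> powr p) * indicator {0<..<1} t \<partial>lborel)" for x
  define Me where "Me x = (\<integral>\<^sup>+t. ennreal (t ^ ?k * \<bar>v (x0 + (t / G x) *\<^sub>R x)\<bar> powr p) * indicator {0<..<1} t \<partial>lborel)" for x
  define Be where "Be x = ennreal (\<bar>v (x0 + (1 / G x) *\<^sub>R x)\<bar> powr p)" for x
  have Eem [measurable]: "Ee \<in> borel_measurable borel" unfolding Ee_def[abs_def] by measurable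
  have Mem [measurable]: "Me \<in> borel_measurable borel" unfolding Me_def[abs_def] by measurable
  have Bem [measurable]: "Be \<in> borel_measurable borel" unfolding Be_def[abs_def] by measurable
  have wt: "ennreal (?n * s ^ ?k) * ennreal y * indicator {0<..<1} s = ennreal ?n * (ennreal (s ^ ?k * y) * indicator {0<..<1} s)"
    if "0 \<le> y" for s y :: real
  proof (cases "s \<in> {0<..<1}")
    case True
    then have "0 \<le> s ^ ?k" by simp
    then show ?thesis using that by (simp add: ennreal_mult mult.assoc)
  qed simp
  have pol: "(\<integral>\<^sup>+x. ennreal (f x) * indicator ?D x \<partial>lborel) =
    (\<integral>\<^sup>+x. ennreal ?n * (\<integral>\<^sup>+t. ennreal (t ^ ?k * f (x0 + (t / G x) *\<^sub>R x)) * indicator {0<..<1} t \<partial>lborel) * indicator {x. G x < 1} x \<partial>lborel)"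
    if f [measurable]: "f \<in> borel_measurable borel" and f0: "\<And>x. 0 \<le> f x" for f :: "real^'n \<Rightarrow> real"
  proof -
    have "(\<integral>\<^sup>+x. ennreal (f x) * indicator ?D x \<partial>lborel) = (\<integral>\<^sup>+x. ennreal (f (x0 + x)) * indicator {x. G x < 1} x \<partial>lborel)"
      by (rule nn_integral_shift) measurable
    also have "\<dots> = (\<integral>\<^sup>+x. (\<integral>\<^sup>+s. ennreal (?n * s ^ ?k) * ennreal (f (x0 + (s / G x) *\<^sub>R x)) * indicator {0<..<1} s \<partial>lborel)
        * indicator {x. G x < 1} x \<partial>lborel)"
      by (rule polar_formula) measurable
    also have "\<dots> = (\<integral>\<^sup>+x. ennreal ?n * (\<integral>\<^sup>+t. ennreal (t ^ ?k * f (x0 + (t / G x) *\<^sub>R x)) * indicator {0<..<1} t \<partial>lborel) * indicator {x. G x < 1} x \<partial>lborel)"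
    proof (rule nn_integral_cong)
      fix x
      have "(\<integral>\<^sup>+s. ennreal (?n * s ^ ?k) * ennreal (f (x0 + (s / G x) *\<^sub>R x)) * indicator {0<..<1} s \<partial>lborel)
        = (\<integral>\<^sup>+s. ennreal ?n * (ennreal (s ^ ?k * f (x0 + (s / G x) *\<^sub>R x)) * indicator {0<..<1} s) \<partial>lborel)"
        by (intro nn_integral_cong wt f0)
      also have "\<dots> = ennreal ?n * (\<integral>\<^sup>+t. ennreal (t ^ ?k * f (x0 + (t / G x) *\<^sub>R x)) * indicator {0<..<1} t \<partial>lborel)"
        by (rule nn_integral_cmult) measurable
      finally show "(\<integral>\<^sup>+s. ennreal (?n * s ^ ?k) * ennreal (f (x0 + (s / G x) *\<^sub>R x)) * indicator {0<..<1} s \<partial>lborel) * indicator {x. G x < 1} x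
        = ennreal ?n * (\<integral>\<^sup>+t. ennreal (t ^ ?k * f (x0 + (t / G x) *\<^sub>R x)) * indicator {0<..<1} t \<partial>lborel) * indicator {x. G x < 1} x"
        by (simp only:)
    qed
    finally show ?thesis .
  qed
  \<comment> \<open>The only estimate among the three: by \<open>FG\<close> just the component of
    the gradient along the ray is kept. Boundary term and mass are exact.\<close>
  have N1: "(\<integral>\<^sup>+x. ennreal ?n * (ennreal ((1 / R) powr p) * Ee x) * indicator {x. G x < 1} x \<partial>lborel)
    \<le> (\<integral>\<^sup>+x. ennreal (F (g x) powr p) \<partial>lebesgue_on ?D)"
  proof -
    have "(\<integral>\<^sup>+x. ennreal ?n * (ennreal ((1 / R) powr p) * Ee x) * indicator {x. G x < 1} x \<partial>lborel)
      \<le> (\<integral>\<^sup>+x. ennreal ?n * (\<integral>\<^sup>+t. ennreal (t ^ ?k * F (g' (x0 + (t / G x) *\<^sub>R x)) powr p) * indicator {0<..<1} t \<partial>lborel) * indicator {x. G x < 1} x \<partial>lborel)"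
    proof (rule nn_integral_mono_AE, rule AE_mp[OF AE_lborel_singleton[of 0]], intro AE_I2 impI mult_right_mono mult_left_mono)
      fix x :: "real^'n" assume x: "x \<noteq> 0"
      have Gx: "0 < G x" by (rule G_pos[OF x])
      have "ennreal ((1 / R) powr p) * Ee x = (\<integral>\<^sup>+t. ennreal ((1 / R) powr p) * (ennreal (t ^ ?k * \<bar>g' (x0 + (t / G x) *\<^sub>R x) \<bullet> ((1 / G x) *\<^sub>R x)\<bar> powr p) * indicator {0<..<1} t) \<partial>lborel)"
        unfolding Ee_def by (rule nn_integral_cmult[symmetric]) measurable
      also have "\<dots> \<le> (\<integral>\<^sup>+t. ennreal (t ^ ?k * F (g' (x0 + (t / G x) *\<^sub>R x)) powr p) * indicator {0<..<1} t \<partial>lborel)"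
      proof (rule nn_integral_mono)
        fix t :: real
        show "ennreal ((1 / R) powr p) * (ennreal (t ^ ?k * \<bar>g' (x0 + (t / G x) *\<^sub>R x) \<bullet> ((1 / G x) *\<^sub>R x)\<bar> powr p) * indicator {0<..<1} t)
          \<le> ennreal (t ^ ?k * F (g' (x0 + (t / G x) *\<^sub>R x)) powr p) * indicator {0<..<1} t"
        proof (cases "t \<in> {0<..<1}")
          case True
          define a where "a = \<bar>g' (x0 + (t / G x) *\<^sub>R x) \<bullet> ((1 / G x) *\<^sub>R x)\<bar>"
          define b where "b = F (g' (x0 + (t / G x) *\<^sub>R x))"
          have "a \<le> R * b * G ((1 / G x) *\<^sub>R x)" unfolding a_def b_def by (rule FG)
          also have "\<dots> = R * b" using G_ray[OF x, of 1] by simp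
          finally have "(1 / R) * a \<le> b" using R by (simp add: field_simps)
          then have "((1 / R) * a) powr p \<le> b powr p" using R p by (intro powr_mono2) (auto simp: a_def)
          then have "(1 / R) powr p * a powr p \<le> b powr p" by (simp only: powr_mult)
          then have "t ^ ?k * ((1 / R) powr p * a powr p) \<le> t ^ ?k * b powr p" using True by (intro mult_left_mono) auto
          then have "ennreal ((1 / R) powr p * (t ^ ?k * a powr p)) \<le> ennreal (t ^ ?k * b powr p)"
            by (intro ennreal_leI) (simp only: mult.left_commute)
          moreover have "ennreal ((1 / R) powr p) * ennreal (t ^ ?k * a powr p) = ennreal ((1 / R) powr p * (t ^ ?k * a powr p))"
            using True by (intro ennreal_mult[symmetric]) auto
          ultimately show ?thesis using True by (simp add: a_def b_def)
        qed simp
      qed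
      finally show "ennreal ((1 / R) powr p) * Ee x \<le> (\<integral>\<^sup>+t. ennreal (t ^ ?k * F (g' (x0 + (t / G x) *\<^sub>R x)) powr p) * indicator {0<..<1} t \<partial>lborel)" .
    qed auto
    also have "\<dots> = (\<integral>\<^sup>+x. ennreal (F (g' x) powr p) * indicator ?D x \<partial>lborel)"
      by (rule pol[symmetric]) auto
    also have "\<dots> = (\<integral>\<^sup>+x. ennreal (F (g x) powr p) * indicator ?D x \<partial>lborel)"
      by (rule nn_integral_cong_AE) (use g'eq in \<open>eventually_elim, auto simp: indicator_def\<close>)
    also have "\<dots> = (\<integral>\<^sup>+x. ennreal (F (g x) powr p) \<partial>lebesgue_on ?D)"
      by (rule nn_integral_lebesgue_on_borel[OF D, symmetric])
    finally show ?thesis .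
  qed
  have N2: "(\<integral>\<^sup>+x. ennreal (c / R) * Be x * indicator {x. G x < 1} x \<partial>lborel)
    = (\<integral>\<^sup>+x. ennreal (\<bar>u x\<bar> powr p * F (outer_normal ?D x)) \<partial>surface_measure ?D)"
  proof -
    let ?N = "\<lambda>x. (1 / norm (dG (x - x0))) *\<^sub>R dG (x - x0)"
    have "(\<integral>\<^sup>+x. ennreal (\<bar>u x\<bar> powr p * F (outer_normal ?D x)) \<partial>surface_measure ?D)
      = (\<integral>\<^sup>+x. ennreal (\<bar>v x\<bar> powr p * F (?N x)) \<partial>surface_measure ?D)"
    proof (rule nn_integral_cong)
      fix x assume "x \<in> space (surface_measure ?D)"
      then have x: "G (x - x0) = 1" by (simp add: surface_measure_def space_restrict_space frontier_G_less)
      then have "v x = u x" by (simp add: v_def)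
      then show "ennreal (\<bar>u x\<bar> powr p * F (outer_normal ?D x)) = ennreal (\<bar>v x\<bar> powr p * F (?N x))"
        by (simp only: outer_normal_eq[OF x])
    qed
    also have "\<dots> = (\<integral>\<^sup>+x. ennreal (\<bar>v (x0 + (1 / G x) *\<^sub>R x)\<bar> powr p * F (?N (x0 + (1 / G x) *\<^sub>R x))) * ennreal (c * norm (dG x)) * indicator {x. G x < 1} x \<partial>lborel)"
      by (rule S) measurable
    also have "\<dots> = (\<integral>\<^sup>+x. ennreal (c / R) * Be x * indicator {x. G x < 1} x \<partial>lborel)"
    proof (rule nn_integral_cong_AE, rule AE_mp[OF AE_lborel_singleton[of 0]], intro AE_I2 impI)
      fix x :: "real^'n" assume x: "x \<noteq> 0"
      have q: "norm (dG x) > 0" using dG_nonzero[OF x] by simp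
      define a where "a = \<bar>v (x0 + (1 / G x) *\<^sub>R x)\<bar> powr p"
      define b where "b = F (?N (x0 + (1 / G x) *\<^sub>R x))"
      have eq: "b * norm (dG x) = F (dG x)"
        unfolding b_def using q G_pos[OF x] by (simp add: dG_scale Fhom)
      have "a * b * (c * norm (dG x)) = c * a * (b * norm (dG x))" by (simp only: mult_ac)
      also have "\<dots> = c / R * a" unfolding eq FdG[OF x] by simp
      finally have "ennreal (a * b) * ennreal (c * norm (dG x)) = ennreal (c / R * a)"
        using F0 c by (subst ennreal_mult[symmetric]) (auto simp: a_def b_def)
      also have "\<dots> = ennreal (c / R) * ennreal a" using c R by (intro ennreal_mult) (auto simp: a_def)
      finally show "ennreal (\<bar>v (x0 + (1 / G x) *\<^sub>R x)\<bar> powr p * F (?N (x0 + (1 / G x) *\<^sub>R x))) * ennreal (c * norm (dG x)) * indicator {x. G x < 1} x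
        = ennreal (c / R) * Be x * indicator {x. G x < 1} x"
        unfolding a_def b_def Be_def by (simp only:)
    qed
    finally show ?thesis by simp
  qed
  have N3: "(\<integral>\<^sup>+x. ennreal (\<bar>u x\<bar> powr p) \<partial>lebesgue_on ?D) = (\<integral>\<^sup>+x. ennreal ?n * Me x * indicator {x. G x < 1} x \<partial>lborel)"
  proof -
    have "(\<integral>\<^sup>+x. ennreal (\<bar>u x\<bar> powr p) \<partial>lebesgue_on ?D) = (\<integral>\<^sup>+x. ennreal (\<bar>u x\<bar> powr p) * indicator ?D x \<partial>lborel)"
      by (rule nn_integral_lebesgue_on_borel[OF D])
    also have "\<dots> = (\<integral>\<^sup>+x. ennreal (\<bar>v x\<bar> powr p) * indicator ?D x \<partial>lborel)"
      by (rule nn_integral_cong) (auto simp: v_def indicator_def)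
    also have "\<dots> = (\<integral>\<^sup>+x. ennreal ?n * Me x * indicator {x. G x < 1} x \<partial>lborel)"
      unfolding Me_def by (rule pol) auto
    finally show ?thesis .
  qed
  let ?P = "\<lambda>x. ennreal ?n * (ennreal ((1 / R) powr p) * Ee x) + ennreal \<beta> * (ennreal (c / R) * Be x)"
  \<comment> \<open>The failure is stated almost everywhere, so that a bad null set of rays can be
    avoided when z is chosen.\<close>
  have "\<not> (AE x in lborel. G x < 1 \<longrightarrow> ennreal lam * (ennreal ?n * Me x) \<le> ?P x)"
  proof
    assume A: "AE x in lborel. G x < 1 \<longrightarrow> ennreal lam * (ennreal ?n * Me x) \<le> ?P x"
    have "ennreal lam * (\<integral>\<^sup>+x. ennreal (\<bar>u x\<bar> powr p) \<partial>lebesgue_on ?D)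
       = (\<integral>\<^sup>+x. ennreal lam * (ennreal ?n * Me x * indicator {x. G x < 1} x) \<partial>lborel)"
      unfolding N3 by (rule nn_integral_cmult[symmetric]) measurable
    also have "\<dots> \<le> (\<integral>\<^sup>+x. ennreal ?n * (ennreal ((1 / R) powr p) * Ee x) * indicator {x. G x < 1} x
        + ennreal \<beta> * (ennreal (c / R) * Be x * indicator {x. G x < 1} x) \<partial>lborel)"
      by (rule nn_integral_mono_AE) (use A in \<open>eventually_elim, auto simp: indicator_def mult.assoc\<close>)
    also have "\<dots> = (\<integral>\<^sup>+x. ennreal ?n * (ennreal ((1 / R) powr p) * Ee x) * indicator {x. G x < 1} x \<partial>lborel)
       + ennreal \<beta> * (\<integral>\<^sup>+x. ennreal (c / R) * Be x * indicator {x. G x < 1} x \<partial>lborel)"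
      by (subst nn_integral_add, measurable, subst nn_integral_cmult, measurable)
    also have "\<dots> \<le> (\<integral>\<^sup>+x. ennreal (F (g x) powr p) \<partial>lebesgue_on ?D)
      + ennreal \<beta> * (\<integral>\<^sup>+x. ennreal (\<bar>u x\<bar> powr p * F (outer_normal ?D x)) \<partial>surface_measure ?D)"
      unfolding N2 by (intro add_mono N1 order_refl)
    finally show False using ineq by simp
  qed
  moreover have ae: "AE z in lborel. z \<noteq> 0 \<and> (\<forall>a\<in>\<rat>. \<forall>b\<in>\<rat>. 0 < a \<longrightarrow> a < b \<longrightarrow> b * G z < 1 \<longrightarrow>
      u (x0 + b *\<^sub>R z) - u (x0 + a *\<^sub>R z) = (LINT s|lborel. indicator {a..b} s * (g' (x0 + s *\<^sub>R z) \<bullet> z)))"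
    using rays AE_lborel_singleton[of "0::real^'n"] by eventually_elim simp
  ultimately obtain z where z: "z \<noteq> 0" "G z < 1" "?P z < ennreal lam * (ennreal ?n * Me z)"
    and ftc: "\<forall>a\<in>\<rat>. \<forall>b\<in>\<rat>. 0 < a \<longrightarrow> a < b \<longrightarrow> b * G z < 1 \<longrightarrow>
      u (x0 + b *\<^sub>R z) - u (x0 + a *\<^sub>R z) = (LINT s|lborel. indicator {a..b} s * (g' (x0 + s *\<^sub>R z) \<bullet> z))"
  proof -
    assume nA: "\<not> (AE x in lborel. G x < 1 \<longrightarrow> ennreal lam * (ennreal ?n * Me x) \<le> ?P x)"
    assume *: "\<And>z. z \<noteq> 0 \<Longrightarrow> G z < 1 \<Longrightarrow> ?P z < ennreal lam * (ennreal ?n * Me z) \<Longrightarrow>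
      \<forall>a\<in>\<rat>. \<forall>b\<in>\<rat>. 0 < a \<longrightarrow> a < b \<longrightarrow> b * G z < 1 \<longrightarrow>
      u (x0 + b *\<^sub>R z) - u (x0 + a *\<^sub>R z) = (LINT s|lborel. indicator {a..b} s * (g' (x0 + s *\<^sub>R z) \<bullet> z)) \<Longrightarrow> thesis"
    show thesis
    proof (rule ccontr)
      assume "\<not> thesis"
      have "AE x in lborel. G x < 1 \<longrightarrow> ennreal lam * (ennreal ?n * Me x) \<le> ?P x"
        using ae
      proof eventually_elim
        fix x assume x: "x \<noteq> 0 \<and> (\<forall>a\<in>\<rat>. \<forall>b\<in>\<rat>. 0 < a \<longrightarrow> a < b \<longrightarrow> b * G x < 1 \<longrightarrow>
          u (x0 + b *\<^sub>R x) - u (x0 + a *\<^sub>R x) = (LINT s|lborel. indicator {a..b} s * (g' (x0 + s *\<^sub>R x) \<bullet> x)))"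
        show "G x < 1 \<longrightarrow> ennreal lam * (ennreal ?n * Me x) \<le> ?P x"
        proof (rule impI, rule ccontr)
          assume "G x < 1" "\<not> ennreal lam * (ennreal ?n * Me x) \<le> ?P x"
          then have "?P x < ennreal lam * (ennreal ?n * Me x)" by simp
          from *[OF conjunct1[OF x] \<open>G x < 1\<close> this conjunct2[OF x]] \<open>\<not> thesis\<close> show False by simp
        qed
      qed
      with nA show False by simp
    qed
  qed
  have Gz: "0 < G z" by (rule G_pos[OF z(1)])
  define b where "b = \<bar>u (x0 + (1 / G z) *\<^sub>R z)\<bar> powr p"
  have in_cl: "x0 + (t / G z) *\<^sub>R z \<in> {x. G (x - x0) \<le> 1}" if "t \<in> {0..1}" for t
    using G_ray[OF z(1), of t] that by simp
  have vu: "v (x0 + (t / G z) *\<^sub>R z) = u (x0 + (t / G z) *\<^sub>R z)" if "t \<in> {0..1}" for t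
    using in_cl[OF that] by (simp add: v_def)
  have Bz: "Be z = ennreal b" using vu[of 1] by (simp add: Be_def b_def)
  obtain B where B: "0 < B" "\<And>t. t \<in> {0..1} \<Longrightarrow> \<bar>u (x0 + (t / G z) *\<^sub>R z)\<bar> \<le> B"
  proof -
    have "continuous_on {0..1} (\<lambda>t. u (x0 + (t / G z) *\<^sub>R z))"
    proof (rule continuous_on_compose2[OF u])
      show "continuous_on {0..1} (\<lambda>t. x0 + (t / G z) *\<^sub>R z)" using Gz by (intro continuous_intros) auto
      show "(\<lambda>t. x0 + (t / G z) *\<^sub>R z) ` {0..1} \<subseteq> closure ?D"
        unfolding closure_G_less using in_cl by blast
    qed
    from compact_imp_bounded[OF compact_continuous_image[OF this compact_Icc]]
    show ?thesis using that unfolding bounded_pos by auto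
  qed
  have Mint: "integrable lborel (\<lambda>t. indicator {0<..<1} t * (t ^ ?k * \<bar>v (x0 + (t / G z) *\<^sub>R z)\<bar> powr p))"
  proof (rule integrable_lborel_bounded_support[where C = "B powr p" and r = 1])
    show "(\<lambda>t. indicator {0<..<1} t * (t ^ ?k * \<bar>v (x0 + (t / G z) *\<^sub>R z)\<bar> powr p)) \<in> borel_measurable borel" by measurable
    show "\<bar>indicator {0<..<1} t * (t ^ ?k * \<bar>v (x0 + (t / G z) *\<^sub>R z)\<bar> powr p)\<bar> \<le> B powr p * indicator (cball 0 1) t" for t :: real
    proof (cases "t \<in> {0<..<1}")
      case True
      then have "t ^ ?k * \<bar>v (x0 + (t / G z) *\<^sub>R z)\<bar> powr p \<le> 1 * B powr p"
        using B(2)[of t] vu[of t] p by (intro mult_mono power_le_one powr_mono2) auto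
      then show ?thesis using True by (simp add: abs_mult)
    qed simp
  qed
  define M where "M = (LINT t|lborel. indicator {0<..<1} t * (t ^ ?k * \<bar>u (x0 + (t / G z) *\<^sub>R z)\<bar> powr p))"
  have Meq: "M = (LINT t|lborel. indicator {0<..<1} t * (t ^ ?k * \<bar>v (x0 + (t / G z) *\<^sub>R z)\<bar> powr p))"
    unfolding M_def by (intro Bochner_Integration.integral_cong refl) (use vu in \<open>auto simp: indicator_def\<close>)
  have Mz: "Me z = ennreal M"
  proof -
    have "Me z = (\<integral>\<^sup>+t. ennreal (indicator {0<..<1} t * (t ^ ?k * \<bar>v (x0 + (t / G z) *\<^sub>R z)\<bar> powr p)) \<partial>lborel)"
      unfolding Me_def by (intro nn_integral_cong) (auto simp: indicator_def)
    also have "\<dots> = ennreal M"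
      unfolding Meq by (rule nn_integral_eq_integral[OF Mint]) (auto intro!: AE_I2 simp: indicator_def)
    finally show ?thesis .
  qed
  have M0: "0 \<le> M" unfolding M_def by (rule Bochner_Integration.integral_nonneg) (auto simp: indicator_def)
  \<comment> \<open>Infinite energy on the ray would contradict the strict upper bound on
    \<open>?P z\<close>.\<close>
  have "Ee z \<noteq> \<infinity>"
  proof
    assume "Ee z = \<infinity>"
    then have "ennreal ?n * (ennreal ((1 / R) powr p) * Ee z) = top" using R n0 by (simp add: ennreal_mult_eq_top_iff)
    then have "?P z = top" by (simp only: add_top_left_ennreal)
    then have "top < ennreal lam * (ennreal ?n * Me z)" using z(3) by (simp only:)
    then show False using top.not_eq_extremum by (metis top_greatest leD)
  qed
  then obtain E where E: "Ee z = ennreal E" "0 \<le> E" by (cases "Ee z") auto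
  have b0: "0 \<le> b" by (simp add: b_def)
  have Peq: "?P z = ennreal (?n * ((1 / R) powr p * E) + \<beta> * (c / R * b))"
    unfolding E(1) Bz using E(2) b0 \<beta> c R by (simp only: ennreal_mult' ennreal_plus n0[THEN less_imp_le]
      divide_nonneg_pos mult_nonneg_nonneg powr_ge_zero)
  have "ennreal (?n * ((1 / R) powr p * E) + \<beta> * (c / R * b)) < ennreal (lam * (?n * M))"
    using z(3) unfolding Peq Mz using lam M0 by (simp add: ennreal_mult)
  then have real_ineq: "?n * ((1 / R) powr p * E) + \<beta> * (c / R * b) < lam * (?n * M)"
    using E(2) b0 \<beta> c R by (subst (asm) ennreal_less_iff) auto
  define A where "A = E * (1 / R) powr p + \<beta> * c / (?n * R) * b"
  have "?n * A = ?n * ((1 / R) powr p * E) + \<beta> * (c / R * b)"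
    using n0 R by (simp add: A_def field_simps)
  then have "?n * A < ?n * (lam * M)" using real_ineq by (simp add: mult.left_commute)
  then have "A < lam * M" using n0 by (simp only: mult_less_cancel_left_pos)
  \<comment> \<open>The numerator of the ray divided by lam is the mass that the smooth profile
    still has to exceed; it serves as the bound \<open>L\<close> of the approximation.\<close>
  then have mass: "A / lam < M" using lam by (simp add: pos_divide_less_eq mult.commute)
  have "\<exists>W W'. smooth_profile W W' \<and> W 1 = u (x0 + (1 / G z) *\<^sub>R z) \<and>
    (\<integral>\<^sup>+t. ennreal (t ^ ?k * \<bar>W' t\<bar> powr p) * indicator {0<..<1} t \<partial>lborel) \<le> ennreal E \<and>
    A / lam < (LINT t|lborel. indicator {0<..<1} t * (t ^ ?k * \<bar>W t\<bar> powr p))"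
    by (rule ray_profile[OF p u g'm z(1) _ _ mass[unfolded M_def]]) (use ftc E(1) in \<open>auto simp: Ee_def\<close>)
  then obtain W W' where W: "smooth_profile W W'" "W 1 = u (x0 + (1 / G z) *\<^sub>R z)"
    "(\<integral>\<^sup>+t. ennreal (t ^ ?k * \<bar>W' t\<bar> powr p) * indicator {0<..<1} t \<partial>lborel) \<le> ennreal E"
    "A / lam < (LINT t|lborel. indicator {0<..<1} t * (t ^ ?k * \<bar>W t\<bar> powr p))" by auto
  have "A < lam * (LINT t|lborel. indicator {0<..<1} t * (t ^ ?k * \<bar>W t\<bar> powr p))"
    using W(4) lam by (simp add: pos_divide_less_eq mult.commute)
  then have "E * (1 / R) powr p + \<beta> * c / (?n * R) * \<bar>W 1\<bar> powr p < lam * (LINT t|lborel. indicator {0<..<1} t * (t ^ ?k * \<bar>W t\<bar> powr p))"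
    unfolding A_def b_def W(2) .
  with W(1,3) E(2) show ?thesis by blast
qed

end

section \<open>Wulff shapes and convex domains as gauge balls\<close>

text \<open>Homogeneity is not among the premises: it follows from comparing the subgradients at
  \<open>x\<close> and at \<open>t *\<^sub>R x\<close>, each being a linear minorant that is
  attained at its own point.\<close>

lemma smooth_gaugeI:
  fixes G :: "real^'n \<Rightarrow> real"
  assumes m: "0 < m" and lower: "\<And>x. m * norm x \<le> G x" and upper: "\<And>x. G x \<le> M * norm x"
    and ex: "\<And>x. x \<noteq> 0 \<Longrightarrow> \<exists>d. (\<forall>y. d \<bullet> y \<le> G y) \<and> d \<bullet> x = G x"
    and uniq: "\<And>x d d'. x \<noteq> 0 \<Longrightarrow> \<forall>y. d \<bullet> y \<le> G y \<Longrightarrow> d \<bullet> x = G x \<Longrightarrow> \<forall>y. d' \<bullet> y \<le> G y \<Longrightarrow> d' \<bullet> x = G x \<Longrightarrow> d' = d"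
  shows "\<exists>dG. smooth_gauge G dG m M"
proof -
  have "\<forall>x. \<exists>d. if x = 0 then d = 0 else (\<forall>y. d \<bullet> y \<le> G y) \<and> d \<bullet> x = G x"
    using ex by auto
  from choice[OF this] obtain dG where dG: "\<And>x. if x = 0 then dG x = 0 else (\<forall>y. dG x \<bullet> y \<le> G y) \<and> dG x \<bullet> x = G x"
    by auto
  have le: "dG x \<bullet> y \<le> G y" and self: "dG x \<bullet> x = G x" if "x \<noteq> 0" for x y
    using dG[of x] that by auto
  have G0: "G 0 = 0" using lower[of 0] upper[of 0] by simp
  have "smooth_gauge G dG m M"
  proof
    show "G (t *\<^sub>R x) = t * G x" if "0 \<le> t" for t x
    proof (cases "t = 0 \<or> x = 0")
      case False
      then have t: "0 < t" and x: "x \<noteq> 0" and tx: "t *\<^sub>R x \<noteq> 0" using that by auto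
      have "t * G x = dG x \<bullet> (t *\<^sub>R x)" using self[OF x] by simp
      also have "\<dots> \<le> G (t *\<^sub>R x)" by (rule le[OF x])
      finally have 1: "t * G x \<le> G (t *\<^sub>R x)" .
      have "G (t *\<^sub>R x) = t * (dG (t *\<^sub>R x) \<bullet> x)" using self[OF tx] by simp
      also have "\<dots> \<le> t * G x" using le[OF tx, of x] t by simp
      finally show ?thesis using 1 by simp
    qed (use G0 in auto)
    show "d = dG x" if "x \<noteq> 0" "\<And>y. d \<bullet> y \<le> G y" "d \<bullet> x = G x" for x d
      using uniq[OF that(1), of "dG x" d] that le[OF that(1)] self[OF that(1)] by simp
  qed (use m lower upper le self dG[of 0] in auto)
  then show ?thesis by blast
qed

section \<open>Finsler norms and their polars\<close>

locale finsler_norm =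
  fixes F :: "real^'n \<Rightarrow> real" and DF :: "real^'n \<Rightarrow> real^'n" and a b :: real
  assumes a_pos: "0 < a" and lower: "a * norm x \<le> F x" and upper: "F x \<le> b * norm x"
    and hom: "F (t *\<^sub>R x) = \<bar>t\<bar> * F x" and subadd: "F (x + y) \<le> F x + F y"
    and deriv: "x \<noteq> 0 \<Longrightarrow> (F has_derivative (\<lambda>w. DF x \<bullet> w)) (at x)"
begin

lemma nonneg [simp]: "0 \<le> F x"
  using lower[of x] a_pos by (smt (verit) mult_nonneg_nonneg norm_ge_zero)

lemma zero [simp]: "F 0 = 0"
  using hom[of 0 0] by simp

lemma pos: "x \<noteq> 0 \<Longrightarrow> 0 < F x"
  using lower[of x] a_pos by (smt (verit) mult_pos_pos zero_less_norm_iff)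

lemma minus: "F (- x) = F x"
  using hom[of "-1" x] by simp

lemma lipschitz: "\<bar>F x - F y\<bar> \<le> b * norm (x - y)"
proof -
  have "F x \<le> F (x - y) + F y" using subadd[of "x - y" y] by simp
  moreover have "F y \<le> F (y - x) + F x" using subadd[of "y - x" x] by simp
  moreover have "F (y - x) = F (x - y)" using minus[of "x - y"] by simp
  ultimately show ?thesis using upper[of "x - y"] by linarith
qed

lemma b_nonneg: "0 \<le> b"
proof -
  obtain x :: "real^'n" where "norm x = 1" using vector_choose_size[of 1] by auto
  then show ?thesis using upper[of x] nonneg[of x] by (metis mult.right_neutral order_trans)
qed

lemma continuous_on_F: "continuous_on A F"
proof -
  have "b-lipschitz_on A F"
    by (rule lipschitz_onI) (use lipschitz b_nonneg in \<open>auto simp: dist_norm\<close>)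
  then show ?thesis by (rule lipschitz_on_continuous_on)
qed

lemma borel_measurable_F [measurable]: "F \<in> borel_measurable borel"
  by (intro borel_measurable_continuous_onI continuous_on_F)

lemma deriv_line:
  assumes "x \<noteq> 0"
  shows "((\<lambda>t. F (x + t *\<^sub>R w)) has_real_derivative DF x \<bullet> w) (at 0)"
proof -
  have l: "((\<lambda>t::real. x + t *\<^sub>R w) has_derivative (\<lambda>t. t *\<^sub>R w)) (at 0)"
    by (auto intro!: derivative_eq_intros)
  have "((\<lambda>t::real. F (x + t *\<^sub>R w)) has_derivative (\<lambda>t. DF x \<bullet> (t *\<^sub>R w))) (at 0)"
    by (rule has_derivative_compose[OF l]) (use deriv[OF assms] in simp)
  moreover have "(\<lambda>t. DF x \<bullet> (t *\<^sub>R w)) = (*) (DF x \<bullet> w)" by (auto simp: mult.commute)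
  ultimately show ?thesis by (simp add: has_field_derivative_def)
qed

text \<open>Euler's identity: along the line through 0 and x the norm is linear near x.\<close>

lemma DF_self: "x \<noteq> 0 \<Longrightarrow> DF x \<bullet> x = F x"
proof -
  assume x: "x \<noteq> 0"
  have "((\<lambda>t. (1 + t) * F x) has_real_derivative F x) (at 0)"
    by (auto intro!: derivative_eq_intros)
  then have "((\<lambda>t. F (x + t *\<^sub>R x)) has_real_derivative F x) (at 0)"
  proof (rule has_field_derivative_transform_within_open)
    show "open {-1<..<1::real}" by simp
    fix t :: real assume "t \<in> {-1<..<1}"
    then have "F ((1 + t) *\<^sub>R x) = (1 + t) * F x" by (simp add: hom)
    then show "(1 + t) * F x = F (x + t *\<^sub>R x)" by (simp add: scaleR_add_left)
  qed simp
  from DERIV_unique[OF deriv_line[OF x] this] show ?thesis .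
qed

text \<open>Subadditivity bounds every forward difference quotient in direction \<open>w\<close> by
  \<open>F w\<close>.\<close>

lemma DF_le: "x \<noteq> 0 \<Longrightarrow> DF x \<bullet> w \<le> F w"
proof -
  assume x: "x \<noteq> 0"
  have "((\<lambda>t. (F (x + t *\<^sub>R w) - F x) / t) \<longlongrightarrow> DF x \<bullet> w) (at 0)"
    using deriv_line[OF x, of w] by (simp add: has_field_derivative_iff)
  then have "((\<lambda>t. (F (x + t *\<^sub>R w) - F x) / t) \<longlongrightarrow> DF x \<bullet> w) (at_right 0)"
    by (rule filterlim_at_split[THEN iffD1, THEN conjunct2])
  then show ?thesis
  proof (rule tendsto_upperbound)
    have "eventually (\<lambda>t::real. t \<in> {0<..}) (at_right 0)" by (rule eventually_at_right_less[of "0::real", folded greaterThan_iff])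
    then show "eventually (\<lambda>t. (F (x + t *\<^sub>R w) - F x) / t \<le> F w) (at_right 0)"
    proof eventually_elim
      fix t :: real assume "t \<in> {0<..}"
      then show "(F (x + t *\<^sub>R w) - F x) / t \<le> F w"
        using subadd[of x "t *\<^sub>R w"] by (simp add: hom pos_divide_le_eq mult.commute)
    qed
  qed simp
qed

lemma bdd_above_polar: "bdd_above ((\<lambda>\<xi>. (\<xi> \<bullet> v) / F \<xi>) ` (UNIV - {0}))"
proof (rule bdd_aboveI2)
  fix \<xi> :: "real^'n" assume "\<xi> \<in> UNIV - {0}"
  then have "0 < F \<xi>" by (simp add: pos)
  have "a * (\<xi> \<bullet> v) \<le> a * (norm \<xi> * norm v)" using a_pos norm_cauchy_schwarz[of \<xi> v] by simp
  also have "\<dots> \<le> F \<xi> * norm v" using mult_right_mono[OF lower[of \<xi>], of "norm v"] by (simp add: mult_ac)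
  finally show "(\<xi> \<bullet> v) / F \<xi> \<le> norm v / a" using \<open>0 < F \<xi>\<close> a_pos by (simp add: field_simps)
qed

text \<open>By homogeneity the supremum is a maximum over the compact unit sphere. The maximiser,
  normalised by \<open>F\<close>, is at the same time a subgradient of the polar at
  \<open>v\<close>.\<close>

lemma polar_attained: "\<exists>d. F d = 1 \<and> d \<bullet> v = polar F v \<and> (\<forall>y. d \<bullet> y \<le> polar F y)"
proof -
  let ?q = "\<lambda>v \<xi>. (\<xi> \<bullet> v) / F \<xi>"
  have "continuous_on (sphere 0 1) (?q v)"
  proof (intro continuous_on_divide continuous_on_inner continuous_on_id continuous_on_const continuous_on_F ballI)
    fix x :: "real^'n" assume "x \<in> sphere 0 1"
    then have "x \<noteq> 0" by auto
    then show "F x \<noteq> 0" using pos[of x] by simp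
  qed
  then obtain \<xi> where \<xi>: "\<xi> \<in> sphere 0 1" "\<And>\<eta>. \<eta> \<in> sphere 0 1 \<Longrightarrow> ?q v \<eta> \<le> ?q v \<xi>"
    using continuous_attains_sup[of "sphere 0 1" "?q v"] by (auto simp del: mem_sphere)
  have ne: "\<xi> \<noteq> 0" using \<xi>(1) by auto
  have "polar F v = ?q v \<xi>"
    unfolding polar_def
  proof (rule cSup_eq_maximum)
    show "?q v \<xi> \<in> ?q v ` (UNIV - {0})" using ne by blast
    fix y assume "y \<in> ?q v ` (UNIV - {0})"
    then obtain \<eta> where \<eta>: "\<eta> \<noteq> 0" "y = ?q v \<eta>" by auto
    have "F ((1 / norm \<eta>) *\<^sub>R \<eta>) = (1 / norm \<eta>) * F \<eta>" unfolding hom by simp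
    then have "?q v ((1 / norm \<eta>) *\<^sub>R \<eta>) = ?q v \<eta>" using \<eta>(1) by (simp only: inner_scaleR_left) simp
    moreover have "(1 / norm \<eta>) *\<^sub>R \<eta> \<in> sphere 0 1" using \<eta>(1) by simp
    ultimately show "y \<le> ?q v \<xi>" using \<xi>(2)[of "(1 / norm \<eta>) *\<^sub>R \<eta>"] \<eta>(2) by (simp only:)
  qed
  moreover have "?q y \<xi> \<le> polar F y" for y
    unfolding polar_def by (rule cSup_upper[OF _ bdd_above_polar]) (use ne in blast)
  ultimately show ?thesis
    using pos[OF ne] by (intro exI[of _ "(1 / F \<xi>) *\<^sub>R \<xi>"]) (simp add: hom)
qed

lemma inner_le_polar: "\<xi> \<bullet> v \<le> F \<xi> * polar F v"
proof (cases "\<xi> = 0")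
  case False
  have "(\<xi> \<bullet> v) / F \<xi> \<le> polar F v"
    unfolding polar_def by (rule cSup_upper[OF _ bdd_above_polar]) (use False in blast)
  then show ?thesis using pos[OF False] by (simp add: field_simps)
qed simp

lemma abs_inner_le_polar: "\<bar>\<xi> \<bullet> v\<bar> \<le> F \<xi> * polar F v"
  using inner_le_polar[of \<xi> v] inner_le_polar[of "- \<xi>" v] by (simp add: minus)

lemma polar_lower: "1 / b * norm v \<le> polar F v" and polar_upper: "polar F v \<le> 1 / a * norm v"
  and b_pos: "0 < b"
proof -
  obtain x :: "real^'n" where "norm x = 1" using vector_choose_size[of 1] by auto
  then have "a \<le> b" using upper[of x] lower[of x] by simp
  then show b: "0 < b" using a_pos by simp
  obtain d where d: "F d = 1" "d \<bullet> v = polar F v" using polar_attained by blast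
  have "polar F v \<le> norm d * norm v" using d(2) norm_cauchy_schwarz[of d v] by simp
  also have "\<dots> \<le> 1 / a * norm v" using lower[of d] d(1) a_pos by (intro mult_right_mono) (auto simp: field_simps)
  finally show "polar F v \<le> 1 / a * norm v" .
  have p0: "0 \<le> polar F v" using abs_inner_le_polar[of d v] d(1) by simp
  show "1 / b * norm v \<le> polar F v"
  proof (cases "v = 0")
    case False
    have "norm v * norm v \<le> F v * polar F v" using inner_le_polar[of v v] by (simp add: dot_square_norm power2_eq_square)
    also have "\<dots> \<le> (b * norm v) * polar F v" by (intro mult_right_mono upper p0)
    finally have "norm v * norm v \<le> norm v * (b * polar F v)" by (simp add: mult_ac)
    then have "norm v \<le> b * polar F v" using False by simp
    then show ?thesis using b by (simp add: field_simps)
  qed (use p0 in simp)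
qed

lemma polar_DF_le: "x \<noteq> 0 \<Longrightarrow> polar F (DF x) \<le> 1"
proof -
  assume x: "x \<noteq> 0"
  obtain d where d: "F d = 1" "d \<bullet> DF x = polar F (DF x)" using polar_attained by blast
  then show ?thesis using DF_le[OF x, of d] by (simp add: inner_commute)
qed

text \<open>One half of the bipolar theorem, obtained by testing with \<open>DF d\<close>: its polar
  is at most 1 and its product with \<open>d\<close> is \<open>F d\<close>.\<close>

lemma bipolar_le:
  assumes "\<And>y. d \<bullet> y \<le> polar F y"
  shows "F d \<le> 1"
proof (cases "d = 0")
  case False
  have "F d = d \<bullet> DF d" using DF_self[OF False] by (simp add: inner_commute)
  also have "\<dots> \<le> polar F (DF d)" by (rule assms)
  also have "\<dots> \<le> 1" by (rule polar_DF_le[OF False])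
  finally show ?thesis .
qed simp

lemma polar_pos: "v \<noteq> 0 \<Longrightarrow> 0 < polar F v"
  using polar_lower[of v] b_pos by (smt (verit) divide_pos_pos mult_pos_pos zero_less_norm_iff)

text \<open>Subgradients of the polar away from the origin lie on the unit sphere of
  \<open>F\<close>; strict convexity of that sphere will make them unique.\<close>

lemma polar_subgradient_norm:
  assumes v: "v \<noteq> 0" and d: "\<And>y. d \<bullet> y \<le> polar F y" and dv: "d \<bullet> v = polar F v"
  shows "F d = 1"
proof (rule antisym)
  show "F d \<le> 1" by (rule bipolar_le[OF d])
  have "1 * polar F v \<le> F d * polar F v" using inner_le_polar[of d v] dv by simp
  then show "1 \<le> F d" using polar_pos[OF v] by (simp only: mult_le_cancel_right_pos)
qed

lemma polar_scale: "0 < t \<Longrightarrow> polar F (t *\<^sub>R v) = t * polar F v"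
proof -
  have le: "polar F (t *\<^sub>R v) \<le> t * polar F v" if "0 < t" for t v
  proof -
    obtain d where d: "d \<bullet> (t *\<^sub>R v) = polar F (t *\<^sub>R v)" "\<forall>y. d \<bullet> y \<le> polar F y" using polar_attained by blast
    then have "polar F (t *\<^sub>R v) = t * (d \<bullet> v)" by simp
    also have "\<dots> \<le> t * polar F v" using d(2) that by (intro mult_left_mono) auto
    finally show ?thesis .
  qed
  assume t: "0 < t"
  have "polar F ((1 / t) *\<^sub>R (t *\<^sub>R v)) \<le> 1 / t * polar F (t *\<^sub>R v)" by (rule le) (use t in simp)
  then have "t * polar F v \<le> polar F (t *\<^sub>R v)" using t by (simp add: field_simps)
  then show ?thesis using le[OF t, of v] by simp
qed

end

text \<open>Along a segment on which \<open>f\<close> is constant the second directional derivative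
  vanishes, against positive definiteness. In this form the Hessian condition excludes segments in a
  level set.\<close>

lemma hessian_posdef_not_constant:
  assumes H: "hessian_posdef_on S f" and w: "w \<noteq> 0"
    and seg: "\<And>t. t \<in> {0<..<1} \<Longrightarrow> x + t *\<^sub>R w \<in> S" and const: "\<And>t. t \<in> {0<..<1} \<Longrightarrow> f (x + t *\<^sub>R w) = c"
  shows False
proof -
  obtain Df Hf where Df: "\<forall>x\<in>S. (f has_derivative (\<lambda>w. Df x \<bullet> w)) (at x)"
    and Hf: "\<forall>x\<in>S. (Df has_derivative (\<lambda>w. Hf x *v w)) (at x)"
    and pd: "\<forall>x\<in>S. \<forall>w. w \<noteq> 0 \<longrightarrow> w \<bullet> (Hf x *v w) > 0"
    using H unfolding hessian_posdef_on_def by blast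
  have l: "((\<lambda>t::real. x + t *\<^sub>R w) has_derivative (\<lambda>t. t *\<^sub>R w)) (at t)" for t
    by (auto intro!: derivative_eq_intros)
  have zero: "Df (x + t *\<^sub>R w) \<bullet> w = 0" if t: "t \<in> {0<..<1}" for t
  proof -
    have "((\<lambda>t. f (x + t *\<^sub>R w)) has_derivative (\<lambda>s. Df (x + t *\<^sub>R w) \<bullet> (s *\<^sub>R w))) (at t)"
      by (rule has_derivative_compose[OF l]) (use Df seg[OF t] in simp)
    moreover have "((\<lambda>t. f (x + t *\<^sub>R w)) has_derivative (\<lambda>s. 0)) (at t)"
    proof (rule has_derivative_transform_within_open[where f = "\<lambda>_. c"])
      show "open {0<..<1::real}" by simp
    qed (use t const in auto)
    ultimately have "(\<lambda>s. Df (x + t *\<^sub>R w) \<bullet> (s *\<^sub>R w)) = (\<lambda>s. 0)" by (rule has_derivative_unique)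
    from fun_cong[OF this, of 1] show ?thesis by simp
  qed
  let ?t = "1 / 2 :: real"
  have t: "?t \<in> {0<..<1}" by simp
  have "((\<lambda>t. Df (x + t *\<^sub>R w)) has_derivative (\<lambda>s. Hf (x + ?t *\<^sub>R w) *v (s *\<^sub>R w))) (at ?t)"
    by (rule has_derivative_compose[OF l]) (use Hf seg[OF t] in simp)
  then have "((\<lambda>t. Df (x + t *\<^sub>R w) \<bullet> w) has_derivative (\<lambda>s. (Hf (x + ?t *\<^sub>R w) *v (s *\<^sub>R w)) \<bullet> w)) (at ?t)"
    by (rule has_derivative_inner_left)
  moreover have "((\<lambda>t. Df (x + t *\<^sub>R w) \<bullet> w) has_derivative (\<lambda>s. 0)) (at ?t)"
  proof (rule has_derivative_transform_within_open[where f = "\<lambda>_. 0"])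
    show "open {0<..<1::real}" by simp
  qed (use t zero in auto)
  ultimately have "(\<lambda>s. (Hf (x + ?t *\<^sub>R w) *v (s *\<^sub>R w)) \<bullet> w) = (\<lambda>s. 0)" by (rule has_derivative_unique)
  from fun_cong[OF this, of 1] have "w \<bullet> (Hf (x + ?t *\<^sub>R w) *v w) = 0" by (simp add: inner_commute)
  moreover have "0 < w \<bullet> (Hf (x + ?t *\<^sub>R w) *v w)" using pd seg[OF t] w by blast
  ultimately show False by simp
qed

text \<open>Two different subgradients of the polar at one point would span a segment of
  subgradients, hence a segment in the unit sphere of \<open>F\<close>, on which the p-th power of
  \<open>F\<close> is constant.\<close>

lemma (in finsler_norm) polar_gauge:
  assumes H: "hessian_posdef_on (- {0}) (\<lambda>\<xi>. F \<xi> powr p)" and R: "0 < R"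
  shows "\<exists>dG m M. smooth_gauge (\<lambda>x. polar F x / R) dG m M \<and> (\<forall>x. x \<noteq> 0 \<longrightarrow> F (dG x) = 1 / R)"
proof -
  have sub: "\<forall>y. (R *\<^sub>R d) \<bullet> y \<le> polar F y" if "\<forall>y. d \<bullet> y \<le> polar F y / R" for d
    using that R by (simp add: field_simps)
  have "\<exists>dG. smooth_gauge (\<lambda>x. polar F x / R) dG (1 / b / R) (1 / a / R)"
  proof (rule smooth_gaugeI)
    show "0 < 1 / b / R" using b_pos R by simp
    show "1 / b / R * norm x \<le> polar F x / R" "polar F x / R \<le> 1 / a / R * norm x" for x
      using divide_right_mono[OF polar_lower[of x], of R] divide_right_mono[OF polar_upper[of x], of R] R by simp_all
    show "\<exists>d. (\<forall>y. d \<bullet> y \<le> polar F y / R) \<and> d \<bullet> x = polar F x / R" for x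
    proof -
      obtain d where d: "d \<bullet> x = polar F x" "\<forall>y. d \<bullet> y \<le> polar F y" using polar_attained by blast
      then show ?thesis using R by (intro exI[of _ "(1 / R) *\<^sub>R d"]) (simp add: divide_right_mono)
    qed
    fix x d d' :: "real^'n" assume x: "x \<noteq> 0" and d: "\<forall>y. d \<bullet> y \<le> polar F y / R" "d \<bullet> x = polar F x / R"
      and d': "\<forall>y. d' \<bullet> y \<le> polar F y / R" "d' \<bullet> x = polar F x / R"
    \<comment> \<open>Scaling by \<open>R\<close> turns subgradients of the gauge into subgradients
      of the polar, and convex combinations of these are again subgradients.\<close>
    define e where "e t = (R *\<^sub>R d) + t *\<^sub>R (R *\<^sub>R (d' - d))" for t
    have e: "F (e t) = 1" if t: "t \<in> {0<..<1}" for t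
    proof (rule polar_subgradient_norm[OF x])
      have eq: "e t \<bullet> y = (1 - t) * ((R *\<^sub>R d) \<bullet> y) + t * ((R *\<^sub>R d') \<bullet> y)" for y
        by (simp add: e_def inner_add_left inner_diff_left algebra_simps)
      show "e t \<bullet> y \<le> polar F y" for y
        unfolding eq using t sub[OF d(1)] sub[OF d'(1)] by (intro convex_bound_le) auto
      show "e t \<bullet> x = polar F x"
        unfolding eq using d(2) d'(2) R by (simp add: algebra_simps)
    qed
    show "d' = d"
    proof (rule ccontr)
      assume "d' \<noteq> d"
      then have w: "R *\<^sub>R (d' - d) \<noteq> 0" using R by simp
      show False
      proof (rule hessian_posdef_not_constant[OF H w])
        fix t :: real assume t: "t \<in> {0<..<1}"
        show "F (R *\<^sub>R d + t *\<^sub>R R *\<^sub>R (d' - d)) powr p = 1" using e[OF t] by (simp add: e_def)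
        have "e t \<noteq> 0" using e[OF t] by auto
        then show "R *\<^sub>R d + t *\<^sub>R R *\<^sub>R (d' - d) \<in> - {0}" by (simp add: e_def)
      qed
    qed
  qed
  then obtain dG where G: "smooth_gauge (\<lambda>x. polar F x / R) dG (1 / b / R) (1 / a / R)" ..
  interpret smooth_gauge "\<lambda>x. polar F x / R" dG "1 / b / R" "1 / a / R" by (rule G)
  have "F (dG x) = 1 / R" if x: "x \<noteq> 0" for x
  proof -
    have "F (R *\<^sub>R dG x) = 1"
    proof (rule polar_subgradient_norm[OF x])
      show "(R *\<^sub>R dG x) \<bullet> y \<le> polar F y" for y using dG_le[OF x, of y] R by (simp add: field_simps)
      show "(R *\<^sub>R dG x) \<bullet> x = polar F x" using dG_self[OF x] R by (simp add: field_simps)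
    qed
    then show ?thesis using R by (simp add: hom finsler_norm.hom[OF finsler_norm_axioms] field_simps)
  qed
  with G show ?thesis by blast
qed

section \<open>Normals and Minkowski gauges of convex domains\<close>

lemma C1_boundary_normal:
  assumes B: "C1_alpha_boundary \<alpha> D" and D: "open D" and y: "y \<in> frontier D"
  shows "\<exists>\<nu>. is_outer_normal D y \<nu>"
proof -
  obtain r e h dh where r: "0 < r" and e: "norm e = 1"
    and h: "\<forall>y. (h has_derivative (\<lambda>w. dh y \<bullet> w)) (at y)"
    and loc: "D \<inter> ball y r = {z \<in> ball y r. z \<bullet> e < h (z - (z \<bullet> e) *\<^sub>R e)}"
    using B y unfolding C1_alpha_boundary_def by blast
  \<comment> \<open>A local defining function, negative exactly on the part of \<open>D\<close> in
    the ball.\<close>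
  define \<phi> where "\<phi> z = z \<bullet> e - h (z - (z \<bullet> e) *\<^sub>R e)" for z
  define g where "g = dh (y - (y \<bullet> e) *\<^sub>R e)"
  \<comment> \<open>The gradient of \<open>\<phi>\<close> at \<open>y\<close>. Since
    \<open>h\<close> is evaluated orthogonally to \<open>e\<close>, its inner product with
    \<open>e\<close> is 1, so it does not vanish.\<close>
  define n where "n = e - g + (g \<bullet> e) *\<^sub>R e"
  have ee: "e \<bullet> e = 1" using e by (simp add: dot_square_norm)
  have "n \<bullet> e = 1" by (simp add: n_def inner_diff_left inner_add_left ee)
  then have n: "n \<noteq> 0" by auto
  have d: "((\<lambda>z. h (z - (z \<bullet> e) *\<^sub>R e)) has_derivative (\<lambda>w. dh (z - (z \<bullet> e) *\<^sub>R e) \<bullet> (w - (w \<bullet> e) *\<^sub>R e))) (at z)" for z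
    by (rule has_derivative_compose[of "\<lambda>z. z - (z \<bullet> e) *\<^sub>R e"]) (auto intro!: derivative_eq_intros simp: h)
  have d\<phi>: "(\<phi> has_derivative (\<lambda>w. w \<bullet> n)) (at y)"
  proof -
    have "(\<phi> has_derivative (\<lambda>w. w \<bullet> e - g \<bullet> (w - (w \<bullet> e) *\<^sub>R e))) (at y)"
      unfolding \<phi>_def[abs_def] g_def by (intro has_derivative_diff d) (auto intro!: derivative_eq_intros)
    moreover have "(\<lambda>w. w \<bullet> e - g \<bullet> (w - (w \<bullet> e) *\<^sub>R e)) = (\<lambda>w. w \<bullet> n)"
      by (auto simp: n_def inner_diff_right inner_add_right inner_commute mult.commute)
    ultimately show ?thesis by simp
  qed
  have c\<phi>: "isCont \<phi> z" for z
    unfolding \<phi>_def[abs_def]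
    by (intro continuous_intros has_derivative_continuous[OF d])
  have in_D: "z \<in> D \<longleftrightarrow> \<phi> z < 0" if "z \<in> ball y r" for z
    using loc that unfolding \<phi>_def by (auto simp del: mem_ball)
  \<comment> \<open>As \<open>y\<close> is not in the open set, \<open>\<phi> y\<close> is not
    negative; as \<open>y\<close> is a limit of points of \<open>D\<close>, it is not
    positive.\<close>
  have "\<phi> y = 0"
  proof (rule antisym)
    have "y \<notin> D" using y D by (simp add: frontier_def interior_open)
    then show "0 \<le> \<phi> y" using in_D[of y] r by simp
    show "\<phi> y \<le> 0"
    proof (rule ccontr)
      assume "\<not> \<phi> y \<le> 0"
      then have "eventually (\<lambda>z. 0 < \<phi> z) (at y)"
        using order_tendstoD(1)[OF c\<phi>[of y, unfolded isCont_def], of 0] by simp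
      then obtain s where s: "0 < s" "\<And>z. z \<noteq> y \<Longrightarrow> dist z y < s \<Longrightarrow> 0 < \<phi> z"
        unfolding eventually_at by blast
      have "y \<in> closure D" using y by (simp add: frontier_def)
      then obtain z where z: "z \<in> D" "dist z y < min r s" using r s(1) unfolding closure_approachable by (metis min_less_iff_conj)
      then have "\<phi> z < 0" using in_D[of z] by (simp add: dist_commute)
      moreover have "z \<noteq> y" using z(1) \<open>y \<notin> D\<close> by auto
      ultimately show False using s(2)[of z] z(2) by simp
    qed
  qed
  have "is_outer_normal D y ((1 / norm n) *\<^sub>R n)"
    unfolding is_outer_normal_def
  proof (intro conjI allI impI)
    show "norm ((1 / norm n) *\<^sub>R n) = 1" using n by simp
    fix \<epsilon> :: real assume \<epsilon>: "0 < \<epsilon>"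
    then have "0 < \<epsilon> * norm n" using n by simp
    then obtain s where s: "0 < s" "\<forall>z. norm (z - y) < s \<longrightarrow> norm (\<phi> z - \<phi> y - (z - y) \<bullet> n) \<le> \<epsilon> * norm n * norm (z - y)"
      using d\<phi> unfolding has_derivative_at_alt by blast
    show "\<exists>r>0. \<forall>z\<in>ball y r. ((z - y) \<bullet> ((1 / norm n) *\<^sub>R n) < - \<epsilon> * norm (z - y) \<longrightarrow> z \<in> D) \<and>
      ((z - y) \<bullet> ((1 / norm n) *\<^sub>R n) > \<epsilon> * norm (z - y) \<longrightarrow> z \<notin> D)"
    proof (intro exI[of _ "min r s"] conjI ballI)
      show "0 < min r s" using r s(1) by simp
      fix z assume z: "z \<in> ball y (min r s)"
      then have zr: "z \<in> ball y r" and "norm (z - y) < s" by (auto simp: dist_norm norm_minus_commute)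
      then have 1: "\<bar>\<phi> z - (z - y) \<bullet> n\<bar> \<le> \<epsilon> * norm n * norm (z - y)" using s(2) \<open>\<phi> y = 0\<close> by simp
      show "(z - y) \<bullet> ((1 / norm n) *\<^sub>R n) < - \<epsilon> * norm (z - y) \<longrightarrow> z \<in> D"
      proof
        assume "(z - y) \<bullet> ((1 / norm n) *\<^sub>R n) < - \<epsilon> * norm (z - y)"
        then have "(z - y) \<bullet> n < - (\<epsilon> * norm n * norm (z - y))" using n by (simp add: field_simps)
        then show "z \<in> D" using 1 in_D[OF zr] by linarith
      qed
      show "(z - y) \<bullet> ((1 / norm n) *\<^sub>R n) > \<epsilon> * norm (z - y) \<longrightarrow> z \<notin> D"
      proof
        assume "(z - y) \<bullet> ((1 / norm n) *\<^sub>R n) > \<epsilon> * norm (z - y)"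
        then have "(z - y) \<bullet> n > \<epsilon> * norm n * norm (z - y)" using n by (simp add: field_simps)
        then show "z \<notin> D" using 1 in_D[OF zr] by linarith
      qed
    qed
  qed
  then show ?thesis ..
qed

lemma outer_normal_inward:
  assumes \<nu>: "is_outer_normal D y \<nu>" and w: "w \<bullet> \<nu> < 0"
  shows "\<exists>t0>0. \<forall>t. 0 < t \<longrightarrow> t < t0 \<longrightarrow> y + t *\<^sub>R w \<in> D"
proof -
  have w0: "w \<noteq> 0" using w by auto
  define \<epsilon> where "\<epsilon> = - (w \<bullet> \<nu>) / (2 * norm w)"
  have \<epsilon>: "0 < \<epsilon>" using w w0 by (simp add: \<epsilon>_def divide_neg_pos)
  obtain r where r: "0 < r" "\<forall>z\<in>ball y r. (z - y) \<bullet> \<nu> < - \<epsilon> * norm (z - y) \<longrightarrow> z \<in> D"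
    using \<nu> \<epsilon> unfolding is_outer_normal_def by blast
  show ?thesis
  proof (intro exI[of _ "r / norm w"] conjI allI impI)
    show "0 < r / norm w" using r w0 by simp
    fix t assume t: "0 < t" "t < r / norm w"
    have "y + t *\<^sub>R w \<in> ball y r" using t w0 by (simp add: dist_norm field_simps)
    moreover have "t * (w \<bullet> \<nu>) < t * (w \<bullet> \<nu> / 2)" using w t(1) by (intro mult_strict_left_mono) auto
    then have "(y + t *\<^sub>R w - y) \<bullet> \<nu> < - \<epsilon> * norm (y + t *\<^sub>R w - y)" using t w0 by (simp add: \<epsilon>_def)
    ultimately show "y + t *\<^sub>R w \<in> D" using r(2) by blast
  qed
qed

lemma outer_normal_outward:
  assumes \<nu>: "is_outer_normal D y \<nu>" and w: "0 < w \<bullet> \<nu>"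
  shows "\<exists>t0>0. \<forall>t. 0 < t \<longrightarrow> t < t0 \<longrightarrow> y + t *\<^sub>R w \<notin> D"
proof -
  have w0: "w \<noteq> 0" using w by auto
  define \<epsilon> where "\<epsilon> = (w \<bullet> \<nu>) / (2 * norm w)"
  have \<epsilon>: "0 < \<epsilon>" using w w0 by (simp add: \<epsilon>_def)
  obtain r where r: "0 < r" "\<forall>z\<in>ball y r. (z - y) \<bullet> \<nu> > \<epsilon> * norm (z - y) \<longrightarrow> z \<notin> D"
    using \<nu> \<epsilon> unfolding is_outer_normal_def by blast
  show ?thesis
  proof (intro exI[of _ "r / norm w"] conjI allI impI)
    show "0 < r / norm w" using r w0 by simp
    fix t assume t: "0 < t" "t < r / norm w"
    have "y + t *\<^sub>R w \<in> ball y r" using t w0 by (simp add: dist_norm field_simps)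
    moreover have "t * (w \<bullet> \<nu> / 2) < t * (w \<bullet> \<nu>)" using w t(1) by (intro mult_strict_left_mono) auto
    then have "(y + t *\<^sub>R w - y) \<bullet> \<nu> > \<epsilon> * norm (y + t *\<^sub>R w - y)" using t w0 by (simp add: \<epsilon>_def)
    ultimately show "y + t *\<^sub>R w \<notin> D" using r(2) by blast
  qed
qed

text \<open>A point on the outer side would bring the beginning of its segment from \<open>y\<close>
  into \<open>D\<close> by convexity and out of \<open>D\<close> by the normal. Strictness follows
  by first pushing the point a little along \<nu> inside the open set.\<close>

lemma convex_outer_normal:
  fixes D :: "(real^'n) set"
  assumes D: "open D" "convex D" and y: "y \<in> frontier D" and \<nu>: "is_outer_normal D y \<nu>" and z: "z \<in> D"
  shows "(z - y) \<bullet> \<nu> < 0"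
proof -
  have le: "(z - y) \<bullet> \<nu> \<le> 0" if z: "z \<in> D" for z
  proof (rule ccontr)
    assume "\<not> (z - y) \<bullet> \<nu> \<le> 0"
    then obtain t0 where t0: "0 < t0" "\<forall>t. 0 < t \<longrightarrow> t < t0 \<longrightarrow> y + t *\<^sub>R (z - y) \<notin> D"
      using outer_normal_outward[OF \<nu>, of "z - y"] by auto
    define t where "t = min 1 (t0 / 2)"
    have t: "0 < t" "t \<le> 1" "t < t0" using t0(1) by (auto simp: t_def min_def)
    have "y - t *\<^sub>R (y - z) \<in> interior D"
      by (rule mem_interior_closure_convex_shrink) (use D z y t in \<open>auto simp: interior_open frontier_def\<close>)
    then have "y + t *\<^sub>R (z - y) \<in> D" using D(1) by (simp add: interior_open algebra_simps)
    then show False using t0(2) t by blast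
  qed
  obtain r where r: "0 < r" "ball z r \<subseteq> D" using D(1) z open_contains_ball by blast
  have n1: "norm \<nu> = 1" using \<nu> by (simp add: is_outer_normal_def)
  then have "z + (r / 2) *\<^sub>R \<nu> \<in> D" using r by (intro subsetD[OF r(2)]) (simp add: dist_norm)
  from le[OF this] have "(z - y) \<bullet> \<nu> + r / 2 * (\<nu> \<bullet> \<nu>) \<le> 0" by (simp add: inner_diff_left inner_add_left)
  then show ?thesis using r(1) n1 by (simp add: dot_square_norm)
qed

text \<open>The gauge is the reciprocal of the ray length to the frontier. A normal at the frontier
  point, suitably scaled, gives a subgradient; any other subgradient is nonpositive on the open
  half-space of inward directions and is therefore a multiple of the same normal.\<close>

lemma convex_domain_gauge:
  fixes D :: "(real^'n) set"
  assumes D: "open D" "convex D" "bounded D" and x0: "x0 \<in> D"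
    and norm_ex: "\<And>y. y \<in> frontier D \<Longrightarrow> \<exists>\<nu>. is_outer_normal D y \<nu>"
  shows "\<exists>G dG m M. smooth_gauge G dG m M \<and> D = {x. G (x - x0) < 1}"
proof -
  have ray: "\<forall>x. \<exists>d. x \<noteq> 0 \<longrightarrow> 0 < d \<and> x0 + d *\<^sub>R x \<in> frontier D \<and> (\<forall>e. 0 \<le> e \<and> e < d \<longrightarrow> x0 + e *\<^sub>R x \<in> D)"
  proof (intro allI)
    fix x :: "real^'n"
    have "x0 \<in> interior D" using x0 D(1) by (simp add: interior_open)
    from ray_to_frontier[OF D(3) this, of x]
    show "\<exists>d. x \<noteq> 0 \<longrightarrow> 0 < d \<and> x0 + d *\<^sub>R x \<in> frontier D \<and> (\<forall>e. 0 \<le> e \<and> e < d \<longrightarrow> x0 + e *\<^sub>R x \<in> D)"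
      using D(1) by (metis interior_open)
  qed
  from choice[OF ray] obtain \<rho> where \<rho>: "\<forall>x. x \<noteq> 0 \<longrightarrow> 0 < \<rho> x \<and> x0 + \<rho> x *\<^sub>R x \<in> frontier D \<and> (\<forall>e. 0 \<le> e \<and> e < \<rho> x \<longrightarrow> x0 + e *\<^sub>R x \<in> D)"
    by auto
  have \<rho>_pos: "0 < \<rho> x" and \<rho>_fr: "x0 + \<rho> x *\<^sub>R x \<in> frontier D" and \<rho>_in: "0 \<le> e \<Longrightarrow> e < \<rho> x \<Longrightarrow> x0 + e *\<^sub>R x \<in> D"
    if "x \<noteq> 0" for x e using \<rho> that by auto
  define G where "G x = (if x = 0 then 0 else 1 / \<rho> x)" for x
  have out: "x0 + \<rho> x *\<^sub>R x \<notin> D" if "x \<noteq> 0" for x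
    using \<rho>_fr[OF that] D(1) by (simp add: frontier_def interior_open)
  have sub: "\<exists>d \<nu>. is_outer_normal D (x0 + \<rho> x *\<^sub>R x) \<nu> \<and> (\<forall>z\<in>D. d \<bullet> (z - x0) < 1) \<and> d \<bullet> x = G x \<and> 0 < x \<bullet> \<nu> \<and> d = (1 / (\<rho> x * (x \<bullet> \<nu>))) *\<^sub>R \<nu>"
    if x: "x \<noteq> 0" for x
  proof -
    let ?y = "x0 + \<rho> x *\<^sub>R x"
    obtain \<nu> where \<nu>: "is_outer_normal D ?y \<nu>" using norm_ex[OF \<rho>_fr[OF x]] by auto
    have neg: "(z - ?y) \<bullet> \<nu> < 0" if "z \<in> D" for z by (rule convex_outer_normal[OF D(1,2) \<rho>_fr[OF x] \<nu> that])
    have pos: "0 < \<rho> x * (x \<bullet> \<nu>)" using neg[OF x0] by simp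
    then have xn: "0 < x \<bullet> \<nu>" using \<rho>_pos[OF x] by (simp add: zero_less_mult_iff)
    have "\<nu> \<bullet> (z - x0) < \<rho> x * (x \<bullet> \<nu>)" if "z \<in> D" for z
      using neg[OF that] by (simp add: inner_diff_left inner_add_left inner_diff_right inner_add_right inner_commute)
    then have "\<forall>z\<in>D. ((1 / (\<rho> x * (x \<bullet> \<nu>))) *\<^sub>R \<nu>) \<bullet> (z - x0) < 1" using pos by (simp add: pos_divide_less_eq)
    moreover have "((1 / (\<rho> x * (x \<bullet> \<nu>))) *\<^sub>R \<nu>) \<bullet> x = G x" using x xn by (simp add: G_def inner_commute)
    ultimately show ?thesis using \<nu> xn by blast
  qed
  have Gle: "d \<bullet> w \<le> G w" if d: "\<forall>z\<in>D. d \<bullet> (z - x0) < 1" for d w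
  proof (cases "w = 0")
    case False
    have "e * (d \<bullet> w) \<le> 1" if "0 < e" "e < \<rho> w" for e
    proof -
      have "x0 + e *\<^sub>R w \<in> D" by (rule \<rho>_in[OF False]) (use that in auto)
      then have "d \<bullet> (x0 + e *\<^sub>R w - x0) < 1" using d by blast
      then show ?thesis by simp
    qed
    then have le: "e * (d \<bullet> w) \<le> 1" if "0 < e \<and> e < \<rho> w" for e using that by simp
    \<comment> \<open>Only points strictly before the frontier lie in \<open>D\<close>, so the
      estimate at the frontier is a limit.\<close>
    have "\<rho> w * (d \<bullet> w) \<le> 1"
    proof (rule field_le_mult_one_interval)
      fix z :: real assume "0 < z" "z < 1"
      then have "0 < z * \<rho> w \<and> z * \<rho> w < \<rho> w" using \<rho>_pos[OF False] by simp
      from le[OF this] show "z * (\<rho> w * (d \<bullet> w)) \<le> 1" by (simp only: mult.assoc)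
    qed
    then show ?thesis using \<rho>_pos[OF False] False by (simp add: G_def field_simps)
  qed (simp add: G_def)
  have Deq: "D = {x. G (x - x0) < 1}"
  proof (intro set_eqI iffI)
    fix x assume x: "x \<in> D"
    show "x \<in> {x. G (x - x0) < 1}"
    proof (cases "x = x0")
      case False
      then have "x - x0 \<noteq> 0" by simp
      from sub[OF this] obtain d where "\<forall>z\<in>D. d \<bullet> (z - x0) < 1" "d \<bullet> (x - x0) = G (x - x0)" by blast
      then show ?thesis using x by force
    qed (simp add: G_def)
  next
    fix x assume "x \<in> {x. G (x - x0) < 1}"
    then have x: "G (x - x0) < 1" by simp
    show "x \<in> D"
    proof (cases "x = x0")
      case False
      then have "1 < \<rho> (x - x0)" using x \<rho>_pos[of "x - x0"] by (simp add: G_def)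
      then show ?thesis using \<rho>_in[of "x - x0" 1] False by simp
    qed (use x0 in simp)
  qed
  obtain r where r: "0 < r" "ball x0 r \<subseteq> D" using D(1) x0 open_contains_ball by blast
  have "bounded ((\<lambda>x. x - x0) ` closure D)"
    using D(3) by (intro bounded_translation_minus bounded_closure)
  then obtain s where s: "0 < s" "\<forall>x\<in>closure D. norm (x - x0) \<le> s" unfolding bounded_pos by auto
  have "\<exists>dG. smooth_gauge G dG (1 / s) (1 / r)"
  proof (rule smooth_gaugeI)
    show "0 < 1 / s" using s by simp
    show "1 / s * norm x \<le> G x" "G x \<le> 1 / r * norm x" for x
    proof -
      show "1 / s * norm x \<le> G x"
      proof (cases "x = 0")
        case False
        have "x0 + \<rho> x *\<^sub>R x \<in> closure D" using \<rho>_fr[OF False] by (simp add: frontier_def)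
        then have "norm (x0 + \<rho> x *\<^sub>R x - x0) \<le> s" using s(2) by blast
        then have "\<rho> x * norm x \<le> s" using \<rho>_pos[OF False] by simp
        then show ?thesis using \<rho>_pos[OF False] s(1) False by (simp add: G_def field_simps)
      qed (simp add: G_def)
      show "G x \<le> 1 / r * norm x"
      proof (cases "x = 0")
        case False
        have "x0 + \<rho> x *\<^sub>R x \<notin> ball x0 r" using out[OF False] r(2) by blast
        then have "r \<le> \<rho> x * norm x" using \<rho>_pos[OF False] by (simp add: dist_norm)
        then show ?thesis using \<rho>_pos[OF False] r(1) False by (simp add: G_def field_simps)
      qed (simp add: G_def)
    qed
    show "\<exists>d. (\<forall>y. d \<bullet> y \<le> G y) \<and> d \<bullet> x = G x" if "x \<noteq> 0" for x
      using sub[OF that] Gle by blast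
    fix x d d' :: "real^'n" assume x: "x \<noteq> 0" and d: "\<forall>y. d \<bullet> y \<le> G y" "d \<bullet> x = G x"
      and d': "\<forall>y. d' \<bullet> y \<le> G y" "d' \<bullet> x = G x"
    obtain d0 \<nu> where \<nu>: "is_outer_normal D (x0 + \<rho> x *\<^sub>R x) \<nu>" "0 < x \<bullet> \<nu>" using sub[OF x] by blast
    have n1: "\<nu> \<bullet> \<nu> = 1" using \<nu>(1) by (simp add: is_outer_normal_def dot_square_norm)
    have "d = (G x / (x \<bullet> \<nu>)) *\<^sub>R \<nu>" if d: "\<forall>y. d \<bullet> y \<le> G y" "d \<bullet> x = G x" for d
    proof -
      have neg: "w \<bullet> d \<le> 0" if w: "w \<bullet> \<nu> < 0" for w
      proof -
        obtain t0 where t0: "0 < t0" "\<forall>t. 0 < t \<longrightarrow> t < t0 \<longrightarrow> x0 + \<rho> x *\<^sub>R x + t *\<^sub>R w \<in> D"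
          using outer_normal_inward[OF \<nu>(1) w] by auto
        then have "x0 + \<rho> x *\<^sub>R x + (t0 / 2) *\<^sub>R w \<in> D" by simp
        then have "G (\<rho> x *\<^sub>R x + (t0 / 2) *\<^sub>R w) < 1" using Deq by (auto simp: add.assoc)
        then have "d \<bullet> (\<rho> x *\<^sub>R x + (t0 / 2) *\<^sub>R w) < 1" using d(1) by (meson le_less_trans)
        then have "\<rho> x * G x + t0 / 2 * (d \<bullet> w) < 1" using d(2) by (simp add: inner_add_right)
        moreover have "\<rho> x * G x = 1" using x \<rho>_pos[OF x] by (simp add: G_def)
        ultimately have "t0 / 2 * (d \<bullet> w) < 0" by simp
        then have "d \<bullet> w < 0" using t0(1) by (simp add: mult_less_0_iff)
        then show ?thesis by (simp add: inner_commute)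
      qed
      \<comment> \<open>The tangential part of the subgradient. The direction q - s \<nu> points
        inward for every s > 0, and s tending to 0 forces q = 0.\<close>
      define q where "q = d - (d \<bullet> \<nu>) *\<^sub>R \<nu>"
      have qn: "q \<bullet> \<nu> = 0" by (simp add: q_def inner_diff_left n1)
      have qd: "q \<bullet> d = q \<bullet> q" using qn by (simp add: q_def inner_diff_left inner_diff_right n1 inner_commute)
      have "q \<bullet> q \<le> s * (\<nu> \<bullet> d)" if "0 < s" for s
      proof -
        have "(q - s *\<^sub>R \<nu>) \<bullet> \<nu> < 0" using that by (simp add: inner_diff_left qn n1)
        from neg[OF this] show ?thesis by (simp add: inner_diff_left qd)
      qed
      then have sm: "q \<bullet> q \<le> s * (\<nu> \<bullet> d)" if "0 < s" for s using that by simp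
      have "q \<bullet> q \<le> 0 + e" if e: "0 < e" for e
      proof -
        define s where "s = e / (1 + \<bar>\<nu> \<bullet> d\<bar>)"
        have s: "0 < s" using e by (simp add: s_def add_pos_nonneg)
        have "q \<bullet> q \<le> s * (\<nu> \<bullet> d)" by (rule sm[OF s])
        also have "\<dots> \<le> s * (1 + \<bar>\<nu> \<bullet> d\<bar>)" using s by (intro mult_left_mono) auto
        also have "\<dots> = e" using abs_ge_zero[of "\<nu> \<bullet> d"] by (simp add: s_def add_pos_nonneg pos_add_strict)
        finally show ?thesis by simp
      qed
      then have "q \<bullet> q \<le> 0" by (rule field_le_epsilon)
      then have "q = 0" using inner_ge_zero[of q] by (simp add: inner_eq_zero_iff)
      then have dd: "d = (d \<bullet> \<nu>) *\<^sub>R \<nu>" by (simp add: q_def)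
      have "d \<bullet> x = (d \<bullet> \<nu>) * (\<nu> \<bullet> x)" by (subst dd) simp
      then have "d \<bullet> \<nu> = G x / (x \<bullet> \<nu>)" using d(2) \<nu>(2) by (simp add: field_simps inner_commute)
      then show ?thesis using dd by simp
    qed
    from this[OF d] this[OF d'] show "d' = d" by simp
  qed
  then show ?thesis using Deq by blast
qed

text \<open>Put d = dG x. The points x0 + s R DF d with 0 < s < 1 lie in the Wulff shape, hence in
  the ball of \<open>G\<close>, and pairing s R DF d with d gives s R F d < 1.\<close>

lemma (in finsler_norm) gauge_of_wulff_superset:
  assumes G: "smooth_gauge G dG m M" and R: "0 < R" and sub: "wulff_shape F x0 R \<subseteq> {x. G (x - x0) < 1}"
  shows "F (dG x) \<le> 1 / R"
proof -
  interpret G: smooth_gauge G dG m M by (rule G)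
  show ?thesis
  proof (cases "x = 0")
    case False
    define d where "d = dG x"
    have d: "d \<noteq> 0" unfolding d_def by (rule G.dG_nonzero[OF False])
    have "R * F d \<le> 1"
    proof (rule field_le_mult_one_interval)
      fix s :: real assume s: "0 < s" "s < 1"
      have "polar F ((s * R) *\<^sub>R DF d) = s * R * polar F (DF d)" by (rule polar_scale) (use s R in simp)
      also have "\<dots> \<le> s * R * 1" using s R by (intro mult_left_mono polar_DF_le[OF d]) auto
      also have "\<dots> < R" using s R by simp
      finally have "x0 + (s * R) *\<^sub>R DF d \<in> wulff_shape F x0 R" by (simp add: wulff_shape_def)
      then have "G ((s * R) *\<^sub>R DF d) < 1" using sub by auto
      moreover have "d \<bullet> ((s * R) *\<^sub>R DF d) \<le> G ((s * R) *\<^sub>R DF d)" unfolding d_def by (rule G.dG_le[OF False])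
      moreover have "d \<bullet> ((s * R) *\<^sub>R DF d) = s * (R * F d)" using DF_self[OF d] by (simp add: inner_commute)
      ultimately show "s * (R * F d) \<le> 1" by linarith
    qed
    then show ?thesis using R by (simp add: d_def field_simps)
  qed (use R G.dG_zero in simp)
qed

section \<open>Continuous competitors\<close>

text \<open>If the difference is small relative to B, then A / B is near 1 and continuity of the
  power gives the first term; otherwise both A and B are bounded by a multiple of the
  difference.\<close>

lemma powr_diff_bound:
  fixes p \<epsilon> :: real
  assumes p: "1 \<le> p" and \<epsilon>: "0 < \<epsilon>"
  shows "\<exists>C\<ge>0. \<forall>A\<ge>0. \<forall>B\<ge>0. \<bar>A powr p - B powr p\<bar> \<le> \<epsilon> * B powr p + C * \<bar>A - B\<bar> powr p"
proof -
  have "isCont (\<lambda>x::real. x powr p) 1" by (intro continuous_intros) auto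
  then have "\<forall>e>0. \<exists>d>0. \<forall>x. \<bar>x - 1\<bar> < d \<longrightarrow> \<bar>x powr p - 1 powr p\<bar> < e"
    unfolding continuous_at_real_range by (simp add: dist_real_def)
  then obtain d where d: "0 < d" "\<forall>x. \<bar>x - 1\<bar> < d \<longrightarrow> \<bar>x powr p - 1 powr p\<bar> < \<epsilon>" using \<epsilon> by blast
  define \<eta> where "\<eta> = d / 2"
  have \<eta>: "0 < \<eta>" "\<eta> < d" using d by (auto simp: \<eta>_def)
  define C where "C = (1 + 1 / \<eta>) powr p"
  have "\<bar>A powr p - B powr p\<bar> \<le> \<epsilon> * B powr p + C * \<bar>A - B\<bar> powr p" if A: "0 \<le> A" and B: "0 \<le> B" for A B :: real
  proof (cases "\<bar>A - B\<bar> \<le> \<eta> * B \<and> B \<noteq> 0")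
    case True
    then have B: "0 < B" using B by simp
    have "A / B - 1 = (A - B) / B" using B by (simp add: diff_divide_distrib)
    then have "\<bar>A / B - 1\<bar> = \<bar>A - B\<bar> / B" using B by (simp only: abs_divide abs_of_pos)
    also have "\<dots> \<le> \<eta>" using True B by (simp add: pos_divide_le_eq)
    finally have "\<bar>A / B - 1\<bar> < d" using \<eta> by simp
    then have "\<bar>(A / B) powr p - 1\<bar> \<le> \<epsilon>" using d(2) by (metis less_imp_le powr_one_eq_one)
    then have "B powr p * \<bar>(A / B) powr p - 1\<bar> \<le> B powr p * \<epsilon>" by (intro mult_left_mono) auto
    moreover have "B powr p * \<bar>(A / B) powr p - 1\<bar> = \<bar>B powr p * ((A / B) powr p - 1)\<bar>" by (simp add: abs_mult)
    moreover have "B powr p * ((A / B) powr p - 1) = A powr p - B powr p" using A B by (simp add: powr_divide field_simps)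
    moreover have "0 \<le> C * \<bar>A - B\<bar> powr p" by (simp add: C_def)
    ultimately show ?thesis by (simp add: mult.commute)
  next
    case False
    have BB: "B \<le> 1 / \<eta> * \<bar>A - B\<bar>" using False \<eta> by (cases "B = 0") (auto simp: field_simps)
    then have "A \<le> (1 + 1 / \<eta>) * \<bar>A - B\<bar>" "B \<le> (1 + 1 / \<eta>) * \<bar>A - B\<bar>" by (auto simp: distrib_right)
    then have "A powr p \<le> ((1 + 1 / \<eta>) * \<bar>A - B\<bar>) powr p" "B powr p \<le> ((1 + 1 / \<eta>) * \<bar>A - B\<bar>) powr p"
      using A B p by (auto intro!: powr_mono2)
    moreover have "((1 + 1 / \<eta>) * \<bar>A - B\<bar>) powr p = C * \<bar>A - B\<bar> powr p" by (simp only: C_def powr_mult)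
    moreover have "0 \<le> \<epsilon> * B powr p" "0 \<le> A powr p" "0 \<le> B powr p" using \<epsilon> by auto
    ultimately show ?thesis by linarith
  qed
  then show ?thesis by (intro exI[of _ C]) (auto simp: C_def)
qed

text \<open>The bound on differences of p-th powers gives integrability with \<epsilon> = 1 and
  convergence with small \<epsilon>. The majorant \<open>D\<close> is kept separate from the
  difference so that Lipschitz images and weighted functions are covered as well.\<close>

lemma Lp_norm_convergence:
  fixes A D :: "nat \<Rightarrow> 'a \<Rightarrow> real" and B :: "'a \<Rightarrow> real"
  assumes p: "1 \<le> p" and [measurable]: "\<And>k. A k \<in> borel_measurable M" "B \<in> borel_measurable M"
    and A0: "\<And>k x. 0 \<le> A k x" and B0: "\<And>x. 0 \<le> B x" and Bi: "integrable M (\<lambda>x. B x powr p)"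
    and Di: "\<And>k. integrable M (D k)" and AD: "\<And>k x. \<bar>A k x - B x\<bar> powr p \<le> D k x"
    and lim: "(\<lambda>k. LINT x|M. D k x) \<longlonglongrightarrow> 0"
  shows "integrable M (\<lambda>x. A k x powr p)" and "(\<lambda>k. LINT x|M. A k x powr p) \<longlonglongrightarrow> (LINT x|M. B x powr p)"
proof -
  have bd: "\<bar>A k x powr p - B x powr p\<bar> \<le> \<epsilon> * B x powr p + C * D k x"
    if C: "0 \<le> C" "\<forall>A\<ge>0. \<forall>B\<ge>0. \<bar>A powr p - B powr p\<bar> \<le> \<epsilon> * B powr p + C * \<bar>A - B\<bar> powr p" for \<epsilon> C k x
  proof -
    have "\<bar>A k x powr p - B x powr p\<bar> \<le> \<epsilon> * B x powr p + C * \<bar>A k x - B x\<bar> powr p" using C(2) A0 B0 by simp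
    moreover have "C * \<bar>A k x - B x\<bar> powr p \<le> C * D k x" by (intro mult_left_mono AD C(1))
    ultimately show ?thesis by linarith
  qed
  show Ai: "integrable M (\<lambda>x. A k x powr p)" for k
  proof -
    obtain C where C: "0 \<le> C" "\<forall>A\<ge>0. \<forall>B\<ge>0. \<bar>A powr p - B powr p\<bar> \<le> 1 * B powr p + C * \<bar>A - B\<bar> powr p"
      using powr_diff_bound[OF p, of 1] by auto
    show ?thesis
    proof (rule Bochner_Integration.integrable_bound)
      show "integrable M (\<lambda>x. 2 * B x powr p + C * D k x)"
        by (intro Bochner_Integration.integrable_add integrable_mult_right Bi Di)
      show "AE x in M. norm (A k x powr p) \<le> norm (2 * B x powr p + C * D k x)"
      proof (rule AE_I2)
        fix x
        have "A k x powr p \<le> 2 * B x powr p + C * D k x" using bd[OF C, of k x] by simp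
        then show "norm (A k x powr p) \<le> norm (2 * B x powr p + C * D k x)" by simp
      qed
    qed measurable
  qed
  define I where "I = (LINT x|M. B x powr p)"
  have I0: "0 \<le> I" unfolding I_def by (intro Bochner_Integration.integral_nonneg) simp
  show "(\<lambda>k. LINT x|M. A k x powr p) \<longlonglongrightarrow> (LINT x|M. B x powr p)"
  proof (rule LIMSEQ_I)
    fix e :: real assume e: "0 < e"
    define \<epsilon> where "\<epsilon> = e / (2 * (1 + I))"
    have \<epsilon>: "0 < \<epsilon>" using e I0 by (simp add: \<epsilon>_def)
    have "\<epsilon> * I \<le> \<epsilon> * (1 + I)" using \<epsilon> by simp
    also have "\<dots> = e / 2" using I0 by (simp add: \<epsilon>_def field_simps)
    finally have eI: "\<epsilon> * I \<le> e / 2" .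
    obtain C where C: "0 \<le> C" "\<forall>A\<ge>0. \<forall>B\<ge>0. \<bar>A powr p - B powr p\<bar> \<le> \<epsilon> * B powr p + C * \<bar>A - B\<bar> powr p"
      using powr_diff_bound[OF p \<epsilon>] by auto
    have "(\<lambda>k. C * (LINT x|M. D k x)) \<longlonglongrightarrow> C * 0" by (intro tendsto_mult_left lim)
    then obtain k0 where k0: "\<forall>k\<ge>k0. norm (C * (LINT x|M. D k x) - C * 0) < e / 2"
      using LIMSEQ_D[of _ "C * 0" "e / 2"] e by auto
    have "norm ((LINT x|M. A k x powr p) - I) < e" if "k0 \<le> k" for k
    proof -
      have "norm ((LINT x|M. A k x powr p) - I) = norm (LINT x|M. A k x powr p - B x powr p)"
        unfolding I_def using Ai Bi by simp
      also have "\<dots> \<le> (LINT x|M. norm (A k x powr p - B x powr p))" by (rule integral_norm_bound)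
      also have "\<dots> \<le> (LINT x|M. \<epsilon> * B x powr p + C * D k x)"
        using bd[OF C] Ai Bi Di by (intro integral_mono) auto
      also have "\<dots> = \<epsilon> * I + C * (LINT x|M. D k x)" unfolding I_def using Bi Di by simp
      also have "\<dots> < e" using eI k0 that by (auto simp: abs_less_iff)
      finally show ?thesis .
    qed
    then show "\<exists>no. \<forall>k\<ge>no. norm ((LINT x|M. A k x powr p) - (LINT x|M. B x powr p)) < e"
      unfolding I_def by blast
  qed
qed

lemma powr_add_le:
  fixes x y p :: real
  assumes "0 \<le> x" "0 \<le> y" "1 \<le> p"
  shows "(x + y) powr p \<le> 2 powr p * (x powr p + y powr p)"
proof -
  have "(x + y) powr p \<le> (2 * max x y) powr p" using assms by (intro powr_mono2) auto
  also have "\<dots> = 2 powr p * max x y powr p" by (rule powr_mult)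
  also have "\<dots> \<le> 2 powr p * (x powr p + y powr p)"
    by (intro mult_left_mono) (auto simp: max_def)
  finally show ?thesis .
qed

lemma integrable_diff_powr:
  fixes f g :: "'a \<Rightarrow> 'b::{second_countable_topology, real_normed_vector}"
  assumes p: "1 \<le> p" and [measurable]: "f \<in> borel_measurable M" "g \<in> borel_measurable M"
    and i: "integrable M (\<lambda>x. norm (f x) powr p)" "integrable M (\<lambda>x. norm (g x) powr p)"
  shows "integrable M (\<lambda>x. norm (f x - g x) powr p)"
proof (rule Bochner_Integration.integrable_bound)
  show "integrable M (\<lambda>x. 2 powr p * (norm (f x) powr p + norm (g x) powr p))"
    using i by simp
  show "AE x in M. norm (norm (f x - g x) powr p) \<le> norm (2 powr p * (norm (f x) powr p + norm (g x) powr p))"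
  proof (rule AE_I2)
    fix x
    have "norm (f x - g x) powr p \<le> (norm (f x) + norm (g x)) powr p"
      using p by (intro powr_mono2 norm_triangle_ineq4) auto
    also have "\<dots> \<le> 2 powr p * (norm (f x) powr p + norm (g x) powr p)" using p by (intro powr_add_le) auto
    finally show "norm (norm (f x - g x) powr p) \<le> norm (2 powr p * (norm (f x) powr p + norm (g x) powr p))" by simp
  qed
qed measurable

lemma integrable_norm_powr_vec:
  fixes g :: "'a \<Rightarrow> real^'n"
  assumes p: "1 \<le> p" and m: "\<And>i. (\<lambda>x. g x $ i) \<in> borel_measurable M"
    and i: "\<And>i. integrable M (\<lambda>x. \<bar>g x $ i\<bar> powr p)"
  shows "g \<in> borel_measurable M" and "integrable M (\<lambda>x. norm (g x) powr p)"
proof -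
  show gm: "g \<in> borel_measurable M"
  proof (subst borel_measurable_euclidean_space, rule ballI)
    fix b :: "real^'n" assume "b \<in> Basis"
    then obtain j where "b = axis j 1" by (auto simp: Basis_vec_def)
    then show "(\<lambda>x. g x \<bullet> b) \<in> borel_measurable M" using m[of j] by (simp add: inner_axis)
  qed
  show "integrable M (\<lambda>x. norm (g x) powr p)"
  proof (rule Bochner_Integration.integrable_bound)
    show "integrable M (\<lambda>x. real CARD('n) powr p * (\<Sum>j\<in>UNIV. \<bar>g x $ j\<bar> powr p))"
      using i by (intro integrable_mult_right Bochner_Integration.integrable_sum) auto
    show "AE x in M. norm (norm (g x) powr p) \<le> norm (real CARD('n) powr p * (\<Sum>j\<in>UNIV. \<bar>g x $ j\<bar> powr p))"
    proof (rule AE_I2)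
      fix x
      let ?m = "Max (range (\<lambda>j. \<bar>g x $ j\<bar>))"
      have "?m \<in> range (\<lambda>j. \<bar>g x $ j\<bar>)" by (intro Max_in) auto
      then obtain j where j: "?m = \<bar>g x $ j\<bar>" by (rule rangeE)
      have "norm (g x) \<le> (\<Sum>j\<in>UNIV. \<bar>g x $ j\<bar>)" by (rule norm_le_l1_cart)
      also have "\<dots> \<le> (\<Sum>j\<in>(UNIV::'n set). ?m)" by (intro sum_mono Max_ge) auto
      also have "\<dots> = real CARD('n) * \<bar>g x $ j\<bar>" by (simp add: j)
      finally have "norm (g x) powr p \<le> (real CARD('n) * \<bar>g x $ j\<bar>) powr p" using p by (intro powr_mono2) auto
      also have "\<dots> = real CARD('n) powr p * \<bar>g x $ j\<bar> powr p" by (rule powr_mult)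
      also have "\<dots> \<le> real CARD('n) powr p * (\<Sum>j\<in>UNIV. \<bar>g x $ j\<bar> powr p)"
        by (intro mult_left_mono member_le_sum) auto
      finally show "norm (norm (g x) powr p) \<le> norm (real CARD('n) powr p * (\<Sum>j\<in>UNIV. \<bar>g x $ j\<bar> powr p))" by simp
    qed
    show "(\<lambda>x. norm (g x) powr p) \<in> borel_measurable M" using gm by measurable
  qed
qed

lemma borel_measurable_surface:
  fixes f :: "real^'n \<Rightarrow> real"
  assumes "f \<in> borel_measurable (restrict_space borel (frontier D))"
  shows "f \<in> borel_measurable (surface_measure D)"
proof -
  have "sets (surface_measure D) = sets (restrict_space borel (frontier D))"
    unfolding surface_measure_def by (rule sets_restrict_space_cong) simp
  then show ?thesis using assms by (simp cong: measurable_cong_sets)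
qed

text \<open>All three integrals converge along the sequence that defines the trace, so the strict
  inequality already holds for one of its continuous members. The result is stated with nonnegative
  integrals, ready for the integration over rays.\<close>

lemma (in smooth_gauge) continuous_competitor:
  assumes p: "1 \<le> p" and F: "finsler_norm F DF a b" and \<beta>: "0 \<le> \<beta>" and c: "0 \<le> c"
    and S: "\<And>f. f \<in> borel_measurable borel \<Longrightarrow> (\<integral>\<^sup>+x. f x \<partial>surface_measure {x. G (x - x0) < 1}) =
      (\<integral>\<^sup>+x. f (x0 + (1 / G x) *\<^sub>R x) * ennreal (c * norm (dG x)) * indicator {x. G x < 1} x \<partial>lborel)"
    and D: "D = {x. G (x - x0) < 1}"
    and wg: "weak_gradient D p v g" and bt: "boundary_trace D p v g t" and nz: "\<not> (AE x in lebesgue_on D. v x = 0)"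
    and lt: "((LINT x|lebesgue_on D. F (g x) powr p) + \<beta> * (LINT x|surface_measure D. \<bar>t x\<bar> powr p * F (outer_normal D x)))
      / (LINT x|lebesgue_on D. \<bar>v x\<bar> powr p) < lam"
  shows "0 < lam" and "\<exists>u gu. continuous_on (closure D) u \<and> weak_gradient D p u gu \<and>
    (\<integral>\<^sup>+x. ennreal (F (gu x) powr p) \<partial>lebesgue_on D)
      + ennreal \<beta> * (\<integral>\<^sup>+x. ennreal (\<bar>u x\<bar> powr p * F (outer_normal D x)) \<partial>surface_measure D)
      < ennreal lam * (\<integral>\<^sup>+x. ennreal (\<bar>u x\<bar> powr p) \<partial>lebesgue_on D)"
proof -
  interpret F: finsler_norm F DF a b by (rule F)
  interpret fs: finite_measure "surface_measure D"
    unfolding D by (rule finite_surface_measure[OF c S])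
  from bt obtain u gu where uc: "\<And>k. continuous_on (closure D) (u k)" and uwg: "\<And>k. weak_gradient D p (u k) (gu k)"
    and lim1: "(\<lambda>k. LINT x|lebesgue_on D. \<bar>u k x - v x\<bar> powr p) \<longlonglongrightarrow> 0"
    and lim2: "(\<lambda>k. LINT x|lebesgue_on D. norm (gu k x - g x) powr p) \<longlonglongrightarrow> 0"
    and lim3: "(\<lambda>k. LINT x|surface_measure D. \<bar>u k x - t x\<bar> powr p) \<longlonglongrightarrow> 0"
    unfolding boundary_trace_def by blast
  have tm: "t \<in> borel_measurable (surface_measure D)" and ti: "integrable (surface_measure D) (\<lambda>x. \<bar>t x\<bar> powr p)"
    using bt unfolding boundary_trace_def by blast+
  have wgD: "v \<in> borel_measurable (lebesgue_on D)" "integrable (lebesgue_on D) (\<lambda>x. \<bar>v x\<bar> powr p)"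
      "g \<in> borel_measurable (lebesgue_on D)" "integrable (lebesgue_on D) (\<lambda>x. norm (g x) powr p)"
    if "weak_gradient D p v g" for v g
    using that integrable_norm_powr_vec[OF p, of g "lebesgue_on D"] unfolding weak_gradient_def Lp_fun_def by blast+
  have ac1: "integrable (lebesgue_on D) (\<lambda>x. \<bar>u k x\<bar> powr p)" for k by (rule wgD(2)[OF uwg])
  have c1: "(\<lambda>k. LINT x|lebesgue_on D. \<bar>u k x\<bar> powr p) \<longlonglongrightarrow> (LINT x|lebesgue_on D. \<bar>v x\<bar> powr p)"
  proof (rule Lp_norm_convergence(2)[OF p])
    show "(\<lambda>x. \<bar>u k x\<bar>) \<in> borel_measurable (lebesgue_on D)" for k using wgD(1)[OF uwg] by measurable
    show "(\<lambda>x. \<bar>v x\<bar>) \<in> borel_measurable (lebesgue_on D)" using wgD(1)[OF wg] by measurable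
    show "integrable (lebesgue_on D) (\<lambda>x. \<bar>u k x - v x\<bar> powr p)" for k
      using integrable_diff_powr[OF p wgD(1)[OF uwg] wgD(1)[OF wg]] wgD(2)[OF uwg] wgD(2)[OF wg] by simp
    show "\<bar>\<bar>u k x\<bar> - \<bar>v x\<bar>\<bar> powr p \<le> \<bar>u k x - v x\<bar> powr p" for k x
      using p by (intro powr_mono2) auto
  qed (use wgD(2)[OF wg] lim1 in auto)
  have Fm: "(\<lambda>x. F (g x)) \<in> borel_measurable (lebesgue_on D)" if "weak_gradient D p v g" for v g
    by (rule measurable_compose[OF wgD(3)[OF that] F.borel_measurable_F])
  have Fi: "integrable (lebesgue_on D) (\<lambda>x. F (g x) powr p)" if wg: "weak_gradient D p v g" for v g
  proof (rule Bochner_Integration.integrable_bound)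
    show "integrable (lebesgue_on D) (\<lambda>x. b powr p * norm (g x) powr p)" using wgD(4)[OF wg] by simp
    show "(\<lambda>x. F (g x) powr p) \<in> borel_measurable (lebesgue_on D)" using Fm[OF wg] by measurable
    show "AE x in lebesgue_on D. norm (F (g x) powr p) \<le> norm (b powr p * norm (g x) powr p)"
    proof (rule AE_I2)
      fix x
      have "F (g x) powr p \<le> (b * norm (g x)) powr p" using p by (intro powr_mono2 F.upper) auto
      then show "norm (F (g x) powr p) \<le> norm (b powr p * norm (g x) powr p)" by (simp add: powr_mult)
    qed
  qed
  have c2: "(\<lambda>k. LINT x|lebesgue_on D. F (gu k x) powr p) \<longlonglongrightarrow> (LINT x|lebesgue_on D. F (g x) powr p)"
  proof (rule Lp_norm_convergence(2)[OF p])
    show "integrable (lebesgue_on D) (\<lambda>x. b powr p * norm (gu k x - g x) powr p)" for k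
      using integrable_diff_powr[OF p wgD(3)[OF uwg] wgD(3)[OF wg] wgD(4)[OF uwg] wgD(4)[OF wg]] by simp
    show "\<bar>F (gu k x) - F (g x)\<bar> powr p \<le> b powr p * norm (gu k x - g x) powr p" for k x
    proof -
      have "\<bar>F (gu k x) - F (g x)\<bar> powr p \<le> (b * norm (gu k x - g x)) powr p"
        using p by (intro powr_mono2 F.lipschitz) auto
      then show ?thesis by (simp add: powr_mult)
    qed
    have "(\<lambda>k. b powr p * (LINT x|lebesgue_on D. norm (gu k x - g x) powr p)) \<longlonglongrightarrow> b powr p * 0"
      by (intro tendsto_mult_left lim2)
    then show "(\<lambda>k. LINT x|lebesgue_on D. b powr p * norm (gu k x - g x) powr p) \<longlonglongrightarrow> 0" by simp
  qed (use Fm uwg wg Fi in auto)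
  \<comment> \<open>A Borel function on the whole space that agrees with \<open>F\<close> of the
    outer normal on the boundary.\<close>
  define \<phi> where "\<phi> x = F ((1 / norm (dG (x - x0))) *\<^sub>R dG (x - x0))" for x
  have \<phi>m: "\<phi> \<in> borel_measurable borel" unfolding \<phi>_def[abs_def] by measurable
  have \<phi>: "0 \<le> \<phi> x" "\<phi> x \<le> b" for x
  proof -
    have "\<phi> x \<le> b * norm ((1 / norm (dG (x - x0))) *\<^sub>R dG (x - x0))" unfolding \<phi>_def by (rule F.upper)
    also have "\<dots> \<le> b * 1" using F.b_nonneg by (intro mult_left_mono) auto
    finally show "\<phi> x \<le> b" by simp
  qed (simp add: \<phi>_def)
  have sp: "space (surface_measure D) = frontier D"
    by (simp add: surface_measure_def space_restrict_space)
  have \<phi>eq: "F (outer_normal D x) = \<phi> x" if "x \<in> space (surface_measure D)" for x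
  proof -
    have "G (x - x0) = 1" using that unfolding sp by (simp add: D frontier_G_less)
    from outer_normal_eq[OF this] show ?thesis by (simp only: D \<phi>_def)
  qed
  have \<phi>ms: "\<phi> \<in> borel_measurable (surface_measure D)"
    by (intro borel_measurable_surface measurable_restrict_space1 \<phi>m)
  have ums: "u k \<in> borel_measurable (surface_measure D)" for k
    by (intro borel_measurable_surface borel_measurable_continuous_on_restrict continuous_on_subset[OF uc])
      (simp add: frontier_def)
  have ui: "integrable (surface_measure D) (\<lambda>x. \<bar>u k x\<bar> powr p)" for k
  proof -
    have "compact (closure D)" unfolding D by (rule compact_closure_G_less)
    from compact_imp_bounded[OF compact_continuous_image[OF uc[of k] this]]
    obtain B where B: "\<forall>x\<in>closure D. \<bar>u k x\<bar> \<le> B" unfolding bounded_iff by auto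
    show ?thesis
    proof (rule fs.integrable_const_bound[where B = "B powr p"])
      show "AE x in surface_measure D. norm (\<bar>u k x\<bar> powr p) \<le> B powr p"
        using B p by (intro AE_I2) (auto simp: sp frontier_def intro!: powr_mono2)
      show "(\<lambda>x. \<bar>u k x\<bar> powr p) \<in> borel_measurable (surface_measure D)" using ums by measurable
    qed
  qed
  \<comment> \<open>The weight is absorbed into the p-th power, so that the convergence lemma
    applies to the boundary term without a weighted version.\<close>
  have root: "(\<bar>w\<bar> * \<phi> x powr (1 / p)) powr p = \<bar>w\<bar> powr p * \<phi> x" for w x
    using p \<phi>(1)[of x] by (simp add: powr_mult powr_powr)
  have i\<phi>: "integrable (surface_measure D) (\<lambda>x. \<bar>w x\<bar> powr p * \<phi> x)"
    if w: "w \<in> borel_measurable (surface_measure D)" "integrable (surface_measure D) (\<lambda>x. \<bar>w x\<bar> powr p)" for w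
  proof (rule Bochner_Integration.integrable_bound)
    show "integrable (surface_measure D) (\<lambda>x. b * \<bar>w x\<bar> powr p)" using w(2) by simp
    show "(\<lambda>x. \<bar>w x\<bar> powr p * \<phi> x) \<in> borel_measurable (surface_measure D)" using w(1) \<phi>ms by measurable
    show "AE x in surface_measure D. norm (\<bar>w x\<bar> powr p * \<phi> x) \<le> norm (b * \<bar>w x\<bar> powr p)"
    proof (rule AE_I2)
      fix x
      have "\<bar>w x\<bar> powr p * \<phi> x \<le> b * \<bar>w x\<bar> powr p"
        using mult_left_mono[OF \<phi>(2), of "\<bar>w x\<bar> powr p" x] by (simp add: mult.commute)
      then show "norm (\<bar>w x\<bar> powr p * \<phi> x) \<le> norm (b * \<bar>w x\<bar> powr p)"
        using \<phi>(1)[of x] F.b_nonneg by (simp add: abs_mult)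
    qed
  qed
  have c3: "(\<lambda>k. LINT x|surface_measure D. \<bar>u k x\<bar> powr p * \<phi> x) \<longlonglongrightarrow> (LINT x|surface_measure D. \<bar>t x\<bar> powr p * \<phi> x)"
  proof -
    have "(\<lambda>k. LINT x|surface_measure D. (\<bar>u k x\<bar> * \<phi> x powr (1 / p)) powr p)
      \<longlonglongrightarrow> (LINT x|surface_measure D. (\<bar>t x\<bar> * \<phi> x powr (1 / p)) powr p)"
    proof (rule Lp_norm_convergence(2)[OF p])
      show "(\<lambda>x. \<bar>u k x\<bar> * \<phi> x powr (1 / p)) \<in> borel_measurable (surface_measure D)" for k
        using ums \<phi>ms by measurable
      show "(\<lambda>x. \<bar>t x\<bar> * \<phi> x powr (1 / p)) \<in> borel_measurable (surface_measure D)"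
        using tm \<phi>ms by measurable
      show "integrable (surface_measure D) (\<lambda>x. (\<bar>t x\<bar> * \<phi> x powr (1 / p)) powr p)"
        unfolding root by (rule i\<phi>[OF tm ti])
      show "integrable (surface_measure D) (\<lambda>x. b * \<bar>u k x - t x\<bar> powr p)" for k
        using integrable_diff_powr[OF p ums tm] ui ti by simp
      show "\<bar>\<bar>u k x\<bar> * \<phi> x powr (1 / p) - \<bar>t x\<bar> * \<phi> x powr (1 / p)\<bar> powr p \<le> b * \<bar>u k x - t x\<bar> powr p" for k x
      proof -
        have "\<bar>\<bar>u k x\<bar> * \<phi> x powr (1 / p) - \<bar>t x\<bar> * \<phi> x powr (1 / p)\<bar> = \<bar>\<bar>u k x\<bar> - \<bar>t x\<bar>\<bar> * \<phi> x powr (1 / p)"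
          by (simp add: abs_mult left_diff_distrib[symmetric])
        then have "\<bar>\<bar>u k x\<bar> * \<phi> x powr (1 / p) - \<bar>t x\<bar> * \<phi> x powr (1 / p)\<bar> powr p = \<bar>\<bar>u k x\<bar> - \<bar>t x\<bar>\<bar> powr p * \<phi> x"
          by (simp only: root)
        also have "\<dots> \<le> \<bar>u k x - t x\<bar> powr p * b"
          using p \<phi>[of x] by (intro mult_mono powr_mono2) auto
        finally show ?thesis by (simp only: mult.commute)
      qed
      have "(\<lambda>k. b * (LINT x|surface_measure D. \<bar>u k x - t x\<bar> powr p)) \<longlonglongrightarrow> b * 0"
        by (intro tendsto_mult_left lim3)
      then show "(\<lambda>k. LINT x|surface_measure D. b * \<bar>u k x - t x\<bar> powr p) \<longlonglongrightarrow> 0" by simp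
    qed (use \<phi> in auto)
    then show ?thesis by (simp only: root)
  qed
  define Nv where "Nv = (LINT x|lebesgue_on D. F (g x) powr p) + \<beta> * (LINT x|surface_measure D. \<bar>t x\<bar> powr p * \<phi> x)"
  define Dv where "Dv = (LINT x|lebesgue_on D. \<bar>v x\<bar> powr p)"
  have "Dv \<noteq> 0"
  proof
    assume "Dv = 0"
    then have "AE x in lebesgue_on D. \<bar>v x\<bar> powr p = 0"
      unfolding Dv_def by (subst (asm) integral_nonneg_eq_0_iff_AE) (use wgD(2)[OF wg] in auto)
    then have "AE x in lebesgue_on D. v x = 0" by eventually_elim simp
    with nz show False by simp
  qed
  moreover have "0 \<le> Dv" unfolding Dv_def by (rule Bochner_Integration.integral_nonneg) simp
  ultimately have Dv: "0 < Dv" by simp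
  have "(LINT x|surface_measure D. \<bar>t x\<bar> powr p * F (outer_normal D x)) = (LINT x|surface_measure D. \<bar>t x\<bar> powr p * \<phi> x)"
    by (intro Bochner_Integration.integral_cong refl) (simp add: \<phi>eq)
  then have "Nv / Dv < lam" using lt by (simp add: Nv_def Dv_def)
  then have NvDv: "Nv < lam * Dv" using Dv by (simp add: pos_divide_less_eq)
  have "0 \<le> Nv" unfolding Nv_def using \<beta> \<phi>(1)
    by (intro add_nonneg_nonneg mult_nonneg_nonneg Bochner_Integration.integral_nonneg) auto
  then have "0 < lam * Dv" using NvDv by simp
  then show lam: "0 < lam" using Dv by (simp add: zero_less_mult_iff)
  have "(\<lambda>k. lam * (LINT x|lebesgue_on D. \<bar>u k x\<bar> powr p)
      - ((LINT x|lebesgue_on D. F (gu k x) powr p) + \<beta> * (LINT x|surface_measure D. \<bar>u k x\<bar> powr p * \<phi> x)))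
    \<longlonglongrightarrow> lam * Dv - Nv"
    unfolding Nv_def Dv_def by (intro tendsto_intros c1 c2 c3)
  then have "eventually (\<lambda>k. 0 < lam * (LINT x|lebesgue_on D. \<bar>u k x\<bar> powr p)
      - ((LINT x|lebesgue_on D. F (gu k x) powr p) + \<beta> * (LINT x|surface_measure D. \<bar>u k x\<bar> powr p * \<phi> x))) sequentially"
    by (rule order_tendstoD(1)) (use NvDv in simp)
  then obtain k where k: "(LINT x|lebesgue_on D. F (gu k x) powr p) + \<beta> * (LINT x|surface_measure D. \<bar>u k x\<bar> powr p * \<phi> x)
      < lam * (LINT x|lebesgue_on D. \<bar>u k x\<bar> powr p)"
    unfolding eventually_sequentially by auto
  define X where "X = (LINT x|lebesgue_on D. F (gu k x) powr p)"
  define Y where "Y = (LINT x|surface_measure D. \<bar>u k x\<bar> powr p * \<phi> x)"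
  define Z where "Z = (LINT x|lebesgue_on D. \<bar>u k x\<bar> powr p)"
  have XYZ: "0 \<le> X" "0 \<le> Y" "0 \<le> Z" unfolding X_def Y_def Z_def using \<phi>(1)
    by (auto intro!: Bochner_Integration.integral_nonneg)
  have "(\<integral>\<^sup>+x. ennreal (F (gu k x) powr p) \<partial>lebesgue_on D) = ennreal X"
    unfolding X_def by (rule nn_integral_eq_integral[OF Fi[OF uwg]]) simp
  moreover have "(\<integral>\<^sup>+x. ennreal (\<bar>u k x\<bar> powr p) \<partial>lebesgue_on D) = ennreal Z"
    unfolding Z_def by (rule nn_integral_eq_integral[OF ac1]) simp
  moreover have "(\<integral>\<^sup>+x. ennreal (\<bar>u k x\<bar> powr p * F (outer_normal D x)) \<partial>surface_measure D) = ennreal Y"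
  proof -
    have "(\<integral>\<^sup>+x. ennreal (\<bar>u k x\<bar> powr p * F (outer_normal D x)) \<partial>surface_measure D)
      = (\<integral>\<^sup>+x. ennreal (\<bar>u k x\<bar> powr p * \<phi> x) \<partial>surface_measure D)"
      by (intro nn_integral_cong) (simp add: \<phi>eq)
    also have "\<dots> = ennreal Y"
      unfolding Y_def by (rule nn_integral_eq_integral[OF i\<phi>[OF ums ui]]) (use \<phi>(1) in simp)
    finally show ?thesis .
  qed
  moreover have "ennreal X + ennreal \<beta> * ennreal Y < ennreal lam * ennreal Z"
  proof -
    have "ennreal X + ennreal \<beta> * ennreal Y = ennreal (X + \<beta> * Y)" using XYZ \<beta> by (simp add: ennreal_mult)
    also have "\<dots> < ennreal (lam * Z)" using k XYZ \<beta> by (intro ennreal_lessI) (auto simp: X_def Y_def Z_def intro: le_less_trans[rotated])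
    also have "\<dots> = ennreal lam * ennreal Z" using XYZ lam by (simp add: ennreal_mult)
    finally show ?thesis .
  qed
  ultimately show "\<exists>u gu. continuous_on (closure D) u \<and> weak_gradient D p u gu \<and>
    (\<integral>\<^sup>+x. ennreal (F (gu x) powr p) \<partial>lebesgue_on D)
      + ennreal \<beta> * (\<integral>\<^sup>+x. ennreal (\<bar>u x\<bar> powr p * F (outer_normal D x)) \<partial>surface_measure D)
      < ennreal lam * (\<integral>\<^sup>+x. ennreal (\<bar>u x\<bar> powr p) \<partial>lebesgue_on D)"
    using uc uwg by (intro exI[of _ "u k"] exI[of _ "gu k"]) simp
qed

section \<open>The comparison\<close>

lemma finsler_normI:
  fixes F :: "real^'n \<Rightarrow> real"
  assumes conv: "convex_on UNIV F" and hom: "\<forall>t \<xi>. F (t *\<^sub>R \<xi>) = \<bar>t\<bar> * F \<xi>" and a: "0 < a"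
    and bd: "\<forall>\<xi>. a * norm \<xi> \<le> F \<xi> \<and> F \<xi> \<le> b * norm \<xi>" and C2: "C2_on (- {0}) F"
  shows "\<exists>DF. finsler_norm F DF a b"
proof -
  obtain DF where DF: "\<forall>x\<in>- {0}. (F has_derivative (\<lambda>w. DF x \<bullet> w)) (at x)"
    using C2 unfolding C2_on_def by blast
  have "finsler_norm F DF a b"
  proof
    show "F (x + y) \<le> F x + F y" for x y
    proof -
      have "F ((1 - 1 / 2) *\<^sub>R x + (1 / 2) *\<^sub>R y) \<le> (1 - 1 / 2) * F x + 1 / 2 * F y"
        by (rule convex_onD[OF conv]) auto
      moreover have "F ((1 / 2) *\<^sub>R (x + y)) = 1 / 2 * F (x + y)" using hom by simp
      ultimately show ?thesis by (simp add: scaleR_add_right)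
    qed
  qed (use a bd hom DF in auto)
  then show ?thesis by blast
qed

theorem theorem5p2:
  fixes F :: "real^'n \<Rightarrow> real" and p \<alpha> \<beta> R a b :: real
    and \<Omega> :: "(real^'n) set" and x0 :: "real^'n"
  assumes "CARD('n) \<ge> 2" and "1 < p"
    and "convex_on UNIV F"
    and "\<forall>\<xi>. F (- \<xi>) = F \<xi>"
    and "\<forall>t \<xi>. F (t *\<^sub>R \<xi>) = \<bar>t\<bar> * F \<xi>"
    and "0 < a" and "a \<le> b"
    and "\<forall>\<xi>. a * norm \<xi> \<le> F \<xi> \<and> F \<xi> \<le> b * norm \<xi>"
    and "C2_on (- {0}) F"
    and "hessian_posdef_on (- {0}) (\<lambda>\<xi>. F \<xi> powr p)"
    and "bounded \<Omega>" and "convex \<Omega>" and "open \<Omega>"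
    and "0 < \<alpha>" and "\<alpha> < 1" and "C1_alpha_boundary \<alpha> \<Omega>"
    and "0 < R" and "wulff_shape F x0 R \<subseteq> \<Omega>"
    and "0 < \<beta>"
  shows "robin_eig1 F p \<beta> \<Omega> \<le> robin_eig1 F p \<beta> (wulff_shape F x0 R)"
proof -
  have p: "1 \<le> p" and \<beta>: "0 \<le> \<beta>" and R: "0 < R" using assms(2,17,19) by auto
  obtain DF where F: "finsler_norm F DF a b" using finsler_normI[OF assms(3,5,6,8,9)] by auto
  interpret F: finsler_norm F DF a b by (rule F)
  define P where "P x = polar F x / R" for x
  obtain dP mP MP where P: "smooth_gauge P dP mP MP" and FdP: "\<And>x. x \<noteq> 0 \<Longrightarrow> F (dP x) = 1 / R"
    using F.polar_gauge[OF assms(10) R] unfolding P_def[abs_def] by auto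
  interpret P: smooth_gauge P dP mP MP by (rule P)
  have W: "wulff_shape F x0 R = {x. P (x - x0) < 1}" using R by (simp add: wulff_shape_def P_def)
  have "x0 \<in> \<Omega>" using assms(18) unfolding W by auto
  from convex_domain_gauge[OF assms(13,12,11) this C1_boundary_normal[OF assms(16,13)]]
  obtain G dG m M where G: "smooth_gauge G dG m M" and \<Omega>: "\<Omega> = {x. G (x - x0) < 1}" by auto
  interpret G: smooth_gauge G dG m M by (rule G)
  have FdG: "F (dG x) \<le> 1 / R" for x
    by (rule F.gauge_of_wulff_superset[OF G R]) (use assms(18) \<Omega> in blast)
  have FdP': "F (dP x) \<le> 1 / R" for x
    using FdP[of x] P.dG_zero R by (cases "x = 0") auto
  \<comment> \<open>The same \<open>c\<close> is fixed here for the Wulff shape and for \<Omega>;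
    the comparison depends on this.\<close>
  from surface_measure_formula[OF assms(1)]
  obtain c where c: "0 \<le> c" and S0: "\<forall>(G::real^'n \<Rightarrow> real) dG m M x0 f. smooth_gauge G dG m M \<longrightarrow> f \<in> borel_measurable borel \<longrightarrow>
    (\<integral>\<^sup>+x. f x \<partial>surface_measure {x. G (x - x0) < 1}) =
      (\<integral>\<^sup>+x. f (x0 + (1 / G x) *\<^sub>R x) * ennreal (c * norm (dG x)) * indicator {x. G x < 1} x \<partial>lborel)"
    by blast
  note S = S0[rule_format]
  show ?thesis
    unfolding robin_eig1_def[of F p \<beta> "wulff_shape F x0 R"]
  proof (rule cInf_greatest)
    \<comment> \<open>The constant profile shows that there are competitors at all; the infimum of
      the empty set would carry no information.\<close>
    have sp: "smooth_profile (\<lambda>_. 1) (\<lambda>_. 0)" by (auto simp: smooth_profile_def intro!: exI[of _ 1] derivative_eq_intros)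
    have en: "(\<integral>\<^sup>+t. ennreal (t ^ (CARD('n) - 1) * \<bar>0\<bar> powr p) * indicator {0<..<1} t \<partial>lborel) \<le> ennreal 0"
      by simp
    have M0: "0 < (LINT t|lborel. indicator {0<..<1} t * (t ^ (CARD('n) - 1) * \<bar>1\<bar> powr p) :: real)"
    proof -
      have "(LINT t|lborel. indicator {0<..<1} t * (t ^ (CARD('n) - 1) * \<bar>1\<bar> powr p) :: real)
        = (LINT t|lborel. t ^ (CARD('n) - 1) * indicator {0..1} t)"
      proof (rule integral_cong_AE)
        show "AE t in lborel. indicator {0<..<1} t * (t ^ (CARD('n) - 1) * \<bar>1\<bar> powr p) = t ^ (CARD('n) - 1) * indicator {0..1::real} t"
          using AE_lborel_singleton[of "0::real"] AE_lborel_singleton[of "1::real"]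
          by eventually_elim (auto simp: indicator_def)
      qed measurable
      also have "\<dots> = 1 / real (Suc (CARD('n) - 1))"
        using integral_power[of 0 1 "CARD('n) - 1"] by simp
      finally show ?thesis by simp
    qed
    have "\<exists>v g t. weak_gradient {x. P (x - x0) < 1} p v g \<and> boundary_trace {x. P (x - x0) < 1} p v g t \<and>
        \<not> (AE x in lebesgue_on {x. P (x - x0) < 1}. v x = 0)"
      using P.radial_competitor[OF p F.nonneg F.hom F.borel_measurable_F FdP' R \<beta> c S[OF P] sp en order_refl refl M0, of x0] by blast
    then show "{((LINT x|lebesgue_on (wulff_shape F x0 R). F (g x) powr p)
        + \<beta> * (LINT x|surface_measure (wulff_shape F x0 R). \<bar>t x\<bar> powr p * F (outer_normal (wulff_shape F x0 R) x)))
       / (LINT x|lebesgue_on (wulff_shape F x0 R). \<bar>v x\<bar> powr p)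
      | v g t. weak_gradient (wulff_shape F x0 R) p v g \<and> boundary_trace (wulff_shape F x0 R) p v g t \<and>
               \<not> (AE x in lebesgue_on (wulff_shape F x0 R). v x = 0)} \<noteq> {}"
      unfolding W by blast
  next
    fix q assume "q \<in> {((LINT x|lebesgue_on (wulff_shape F x0 R). F (g x) powr p)
        + \<beta> * (LINT x|surface_measure (wulff_shape F x0 R). \<bar>t x\<bar> powr p * F (outer_normal (wulff_shape F x0 R) x)))
       / (LINT x|lebesgue_on (wulff_shape F x0 R). \<bar>v x\<bar> powr p)
      | v g t. weak_gradient (wulff_shape F x0 R) p v g \<and> boundary_trace (wulff_shape F x0 R) p v g t \<and>
               \<not> (AE x in lebesgue_on (wulff_shape F x0 R). v x = 0)}"
    then obtain v g t where q: "q = ((LINT x|lebesgue_on (wulff_shape F x0 R). F (g x) powr p)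
        + \<beta> * (LINT x|surface_measure (wulff_shape F x0 R). \<bar>t x\<bar> powr p * F (outer_normal (wulff_shape F x0 R) x)))
       / (LINT x|lebesgue_on (wulff_shape F x0 R). \<bar>v x\<bar> powr p)"
      and comp: "weak_gradient (wulff_shape F x0 R) p v g" "boundary_trace (wulff_shape F x0 R) p v g t"
        "\<not> (AE x in lebesgue_on (wulff_shape F x0 R). v x = 0)"
      by auto
    show "robin_eig1 F p \<beta> \<Omega> \<le> q"
    proof (rule ccontr)
      define lam where "lam = robin_eig1 F p \<beta> \<Omega>"
      assume "\<not> robin_eig1 F p \<beta> \<Omega> \<le> q"
      then have "q < lam" by (simp add: lam_def)
      note cc = P.continuous_competitor[OF p F \<beta> c S[OF P] W comp this[unfolded q]]
      have lam: "0 < lam" by (rule cc(1))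
      from cc(2) obtain u gu where u: "continuous_on (closure (wulff_shape F x0 R)) u" "weak_gradient (wulff_shape F x0 R) p u gu"
        "(\<integral>\<^sup>+x. ennreal (F (gu x) powr p) \<partial>lebesgue_on (wulff_shape F x0 R))
        + ennreal \<beta> * (\<integral>\<^sup>+x. ennreal (\<bar>u x\<bar> powr p * F (outer_normal (wulff_shape F x0 R) x)) \<partial>surface_measure (wulff_shape F x0 R))
        < ennreal lam * (\<integral>\<^sup>+x. ennreal (\<bar>u x\<bar> powr p) \<partial>lebesgue_on (wulff_shape F x0 R))"
        by auto
      have FP: "\<bar>\<xi> \<bullet> x\<bar> \<le> R * F \<xi> * P x" for \<xi> x
        using F.abs_inner_le_polar[of \<xi> x] R by (simp add: P_def)
      from P.profile_of_competitor[OF p F.nonneg F.hom F.borel_measurable_F FdP R FP \<beta> c lam S[OF P] u[unfolded W]]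
      obtain V V' E where V: "smooth_profile V V'" "0 \<le> E"
        "(\<integral>\<^sup>+t. ennreal (t ^ (CARD('n) - 1) * \<bar>V' t\<bar> powr p) * indicator {0<..<1} t \<partial>lborel) \<le> ennreal E"
        "E * (1 / R) powr p + \<beta> * c / (real CARD('n) * R) * \<bar>V 1\<bar> powr p
          < lam * (LINT t|lborel. indicator {0<..<1} t * (t ^ (CARD('n) - 1) * \<bar>V t\<bar> powr p))" (is "?N < lam * ?M")
        by auto
      \<comment> \<open>The profile comes without a positivity statement for its mass; the strict
        inequality and \<open>0 < lam\<close> supply it.\<close>
      have "0 \<le> ?N" using V(2) \<beta> c R by simp
      then have "0 < lam * ?M" using V(4) by simp
      then have M: "0 < ?M" using lam by (simp add: zero_less_mult_iff)
      from G.radial_competitor[OF p F.nonneg F.hom F.borel_measurable_F FdG R \<beta> c S[OF G] V(1,3,2) refl M, of x0]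
      obtain w h s where w: "weak_gradient \<Omega> p w h" "boundary_trace \<Omega> p w h s" "\<not> (AE x in lebesgue_on \<Omega>. w x = 0)"
        and le: "((LINT x|lebesgue_on \<Omega>. F (h x) powr p) + \<beta> * (LINT x|surface_measure \<Omega>. \<bar>s x\<bar> powr p * F (outer_normal \<Omega> x)))
          / (LINT x|lebesgue_on \<Omega>. \<bar>w x\<bar> powr p) \<le> ?N / ?M"
        unfolding \<Omega> by auto
      have "lam \<le> ?N / ?M" using robin_eig1_le[OF F.nonneg \<beta> w] le unfolding lam_def by (rule order_trans)
      also have "\<dots> < lam" using V(4) M by (simp add: pos_divide_less_eq)
      finally show False by simp
    qed
  qed
qed

end
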